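(* Assume the sieving system and notation described in the context. Let $10^{-3}<\delta<C(1)$, $M>6$, $\xi>1$, $K$ a positive integer, and $0<\varepsilon<\frac17(M-6)$, and let $x$ be sufficiently large depending on $\delta,M,\xi,K,\varepsilon$. Then there exist a residue class $b\bmod P(z)$ and subsets $\mathcal{R}^\nu\subseteq\mathcal{Q}^\nu$ for $\nu\in\mathcal{N}$ such that, with $S=S_z+b$ and all weights $\lambda(H;q,n)$ computed for this fixed $b$: (i) $|S\cap[1,y]|\le 2\sigma y$; (ii) for every $q\in\mathcal{R}=\bigcup_{\nu\in\mathcal{N}}\mathcal{R}^\nu$, \[ \sum_{-(K+1)y<n\le y}\lambda(H_q;q,n)=(1+\theta)(K+2)y\quad\text{with } |\theta|\le (\log x)^{-\delta(1+\varepsilon)}; \] (iii) there are numbers $C_{2,\nu}$ ($\nu\in\mathcal{N}$), depending on $x,\delta,M,\xi,K$ but not on $n$ or $i$, satisfying \[ C_{2,\nu}\sim \frac{K\rho_\nu}{(K+2)M}\cdot\frac{1-1/\xi}{\log\xi}\log\big(1/(2\delta)\big)\qquad(x\to\infty), \] such that for each $\nu\in\mathcal{N}$ and each $i\in\{1,\ldots,\nu\}$, all but at most $\frac{\rho x}{8B^2\log x}$ elements $n$ of $S\cap[1,y]$ satisfy \[ \sum_{q\in\mathcal{R}^\nu}\ \sum_{1\le h\le KH_q}\lambda(H_q;q,n-a_{i,q}-qh)=(C_{2,\nu}+\theta')(K+2)y\quad\text{with }|\theta'|\le 2(\log x)^{-\delta(1+\varepsilon)}. \]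
   Context: Sieving system: for each prime $p$ a set $I_p\subseteq\mathbb{Z}/p\mathbb{Z}$ (residue classes viewed as subsets of $\mathbb{Z}$ when convenient) such that: (a) $|I_p|\le p-1$; (b) $|I_p|\le B$ for a fixed $B\in\mathbb{N}$; (c) $\prod_{p\le x}(1-|I_p|/p)\sim C_1/\log x$ for some $C_1>0$; (e) for each $\nu\in\{1,\ldots,B\}$, $\rho_\nu=\lim_{x\to\infty}\#\{p\le x:|I_p|=\nu\}/(x/\log x)$ exists; (f) $N(v)\ll v^{0.49}$ for all integers $v\ge1$, where $N(v)=\#\{p: v\bmod p\in I_p-I_p\}$ and $I_p-I_p=\{a-a':a,a'\in I_p\}$; (g) there are constants $c_1,c_2>0$ such that for all $u\ge10$, all choices of nonzero integers $m_q$ with $m_q\bmod q\in I_q-I_q$ for each prime $q$ with $|I_q|\ge1$, all $|w|\le u$ and $k\ge1$: $\#\{q:|I_q|\ge1, 0<|m_q|\le u, m_q+w\ne0, N(m_q+w)\ge k\}\ll u(\log u)^{c_1}e^{-c_2k}$. Here $p,q$ denote primes. Notation: $C(1)=\sup\{\delta>0: 6\cdot10^{2\delta}/\log(1/(2\delta))<1\}$. $\mathcal{N}=\{1\le\nu\le B:\rho_\nu>0\}$, $\rho=\sum_{\nu\in\mathcal{N}}\rho_\nu$. Set $y=\lceil x(\log x)^\delta\rceil$ and $z=y\log\log x/(\log x)^{1/2}$. Let $\mathfrak{H}=\{H\in\{1,\xi,\xi^2,\ldots\}: 2y/x\le H\le y/(\xi z)\}$. For $H\in\mathfrak{H}$ and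 $\nu\in\mathcal{N}$, $\mathcal{Q}_{H,\nu}=\{q\in(y/(\xi H),y/H]: |I_q|=\nu\}$, $\mathcal{Q}^\nu=\bigcup_{H\in\mathfrak{H}}\mathcal{Q}_{H,\nu}$; for $q\in\mathcal{Q}^\nu$, $H_q$ is the unique $H\in\mathfrak H$ with $y/(\xi H)<q\le y/H$. For each prime $q$ write $\nu_q=|I_q|$ and $I_q=\{a_{1,q},\ldots,a_{\nu_q,q}\bmod q\}$ with distinct integers $a_{i,q}\in[1,q]$ (a fixed labeling). For $w\le w'$: $S_w=\mathbb{Z}\setminus\bigcup_{p\le w}I_p$, $S_{w,w'}=\mathbb{Z}\setminus\bigcup_{w<p\le w'}I_p$, $\sigma(w)=\prod_{p\le w}(1-|I_p|/p)$. $P(z)=\prod_{p\le z}p$, $\sigma=\sigma(z)$, and for a residue $b\bmod P(z)$, $S=S_z+b$. For $H\in\mathfrak H$: $S_1=S_{H^M}+b$, $S_2=S_{H^M,z}+b$ (these depend only on $b$ modulo $\prod_{p\le H^M}p$ and $\prod_{H^M<p\le z}p$ respectively), $\sigma_2=\sigma(z)/\sigma(H^M)$. For an integer $J$ and integer $n$, \[ AP(J;q,n)=\Big(\bigsqcup_{i=1}^{\nu_q}\{n+a_{i,q}+hq:1\le h\le J\}\Big)\cap S_1,\qquad \lambda(H;q,n)=\frac{\mathbf 1_{AP(KH;q,n)\subseteq S_2}}{\sigma_2^{|AP(KH;q,n)|}}, \] where $\{1\le h\le KH\}$ means integers $h$ with $1\le h\le KH$, and $S_1,S_2,\sigma_2$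 are those attached to the given $H$.
   Formalization: The supremum defining C(1) is taken over 0<δ<1/2 instead of all δ>0, because for δ>1/2 the logarithm log(1/(2δ)) is negative, the inequality holds trivially and the supremum as printed is not finite. *)

theory Defs
  imports
    Complex_Main
    "HOL-Library.Landau_Symbols"
    "HOL-Number_Theory.Cong"
begin

text \<open>
  A system of residue classes is a function \<open>I\<close> on the primes, where \<open>I p\<close> consists of the
  representatives in \<open>{0..<p}\<close> of the chosen classes modulo \<open>p\<close>.
\<close>

definition primes_upto :: "real \<Rightarrow> nat set" where
  "primes_upto w = {p. prime p \<and> real p \<le> w}"

definition sieve_density :: "(nat \<Rightarrow> int set) \<Rightarrow> real \<Rightarrow> real" where
  "sieve_density I w = (\<Prod>p\<in>primes_upto w. 1 - real (card (I p)) / real p)"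

definition class_frequency :: "(nat \<Rightarrow> int set) \<Rightarrow> nat \<Rightarrow> real \<Rightarrow> real" where
  "class_frequency I \<nu> x = real (card {p \<in> primes_upto x. card (I p) = \<nu>}) / (x / ln x)"

definition class_density :: "(nat \<Rightarrow> int set) \<Rightarrow> nat \<Rightarrow> real" where
  "class_density I \<nu> = Lim at_top (class_frequency I \<nu>)"

definition in_difference_set :: "(nat \<Rightarrow> int set) \<Rightarrow> nat \<Rightarrow> int \<Rightarrow> bool" where
  "in_difference_set I p v \<longleftrightarrow> (\<exists>a\<in>I p. \<exists>a'\<in>I p. [v = a - a'] (mod int p))"

definition difference_primes :: "(nat \<Rightarrow> int set) \<Rightarrow> int \<Rightarrow> nat set" where
  "difference_primes I v = {p. prime p \<and> in_difference_set I p v}"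

text \<open>
  Since \<^const>\<open>card\<close> of an infinite set is \<open>0\<close>, the bounds on cardinalities below are
  accompanied by explicit finiteness assumptions.
\<close>

locale sieving_system =
  fixes I :: "nat \<Rightarrow> int set" and B :: nat
  assumes classes: "prime p \<Longrightarrow> I p \<subseteq> {0..<int p}"
    and non_degenerate: "prime p \<Longrightarrow> card (I p) \<le> p - 1"
    and bounded: "prime p \<Longrightarrow> card (I p) \<le> B"
    and one_dimensional: "\<exists>C\<^sub>1>0. sieve_density I \<sim>[at_top] (\<lambda>x. C\<^sub>1 / ln x)"
    and density_exists: "\<nu> \<in> {1..B} \<Longrightarrow> \<exists>l. (class_frequency I \<nu> \<longlongrightarrow> l) at_top"
    and difference_bound:
      "\<exists>C. \<forall>v\<ge>1. finite (difference_primes I v) \<and>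
         real (card (difference_primes I v)) \<le> C * real_of_int v powr 0.49"
    and difference_tail:
      "\<exists>c\<^sub>1>0. \<exists>c\<^sub>2>0. \<exists>C. \<forall>u\<ge>10. \<forall>m::nat \<Rightarrow> int.
         (\<forall>q. prime q \<and> card (I q) \<ge> 1 \<longrightarrow> m q \<noteq> 0 \<and> in_difference_set I q (m q)) \<longrightarrow>
         (\<forall>(w::int) (k::nat). \<bar>real_of_int w\<bar> \<le> u \<and> k \<ge> 1 \<longrightarrow>
           (let X = {q. prime q \<and> card (I q) \<ge> 1 \<and>
                        0 < \<bar>m q\<bar> \<and> real_of_int \<bar>m q\<bar> \<le> u \<and> m q + w \<noteq> 0 \<and>
                        card (difference_primes I (m q + w)) \<ge> k}
            in finite X \<and> real (card X) \<le> C * (u * ln u powr c\<^sub>1 * exp (- c\<^sub>2 * real k))))"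

text \<open>\<open>a i q\<close> is the \<open>i\<close>-th labelled representative, in \<open>{1..q}\<close>, of the classes in \<open>I q\<close>.\<close>

definition labelling :: "(nat \<Rightarrow> int set) \<Rightarrow> (nat \<Rightarrow> nat \<Rightarrow> int) \<Rightarrow> bool" where
  "labelling I a \<longleftrightarrow> (\<forall>q. prime q \<longrightarrow>
     (\<forall>i\<in>{1..card (I q)}. a i q \<in> {1..int q}) \<and>
     inj_on (\<lambda>i. a i q) {1..card (I q)} \<and>
     (\<lambda>i. a i q mod int q) ` {1..card (I q)} = I q)"

text \<open>
  The restriction \<open>\<delta> < 1/2\<close> is essential: beyond it \<open>ln (1 / (2 * \<delta>))\<close> is not positive, the
  inequality holds trivially, and the supremum would not exist.
\<close>

definition C_one :: real where
  "C_one = Sup {\<delta>. 0 < \<delta> \<and> \<delta> < 1/2 \<and> 6 * 10 powr (2 * \<delta>) / ln (1 / (2 * \<delta>)) < 1}"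

definition supp_densities :: "(nat \<Rightarrow> int set) \<Rightarrow> nat \<Rightarrow> nat set" where
  "supp_densities I B = {\<nu>\<in>{1..B}. class_density I \<nu> > 0}"

definition total_density :: "(nat \<Rightarrow> int set) \<Rightarrow> nat \<Rightarrow> real" where
  "total_density I B = (\<Sum>\<nu>\<in>supp_densities I B. class_density I \<nu>)"

definition y_of :: "real \<Rightarrow> real \<Rightarrow> int" where
  "y_of \<delta> x = \<lceil>x * ln x powr \<delta>\<rceil>"

definition z_of :: "real \<Rightarrow> real \<Rightarrow> real" where
  "z_of \<delta> x = real_of_int (y_of \<delta> x) * ln (ln x) / sqrt (ln x)"

definition scales :: "real \<Rightarrow> real \<Rightarrow> real \<Rightarrow> real set" where
  "scales \<delta> \<xi> x = {H \<in> range (\<lambda>j::nat. \<xi> ^ j).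
     2 * real_of_int (y_of \<delta> x) / x \<le> H \<and> H \<le> real_of_int (y_of \<delta> x) / (\<xi> * z_of \<delta> x)}"

definition at_scale :: "real \<Rightarrow> real \<Rightarrow> real \<Rightarrow> real \<Rightarrow> nat \<Rightarrow> bool" where
  "at_scale \<delta> \<xi> x H q \<longleftrightarrow>
     real_of_int (y_of \<delta> x) / (\<xi> * H) < real q \<and> real q \<le> real_of_int (y_of \<delta> x) / H"

definition Q_scale :: "(nat \<Rightarrow> int set) \<Rightarrow> real \<Rightarrow> real \<Rightarrow> real \<Rightarrow> real \<Rightarrow> nat \<Rightarrow> nat set" where
  "Q_scale I \<delta> \<xi> x H \<nu> = {q. prime q \<and> at_scale \<delta> \<xi> x H q \<and> card (I q) = \<nu>}"

definition Q_set :: "(nat \<Rightarrow> int set) \<Rightarrow> real \<Rightarrow> real \<Rightarrow> real \<Rightarrow> nat \<Rightarrow> nat set" where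
  "Q_set I \<delta> \<xi> x \<nu> = (\<Union>H\<in>scales \<delta> \<xi> x. Q_scale I \<delta> \<xi> x H \<nu>)"

definition scale_of :: "real \<Rightarrow> real \<Rightarrow> real \<Rightarrow> nat \<Rightarrow> real" where
  "scale_of \<delta> \<xi> x q = (THE H. H \<in> scales \<delta> \<xi> x \<and> at_scale \<delta> \<xi> x H q)"

definition sieved :: "(nat \<Rightarrow> int set) \<Rightarrow> real \<Rightarrow> int set" where
  "sieved I w = {n. \<forall>p\<in>primes_upto w. n mod int p \<notin> I p}"

definition sieved_between :: "(nat \<Rightarrow> int set) \<Rightarrow> real \<Rightarrow> real \<Rightarrow> int set" where
  "sieved_between I w w' = {n. \<forall>p\<in>primes_upto w'. w < real p \<longrightarrow> n mod int p \<notin> I p}"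

definition translate :: "int set \<Rightarrow> int \<Rightarrow> int set" where
  "translate A b = (\<lambda>n. n + b) ` A"

definition step_range :: "real \<Rightarrow> nat set" where
  "step_range J = {h. 1 \<le> h \<and> real h \<le> J}"

text \<open>
  The scale \<open>H\<close> enters \<open>AP\<close> only through the set \<open>S\<^sub>1\<close> attached to it; \<open>J\<close> is an arbitrary real, since
  it is used with \<open>J = K * H\<close>. The union over \<open>i\<close> is disjoint, because the labelled
  representatives are distinct modulo \<open>q\<close>.
\<close>

definition AP :: "(nat \<Rightarrow> int set) \<Rightarrow> (nat \<Rightarrow> nat \<Rightarrow> int) \<Rightarrow> real \<Rightarrow> int \<Rightarrow> real \<Rightarrow>
    real \<Rightarrow> nat \<Rightarrow> int \<Rightarrow> int set" where
  "AP I a M b H J q n =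
     (\<Union>i\<in>{1..card (I q)}. (\<lambda>h. n + a i q + int h * int q) ` step_range J)
       \<inter> translate (sieved I (H powr M)) b"

definition weight :: "(nat \<Rightarrow> int set) \<Rightarrow> (nat \<Rightarrow> nat \<Rightarrow> int) \<Rightarrow> real \<Rightarrow> nat \<Rightarrow> real \<Rightarrow> int \<Rightarrow>
    real \<Rightarrow> nat \<Rightarrow> int \<Rightarrow> real" where
  "weight I a M K z b H q n =
     (let A = AP I a M b H (real K * H) q n;
          \<sigma>\<^sub>2 = sieve_density I z / sieve_density I (H powr M)
      in of_bool (A \<subseteq> translate (sieved_between I (H powr M) z) b) / \<sigma>\<^sub>2 ^ card A)"

end

theory Submission
  imports Defs "HOL-Analysis.Harmonic_Numbers" "HOL-Real_Asymp.Real_Asymp"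
begin

text \<open>
  The proof is a second moment argument over a uniformly random residue class \<open>b\<close> modulo the product of the
  primes up to \<open>z\<close>. Split these primes at \<open>W = H powr M\<close>. The progressions \<open>AP\<close> depend only on \<open>b\<close> modulo the
  small primes, so by the Chinese remainder theorem one may first average over the large ones: a finite set \<open>A\<close>
  survives with probability \<open>\<Prod>p. 1 - \<bar>A - I p\<bar> / p\<close>. This is at least \<open>(1 - O(\<bar>A\<bar>\<^sup>2 / W)) * \<sigma>\<^sub>2 ^ \<bar>A\<bar>\<close>, and it is
  not much larger either unless some difference of two elements of \<open>A\<close> lies in \<open>I p - I p\<close> for many \<open>p\<close>. For two
  progressions with moduli \<open>q\<close> and \<open>q'\<close> such differences are rare by the tail hypothesis on difference primes,
  and for two translates of one progression the common difference \<open>w\<close> is harmless for all but very few \<open>w\<close>, by a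
  high moment computation in blocks of primes. Both sums in the theorem therefore have relative variance
  \<open>O(H powr (2 - M) * ln (ln x))\<close>. Chebyshev's inequality removes the irregular \<open>q\<close> and bounds the number of
  exceptional \<open>n\<close>, and some \<open>b\<close> satisfies everything at once because the expected numbers of violations, suitably
  normalised, sum to less than \<open>1\<close>.
\<close>

section \<open>Averages over residue classes\<close>

text \<open>The obstacle is the size of the weights. A progression has up to
  \<open>B * K * H\<close> elements, so a weight can be as large as exp(O(sqrt(ln x))), and a pair
  without a usable collision bound costs that much. The upper limit on \<open>H\<close> keeps this
  below every power of x, and M > 6 gives sqrt W \<ge> H^3, so the proportion of heavy shifts,
  essentially exp(- sqrt W / 12), still beats it.

  The tail hypothesis speaks of one nonzero element of I_q - I_q per prime q and only on average
  over q. Hence differences are indexed by data independent of q, and errors are summed over q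
  before they are estimated.

  Since H \<ge> (ln x)^\<delta>, the relative variance is (ln x)^(\<delta> (2 - M)) up to ln (ln x).
  With accuracy \<theta> = (ln x)^(-\<delta> (1 + \<epsilon>)), removing irregular primes
  (Chebyshev) and then bounding their effect on points (Markov) costs \<theta>^(-3), and y / x costs
  (ln x)^\<delta>. The total exponent \<delta> (6 + 3 \<epsilon> - M) is negative.

  One scale H contributes a multiple of 1 / ln H to the main term. For H = \<xi>^j this is a
  harmonic sum over j from about \<delta> to 1/2 times ln (ln x) / ln \<xi>, which produces ln (1 /
  (2 \<delta>)).\<close>

definition avoids :: "(nat \<Rightarrow> int set) \<Rightarrow> nat set \<Rightarrow> int set \<Rightarrow> int \<Rightarrow> bool" where
  "avoids I P A b \<longleftrightarrow> (\<forall>p\<in>P. \<forall>v\<in>A. (v - b) mod int p \<notin> I p)"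

text \<open>The residues of \<open>b\<close> modulo \<open>p\<close> for which \<open>p\<close>
  removes some element of \<open>A\<close>. Their proportion is the probability of losing
  \<open>A\<close> at \<open>p\<close>.\<close>

definition shifts :: "(nat \<Rightarrow> int set) \<Rightarrow> nat \<Rightarrow> int set \<Rightarrow> int set" where
  "shifts I p A = (\<lambda>(v, c). (v - c) mod int p) ` (A \<times> I p)"

definition survival :: "(nat \<Rightarrow> int set) \<Rightarrow> nat set \<Rightarrow> int set \<Rightarrow> real" where
  "survival I P A = (\<Prod>p\<in>P. 1 - real (card (shifts I p A)) / real p)"

definition avg :: "nat set \<Rightarrow> (int \<Rightarrow> real) \<Rightarrow> real" where
  "avg P f = (\<Sum>b\<in>{0..<(\<Prod>p\<in>P. int p)}. f b) / (\<Prod>p\<in>P. real p)"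

lemma crt_bij:
  fixes m n :: int
  assumes "coprime m n" "m > 0" "n > 0"
  shows "bij_betw (\<lambda>b. (b mod m, b mod n)) {0..<m * n} ({0..<m} \<times> {0..<n})"
proof -
  let ?f = "\<lambda>b. (b mod m, b mod n)"
  have inj: "inj_on ?f {0..<m * n}"
  proof (rule inj_onI)
    fix b c assume bc: "b \<in> {0..<m * n}" "c \<in> {0..<m * n}" "?f b = ?f c"
    have "m dvd b - c" "n dvd b - c" using bc(3) by (auto simp: mod_eq_dvd_iff)
    then have "m * n dvd b - c" using assms(1) by (simp add: divides_mult)
    then have "b mod (m * n) = c mod (m * n)" by (simp add: mod_eq_dvd_iff)
    then show "b = c" using bc(1,2) by simp
  qed
  have sub: "?f ` {0..<m * n} \<subseteq> {0..<m} \<times> {0..<n}" using assms by auto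
  have "card (?f ` {0..<m * n}) = card ({0..<m} \<times> {0..<n})"
    using inj assms by (simp add: card_image nat_mult_distrib)
  then have "?f ` {0..<m * n} = {0..<m} \<times> {0..<n}"
    using sub by (intro card_subset_eq) auto
  then show ?thesis using inj by (simp add: bij_betw_def)
qed

lemma crt_sum:
  fixes m n :: int and F :: "int \<Rightarrow> int \<Rightarrow> real"
  assumes "coprime m n" "m > 0" "n > 0"
  shows "(\<Sum>b\<in>{0..<m * n}. F (b mod m) (b mod n)) = (\<Sum>b\<in>{0..<m}. \<Sum>c\<in>{0..<n}. F b c)"
  using sum.reindex_bij_betw[OF crt_bij[OF assms], of "\<lambda>(b, c). F b c"]
  by (simp add: sum.cartesian_product)

lemma coprime_prod_primes:
  fixes P Q :: "nat set"
  assumes "finite P" "finite Q" "\<And>p. p \<in> P \<Longrightarrow> prime p" "\<And>p. p \<in> Q \<Longrightarrow> prime p" "P \<inter> Q = {}"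
  shows "coprime (\<Prod>p\<in>P. int p) (\<Prod>q\<in>Q. int q)"
proof (rule prod_coprime_left, rule prod_coprime_right)
  fix p q assume "p \<in> P" "q \<in> Q"
  with assms have "prime p" "prime q" "p \<noteq> q" by auto
  then show "coprime (int p) (int q)" using primes_coprime coprime_int_iff by blast
qed

lemma mod_prod_mod:
  assumes "finite P" "p \<in> P"
  shows "b mod (\<Prod>q\<in>P. int q) mod int p = b mod int p"
  using assms by (intro mod_mod_cancel dvd_prodI) auto

lemma prod_primes_pos:
  assumes "\<And>p. p \<in> P \<Longrightarrow> prime p"
  shows "(\<Prod>p\<in>P. int p) > 0" "(\<Prod>p\<in>P. real p) > 0"
  using prime_gt_0_nat[OF assms] by (auto intro!: prod_pos)

text \<open>Conditions at distinct primes are independent by the Chinese remainder theorem. The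
  forbidden sets \<open>T p\<close> are arbitrary because they are taken to be \<open>shifts\<close>
  here and complements of difference sets in \<open>card_multi_difference\<close>.\<close>

lemma avg_avoiding:
  assumes "finite P" "\<And>p. p \<in> P \<Longrightarrow> prime p" "\<And>p. p \<in> P \<Longrightarrow> T p \<subseteq> {0..<int p}"
  shows "avg P (\<lambda>b. of_bool (\<forall>p\<in>P. b mod int p \<notin> T p)) = (\<Prod>p\<in>P. 1 - real (card (T p)) / real p)"
  using assms
proof (induction P rule: finite_induct)
  case empty
  then show ?case by (simp add: avg_def)
next
  case (insert p P)
  let ?m = "\<Prod>q\<in>P. int q"
  have p: "prime p" and P: "\<And>q. q \<in> P \<Longrightarrow> prime q" using insert by auto
  have p0: "p > 0" using p prime_gt_0_nat by simp
  have cop: "coprime (int p) ?m"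
    using coprime_prod_primes[of "{p}" P] insert p P by auto
  have m0: "?m > 0" using prod_primes_pos(1)[of P] P by blast
  have fT: "finite (T p)" using insert.prems(2)[of p] finite_subset by blast
  have cnt: "(\<Sum>b\<in>{0..<int p}. of_bool (b \<notin> T p)) = real p - real (card (T p))"
  proof -
    have "(\<Sum>b\<in>{0..<int p}. of_bool (b \<notin> T p) :: real) = real (card ({0..<int p} - T p))"
      by (subst sum_of_bool_eq) (auto intro!: arg_cong[where f = card])
    also have "card ({0..<int p} - T p) = p - card (T p)"
      using insert.prems(2)[of p] fT by (subst card_Diff_subset) auto
    also have "real \<dots> = real p - real (card (T p))"
      using card_mono[OF _ insert.prems(2)[of p]] by (simp add: of_nat_diff)
    finally show ?thesis .
  qed
  have "(\<Sum>b\<in>{0..<int p * ?m}. of_bool (\<forall>q\<in>insert p P. b mod int q \<notin> T q)) =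
      (\<Sum>b\<in>{0..<int p * ?m}. of_bool (b mod int p \<notin> T p) * of_bool (\<forall>q\<in>P. b mod ?m mod int q \<notin> T q) :: real)"
    using mod_prod_mod[OF insert.hyps(1)] by (intro sum.cong) auto
  also have "\<dots> = (\<Sum>b\<in>{0..<int p}. of_bool (b \<notin> T p)) * (\<Sum>c\<in>{0..<?m}. of_bool (\<forall>q\<in>P. c mod int q \<notin> T q))"
    using crt_sum[OF cop _ m0, of "\<lambda>b c. of_bool (b \<notin> T p) * of_bool (\<forall>q\<in>P. c mod int q \<notin> T q)"] p0
    by (simp add: sum_product del: sum_of_bool_eq sum_mult_of_bool_eq sum_of_bool_mult_eq of_bool_conj)
  also have "\<dots> = (real p - real (card (T p))) * ((\<Prod>q\<in>P. 1 - real (card (T q)) / real q) * (\<Prod>q\<in>P. real q))"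
    using insert.IH P insert.prems prod_primes_pos(2)[of P] unfolding cnt by (simp add: avg_def divide_eq_eq del: sum_of_bool_eq)
  finally have *: "(\<Sum>b\<in>{0..<int p * ?m}. of_bool (\<forall>q\<in>insert p P. b mod int q \<notin> T q)) =
    (real p - real (card (T p))) * ((\<Prod>q\<in>P. 1 - real (card (T q)) / real q) * (\<Prod>q\<in>P. real q))" .
  have "(\<Prod>q\<in>P. real q) > 0" using prod_primes_pos(2)[of P] P by blast
  moreover have "(r - t) * (R * Q) / (r * Q) = (1 - t / r) * R" if "r > 0" "Q > 0" for r t R Q :: real
    using that by (simp add: field_simps)
  ultimately show ?case
    unfolding avg_def prod.insert[OF insert.hyps] * using p0 by simp
qed

text \<open>Fubini in Chinese remainder coordinates: once \<open>b\<close> is fixed modulo the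
  primes in \<open>P\<close>, both \<open>c b\<close> and \<open>A b\<close> are constants, and
  averaging over the residue modulo the primes in \<open>Q\<close> turns the indicator into its
  probability.\<close>

lemma avg_conditional:
  assumes fin: "finite P" "finite Q" and pr: "\<And>p. p \<in> P \<Longrightarrow> prime p" "\<And>p. p \<in> Q \<Longrightarrow> prime p"
    and disj: "P \<inter> Q = {}" and I: "\<And>p. p \<in> Q \<Longrightarrow> I p \<subseteq> {0..<int p}"
    and c: "\<And>b. c (b mod (\<Prod>p\<in>P. int p)) = c b"
    and A: "\<And>b. A (b mod (\<Prod>p\<in>P. int p)) = A b"
  shows "avg (P \<union> Q) (\<lambda>b. c b * of_bool (avoids I Q (A b) b)) =
         avg (P \<union> Q) (\<lambda>b. c b * survival I Q (A b))"
proof -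
  let ?m = "\<Prod>p\<in>P. int p" and ?n = "\<Prod>p\<in>Q. int p"
  have cop: "coprime ?m ?n" using coprime_prod_primes fin pr disj by blast
  have pos: "?m > 0" "?n > 0" using prod_primes_pos(1) pr by blast+
  have mn: "(\<Prod>p\<in>P \<union> Q. int p) = ?m * ?n" using fin disj by (simp add: prod.union_disjoint)
  \<comment> \<open>Avoidance is rewritten as a condition on \<open>b mod p\<close> alone: v - b
    lies in I_p exactly when b lies in v - I_p.\<close>
  have av: "avoids I Q X b \<longleftrightarrow> (\<forall>p\<in>Q. b mod int p \<notin> shifts I p X)" for X b
  proof -
    have "(\<exists>v\<in>X. (v - b) mod int p \<in> I p) \<longleftrightarrow> b mod int p \<in> shifts I p X" if "p \<in> Q" for p
    proof
      assume "\<exists>v\<in>X. (v - b) mod int p \<in> I p"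
      then obtain v where v: "v \<in> X" "(v - b) mod int p \<in> I p" by blast
      have "b mod int p = (v - (v - b) mod int p) mod int p" by (simp add: mod_diff_right_eq)
      then show "b mod int p \<in> shifts I p X" unfolding shifts_def using v by force
    next
      assume "b mod int p \<in> shifts I p X"
      then obtain v d where v: "v \<in> X" "d \<in> I p" "b mod int p = (v - d) mod int p"
        unfolding shifts_def by auto
      have "(v - b) mod int p = (v - b mod int p) mod int p" by (simp add: mod_diff_right_eq)
      also have "\<dots> = d mod int p" unfolding v(3) by (simp add: mod_diff_right_eq)
      also have "\<dots> = d" using I[OF that] v(2) by auto
      finally show "\<exists>v\<in>X. (v - b) mod int p \<in> I p" using v by auto
    qed
    then show ?thesis unfolding avoids_def by blast
  qed
  have surv: "(\<Sum>e\<in>{0..<?n}. of_bool (\<forall>p\<in>Q. e mod int p \<notin> shifts I p X)) = survival I Q X * of_int ?n" for X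
  proof -
    have "shifts I p X \<subseteq> {0..<int p}" if "p \<in> Q" for p
      using prime_gt_0_nat[OF pr(2)[OF that]] by (auto simp: shifts_def)
    then have "avg Q (\<lambda>b. of_bool (\<forall>p\<in>Q. b mod int p \<notin> shifts I p X)) = survival I Q X"
      unfolding survival_def using avg_avoiding[of Q "\<lambda>p. shifts I p X"] fin pr by blast
    moreover have "(\<Prod>p\<in>Q. real p) = of_int ?n" by simp
    ultimately show ?thesis using pos(2) unfolding avg_def by (simp add: divide_eq_eq del: sum_of_bool_eq of_int_prod)
  qed
  have "(\<Sum>b\<in>{0..<?m * ?n}. c b * of_bool (avoids I Q (A b) b)) =
        (\<Sum>b\<in>{0..<?m * ?n}. c (b mod ?m) * of_bool (\<forall>p\<in>Q. (b mod ?n) mod int p \<notin> shifts I p (A (b mod ?m))))"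
    unfolding av c A using mod_prod_mod[OF fin(2)] by (intro sum.cong) auto
  also have "\<dots> = (\<Sum>b\<in>{0..<?m}. \<Sum>e\<in>{0..<?n}. c b * of_bool (\<forall>p\<in>Q. e mod int p \<notin> shifts I p (A b)))"
    using crt_sum[OF cop pos, of "\<lambda>b e. c b * of_bool (\<forall>p\<in>Q. e mod int p \<notin> shifts I p (A b))"] .
  also have "\<dots> = (\<Sum>b\<in>{0..<?m}. \<Sum>e\<in>{0..<?n}. c b * survival I Q (A b))"
    using pos(2) surv by (simp add: sum_distrib_left[symmetric] mult_ac)
  also have "\<dots> = (\<Sum>b\<in>{0..<?m * ?n}. c (b mod ?m) * survival I Q (A (b mod ?m)))"
    using crt_sum[OF cop pos, of "\<lambda>b e. c b * survival I Q (A b)"] by simp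
  finally show ?thesis unfolding avg_def mn c A by simp
qed

lemma avg_mono:
  assumes "\<And>b. f b \<le> g b"
  shows "avg P f \<le> avg P g"
  unfolding avg_def using assms by (intro divide_right_mono sum_mono prod_nonneg) auto

lemma avg_add: "avg P (\<lambda>b. f b + g b) = avg P f + avg P g"
  by (simp add: avg_def sum.distrib add_divide_distrib)

lemma avg_diff: "avg P (\<lambda>b. f b - g b) = avg P f - avg P g"
  by (simp add: avg_def sum_subtractf diff_divide_distrib)

lemma avg_cmult: "avg P (\<lambda>b. c * f b) = c * avg P f"
  by (simp add: avg_def sum_distrib_left)

lemma avg_sum: "avg P (\<lambda>b. \<Sum>i\<in>X. f i b) = (\<Sum>i\<in>X. avg P (f i))"
  unfolding avg_def by (subst sum.swap) (simp add: sum_divide_distrib)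

lemma avg_const:
  assumes "\<And>p. p \<in> P \<Longrightarrow> prime p"
  shows "avg P (\<lambda>b. c) = c"
proof -
  have "of_int (\<Prod>p\<in>P. int p) = (\<Prod>p\<in>P. real p)" by simp
  then show ?thesis using prod_primes_pos[OF assms, of P] unfolding avg_def
    by (simp del: of_int_prod add: of_nat_nat)
qed

lemma avg_pigeonhole:
  assumes "\<And>p. p \<in> P \<Longrightarrow> prime p" "avg P f < c"
  shows "\<exists>b\<in>{0..<(\<Prod>p\<in>P. int p)}. f b < c"
proof (rule ccontr)
  assume "\<not> ?thesis"
  then have "\<And>b. b \<in> {0..<(\<Prod>p\<in>P. int p)} \<Longrightarrow> c \<le> f b" by force
  then have "avg P (\<lambda>b. c) \<le> avg P f"
    unfolding avg_def by (intro divide_right_mono sum_mono prod_nonneg) auto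
  then show False using assms avg_const[of P c] by auto
qed

section \<open>Survival probabilities of finite sets\<close>

definition density_of :: "(nat \<Rightarrow> int set) \<Rightarrow> nat set \<Rightarrow> real" where
  "density_of I P = (\<Prod>p\<in>P. 1 - real (card (I p)) / real p)"

text \<open>The price of a difference \<open>w\<close> in the exponent of the upper bound for
  \<open>survival\<close>: at each prime counted here two translates of \<open>I p\<close> at
  distance \<open>w\<close> overlap.\<close>

definition collision_mass :: "(nat \<Rightarrow> int set) \<Rightarrow> nat set \<Rightarrow> int \<Rightarrow> real" where
  "collision_mass I P w = (\<Sum>p\<in>{p\<in>P. in_difference_set I p w}. 1 / real p)"

text \<open>A pair is counted exactly when v - I_p and v' - I_p share a residue, so this measures
  how far \<open>shifts\<close> falls short of its maximal size.\<close>

definition collisions :: "(nat \<Rightarrow> int set) \<Rightarrow> nat \<Rightarrow> int set \<Rightarrow> nat" where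
  "collisions I p A = card {(v, v'). v \<in> A \<and> v' \<in> A \<and> v \<noteq> v' \<and> in_difference_set I p (v - v')}"

lemma card_filter_eq_sum:
  "finite S \<Longrightarrow> real (card {x\<in>S. Q x}) = (\<Sum>x\<in>S. of_bool (Q x))"
  by (subst sum_of_bool_eq) (auto intro!: arg_cong[where f = card])

lemma in_difference_set_uminus: "in_difference_set I p (- v) \<longleftrightarrow> in_difference_set I p v"
proof -
  have "in_difference_set I p (- v)" if "in_difference_set I p v" for v
  proof -
    from that obtain a a' where a: "a \<in> I p" "a' \<in> I p" "[v = a - a'] (mod int p)"
      unfolding in_difference_set_def by auto
    then have "[- v = a' - a] (mod int p)" using cong_minus_minus_iff[of v "a - a'"] by simp
    then show ?thesis unfolding in_difference_set_def using a by auto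
  qed
  from this[of v] this[of "- v"] show ?thesis by auto
qed

lemma difference_primes_uminus: "difference_primes I (- v) = difference_primes I v"
  by (simp add: difference_primes_def in_difference_set_uminus)

lemma collision_mass_uminus: "collision_mass I P (- w) = collision_mass I P w"
  by (simp add: collision_mass_def in_difference_set_uminus)

lemma collision_mass_nonneg: "collision_mass I P w \<ge> 0"
  unfolding collision_mass_def by (intro sum_nonneg) auto

text \<open>Telescoping from N = floor W. The factor 2 absorbs the rounding, as W < N + 1 \<le> 2
  N.\<close>

lemma sum_inverse_squares_tail:
  fixes P :: "nat set"
  assumes "finite P" "W \<ge> 1" "\<And>p. p \<in> P \<Longrightarrow> W < real p"
  shows "(\<Sum>p\<in>P. 1 / (real p)\<^sup>2) \<le> 2 / W"
proof -
  define N where "N = nat \<lfloor>W\<rfloor>"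
  have N: "N \<ge> 1" "real N \<le> W" "W < real N + 1" using assms(2) unfolding N_def by linarith+
  have P: "p \<ge> Suc N" if "p \<in> P" for p using assms(3)[OF that] N by linarith
  obtain T where T: "P \<subseteq> {..T}" using assms(1) finite_nat_set_iff_bounded_le by auto
  have tele: "(\<Sum>p\<in>{Suc N..N + j}. 1 / (real p)\<^sup>2) \<le> 1 / real N - 1 / real (N + j)" for j
  proof (induction j)
    case (Suc j)
    have "1 / (real (Suc (N + j)))\<^sup>2 \<le> 1 / real (N + j) - 1 / real (Suc (N + j))"
    proof -
      have "1 / (a + 1)\<^sup>2 \<le> 1 / a - 1 / (a + 1)" if "a > 0" for a :: real
      proof -
        have "1 / (a + 1)\<^sup>2 \<le> 1 / (a * (a + 1))"
          using that by (intro divide_left_mono) (auto simp: power2_eq_square)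
        also have "\<dots> = 1 / a - 1 / (a + 1)" using that by (simp add: field_simps)
        finally show ?thesis .
      qed
      from this[of "real (N + j)"] show ?thesis using N(1) by (simp add: add_ac)
    qed
    with Suc show ?case by simp
  qed simp
  have "(\<Sum>p\<in>P. 1 / (real p)\<^sup>2) \<le> (\<Sum>p\<in>{Suc N..N + T}. 1 / (real p)\<^sup>2)"
    using P T by (intro sum_mono2) (auto intro: trans_le_add2)
  also have "\<dots> \<le> 1 / real N" using tele[of T] by (smt (verit) divide_nonneg_nonneg of_nat_0_le_iff)
  also have "\<dots> \<le> 2 / W" using N by (simp add: field_simps)
  finally show ?thesis .
qed

lemma prod_one_minus_ge:
  fixes e :: "'a \<Rightarrow> real"
  assumes "finite P" "\<And>p. p \<in> P \<Longrightarrow> 0 \<le> e p" "\<And>p. p \<in> P \<Longrightarrow> e p \<le> 1"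
  shows "(\<Prod>p\<in>P. 1 - e p) \<ge> 1 - (\<Sum>p\<in>P. e p)"
  using assms
proof (induction P rule: finite_induct)
  case (insert p P)
  have "(\<Prod>p\<in>P. 1 - e p) \<le> 1" using insert by (intro prod_le_1) auto
  then have "e p * (\<Prod>p\<in>P. 1 - e p) \<le> e p" using insert.prems by (simp add: mult_left_le)
  with insert show ?case by (simp add: algebra_simps)
qed simp

section \<open>Two-sided bounds for survival probabilities in terms of differences\<close>

context sieving_system
begin

lemma finite_classes: "prime p \<Longrightarrow> finite (I p)"
  using classes finite_subset by blast

lemma card_shifts_le:
  assumes "prime p" "finite A"
  shows "card (shifts I p A) \<le> card A * card (I p)"
  unfolding shifts_def using card_image_le[of "A \<times> I p"] assms finite_classes
  by (simp add: card_cartesian_product)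

text \<open>Insert the elements one at a time. A new element without collision adds
  \<open>card (I p)\<close> fresh residues; one with a collision loses at most \<open>B\<close>
  residues but creates a new counted pair that pays for them.\<close>

lemma card_shifts_ge:
  assumes p: "prime p" and "finite A"
  shows "card A * card (I p) \<le> card (shifts I p A) + B * collisions I p A"
  using assms(2)
proof (induction A rule: finite_induct)
  case (insert v A)
  let ?new = "(\<lambda>c. (v - c) mod int p) ` I p"
  have fin: "finite (I p)" using finite_classes p by simp
  have un: "shifts I p (insert v A) = ?new \<union> shifts I p A" unfolding shifts_def by auto
  have fA: "finite (shifts I p A)" unfolding shifts_def using insert fin by simp
  have inj: "inj_on (\<lambda>c. (v - c) mod int p) (I p)"
  proof (rule inj_onI)
    fix c d assume cd: "c \<in> I p" "d \<in> I p" "(v - c) mod int p = (v - d) mod int p"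
    have "[v - c = v - d] (mod int p)" using cd(3) by (simp only: unique_euclidean_semiring_class.cong_def)
    then have "[c = d] (mod int p)" by (simp add: cong_iff_dvd_diff dvd_diff_commute)
    then show "c = d" using classes[OF p] cd
      by (metis atLeastLessThan_iff mod_pos_pos_trivial subsetD unique_euclidean_semiring_class.cong_def)
  qed
  have cn: "card ?new = card (I p)" using inj by (simp add: card_image)
  have sub: "{(u, u'). u \<in> A \<and> u' \<in> A \<and> u \<noteq> u' \<and> in_difference_set I p (u - u')}
     \<subseteq> {(u, u'). u \<in> insert v A \<and> u' \<in> insert v A \<and> u \<noteq> u' \<and> in_difference_set I p (u - u')}"
    (is "?S \<subseteq> ?S'") by auto
  have fS': "finite ?S'" using insert.hyps by (auto intro: finite_subset[of _ "insert v A \<times> insert v A"])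
  have IH: "card A * card (I p) \<le> card (shifts I p A) + B * collisions I p A" by fact
  have mono: "collisions I p A \<le> collisions I p (insert v A)"
    unfolding collisions_def using sub fS' by (intro card_mono) auto
  show ?case
  proof (cases "\<exists>v'\<in>A. in_difference_set I p (v - v')")
    case True
    then obtain v' where v': "v' \<in> A" "in_difference_set I p (v - v')" by blast
    have ins: "insert (v, v') ?S \<subseteq> ?S'" "(v, v') \<notin> ?S" using v' insert.hyps by auto
    have "Suc (card ?S) = card (insert (v, v') ?S)"
      by (rule card_insert_disjoint[OF finite_subset[OF sub fS'] ins(2), symmetric])
    also have "\<dots> \<le> card ?S'" by (rule card_mono[OF fS' ins(1)])
    finally have "Suc (card ?S) \<le> card ?S'" .
    then have c1: "collisions I p A + 1 \<le> collisions I p (insert v A)"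
      unfolding collisions_def by simp
    have "card (shifts I p A) \<le> card (shifts I p (insert v A))"
      unfolding un using fA fin by (intro card_mono) auto
    moreover have "B * (collisions I p A + 1) \<le> B * collisions I p (insert v A)"
      using c1 by (rule mult_le_mono2)
    ultimately show ?thesis using IH bounded[OF p] insert.hyps by (simp add: algebra_simps)
  next
    case False
    have "?new \<inter> shifts I p A = {}"
    proof (rule ccontr)
      assume "\<not> ?thesis"
      then obtain c v' d where *: "c \<in> I p" "d \<in> I p" "v' \<in> A" "(v - c) mod int p = (v' - d) mod int p"
        unfolding shifts_def by auto
      then have "[v - c = v' - d] (mod int p)" by (simp only: unique_euclidean_semiring_class.cong_def)
      then have "[v - v' = c - d] (mod int p)" by (simp add: cong_iff_dvd_diff algebra_simps)
      then show False using False * unfolding in_difference_set_def by blast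
    qed
    then have "card (shifts I p (insert v A)) = card (I p) + card (shifts I p A)"
      unfolding un using fA fin cn by (simp add: card_Un_disjoint)
    moreover have "B * collisions I p A \<le> B * collisions I p (insert v A)"
      using mono by (rule mult_le_mono2)
    moreover have "card (insert v A) = Suc (card A)" using insert.hyps by simp
    ultimately show ?thesis using IH by (simp only: mult_Suc)
  qed
qed simp

lemma density_of_factor:
  assumes "prime p"
  shows "1 - real (card (I p)) / real p > 0" "1 - real (card (I p)) / real p \<le> 1"
  using non_degenerate[OF assms] prime_gt_0_nat[OF assms] by (auto simp: field_simps)

lemma density_of_pos:
  assumes "\<And>p. p \<in> P \<Longrightarrow> prime p"
  shows "density_of I P > 0" "density_of I P \<le> 1"
proof -
  show "density_of I P > 0" unfolding density_of_def using density_of_factor(1) assms by (intro prod_pos) blast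
  show "density_of I P \<le> 1" unfolding density_of_def
    using density_of_factor assms by (intro prod_le_1) (blast intro: less_imp_le)
qed

lemma density_of_power: "density_of I P ^ k = (\<Prod>p\<in>P. (1 - real (card (I p)) / real p) ^ k)"
  unfolding density_of_def by (simp add: prod_power_distrib)

text \<open>At one prime let x = |I_p| / p and n = |A|. The union bound gives at least 1 - n x, and
  (1 - x)^n (1 + n x) \<le> (1 - x^2)^n \<le> 1 shows 1 - n x \<ge> (1 - x)^n (1 - (n x)^2). The
  losses (n x)^2 are summable over p > W.\<close>

lemma survival_lower:
  assumes "finite P" "\<And>p. p \<in> P \<Longrightarrow> prime p" "\<And>p. p \<in> P \<Longrightarrow> W < real p"
    and "finite A" "card A \<le> k" "real (k * B) \<le> W" "W \<ge> 1"
  shows "survival I P A \<ge> density_of I P ^ card A * (1 - 2 * (real (k * B))\<^sup>2 / W)"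
proof -
  define n where "n = card A"
  define e where "e = (\<lambda>p::nat. (real (n * B))\<^sup>2 / (real p)\<^sup>2)"
  have nk: "real (n * B) \<le> real (k * B)" using assms(5) unfolding n_def by (simp only: of_nat_le_iff mult_le_mono1)
  have e1: "e p \<le> 1" if "p \<in> P" for p
    using nk assms(6) assms(3)[OF that] assms(7) unfolding e_def
    by (simp add: divide_le_eq power_mono)
  have "density_of I P ^ n * (\<Prod>p\<in>P. 1 - e p) \<le> survival I P A"
    unfolding density_of_power survival_def prod.distrib[symmetric]
  proof (intro prod_mono conjI)
    fix p assume pP: "p \<in> P"
    then have p: "prime p" using assms by blast
    have p0: "real p > 0" using prime_gt_0_nat[OF p] by simp
    let ?x = "real (card (I p)) / real p"
    have x: "0 \<le> ?x" "?x \<le> 1" "?x \<le> real B / real p"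
      using density_of_factor[OF p] bounded[OF p] p0 by (auto simp: divide_right_mono)
    show "0 \<le> (1 - ?x) ^ n * (1 - e p)" using x e1[OF pP] by simp
    have nx: "real n * ?x \<le> 1"
    proof -
      have "real n * ?x \<le> real n * (real B / real p)" using x by (intro mult_left_mono) auto
      also have "\<dots> \<le> 1" using nk assms(6) assms(3)[OF pP] p0 by (simp add: field_simps)
      finally show ?thesis .
    qed
    have "(real n * ?x)\<^sup>2 \<le> e p"
    proof -
      have "real n * ?x \<le> real (n * B) / real p" using x(3) by (simp add: mult_left_mono flip: times_divide_eq_right)
      then have "(real n * ?x)\<^sup>2 \<le> (real (n * B) / real p)\<^sup>2" using x by (intro power_mono) auto
      then show ?thesis by (simp add: e_def power_divide)
    qed
    then have "(1 - ?x) ^ n * (1 - e p) \<le> (1 - ?x) ^ n * (1 - (real n * ?x)\<^sup>2)"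
      using x by (intro mult_left_mono) auto
    also have "\<dots> = ((1 - ?x) ^ n * (1 + real n * ?x)) * (1 - real n * ?x)"
    proof -
      have "c * (1 - s\<^sup>2) = (c * (1 + s)) * (1 - s)" for c s :: real
        by (simp add: power2_eq_square algebra_simps)
      then show ?thesis .
    qed
    also have "\<dots> \<le> 1 * (1 - real n * ?x)"
    proof (intro mult_right_mono)
      have "(1 - ?x) ^ n * (1 + real n * ?x) \<le> (1 - ?x) ^ n * (1 + ?x) ^ n"
        using x Bernoulli_inequality[of ?x n] by (intro mult_left_mono zero_le_power) linarith+
      also have "\<dots> = ((1 - ?x) * (1 + ?x)) ^ n" by (rule power_mult_distrib[symmetric])
      also have "\<dots> \<le> 1"
      proof (intro power_le_one)
        have "(1 - s) * (1 + s) \<le> 1" for s :: real by (simp add: algebra_simps)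
        then show "(1 - ?x) * (1 + ?x) \<le> 1" .
      qed (use x in auto)
      finally show "(1 - ?x) ^ n * (1 + real n * ?x) \<le> 1" .
    qed (use nx in auto)
    also have "\<dots> \<le> 1 - real (card (shifts I p A)) / real p"
    proof -
      have "real (card (shifts I p A)) \<le> real n * real (card (I p))"
        using card_shifts_le[OF p assms(4)] unfolding n_def by (metis of_nat_le_iff of_nat_mult)
      then show ?thesis using p0 by (simp add: field_simps)
    qed
    finally show "(1 - ?x) ^ n * (1 - e p) \<le> 1 - real (card (shifts I p A)) / real p" .
  qed
  moreover have "(\<Prod>p\<in>P. 1 - e p) \<ge> 1 - 2 * (real (k * B))\<^sup>2 / W"
  proof -
    have "(\<Sum>p\<in>P. e p) = (real (n * B))\<^sup>2 * (\<Sum>p\<in>P. 1 / (real p)\<^sup>2)"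
      unfolding e_def sum_distrib_left by simp
    also have "\<dots> \<le> (real (k * B))\<^sup>2 * (2 / W)"
      using nk sum_inverse_squares_tail[OF assms(1,7,3)]
      by (intro mult_mono power_mono sum_nonneg) auto
    finally have "(\<Sum>p\<in>P. e p) \<le> 2 * (real (k * B))\<^sup>2 / W" by (simp add: mult_ac)
    then show ?thesis using prod_one_minus_ge[OF assms(1), of e] e1 by (force simp: e_def)
  qed
  moreover have "density_of I P ^ n \<ge> 0" using density_of_pos(1)[of P] assms(2) by (simp add: less_imp_le)
  ultimately have "density_of I P ^ n * (1 - 2 * (real (k * B))\<^sup>2 / W) \<le> survival I P A"
    by (meson mult_left_mono order_trans)
  then show ?thesis unfolding n_def .
qed

lemma finite_difference_primes:
  assumes "v \<noteq> 0"
  shows "finite (difference_primes I v)"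
proof (cases "v \<ge> 1")
  case True
  then show ?thesis using difference_bound by blast
next
  case False
  then have "- v \<ge> 1" using assms by simp
  then have "finite (difference_primes I (- v))" using difference_bound by blast
  then show ?thesis by (simp add: difference_primes_uminus)
qed

lemma collision_mass_le:
  assumes "\<And>p. p \<in> P \<Longrightarrow> prime p" "\<And>p. p \<in> P \<Longrightarrow> W < real p" "w \<noteq> 0" "W > 0"
  shows "collision_mass I P w \<le> real (card (difference_primes I w)) / W"
proof -
  have sub: "{p\<in>P. in_difference_set I p w} \<subseteq> difference_primes I w"
    using assms(1) by (auto simp: difference_primes_def)
  have "collision_mass I P w \<le> (\<Sum>p\<in>{p\<in>P. in_difference_set I p w}. 1 / W)"
    unfolding collision_mass_def using assms(2,4) by (intro sum_mono divide_left_mono) (auto intro!: less_imp_le mult_pos_pos intro: less_trans)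
  also have "\<dots> = real (card {p\<in>P. in_difference_set I p w}) / W" by simp
  also have "\<dots> \<le> real (card (difference_primes I w)) / W"
    using card_mono[OF finite_difference_primes[OF assms(3)] sub] assms(4) by (simp add: divide_right_mono)
  finally show ?thesis .
qed

text \<open>With x and n as in the lower bound, Bernoulli's inequality bounds the local factor by (1
  - x)^n plus \<open>B\<close> times the collision count over p. The size condition forces (1 - x)^n
  \<ge> 1/2, so the additive error becomes a factor 1 + 2 B c \<le> exp (2 B c).\<close>

lemma survival_upper_collisions:
  assumes "finite P" "\<And>p. p \<in> P \<Longrightarrow> prime p" "\<And>p. p \<in> P \<Longrightarrow> W < real p"
    and "finite A" "card A \<le> k" "2 * real (k * B) \<le> W"
  shows "survival I P A \<le> density_of I P ^ card A * exp (2 * real B * (\<Sum>p\<in>P. real (collisions I p A) / real p))"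
proof -
  define n where "n = card A"
  have nk: "real (n * B) \<le> real (k * B)" using assms(5) unfolding n_def by (simp only: of_nat_le_iff mult_le_mono1)
  have "survival I P A \<le> (\<Prod>p\<in>P. (1 - real (card (I p)) / real p) ^ n * exp (2 * real B * (real (collisions I p A) / real p)))"
    unfolding survival_def
  proof (intro prod_mono conjI)
    fix p assume pP: "p \<in> P"
    then have p: "prime p" using assms by blast
    have p0: "real p > 0" using prime_gt_0_nat[OF p] by simp
    show "0 \<le> 1 - real (card (shifts I p A)) / real p"
    proof -
      have "shifts I p A \<subseteq> {0..<int p}" using p0 by (auto simp: shifts_def)
      then have "card (shifts I p A) \<le> p" using card_mono[of "{0..<int p}"] by simp
      then show ?thesis using p0 by (simp add: field_simps)
    qed
    let ?x = "real (card (I p)) / real p" and ?c = "real (collisions I p A) / real p"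
    have x: "0 \<le> ?x" "?x \<le> 1" "?x \<le> real B / real p"
      using density_of_factor[OF p] bounded[OF p] p0 by (auto simp: divide_right_mono)
    have nx: "real n * ?x \<le> 1 / 2"
    proof -
      have "real n * ?x \<le> real n * (real B / real p)" using x by (intro mult_left_mono) auto
      also have "\<dots> \<le> 1 / 2" using nk assms(6) assms(3)[OF pP] p0 by (simp add: field_simps)
      finally show ?thesis .
    qed
    have bern: "1 - real n * ?x \<le> (1 - ?x) ^ n"
      using Bernoulli_inequality[of "- ?x" n] x by simp
    then have half: "(1 - ?x) ^ n \<ge> 1 / 2" using nx by linarith
    have "real n * real (card (I p)) \<le> real (card (shifts I p A)) + real B * real (collisions I p A)"
      using card_shifts_ge[OF p assms(4)] unfolding n_def by (metis of_nat_le_iff of_nat_mult of_nat_add)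
    then have "(real n * real (card (I p))) / real p \<le> (real (card (shifts I p A)) + real B * real (collisions I p A)) / real p"
      using p0 by (intro divide_right_mono) auto
    then have "1 - real (card (shifts I p A)) / real p \<le> 1 - real n * ?x + real B * ?c"
      by (simp add: add_divide_distrib)
    also have "\<dots> \<le> (1 - ?x) ^ n + (1 - ?x) ^ n * (2 * real B * ?c)"
    proof -
      have "(1/2) * (2 * real B * ?c) \<le> (1 - ?x) ^ n * (2 * real B * ?c)"
        using half by (intro mult_right_mono) auto
      then show ?thesis using bern by simp
    qed
    also have "\<dots> = (1 - ?x) ^ n * (1 + 2 * real B * ?c)" by (simp add: algebra_simps)
    also have "\<dots> \<le> (1 - ?x) ^ n * exp (2 * real B * ?c)"
      using x by (intro mult_left_mono exp_ge_add_one_self) auto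
    finally show "1 - real (card (shifts I p A)) / real p \<le> (1 - ?x) ^ n * exp (2 * real B * ?c)" .
  qed
  also have "\<dots> = density_of I P ^ n * exp (2 * real B * (\<Sum>p\<in>P. real (collisions I p A) / real p))"
    using assms(1) by (simp add: prod.distrib density_of_power exp_sum sum_distrib_left)
  finally show ?thesis unfolding n_def .
qed

lemma sum_collisions:
  assumes "finite P" "finite A"
  shows "(\<Sum>p\<in>P. real (collisions I p A) / real p) =
    (\<Sum>(v, v')\<in>{(v, v'). v \<in> A \<and> v' \<in> A \<and> v \<noteq> v'}. collision_mass I P (v - v'))"
proof -
  let ?D = "{(v, v'). v \<in> A \<and> v' \<in> A \<and> v \<noteq> v'}"
  have fD: "finite ?D" using assms(2) by (auto intro: finite_subset[of _ "A \<times> A"])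
  have "(\<Sum>p\<in>P. real (collisions I p A) / real p) =
     (\<Sum>p\<in>P. \<Sum>d\<in>?D. if in_difference_set I p (fst d - snd d) then 1 / real p else 0)"
  proof (intro sum.cong refl)
    fix p
    have "{(v, v'). v \<in> A \<and> v' \<in> A \<and> v \<noteq> v' \<and> in_difference_set I p (v - v')} =
        {d\<in>?D. in_difference_set I p (fst d - snd d)}" by auto
    then show "real (collisions I p A) / real p =
      (\<Sum>d\<in>?D. if in_difference_set I p (fst d - snd d) then 1 / real p else 0)"
      unfolding collisions_def using fD by (simp add: sum.If_cases Int_def conj_commute)
  qed
  also have "\<dots> = (\<Sum>d\<in>?D. \<Sum>p\<in>P. if in_difference_set I p (fst d - snd d) then 1 / real p else 0)"
    by (rule sum.swap)
  also have "\<dots> = (\<Sum>d\<in>?D. collision_mass I P (fst d - snd d))"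
    unfolding collision_mass_def using assms(1) by (intro sum.cong[OF refl, of ?D]) (rule sum.inter_filter[symmetric])
  finally show ?thesis by (simp add: case_prod_beta')
qed

text \<open>The difference \<open>w\<close> is singled out because it may occur for many pairs: each
  element has at most two partners at distance \<open>w\<close>, which gives the factor 2 k. Every
  other pair meets at most \<kappa> primes, all larger than \<open>W\<close>.\<close>

lemma sum_collision_mass_le:
  assumes "finite P" "\<And>p. p \<in> P \<Longrightarrow> prime p" "\<And>p. p \<in> P \<Longrightarrow> W < real p" "W > 0"
    and "finite A" "card A \<le> k" "\<kappa> \<ge> 0" "g \<ge> 0" "w \<noteq> 0 \<Longrightarrow> collision_mass I P w \<le> g"
    and diff: "\<And>v v'. v \<in> A \<Longrightarrow> v' \<in> A \<Longrightarrow> v \<noteq> v' \<Longrightarrow>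
       v - v' = w \<or> v - v' = - w \<or> real (card (difference_primes I (v - v'))) \<le> \<kappa>"
  shows "(\<Sum>(v, v')\<in>{(v, v'). v \<in> A \<and> v' \<in> A \<and> v \<noteq> v'}. collision_mass I P (v - v'))
    \<le> 2 * real k * g + (real k)\<^sup>2 * \<kappa> / W"
proof -
  let ?D = "{(v, v'). v \<in> A \<and> v' \<in> A \<and> v \<noteq> v'}"
  let ?E = "{(v, v'). v \<in> A \<and> v' \<in> A \<and> (v - v' = w \<or> v - v' = - w)}"
  have fin: "finite (A \<times> A)" using assms by simp
  have "(\<Sum>(v, v')\<in>?D. collision_mass I P (v - v')) \<le>
    (\<Sum>(v, v')\<in>A \<times> A. of_bool (v - v' = w \<or> v - v' = - w) * g + \<kappa> / W)"
  proof (rule sum_le_included[where i = id])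
    show "finite ?D" using fin by (rule rev_finite_subset) auto
    show "\<forall>x\<in>A \<times> A. 0 \<le> (case x of (v, v') \<Rightarrow> of_bool (v - v' = w \<or> v - v' = - w) * g + \<kappa> / W)"
      using assms by (auto intro!: add_nonneg_nonneg mult_nonneg_nonneg)
    show "\<forall>x\<in>?D. \<exists>y\<in>A \<times> A. id y = x \<and> (case x of (v, v') \<Rightarrow> collision_mass I P (v - v')) \<le>
        (case y of (v, v') \<Rightarrow> of_bool (v - v' = w \<or> v - v' = - w) * g + \<kappa> / W)"
    proof
      fix x assume "x \<in> ?D"
      then obtain v v' where x: "x = (v, v')" "v \<in> A" "v' \<in> A" "v \<noteq> v'" by auto
      have "collision_mass I P (v - v') \<le> of_bool (v - v' = w \<or> v - v' = - w) * g + \<kappa> / W"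
      proof (cases "v - v' = w \<or> v - v' = - w")
        case True
        then have "collision_mass I P (v - v') = collision_mass I P w" using collision_mass_uminus by metis
        moreover have "w \<noteq> 0" using True x by auto
        ultimately show ?thesis using True assms by (simp add: add_increasing2)
      next
        case False
        then have "real (card (difference_primes I (v - v'))) \<le> \<kappa>" using diff x by blast
        moreover have "collision_mass I P (v - v') \<le> real (card (difference_primes I (v - v'))) / W"
          using assms x by (intro collision_mass_le) auto
        ultimately show ?thesis using False \<open>W > 0\<close> by (simp add: field_simps)
      qed
      then show "\<exists>y\<in>A \<times> A. id y = x \<and> (case x of (v, v') \<Rightarrow> collision_mass I P (v - v')) \<le>
        (case y of (v, v') \<Rightarrow> of_bool (v - v' = w \<or> v - v' = - w) * g + \<kappa> / W)"
        using x by auto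
    qed
  qed (use assms in auto)
  also have "\<dots> = real (card ?E) * g + (real (card A))\<^sup>2 * \<kappa> / W"
  proof -
    have "?E = {x \<in> A \<times> A. fst x - snd x = w \<or> fst x - snd x = - w}" by auto
    then have E: "real (card ?E) = (\<Sum>x\<in>A \<times> A. of_bool (fst x - snd x = w \<or> fst x - snd x = - w))"
      using card_filter_eq_sum[OF fin] by simp
    show ?thesis unfolding E
      by (simp add: sum.distrib case_prod_beta' sum_distrib_right[symmetric] card_cartesian_product power2_eq_square
          del: sum_of_bool_eq)
  qed
  also have "\<dots> \<le> 2 * real k * g + (real k)\<^sup>2 * \<kappa> / W"
  proof (intro add_mono mult_right_mono divide_right_mono)
    have "?E \<subseteq> (\<lambda>v. (v, v - w)) ` A \<union> (\<lambda>v. (v, v + w)) ` A" by force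
    then have "card ?E \<le> card ((\<lambda>v. (v, v - w)) ` A \<union> (\<lambda>v. (v, v + w)) ` A)"
      using assms by (intro card_mono) auto
    also have "\<dots> \<le> card A + card A"
      using card_Un_le card_image_le[OF assms(5)] by (meson add_mono order_trans)
    finally show "real (card ?E) \<le> 2 * real k" using assms(6) by simp
  qed (use assms in \<open>auto intro!: power_mono\<close>)
  finally show ?thesis .
qed

lemma survival_upper:
  assumes "finite P" "\<And>p. p \<in> P \<Longrightarrow> prime p" "\<And>p. p \<in> P \<Longrightarrow> W < real p" "W > 0"
    and "finite A" "card A \<le> k" "2 * real (k * B) \<le> W" "\<kappa> \<ge> 0" "g \<ge> 0" "w \<noteq> 0 \<Longrightarrow> collision_mass I P w \<le> g"
    and "\<And>v v'. v \<in> A \<Longrightarrow> v' \<in> A \<Longrightarrow> v \<noteq> v' \<Longrightarrow>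
       v - v' = w \<or> v - v' = - w \<or> real (card (difference_primes I (v - v'))) \<le> \<kappa>"
  shows "survival I P A \<le> density_of I P ^ card A *
    exp (2 * real B * (2 * real k * g + (real k)\<^sup>2 * \<kappa> / W))"
proof -
  have "survival I P A \<le> density_of I P ^ card A * exp (2 * real B * (\<Sum>p\<in>P. real (collisions I p A) / real p))"
    using survival_upper_collisions[OF assms(1,2,3,5,6,7)] by blast
  also have "\<dots> \<le> density_of I P ^ card A *
    exp (2 * real B * (2 * real k * g + (real k)\<^sup>2 * \<kappa> / W))"
    unfolding sum_collisions[OF assms(1,5)] exp_le_cancel_iff
    using density_of_pos(1)[of P] assms(2) sum_collision_mass_le[OF assms(1,2,3,4,5,6,8,9,10,11)]
    by (intro mult_left_mono iffD2[OF exp_le_cancel_iff]) auto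
  finally show ?thesis .
qed

end

section \<open>Second moments\<close>

text \<open>Expand the square. The first moment enters with a negative sign, so it needs only a
  lower bound and the second moments only upper bounds. The weight \<open>c\<close> allows
  restricting to the event that a given point survives.\<close>

lemma avg_weighted_variance:
  fixes c :: "int \<Rightarrow> real" and lam :: "'a \<Rightarrow> int \<Rightarrow> real" and ex :: "'a \<Rightarrow> 'a \<Rightarrow> real"
  assumes "e0 \<ge> 0" "t \<ge> 0" "avg P c = e0"
    and lower: "\<And>i. i \<in> X \<Longrightarrow> avg P (\<lambda>b. c b * lam i b) \<ge> e0 * t * (1 - \<eta>)"
    and upper: "\<And>i j. i \<in> X \<Longrightarrow> j \<in> X \<Longrightarrow> avg P (\<lambda>b. c b * (lam i b * lam j b)) \<le> e0 * t\<^sup>2 * (1 + ex i j)"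
  shows "avg P (\<lambda>b. c b * ((\<Sum>i\<in>X. lam i b) - real (card X) * t)\<^sup>2) \<le>
    e0 * t\<^sup>2 * ((\<Sum>i\<in>X. \<Sum>j\<in>X. ex i j) + 2 * (real (card X))\<^sup>2 * \<eta>)"
proof -
  define N where "N = real (card X)"
  have N0: "N \<ge> 0" by (simp add: N_def)
  have eq: "c b * ((\<Sum>i\<in>X. lam i b) - N * t)\<^sup>2 =
      (\<Sum>i\<in>X. \<Sum>j\<in>X. c b * (lam i b * lam j b)) - 2 * N * t * (\<Sum>i\<in>X. c b * lam i b) + (N * t)\<^sup>2 * c b" for b
  proof -
    have "(\<Sum>i\<in>X. \<Sum>j\<in>X. c b * (lam i b * lam j b)) = c b * ((\<Sum>i\<in>X. lam i b) * (\<Sum>j\<in>X. lam j b))"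
      unfolding sum_product by (simp add: sum_distrib_left)
    moreover have "(\<Sum>i\<in>X. c b * lam i b) = c b * (\<Sum>i\<in>X. lam i b)" by (simp add: sum_distrib_left)
    ultimately show ?thesis by (simp add: power2_eq_square algebra_simps)
  qed
  have "avg P (\<lambda>b. c b * ((\<Sum>i\<in>X. lam i b) - N * t)\<^sup>2) =
      (\<Sum>i\<in>X. \<Sum>j\<in>X. avg P (\<lambda>b. c b * (lam i b * lam j b))) - 2 * N * t * (\<Sum>i\<in>X. avg P (\<lambda>b. c b * lam i b)) + (N * t)\<^sup>2 * e0"
    unfolding eq avg_add avg_diff avg_cmult avg_sum assms(3) by simp
  also have "\<dots> \<le> (\<Sum>i\<in>X. \<Sum>j\<in>X. e0 * t\<^sup>2 * (1 + ex i j)) - 2 * N * t * (\<Sum>i\<in>X. e0 * t * (1 - \<eta>)) + (N * t)\<^sup>2 * e0"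
    using N0 assms(2) lower upper
    by (intro add_mono diff_mono order_refl sum_mono mult_left_mono) auto
  also have "(\<Sum>i\<in>X. \<Sum>j\<in>X. e0 * t\<^sup>2 * (1 + ex i j)) = e0 * t\<^sup>2 * (N\<^sup>2 + (\<Sum>i\<in>X. \<Sum>j\<in>X. ex i j))"
    by (simp add: sum_distrib_left[symmetric] sum.distrib N_def power2_eq_square)
  also have "(\<Sum>i\<in>X. e0 * t * (1 - \<eta>)) = N * (e0 * t * (1 - \<eta>))" by (simp add: N_def)
  also have "e0 * t\<^sup>2 * (N\<^sup>2 + (\<Sum>i\<in>X. \<Sum>j\<in>X. ex i j)) - 2 * N * t * (N * (e0 * t * (1 - \<eta>))) + (N * t)\<^sup>2 * e0
     = e0 * t\<^sup>2 * ((\<Sum>i\<in>X. \<Sum>j\<in>X. ex i j) + 2 * N\<^sup>2 * \<eta>)"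
    by (simp add: power2_eq_square algebra_simps)
  finally show ?thesis unfolding N_def .
qed

definition lambda_of :: "(nat \<Rightarrow> int set) \<Rightarrow> nat set \<Rightarrow> int set \<Rightarrow> int \<Rightarrow> real" where
  "lambda_of I Q A b = of_bool (avoids I Q A b) / density_of I Q ^ card A"

section \<open>Averages with the small primes \<open>P1\<close> fixed and the large primes
  \<open>P2\<close> random\<close>

locale sieve_split = sieving_system +
  fixes P1 P2 :: "nat set" and W :: real
  assumes fin: "finite P1" "finite P2" and pr: "\<And>p. p \<in> P1 \<Longrightarrow> prime p" "\<And>p. p \<in> P2 \<Longrightarrow> prime p"
    and disj: "P1 \<inter> P2 = {}" and W: "\<And>p. p \<in> P2 \<Longrightarrow> W < real p" and W1: "W \<ge> 1"
begin

abbreviation "\<sigma>2 \<equiv> density_of I P2"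

definition periodic1 :: "(int \<Rightarrow> 'a) \<Rightarrow> bool" where
  "periodic1 f \<longleftrightarrow> (\<forall>b. f (b mod (\<Prod>p\<in>P1. int p)) = f b)"

lemma \<sigma>2_pos: "\<sigma>2 > 0" "\<sigma>2 \<le> 1"
  using density_of_pos[of P2] pr by blast+

lemma avg_lambda:
  assumes "periodic1 c" "periodic1 A"
  shows "avg (P1 \<union> P2) (\<lambda>b. c b * lambda_of I P2 (A b) b) =
    avg (P1 \<union> P2) (\<lambda>b. c b * (survival I P2 (A b) / \<sigma>2 ^ card (A b)))"
proof -
  \<comment> \<open>The normalising power depends on \<open>b\<close> only through
    \<open>A b\<close>, so it may be moved into the periodic factor.\<close>
  have "avg (P1 \<union> P2) (\<lambda>b. (c b / \<sigma>2 ^ card (A b)) * of_bool (avoids I P2 (A b) b)) =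
    avg (P1 \<union> P2) (\<lambda>b. (c b / \<sigma>2 ^ card (A b)) * survival I P2 (A b))"
    using fin pr disj classes assms by (intro avg_conditional) (auto simp: periodic1_def)
  then show ?thesis by (simp add: lambda_of_def)
qed

lemma avg_lambda_ge:
  assumes "periodic1 c" "periodic1 A" "\<And>b. c b \<ge> 0" "\<And>b. finite (A b)" "\<And>b. card (A b) \<le> k" "real (k * B) \<le> W"
  shows "avg (P1 \<union> P2) (\<lambda>b. c b * lambda_of I P2 (A b) b) \<ge> avg (P1 \<union> P2) c * (1 - 2 * (real (k * B))\<^sup>2 / W)"
proof -
  have "(1 - 2 * (real (k * B))\<^sup>2 / W) * avg (P1 \<union> P2) c = avg (P1 \<union> P2) (\<lambda>b. (1 - 2 * (real (k * B))\<^sup>2 / W) * c b)"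
    by (rule avg_cmult[symmetric])
  also have "\<dots> \<le> avg (P1 \<union> P2) (\<lambda>b. c b * (survival I P2 (A b) / \<sigma>2 ^ card (A b)))"
  proof (rule avg_mono)
    fix b
    have "\<sigma>2 ^ card (A b) * (1 - 2 * (real (k * B))\<^sup>2 / W) \<le> survival I P2 (A b)"
      using survival_lower[of P2 W "A b" k] fin pr W W1 assms by blast
    then have "(1 - 2 * (real (k * B))\<^sup>2 / W) \<le> survival I P2 (A b) / \<sigma>2 ^ card (A b)"
      using \<sigma>2_pos by (simp add: pos_le_divide_eq mult.commute)
    then show "(1 - 2 * (real (k * B))\<^sup>2 / W) * c b \<le> c b * (survival I P2 (A b) / \<sigma>2 ^ card (A b))"
      using assms(3) by (subst mult.commute) (intro mult_left_mono)
  qed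
  finally show ?thesis unfolding avg_lambda[OF assms(1,2)] by (simp add: mult.commute)
qed

lemma lambda_of_nonneg: "lambda_of I P2 A b \<ge> 0"
  using \<sigma>2_pos by (simp add: lambda_of_def)

lemma lambda_of_le:
  assumes "card A \<le> k"
  shows "lambda_of I P2 A b \<le> 1 / \<sigma>2 ^ k"
proof -
  have "lambda_of I P2 A b \<le> 1 / \<sigma>2 ^ card A" unfolding lambda_of_def using \<sigma>2_pos by (simp add: divide_right_mono)
  also have "\<dots> \<le> 1 / \<sigma>2 ^ k" using \<sigma>2_pos assms by (intro divide_left_mono power_decreasing) auto
  finally show ?thesis .
qed

text \<open>The fallback for pairs whose collisions are not controlled; it is affordable only
  because such pairs are rare.\<close>

lemma avg_lambda_mult_trivial:
  assumes "\<And>b. c b \<ge> 0" "\<And>b. card (A b) \<le> k" "\<And>b. card (A' b) \<le> k"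
  shows "avg (P1 \<union> P2) (\<lambda>b. c b * (lambda_of I P2 (A b) b * lambda_of I P2 (A' b) b)) \<le> avg (P1 \<union> P2) c * (1 / \<sigma>2 ^ (2 * k))"
proof -
  have "avg (P1 \<union> P2) (\<lambda>b. c b * (lambda_of I P2 (A b) b * lambda_of I P2 (A' b) b)) \<le> avg (P1 \<union> P2) (\<lambda>b. (1 / \<sigma>2 ^ (2 * k)) * c b)"
  proof (rule avg_mono)
    fix b
    have "lambda_of I P2 (A b) b * lambda_of I P2 (A' b) b \<le> (1 / \<sigma>2 ^ k) * (1 / \<sigma>2 ^ k)"
      using lambda_of_nonneg lambda_of_le assms \<sigma>2_pos by (intro mult_mono) auto
    also have "\<dots> = 1 / \<sigma>2 ^ (2 * k)" by (simp add: mult_2 power_add)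
    finally show "c b * (lambda_of I P2 (A b) b * lambda_of I P2 (A' b) b) \<le> (1 / \<sigma>2 ^ (2 * k)) * c b"
      using assms(1) by (subst (2) mult.commute) (intro mult_left_mono)
  qed
  then show ?thesis unfolding avg_cmult by (simp only: mult.commute)
qed

text \<open>The product of the two indicators is the indicator of the union, while the normalisation
  counts the \<open>d\<close> common elements twice, hence the factor
  \<open>1 / \<sigma>2 ^ d\<close>. It is used with d = 0 for disjoint progressions and d = 1 for
  two progressions meeting in one point.\<close>

lemma avg_lambda_mult_le:
  assumes "periodic1 c" "periodic1 A" "periodic1 A'" "\<And>b. c b \<ge> 0"
    and "\<And>b. finite (A b)" "\<And>b. card (A b) \<le> k" "\<And>b. finite (A' b)" "\<And>b. card (A' b) \<le> k"
    and "4 * real (k * B) \<le> W" "\<kappa> \<ge> 0" "g \<ge> 0" "w \<noteq> 0 \<Longrightarrow> collision_mass I P2 w \<le> g"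
    and int: "\<And>b. c b \<noteq> 0 \<Longrightarrow> card (A b \<inter> A' b) = d"
    and diff: "\<And>b v v'. c b \<noteq> 0 \<Longrightarrow> v \<in> A b \<union> A' b \<Longrightarrow> v' \<in> A b \<union> A' b \<Longrightarrow> v \<noteq> v' \<Longrightarrow>
       v - v' = w \<or> v - v' = - w \<or> real (card (difference_primes I (v - v'))) \<le> \<kappa>"
  shows "avg (P1 \<union> P2) (\<lambda>b. c b * (lambda_of I P2 (A b) b * lambda_of I P2 (A' b) b)) \<le>
     avg (P1 \<union> P2) c * (1 / \<sigma>2 ^ d) *
       exp (2 * real B * (2 * real (2 * k) * g + (real (2 * k))\<^sup>2 * \<kappa> / W))"
    (is "_ \<le> _ * _ * ?E")
proof -
  have card_Un: "card (A b) + card (A' b) = card (A b \<union> A' b) + d" if "c b \<noteq> 0" for b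
    using card_Un_Int[of "A b" "A' b"] assms int[OF that] by simp
  have prod: "c b * (lambda_of I P2 (A b) b * lambda_of I P2 (A' b) b) =
      (c b * (1 / \<sigma>2 ^ d)) * lambda_of I P2 (A b \<union> A' b) b" for b
  proof (cases "c b = 0")
    case False
    have "lambda_of I P2 (A b) b * lambda_of I P2 (A' b) b =
        of_bool (avoids I P2 (A b \<union> A' b) b) / \<sigma>2 ^ (card (A b) + card (A' b))"
      by (auto simp: lambda_of_def avoids_def power_add)
    then show ?thesis unfolding card_Un[OF False] by (simp add: lambda_of_def power_add)
  qed simp
  have per: "periodic1 (\<lambda>b. c b * (1 / \<sigma>2 ^ d))" "periodic1 (\<lambda>b. A b \<union> A' b)"
    using assms by (auto simp: periodic1_def)
  have "avg (P1 \<union> P2) (\<lambda>b. c b * (lambda_of I P2 (A b) b * lambda_of I P2 (A' b) b)) =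
     avg (P1 \<union> P2) (\<lambda>b. (c b * (1 / \<sigma>2 ^ d)) * (survival I P2 (A b \<union> A' b) / \<sigma>2 ^ card (A b \<union> A' b)))"
    unfolding prod by (rule avg_lambda[OF per])
  also have "\<dots> \<le> avg (P1 \<union> P2) (\<lambda>b. ((1 / \<sigma>2 ^ d) * ?E) * c b)"
  proof (rule avg_mono)
    fix b
    show "(c b * (1 / \<sigma>2 ^ d)) * (survival I P2 (A b \<union> A' b) / \<sigma>2 ^ card (A b \<union> A' b)) \<le> ((1 / \<sigma>2 ^ d) * ?E) * c b"
    proof (cases "c b = 0")
      case False
      \<comment> \<open>The union may have 2 k elements; this explains the 2 k in the bound and the
        factor 4 in the hypothesis on \<open>W\<close>.\<close>
      have "card (A b \<union> A' b) \<le> 2 * k" using card_Un_le[of "A b" "A' b"] assms(6,8)[of b] by linarith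
      then have "survival I P2 (A b \<union> A' b) \<le> \<sigma>2 ^ card (A b \<union> A' b) * ?E"
        using fin pr W W1 assms(5,7,9,10,11,12)
        by (intro survival_upper[where W = W and w = w] diff[OF False]) auto
      then have "survival I P2 (A b \<union> A' b) / \<sigma>2 ^ card (A b \<union> A' b) \<le> ?E"
        using \<sigma>2_pos by (simp add: pos_divide_le_eq mult.commute)
      then have "(c b * (1 / \<sigma>2 ^ d)) * (survival I P2 (A b \<union> A' b) / \<sigma>2 ^ card (A b \<union> A' b)) \<le> (c b * (1 / \<sigma>2 ^ d)) * ?E"
        using assms(4)[of b] \<sigma>2_pos by (intro mult_left_mono) auto
      then show ?thesis by (simp only: mult_ac)
    qed simp
  qed
  finally show ?thesis unfolding avg_cmult by (simp only: mult_ac)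
qed

lemma survival_singleton:
  assumes "\<And>p. p \<in> P \<Longrightarrow> prime p"
  shows "survival I P {n} = density_of I P"
  unfolding survival_def density_of_def
proof (intro prod.cong refl)
  fix p assume "p \<in> P"
  then have p: "prime p" using assms by blast
  have "card (shifts I p {n}) \<le> card (I p)" using card_shifts_le[OF p, of "{n}"] by simp
  moreover have "card (I p) \<le> card (shifts I p {n}) + B * collisions I p {n}"
    using card_shifts_ge[OF p, of "{n}"] by simp
  moreover have "{(v, v'). v \<in> {n} \<and> v' \<in> {n} \<and> v \<noteq> v' \<and> in_difference_set I p (v - v')} = {}" by auto
  then have "collisions I p {n} = 0" unfolding collisions_def by (simp only: card.empty)
  ultimately show "1 - real (card (shifts I p {n})) / real p = 1 - real (card (I p)) / real p" by simp
qed

lemma avg_avoids1: "avg (P1 \<union> P2) (\<lambda>b. of_bool (avoids I P1 {n} b)) = density_of I P1"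
proof -
  \<comment> \<open>The conditioning is used with the roles of the two sets of primes
    exchanged.\<close>
  have "avg (P2 \<union> P1) (\<lambda>b. 1 * of_bool (avoids I P1 {n} b)) = avg (P2 \<union> P1) (\<lambda>b. 1 * survival I P1 {n})"
    using fin pr disj classes by (intro avg_conditional) auto
  also have "\<dots> = survival I P1 {n}" using avg_const[of "P2 \<union> P1" "survival I P1 {n}"] pr by auto
  finally show ?thesis by (simp add: Un_commute survival_singleton pr)
qed

lemma avoids_periodic1: "periodic1 (avoids I P1 A)"
  unfolding periodic1_def avoids_def
  by (metis (no_types, lifting) fin(1) mod_diff_right_eq mod_prod_mod)

lemma avg_avoids12:
  "avg (P1 \<union> P2) (\<lambda>b. of_bool (avoids I P1 {n} b) * of_bool (avoids I P2 {n} b)) = density_of I P1 * \<sigma>2"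
proof -
  have "avg (P1 \<union> P2) (\<lambda>b. of_bool (avoids I P1 {n} b) * of_bool (avoids I P2 {n} b)) =
      avg (P1 \<union> P2) (\<lambda>b. of_bool (avoids I P1 {n} b) * survival I P2 {n})"
    using fin pr disj classes avoids_periodic1[of "{n}"]
    by (intro avg_conditional) (auto simp: periodic1_def)
  also have "\<dots> = avg (P1 \<union> P2) (\<lambda>b. survival I P2 {n} * of_bool (avoids I P1 {n} b))"
    by (simp add: mult.commute)
  finally show ?thesis unfolding avg_cmult avg_avoids1 by (simp add: survival_singleton pr mult.commute)
qed

end

section \<open>Progressions\<close>

text \<open>
  The tail hypothesis controls exponential moments of the number of difference primes; truncating at \<open>k0\<close>,
  a multiple of \<open>ln (ln x)\<close>, makes their total contribution negligible.
\<close>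

definition tail_weight :: "real \<Rightarrow> real \<Rightarrow> nat \<Rightarrow> real" where
  "tail_weight c k0 n = (if real n > k0 then exp (c * real n) else 0)"

lemma sum_union_le:
  fixes f :: "'a \<Rightarrow> real"
  assumes "finite A" "finite B" "\<And>x. f x \<ge> 0"
  shows "sum f (A \<union> B) \<le> sum f A + sum f B"
  using sum.union_inter[OF assms(1,2), of f] sum_nonneg[of "A \<inter> B" f, OF assms(3)] by linarith

lemma tail_weight_nonneg: "tail_weight c k0 n \<ge> 0"
  by (simp add: tail_weight_def)

text \<open>Either no count exceeds \<open>k0\<close>, then \<kappa> = k0 works and exp t \<le> 1 +
  2 t for 0 \<le> t \<le> 1; or \<kappa> is the largest count, and the exponential is at most exp
  (1/2) times a single tail weight, because s \<le> c.\<close>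

lemma exp_le_tail_weights:
  fixes N :: "'a \<Rightarrow> nat"
  assumes "finite D" "0 \<le> g" "g \<le> 1 / 2" "0 \<le> s" "s \<le> c" "s * k0 \<le> 1 / 2" "k0 \<ge> 0"
  shows "\<exists>\<kappa>\<ge>0. (\<forall>d\<in>D. real (N d) \<le> \<kappa>) \<and> exp (g + s * \<kappa>) \<le> 1 + (2 * (g + s * k0) + 3 * (\<Sum>d\<in>D. tail_weight c k0 (N d)))"
proof (cases "\<forall>d\<in>D. real (N d) \<le> k0")
  case True
  have "0 \<le> g + s * k0" "g + s * k0 \<le> 1" using assms by auto
  then have "exp (g + s * k0) \<le> 1 + (g + s * k0) + (g + s * k0)\<^sup>2" by (intro exp_bound)
  moreover have "(g + s * k0)\<^sup>2 \<le> g + s * k0"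
    using \<open>0 \<le> g + s * k0\<close> \<open>g + s * k0 \<le> 1\<close> by (simp add: power2_eq_square mult_left_le)
  ultimately have "exp (g + s * k0) \<le> 1 + (2 * (g + s * k0) + 3 * (\<Sum>d\<in>D. tail_weight c k0 (N d)))"
  proof -
    have *: "E \<le> 1 + (2 * e + 3 * T)" if "E \<le> 1 + e + e2" "e2 \<le> e" "0 \<le> T" for E e e2 T :: real
      using that by linarith
    show "exp (g + s * k0) \<le> 1 + (g + s * k0) + (g + s * k0)\<^sup>2 \<Longrightarrow> (g + s * k0)\<^sup>2 \<le> g + s * k0 \<Longrightarrow> exp (g + s * k0) \<le> 1 + (2 * (g + s * k0) + 3 * (\<Sum>d\<in>D. tail_weight c k0 (N d)))"
      by (rule *) (auto intro!: sum_nonneg tail_weight_nonneg)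
  qed
  then show ?thesis using True assms by blast
next
  case False
  then have ne: "N ` D \<noteq> {}" "finite (N ` D)" using assms by auto
  obtain d where d: "d \<in> D" "N d = Max (N ` D)" using Max_in[OF ne(2,1)] by force
  have le: "N e \<le> N d" if "e \<in> D" for e using that d ne by simp
  have big: "real (N d) > k0" using False le by (meson not_le of_nat_mono order_less_le_trans)
  have "exp (g + s * real (N d)) \<le> exp (1 / 2 + c * real (N d))"
    using assms by (auto intro!: add_mono mult_right_mono)
  also have "\<dots> = exp (1 / 2) * tail_weight c k0 (N d)" using big by (simp add: exp_add tail_weight_def)
  also have "\<dots> \<le> 3 * tail_weight c k0 (N d)"
  proof -
    have "exp (1 / 2 :: real) \<le> 1 + 1 / 2 + (1 / 2)\<^sup>2" by (rule exp_bound) auto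
    then have "exp (1 / 2 :: real) \<le> 3" by (simp add: power2_eq_square)
    then show ?thesis by (rule mult_right_mono[OF _ tail_weight_nonneg])
  qed
  also have "\<dots> \<le> 3 * (\<Sum>d\<in>D. tail_weight c k0 (N d))"
    using member_le_sum[of d D "\<lambda>d. tail_weight c k0 (N d)"] d(1) assms(1) tail_weight_nonneg by simp
  also have "\<dots> \<le> 1 + (2 * (g + s * k0) + 3 * (\<Sum>d\<in>D. tail_weight c k0 (N d)))"
    using assms by simp
  finally show ?thesis using le by (intro exI[of _ "real (N d)"]) auto
qed

text \<open>The progression relative to its starting point, before the small primes act; it depends
  on neither n nor b.\<close>

definition offsets :: "(nat \<Rightarrow> int set) \<Rightarrow> (nat \<Rightarrow> nat \<Rightarrow> int) \<Rightarrow> nat \<Rightarrow> nat \<Rightarrow> int set" where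
  "offsets I a J q = (\<lambda>(i, h). a i q + int h * int q) ` ({1..card (I q)} \<times> {1..J})"

definition offset_differences :: "(nat \<Rightarrow> int set) \<Rightarrow> (nat \<Rightarrow> nat \<Rightarrow> int) \<Rightarrow> nat \<Rightarrow> nat \<Rightarrow> int set" where
  "offset_differences I a J q = (\<lambda>(u, v). u - v) ` (offsets I a J q \<times> offsets I a J q) - {0}"

lemma finite_offsets: "finite (offsets I a J q)"
  by (simp add: offsets_def)

lemma finite_offset_differences: "finite (offset_differences I a J q)"
  by (simp add: offset_differences_def finite_offsets)

lemma offset_differences_uminus: "d \<in> offset_differences I a J q \<Longrightarrow> - d \<in> offset_differences I a J q"
  by (force simp: offset_differences_def)

context sieving_system
begin

definition pair_weight :: "real \<Rightarrow> real \<Rightarrow> int \<Rightarrow> real" where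
  "pair_weight c k0 v = tail_weight c k0 (card (difference_primes I v))"

lemma pair_weight_nonneg: "pair_weight c k0 v \<ge> 0"
  by (simp add: pair_weight_def tail_weight_nonneg)

end

text \<open>\<open>k\<close> bounds the size of a progression, \<open>c\<close> is the rate at which
  exponential moments of difference primes are available, and \<open>k0\<close> is the truncation.
  The last two assumptions are what \<open>exp_le_tail_weights\<close> requires of the parameter
  \<open>s\<close> below.\<close>

locale progression_sieve = sieve_split +
  fixes a :: "nat \<Rightarrow> nat \<Rightarrow> int" and J k :: nat and c k0 :: real
  assumes k: "k = B * J" and kW: "4 * real (k * B) \<le> W" and k0: "k0 \<ge> 0"
    and c: "8 * real B * (real k)\<^sup>2 / W \<le> c" and ck0: "8 * real B * (real k)\<^sup>2 / W * k0 \<le> 1 / 2"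
begin

abbreviation "off \<equiv> offsets I a J"
abbreviation "odiffs \<equiv> offset_differences I a J"

definition prog :: "nat \<Rightarrow> int \<Rightarrow> int \<Rightarrow> int set" where
  "prog q n b = ((\<lambda>v. n + v) ` off q) \<inter> {v. avoids I P1 {v} b}"

definition lam :: "nat \<Rightarrow> int \<Rightarrow> int \<Rightarrow> real" where
  "lam q n b = lambda_of I P2 (prog q n b) b"

lemma finite_prog: "finite (prog q n b)"
  by (simp add: prog_def finite_offsets)

lemma card_prog:
  assumes "prime q"
  shows "card (prog q n b) \<le> k"
proof -
  have "card (prog q n b) \<le> card ((\<lambda>v. n + v) ` off q)"
    unfolding prog_def by (intro card_mono) (auto simp: finite_offsets)
  also have "\<dots> \<le> card (off q)" by (rule card_image_le[OF finite_offsets])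
  also have "\<dots> \<le> card ({1..card (I q)} \<times> {1..J})" unfolding offsets_def by (rule card_image_le) simp
  also have "\<dots> \<le> B * J" using bounded[OF assms] by (simp add: card_cartesian_product)
  finally show ?thesis unfolding k .
qed

lemma periodic_prog: "periodic1 (prog q n)"
  using avoids_periodic1 unfolding periodic1_def prog_def by simp

text \<open>\<open>s\<close> is 2 B (2 k)^2 / W, the exponent paid per difference prime for a union
  of two progressions; \<open>\<eta>\<close> is the relative loss in \<open>survival_lower\<close>,
  and \<open>V\<close> bounds the product of any two weights.\<close>

definition s :: real where "s = 8 * real B * (real k)\<^sup>2 / W"
definition \<eta> :: real where "\<eta> = 2 * (real (k * B))\<^sup>2 / W"
definition V :: real where "V = 1 / \<sigma>2 ^ (2 * k)"

text \<open>
  Elements with equal offsets in the progressions starting at \<open>n\<close> and \<open>n'\<close> all differ by \<open>w = n - n'\<close>, so a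
  prime \<open>p\<close> with \<open>w \<in> I p - I p\<close> makes up to \<open>k\<close> pairs collide at once. For heavy \<open>w\<close> only the trivial bound
  \<open>V\<close> is available.
\<close>

definition heavy :: "int \<Rightarrow> bool" where
  "heavy w \<longleftrightarrow> 8 * real B * real k * collision_mass I P2 w > 1 / 2"

lemma s_nonneg: "s \<ge> 0" unfolding s_def using W1 by simp
lemma V_nonneg: "V \<ge> 0" unfolding V_def using \<sigma>2_pos by simp

text \<open>Bounds the correlation of two weights of one prime beyond the expected value 1. The
  inserted 0 covers w = 0; for the other d with d + w = 0 the two progressions may overlap, and then
  only \<open>V\<close> is used.\<close>

definition pair_excess :: "nat \<Rightarrow> int \<Rightarrow> real" where
  "pair_excess q w = (if (\<exists>d\<in>insert 0 (odiffs q). d + w = 0) \<or> heavy w then V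
     else 2 * (8 * real B * real k * collision_mass I P2 w + s * k0)
       + 3 * (\<Sum>d\<in>odiffs q. pair_weight c k0 d + pair_weight c k0 (d + w)))"

lemma mem_prog_diff:
  assumes "v \<in> prog q n b" "v' \<in> prog q n' b"
  shows "v - v' = n - n' \<or> v - v' - (n - n') \<in> odiffs q"
proof -
  obtain u u' where u: "v = n + u" "v' = n' + u'" "u \<in> off q" "u' \<in> off q"
    using assms unfolding prog_def by blast
  show ?thesis
  proof (cases "u = u'")
    case False
    then have "u - u' \<in> odiffs q" using u by (auto simp: offset_differences_def intro!: image_eqI[where x = "(u, u')"])
    then show ?thesis using u by (simp add: algebra_simps)
  qed (use u in simp)
qed

text \<open>Outside the trivial cases the progressions are disjoint. A difference of two elements of
  their union is either \<plusminus>w, or a difference inside one progression, or such a difference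
  shifted by \<plusminus>w.\<close>

lemma avg_lam_mult:
  assumes q: "prime q"
  shows "avg (P1 \<union> P2) (\<lambda>b. 1 * (lam q n b * lam q n' b)) \<le> 1 + pair_excess q (n - n')"
proof (cases "(\<exists>d\<in>insert 0 (odiffs q). d + (n - n') = 0) \<or> heavy (n - n')")
  case True
  have "avg (P1 \<union> P2) (\<lambda>b. 1 * (lam q n b * lam q n' b)) \<le> avg (P1 \<union> P2) (\<lambda>b. 1) * V"
    unfolding lam_def V_def using card_prog[OF q] by (intro avg_lambda_mult_trivial) auto
  also have "avg (P1 \<union> P2) (\<lambda>b. 1) = 1" using avg_const[of "P1 \<union> P2" 1] pr by blast
  finally show ?thesis using True by (simp add: pair_excess_def)
next
  case False
  define w where "w = n - n'"
  define g where "g = 8 * real B * real k * collision_mass I P2 w"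
  \<comment> \<open>Only shifts by +w are listed: difference primes are even in their argument and
    \<open>odiffs\<close> is closed under negation.\<close>
  define D where "D = odiffs q \<union> (\<lambda>d. d + w) ` odiffs q"
  have fD: "finite D" unfolding D_def by (simp add: finite_offset_differences)
  have g: "0 \<le> g" "g \<le> 1 / 2" using False collision_mass_nonneg unfolding g_def w_def heavy_def by auto
  obtain \<kappa> where \<kappa>: "\<kappa> \<ge> 0" "\<And>d. d \<in> D \<Longrightarrow> real (card (difference_primes I d)) \<le> \<kappa>"
    "exp (g + s * \<kappa>) \<le> 1 + (2 * (g + s * k0) + 3 * (\<Sum>d\<in>D. tail_weight c k0 (card (difference_primes I d))))"
    using exp_le_tail_weights[OF fD g s_nonneg, of c k0 "\<lambda>d. card (difference_primes I d)"] c ck0 k0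
    unfolding s_def by blast
  have int0: "prog q n b \<inter> prog q n' b = {}" for b
  proof (rule ccontr)
    assume "\<not> ?thesis"
    then obtain v where "v \<in> prog q n b" "v \<in> prog q n' b" by blast
    from mem_prog_diff[OF this] have "0 = w \<or> - w \<in> odiffs q" by (simp add: w_def)
    then show False using False by (auto simp: w_def)
  qed
  have dif: "v - v' = w \<or> v - v' = - w \<or> real (card (difference_primes I (v - v'))) \<le> \<kappa>"
    if vv: "v \<in> prog q n b \<union> prog q n' b" "v' \<in> prog q n b \<union> prog q n' b" "v \<noteq> v'" for b v v'
  proof -
    consider "v - v' = w" | "v - v' = - w" | "v - v' \<in> odiffs q" | "v - v' - w \<in> odiffs q" | "v - v' + w \<in> odiffs q"
    proof -
      have *: "n' - n = - w" by (simp add: w_def)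
      have "v - v' = - w \<or> v - v' + w \<in> odiffs q" if "v \<in> prog q n' b" "v' \<in> prog q n b"
        using mem_prog_diff[OF that] unfolding * by simp
      moreover have "v - v' = w \<or> v - v' - w \<in> odiffs q" if "v \<in> prog q n b" "v' \<in> prog q n' b"
        using mem_prog_diff[OF that] by (simp add: w_def)
      moreover have "v - v' \<in> odiffs q" if "v \<in> prog q m b" "v' \<in> prog q m b" for m
        using mem_prog_diff[OF that] vv(3) by simp
      ultimately show thesis using vv that by blast
    qed
    then show ?thesis
    proof cases
      case 3
      then show ?thesis using \<kappa>(2) by (simp add: D_def)
    next
      case 4
      then have "(v - v' - w) + w \<in> D" unfolding D_def by blast
      then show ?thesis using \<kappa>(2) by simp
    next
      case 5
      then have "- (v - v' + w) + w \<in> D" unfolding D_def using offset_differences_uminus by blast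
      then have "- (v - v') \<in> D" by simp
      then show ?thesis using \<kappa>(2) by (metis difference_primes_uminus)
    qed auto
  qed
  have "avg (P1 \<union> P2) (\<lambda>b. 1 * (lam q n b * lam q n' b)) \<le>
      avg (P1 \<union> P2) (\<lambda>b. 1) * (1 / \<sigma>2 ^ 0) *
       exp (2 * real B * (2 * real (2 * k) * collision_mass I P2 w + (real (2 * k))\<^sup>2 * \<kappa> / W))"
    unfolding lam_def using card_prog[OF q] finite_prog periodic_prog int0 \<kappa>(1) kW collision_mass_nonneg
    by (intro avg_lambda_mult_le[where w = w] dif) (auto simp: periodic1_def)
  also have "avg (P1 \<union> P2) (\<lambda>b. 1) = 1" using avg_const[of "P1 \<union> P2" 1] pr by blast
  also have "2 * real B * (2 * real (2 * k) * collision_mass I P2 w + (real (2 * k))\<^sup>2 * \<kappa> / W) = g + s * \<kappa>"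
    unfolding g_def s_def using W1 by (simp add: field_simps power2_eq_square)
  also have "1 * (1 / \<sigma>2 ^ 0) * exp (g + s * \<kappa>) \<le> 1 + (2 * (g + s * k0) + 3 * (\<Sum>d\<in>D. pair_weight c k0 d))"
    using \<kappa>(3) by (simp add: pair_weight_def)
  also have "(\<Sum>d\<in>D. pair_weight c k0 d) \<le> (\<Sum>d\<in>odiffs q. pair_weight c k0 d + pair_weight c k0 (d + w))"
  proof -
    have "(\<Sum>d\<in>D. pair_weight c k0 d) \<le> (\<Sum>d\<in>odiffs q. pair_weight c k0 d) + (\<Sum>d\<in>(\<lambda>d. d + w) ` odiffs q. pair_weight c k0 d)"
      unfolding D_def using pair_weight_nonneg finite_offset_differences
      by (subst sum.union_inter[symmetric]) (auto simp: sum_nonneg)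
    also have "(\<Sum>d\<in>(\<lambda>d. d + w) ` odiffs q. pair_weight c k0 d) = (\<Sum>d\<in>odiffs q. pair_weight c k0 (d + w))"
      by (subst sum.reindex) (auto simp: inj_on_def)
    finally show ?thesis by (simp add: sum.distrib)
  qed
  finally show ?thesis using False by (simp add: pair_excess_def g_def w_def)
qed

lemma avg_lam_ge:
  assumes q: "prime q" and "periodic1 f" "\<And>b. f b \<ge> 0"
  shows "avg (P1 \<union> P2) f * (1 - \<eta>) \<le> avg (P1 \<union> P2) (\<lambda>b. f b * lam q n b)"
proof -
  have "real (k * B) \<le> W" using kW by linarith
  then show ?thesis unfolding lam_def \<eta>_def using assms periodic_prog finite_prog card_prog[OF q]
    by (intro avg_lambda_ge) auto
qed

lemma variance_progressions:
  assumes q: "prime q"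
  shows "avg (P1 \<union> P2) (\<lambda>b. ((\<Sum>n\<in>X. lam q n b) - real (card X))\<^sup>2) \<le>
    (\<Sum>n\<in>X. \<Sum>n'\<in>X. pair_excess q (n - n')) + 2 * (real (card X))\<^sup>2 * \<eta>"
proof -
  have one: "avg (P1 \<union> P2) (\<lambda>b. 1) = 1" using avg_const[of "P1 \<union> P2" 1] pr by blast
  have "avg (P1 \<union> P2) (\<lambda>b. 1 * ((\<Sum>n\<in>X. lam q n b) - real (card X) * 1)\<^sup>2) \<le>
    1 * 1\<^sup>2 * ((\<Sum>n\<in>X. \<Sum>n'\<in>X. pair_excess q (n - n')) + 2 * (real (card X))\<^sup>2 * \<eta>)"
  proof (rule avg_weighted_variance)
    fix n
    show "1 * 1 * (1 - \<eta>) \<le> avg (P1 \<union> P2) (\<lambda>b. 1 * lam q n b)"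
      using avg_lam_ge[OF q, of "\<lambda>b. 1"] one by (auto simp: periodic1_def)
  qed (use one avg_lam_mult[OF q] in auto)
  then show ?thesis by simp
qed

text \<open>Both progressions will pass through a common point, so d - d' runs over the differences
  between an element of one and an element of the other. A shared difference would allow a second
  common point, hence \<open>V\<close>.\<close>

definition cross_excess :: "nat \<Rightarrow> nat \<Rightarrow> real" where
  "cross_excess q q' = (if odiffs q \<inter> odiffs q' \<noteq> {} then V
     else 2 * (s * k0) + 3 * ((\<Sum>d\<in>odiffs q. pair_weight c k0 d) + (\<Sum>d\<in>odiffs q'. pair_weight c k0 d)
       + (\<Sum>d\<in>odiffs q. \<Sum>d'\<in>odiffs q'. pair_weight c k0 (d - d'))))"

text \<open>The starting points n - u and n - u' place \<open>n\<close> on both progressions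
  whenever it survives the small primes. Without a shared difference they meet only there, which
  accounts for one factor \<open>1 / \<sigma>2\<close>; no repeated shift occurs, so the special
  difference is 0.\<close>

lemma avg_lam_mult_cross:
  assumes q: "prime q" "prime q'" and u: "u \<in> off q" "u' \<in> off q'"
  shows "avg (P1 \<union> P2) (\<lambda>b. of_bool (avoids I P1 {n} b) * (lam q (n - u) b * lam q' (n - u') b))
    \<le> density_of I P1 / \<sigma>2 * (1 + cross_excess q q')"
proof -
  let ?c = "\<lambda>b. of_bool (avoids I P1 {n} b) :: real"
  have c1: "avg (P1 \<union> P2) ?c = density_of I P1" by (rule avg_avoids1)
  have s1: "density_of I P1 > 0" using density_of_pos[of P1] pr by blast
  show ?thesis
  proof (cases "odiffs q \<inter> odiffs q' \<noteq> {}")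
    case True
    have "avg (P1 \<union> P2) (\<lambda>b. ?c b * (lam q (n - u) b * lam q' (n - u') b)) \<le> density_of I P1 * V"
      unfolding lam_def V_def c1[symmetric] using card_prog q by (intro avg_lambda_mult_trivial) auto
    \<comment> \<open>A loss by the factor \<open>1 / \<sigma>2\<close>, accepted so that both cases
      have the same shape.\<close>
    also have "\<dots> \<le> density_of I P1 / \<sigma>2 * V"
      using s1 \<sigma>2_pos V_nonneg by (intro mult_right_mono) (auto simp: field_simps)
    also have "\<dots> \<le> density_of I P1 / \<sigma>2 * (1 + V)"
      using s1 \<sigma>2_pos V_nonneg by (intro mult_left_mono) auto
    finally show ?thesis using True by (simp add: cross_excess_def)
  next
    case False
    define D where "D = odiffs q \<union> odiffs q' \<union> (\<lambda>(d, d'). d - d') ` (odiffs q \<times> odiffs q')"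
    have fD: "finite D" unfolding D_def by (simp add: finite_offset_differences)
    have "\<exists>\<kappa>\<ge>0. (\<forall>d\<in>D. real (card (difference_primes I d)) \<le> \<kappa>) \<and>
      exp (0 + s * \<kappa>) \<le> 1 + (2 * (0 + s * k0) + 3 * (\<Sum>d\<in>D. tail_weight c k0 (card (difference_primes I d))))"
      using s_nonneg c ck0 k0 unfolding s_def
      by (intro exp_le_tail_weights[OF fD]) auto
    then obtain \<kappa> where \<kappa>: "\<kappa> \<ge> 0" "\<And>d. d \<in> D \<Longrightarrow> real (card (difference_primes I d)) \<le> \<kappa>"
      "exp (s * \<kappa>) \<le> 1 + (2 * (s * k0) + 3 * (\<Sum>d\<in>D. pair_weight c k0 d))"
      unfolding pair_weight_def by auto
    have mem: "v - n \<in> insert 0 (odiffs q)" if "v \<in> prog q (n - u) b" "u \<in> off q" for v q u b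
      using that unfolding prog_def offset_differences_def
      by (auto intro!: image_eqI[where x = "(_, u)"] split: prod.splits)
    have n_in: "n \<in> prog q (n - u) b" if "?c b \<noteq> 0" "u \<in> off q" for q u b
      using that by (auto simp: prog_def intro!: image_eqI[where x = u])
    have int1: "card (prog q (n - u) b \<inter> prog q' (n - u') b) = 1" if "?c b \<noteq> 0" for b
    proof -
      have "prog q (n - u) b \<inter> prog q' (n - u') b = {n}"
        using n_in[OF that u(1)] n_in[OF that u(2)] mem[OF _ u(1)] mem[OF _ u(2)] False by force
      then show ?thesis by simp
    qed
    have pm: "v - v' = (v - n) - (v' - n)" for v v' by simp
    have dD: "real (card (difference_primes I (v - v'))) \<le> \<kappa>"
      if v: "v \<in> prog q (n - u) b" "v' \<in> prog q' (n - u') b" "v \<noteq> v'" for b v v'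
    proof -
      have "v - n \<in> insert 0 (odiffs q)" "v' - n \<in> insert 0 (odiffs q')"
        using mem v u by blast+
      then consider "v = n" "v' - n \<in> odiffs q'" | "v' = n" "v - n \<in> odiffs q" | "v - n \<in> odiffs q" "v' - n \<in> odiffs q'"
        using v(3) by auto
      then show ?thesis
      proof cases
        case 1
        then have "real (card (difference_primes I (v' - n))) \<le> \<kappa>" using \<kappa>(2) by (simp add: D_def)
        moreover have "v - v' = - (v' - n)" using 1 by simp
        ultimately show ?thesis by (metis difference_primes_uminus)
      next
        case 2
        then show ?thesis using \<kappa>(2) by (simp add: D_def)
      next
        case 3
        then have "(v - n) - (v' - n) \<in> D" unfolding D_def by (auto intro!: image_eqI[where x = "(v - n, v' - n)"])
        then show ?thesis using \<kappa>(2) by fastforce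
      qed
    qed
    have same: "real (card (difference_primes I (v - v'))) \<le> \<kappa>"
      if "v \<in> prog r (n - t) b" "v' \<in> prog r (n - t) b" "v \<noteq> v'" "r \<in> {q, q'}" for b v v' r t
      using mem_prog_diff[OF that(1,2)] that \<kappa>(2) by (auto simp: D_def)
    have dif: "v - v' = 0 \<or> v - v' = - 0 \<or> real (card (difference_primes I (v - v'))) \<le> \<kappa>"
      if vv: "v \<in> prog q (n - u) b \<union> prog q' (n - u') b" "v' \<in> prog q (n - u) b \<union> prog q' (n - u') b" "v \<noteq> v'" for b v v'
    proof -
      have "real (card (difference_primes I (v - v'))) \<le> \<kappa>"
        if "v \<in> prog q' (n - u') b" "v' \<in> prog q (n - u) b"
        using dD[OF that(2,1)] vv(3) by (metis difference_primes_uminus minus_diff_eq)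
      then show ?thesis using vv same[of v q u b v'] same[of v q' u' b v'] dD[of v b v'] by blast
    qed
    have "avg (P1 \<union> P2) (\<lambda>b. ?c b * (lam q (n - u) b * lam q' (n - u') b)) \<le>
        avg (P1 \<union> P2) ?c * (1 / \<sigma>2 ^ 1) *
         exp (2 * real B * (2 * real (2 * k) * 0 + (real (2 * k))\<^sup>2 * \<kappa> / W))"
      unfolding lam_def using card_prog q finite_prog periodic_prog avoids_periodic1[of "{n}"] int1 \<kappa>(1) kW
      by (intro avg_lambda_mult_le[where w = 0] dif) (auto simp: periodic1_def)
    also have "avg (P1 \<union> P2) ?c = density_of I P1" by (rule c1)
    also have "2 * real B * (2 * real (2 * k) * 0 + (real (2 * k))\<^sup>2 * \<kappa> / W) = s * \<kappa>"
      unfolding s_def using W1 by (simp add: field_simps power2_eq_square)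
    also have "density_of I P1 * (1 / \<sigma>2 ^ 1) * exp (s * \<kappa>) \<le> density_of I P1 * (1 / \<sigma>2 ^ 1) * (1 + cross_excess q q')"
    proof (intro mult_left_mono)
      have "(\<Sum>d\<in>D. pair_weight c k0 d) \<le> (\<Sum>d\<in>odiffs q. pair_weight c k0 d) + (\<Sum>d\<in>odiffs q'. pair_weight c k0 d)
          + (\<Sum>d\<in>(\<lambda>(d, d'). d - d') ` (odiffs q \<times> odiffs q'). pair_weight c k0 d)"
        unfolding D_def using finite_offset_differences
        by (intro order_trans[OF sum_union_le] add_mono order_refl finite_UnI finite_imageI finite_cartesian_product sum_union_le pair_weight_nonneg)
      also have "(\<Sum>d\<in>(\<lambda>(d, d'). d - d') ` (odiffs q \<times> odiffs q'). pair_weight c k0 d) \<le>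
          (\<Sum>x\<in>odiffs q \<times> odiffs q'. pair_weight c k0 (case x of (d, d') \<Rightarrow> d - d'))"
        using finite_offset_differences pair_weight_nonneg by (intro sum_image_le[unfolded o_def]) auto
      also have "\<dots> = (\<Sum>d\<in>odiffs q. \<Sum>d'\<in>odiffs q'. pair_weight c k0 (d - d'))"
        by (simp add: sum.cartesian_product case_prod_beta')
      finally show "exp (s * \<kappa>) \<le> 1 + cross_excess q q'"
        using \<kappa>(3) False by (simp add: cross_excess_def)
    qed (use s1 \<sigma>2_pos in auto)
    finally show ?thesis by simp
  qed
qed

text \<open>Each progression contains \<open>n\<close>, so conditioning on the survival of
  \<open>n\<close> raises the mean of its weight from about 1 to about
  \<open>1 / \<sigma>2\<close>.\<close>

lemma variance_at_point:
  assumes Q: "\<And>q. q \<in> Q \<Longrightarrow> prime q" and i: "\<And>q. q \<in> Q \<Longrightarrow> i \<in> {1..card (I q)}"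
  shows "avg (P1 \<union> P2) (\<lambda>b. of_bool (avoids I P1 {n} b \<and> avoids I P2 {n} b) *
      ((\<Sum>(q, h)\<in>Q \<times> {1..J}. lam q (n - a i q - int h * int q) b) - real (card Q * J) * (1 / \<sigma>2))\<^sup>2)
    \<le> density_of I P1 / \<sigma>2 * ((real J)\<^sup>2 * (\<Sum>q\<in>Q. \<Sum>q'\<in>Q. cross_excess q q') + 2 * (real (card Q * J))\<^sup>2 * \<eta>)"
proof -
  let ?c = "\<lambda>b. of_bool (avoids I P1 {n} b) * of_bool (avoids I P2 {n} b) :: real"
  let ?c1 = "\<lambda>b. of_bool (avoids I P1 {n} b) :: real"
  let ?u = "\<lambda>x. a i (fst x) + int (snd x) * int (fst x)"
  let ?l = "\<lambda>x. lam (fst x) (n - ?u x)"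
  let ?X = "Q \<times> {1..J}"
  have u: "?u x \<in> off (fst x)" if "x \<in> ?X" for x
    using that i[of "fst x"] unfolding offsets_def by (auto intro!: image_eqI[where x = "(i, snd x)"])
  \<comment> \<open>A nonzero weight forces its whole progression, and with it \<open>n\<close>, to
    survive the large primes; the indicator for \<open>P2\<close> is therefore redundant next to a
    weight.\<close>
  have absorb: "?c b * ?l x b = ?c1 b * ?l x b" if "x \<in> ?X" for x b
  proof (cases "?c1 b * ?l x b = 0")
    case False
    then have "avoids I P1 {n} b" "avoids I P2 (prog (fst x) (n - ?u x) b) b"
      by (auto simp: lam_def lambda_of_def)
    moreover from this(1) have "n \<in> prog (fst x) (n - ?u x) b"
      using u[OF that] by (auto simp: prog_def intro!: image_eqI[where x = "?u x"])
    ultimately have "avoids I P2 {n} b" by (auto simp: avoids_def)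
    then show ?thesis by simp
  qed auto
  have s1: "density_of I P1 > 0" using density_of_pos[of P1] pr by blast
  have "avg (P1 \<union> P2) (\<lambda>b. ?c b * ((\<Sum>x\<in>?X. ?l x b) - real (card ?X) * (1 / \<sigma>2))\<^sup>2) \<le>
    (density_of I P1 * \<sigma>2) * (1 / \<sigma>2)\<^sup>2 * ((\<Sum>x\<in>?X. \<Sum>x'\<in>?X. cross_excess (fst x) (fst x')) + 2 * (real (card ?X))\<^sup>2 * \<eta>)"
  proof (rule avg_weighted_variance)
    show "avg (P1 \<union> P2) ?c = density_of I P1 * \<sigma>2" by (rule avg_avoids12)
    fix x assume x: "x \<in> ?X"
    have px: "prime (fst x)" using x Q by auto
    have "density_of I P1 * (1 - \<eta>) \<le> avg (P1 \<union> P2) (\<lambda>b. ?c1 b * ?l x b)"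
      using avg_lam_ge[OF px, of ?c1 "n - ?u x"] avoids_periodic1[of "{n}"]
      unfolding avg_avoids1 by (simp add: periodic1_def)
    then show "density_of I P1 * \<sigma>2 * (1 / \<sigma>2) * (1 - \<eta>) \<le> avg (P1 \<union> P2) (\<lambda>b. ?c b * ?l x b)"
      using \<sigma>2_pos unfolding absorb[OF x] by simp
    fix x' assume x': "x' \<in> ?X"
    have px': "prime (fst x')" using x' Q by auto
    have "avg (P1 \<union> P2) (\<lambda>b. ?c b * (?l x b * ?l x' b)) = avg (P1 \<union> P2) (\<lambda>b. ?c1 b * (?l x b * ?l x' b))"
      unfolding mult.assoc[symmetric] absorb[OF x] ..
    also have "\<dots> \<le> density_of I P1 / \<sigma>2 * (1 + cross_excess (fst x) (fst x'))"
      by (rule avg_lam_mult_cross[OF px px' u[OF x] u[OF x']])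
    also have "\<dots> = density_of I P1 * \<sigma>2 * (1 / \<sigma>2)\<^sup>2 * (1 + cross_excess (fst x) (fst x'))"
      using \<sigma>2_pos by (simp add: power2_eq_square)
    finally show "avg (P1 \<union> P2) (\<lambda>b. ?c b * (?l x b * ?l x' b)) \<le>
      density_of I P1 * \<sigma>2 * (1 / \<sigma>2)\<^sup>2 * (1 + cross_excess (fst x) (fst x'))" .
  qed (use s1 \<sigma>2_pos in auto)
  also have "(\<Sum>x\<in>?X. \<Sum>x'\<in>?X. cross_excess (fst x) (fst x')) = (real J)\<^sup>2 * (\<Sum>q\<in>Q. \<Sum>q'\<in>Q. cross_excess q q')"
  proof -
    have "(\<Sum>x\<in>?X. f (fst x)) = real J * (\<Sum>q\<in>Q. f q)" for f :: "nat \<Rightarrow> real"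
      using sum.cartesian_product[of "\<lambda>q h. f q" "{1..J}" Q] by (simp add: case_prod_beta' sum_distrib_left)
    from this[of "\<lambda>q'. cross_excess q q'" for q] this[of "\<lambda>q. real J * (\<Sum>q'\<in>Q. cross_excess q q')"]
    show ?thesis by (simp only: sum_distrib_left[symmetric] power2_eq_square mult.assoc)
  qed
  also have "density_of I P1 * \<sigma>2 * (1 / \<sigma>2)\<^sup>2 = density_of I P1 / \<sigma>2" using \<sigma>2_pos by (simp add: power2_eq_square)
  finally show ?thesis by (simp add: case_prod_beta' diff_diff_eq card_cartesian_product of_bool_conj)
qed

end

section \<open>Integers with many difference primes\<close>

text \<open>A falling factorial with r factors, each larger than n - r; truncated subtraction makes
  the left side harmless when r > n.\<close>

lemma falling_power_le: "(n - r) ^ r \<le> (n choose r) * fact r"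
proof (induction r)
  case (Suc r)
  have "(n - Suc r) ^ Suc r \<le> (n - r) ^ r * (n - r)"
    by (simp add: mult_le_mono power_mono mult.commute del: diff_Suc_eq_diff_pred) 
  also have "\<dots> \<le> ((n choose r) * fact r) * (n - r)" using Suc by (rule mult_le_mono1)
  also have "\<dots> = ((n - r) * (n choose r)) * fact r" by simp
  also have "(n - r) * (n choose r) = Suc r * (n choose Suc r)"
    by (simp only: binomial_absorb_comp binomial_absorption)
  finally show ?case by (simp add: algebra_simps)
qed simp

context sieving_system
begin

text \<open>Modulo the product m of the primes at most B^2 residues per prime are admissible, and
  since m \<le> Y each residue class meets the window at most 4 Y / m times.\<close>

lemma card_multi_difference:
  fixes Y :: int
  assumes R: "finite R" "\<And>p. p \<in> R \<Longrightarrow> prime p" and Y: "(\<Prod>p\<in>R. int p) \<le> Y"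
  shows "real (card {w\<in>{-Y..Y}. \<forall>p\<in>R. in_difference_set I p w}) \<le>
    4 * of_int Y * (real B ^ 2) ^ card R / (\<Prod>p\<in>R. real p)"
proof -
  define m where "m = (\<Prod>p\<in>R. int p)"
  define T where "T = (\<lambda>p::nat. (\<lambda>(c, d). (c - d) mod int p) ` (I p \<times> I p))"
  define S where "S = {c\<in>{0..<m}. \<forall>p\<in>R. c mod int p \<in> T p}"
  have m0: "m > 0" using prod_primes_pos(1)[of R] R unfolding m_def by blast
  have inT: "in_difference_set I p w \<longleftrightarrow> w mod int p \<in> T p" for p w
    unfolding in_difference_set_def T_def unique_euclidean_semiring_class.cong_def by auto
  have cT: "card (T p) \<le> B ^ 2" if "prime p" for p
  proof -
    have "card (T p) \<le> card (I p \<times> I p)" unfolding T_def using finite_classes[OF that] by (intro card_image_le) auto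
    also have "\<dots> \<le> B * B" using bounded[OF that] by (simp add: card_cartesian_product mult_le_mono)
    finally show ?thesis by (simp add: power2_eq_square)
  qed
  have Tsub: "T p \<subseteq> {0..<int p}" if "prime p" for p
    using prime_gt_0_nat[OF that] unfolding T_def by auto
  have cS: "real (card S) \<le> (real B ^ 2) ^ card R"
  proof -
    \<comment> \<open>Lying in every \<open>T p\<close> is avoiding every complement, so the
      avoidance formula counts the admissible residues.\<close>
    have "avg R (\<lambda>b. of_bool (\<forall>p\<in>R. b mod int p \<notin> {0..<int p} - T p)) =
        (\<Prod>p\<in>R. 1 - real (card ({0..<int p} - T p)) / real p)"
      using R by (intro avg_avoiding) auto
    also have "\<dots> = (\<Prod>p\<in>R. real (card (T p)) / real p)"
    proof (intro prod.cong refl)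
      fix p assume "p \<in> R"
      then have p: "prime p" using R by blast
      have "card ({0..<int p} - T p) = p - card (T p)"
        using Tsub[OF p] by (subst card_Diff_subset) (auto intro: finite_subset)
      moreover have "card (T p) \<le> p" using card_mono[OF _ Tsub[OF p]] by simp
      ultimately show "1 - real (card ({0..<int p} - T p)) / real p = real (card (T p)) / real p"
        using prime_gt_0_nat[OF p] by (simp add: of_nat_diff field_simps)
    qed
    also have "avg R (\<lambda>b. of_bool (\<forall>p\<in>R. b mod int p \<notin> {0..<int p} - T p)) = real (card S) / (\<Prod>p\<in>R. real p)"
    proof -
      have "(\<Sum>b\<in>{0..<m}. of_bool (\<forall>p\<in>R. b mod int p \<notin> {0..<int p} - T p) :: real) =
          (\<Sum>b\<in>{0..<m}. of_bool (\<forall>p\<in>R. b mod int p \<in> T p))"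
        using R prime_gt_0_nat by (intro sum.cong refl arg_cong[where f = of_bool] ball_cong) auto
      also have "\<dots> = real (card S)" unfolding S_def by (rule card_filter_eq_sum[symmetric]) simp
      finally show ?thesis unfolding avg_def m_def by (simp only:)
    qed
    finally have "real (card S) / (\<Prod>p\<in>R. real p) = (\<Prod>p\<in>R. real (card (T p))) / (\<Prod>p\<in>R. real p)"
      by (simp only: prod_dividef)
    moreover have "(\<Prod>p\<in>R. real p) \<noteq> 0" using prod_primes_pos(2)[of R] R(2) by force
    ultimately have "real (card S) = (\<Prod>p\<in>R. real (card (T p)))"
      by (simp only: divide_cancel_right simp_thms)
    also have "\<dots> \<le> (\<Prod>p\<in>R. real B ^ 2)"
      using cT R by (intro prod_mono) (auto simp flip: of_nat_power)
    finally show ?thesis by simp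
  qed
  \<comment> \<open>Each \<open>w\<close> is determined by its residue and its quotient modulo
    \<open>m\<close>.\<close>
  have "card {w\<in>{-Y..Y}. \<forall>p\<in>R. in_difference_set I p w} \<le> card (S \<times> {(-Y) div m..Y div m})"
  proof (rule card_inj_on_le[where f = "\<lambda>w. (w mod m, w div m)"])
    show "inj_on (\<lambda>w. (w mod m, w div m)) {w\<in>{-Y..Y}. \<forall>p\<in>R. in_difference_set I p w}"
      by (intro inj_onI) (metis div_mult_mod_eq prod.inject)
    show "(\<lambda>w. (w mod m, w div m)) ` {w\<in>{-Y..Y}. \<forall>p\<in>R. in_difference_set I p w} \<subseteq> S \<times> {(-Y) div m..Y div m}"
      using m0 mod_prod_mod[OF R(1)] unfolding S_def inT m_def
      by (auto intro: zdiv_mono1)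
    have "finite S" unfolding S_def by (rule finite_subset[of _ "{0..<m}"]) auto
    then show "finite (S \<times> {(-Y) div m..Y div m})" by simp
  qed
  also have "\<dots> = card S * card {(-Y) div m..Y div m}" by (rule card_cartesian_product)
  finally have "real (card {w\<in>{-Y..Y}. \<forall>p\<in>R. in_difference_set I p w}) \<le> real (card S * card {(-Y) div m..Y div m})"
    by (simp only: of_nat_le_iff)
  also have "\<dots> = real (card S) * real (card {(-Y) div m..Y div m})" by (rule of_nat_mult)
  also have "\<dots> \<le> (real B ^ 2) ^ card R * (4 * (of_int Y / of_int m))"
  proof (intro mult_mono cS)
    have "real (card {(-Y) div m..Y div m}) \<le> of_int (Y div m) - of_int ((-Y) div m) + 1"
    proof -
      have "(-Y) div m \<le> Y div m" using m0 Y unfolding m_def[symmetric] by (intro zdiv_mono1) auto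
      then show ?thesis by simp
    qed
    also have "of_int (Y div m) \<le> (of_int Y / of_int m :: real)" 
      unfolding floor_divide_of_int_eq[symmetric, where ?'a = real] by (rule of_int_floor_le)
    finally have "real (card {(-Y) div m..Y div m}) \<le> of_int Y / of_int m - of_int ((-Y) div m) + 1" by simp
    moreover have "of_int ((-Y) div m) \<ge> - (of_int Y / of_int m :: real) - 1"
    proof -
      have "(-Y) div m = \<lfloor>of_int (- Y) / (of_int m :: real)\<rfloor>" by (rule floor_divide_of_int_eq[symmetric])
      then show ?thesis by linarith
    qed
    ultimately have "real (card {(-Y) div m..Y div m}) \<le> 2 * (of_int Y / of_int m) + 2" by linarith
    \<comment> \<open>The rounding term 2 is absorbed because Y / m \<ge> 1.\<close>
    also have "2 * (of_int Y / of_int m) + 2 \<le> 4 * (of_int Y / of_int m :: real)"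
    proof -
      have "(1::real) \<le> of_int Y / of_int m" using m0 Y unfolding m_def[symmetric] by simp
      then show ?thesis by simp
    qed
    finally show "real (card {(-Y) div m..Y div m}) \<le> 4 * (of_int Y / of_int m)" .
  qed auto
  also have "of_int m = (\<Prod>p\<in>R. real p)" unfolding m_def by simp
  finally show ?thesis by (simp add: mult_ac)
qed

text \<open>A fixed p hits at most 4 Y B^2 / p elements of the window, each with mass 1 / p, so the
  total is governed by the tail of the sum of 1 / p^2.\<close>

lemma sum_collision_mass_window:
  fixes Y :: int
  assumes P: "finite P" "\<And>p. p \<in> P \<Longrightarrow> prime p" "\<And>p. p \<in> P \<Longrightarrow> W < real p" "W \<ge> 1" and Y: "\<And>p. p \<in> P \<Longrightarrow> int p \<le> Y" "Y \<ge> 0"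
  shows "(\<Sum>w\<in>{-Y..Y}. collision_mass I P w) \<le> 8 * of_int Y * real B ^ 2 / W"
proof -
  have "(\<Sum>w\<in>{-Y..Y}. collision_mass I P w) = (\<Sum>w\<in>{-Y..Y}. \<Sum>p\<in>P. of_bool (in_difference_set I p w) / real p)"
    unfolding collision_mass_def sum.inter_filter[OF P(1)] by (intro sum.cong refl) auto
  also have "\<dots> = (\<Sum>p\<in>P. \<Sum>w\<in>{-Y..Y}. of_bool (in_difference_set I p w) / real p)" by (rule sum.swap)
  also have "\<dots> = (\<Sum>p\<in>P. real (card {w\<in>{-Y..Y}. in_difference_set I p w}) / real p)"
    by (simp only: card_filter_eq_sum[OF finite_atLeastAtMost_int] sum_divide_distrib)
  also have "\<dots> \<le> (\<Sum>p\<in>P. 4 * of_int Y * real B ^ 2 * (1 / (real p)\<^sup>2))"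
  proof (intro sum_mono)
    fix p assume p: "p \<in> P"
    have "real (card {w\<in>{-Y..Y}. in_difference_set I p w}) \<le> 4 * of_int Y * real B ^ 2 / real p"
      using card_multi_difference[of "{p}" Y] P Y p by simp
    then have "real (card {w\<in>{-Y..Y}. in_difference_set I p w}) / real p \<le> 4 * of_int Y * real B ^ 2 / real p / real p"
      by (rule divide_right_mono) simp
    then show "real (card {w\<in>{-Y..Y}. in_difference_set I p w}) / real p \<le> 4 * of_int Y * real B ^ 2 * (1 / (real p)\<^sup>2)"
      by (simp add: power2_eq_square)
  qed
  also have "\<dots> = 4 * of_int Y * real B ^ 2 * (\<Sum>p\<in>P. 1 / (real p)\<^sup>2)" by (simp add: sum_distrib_left)
  also have "\<dots> \<le> 4 * of_int Y * real B ^ 2 * (2 / W)"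
    using sum_inverse_squares_tail[OF P(1,4,3)] Y(2) by (intro mult_left_mono) auto
  finally show ?thesis by simp
qed

text \<open>
  Double counting of the pairs \<open>(w, A)\<close> where \<open>A\<close> consists of \<open>r\<close> primes of the block that are difference primes of \<open>w\<close>.
  The condition \<open>4 ^ (Suc j * r) \<le> Y\<close> keeps the product of the primes in \<open>A\<close> below the length of the window.
\<close>

lemma card_block_hits:
  fixes Y :: int
  assumes R: "finite R" "\<And>p. p \<in> R \<Longrightarrow> prime p \<and> 4 ^ j < p \<and> p \<le> 4 ^ Suc j"
    and r: "2 * r \<le> 2 ^ j" "4 ^ (Suc j * r) \<le> Y" and B: "64 * B ^ 4 \<le> 2 ^ j"
  shows "real (card {w\<in>{-Y..Y}. card {p\<in>R. in_difference_set I p w} \<ge> 2 ^ j}) \<le> 4 * of_int Y * exp (- (ln 2 / 2 * real (j * r)))"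
proof -
  define X where "X = {w\<in>{-Y..Y}. card {p\<in>R. in_difference_set I p w} \<ge> 2 ^ j}"
  define \<R> where "\<R> = {A. A \<subseteq> R \<and> card A = r}"
  have fR: "finite \<R>" unfolding \<R>_def using R(1) by simp
  have fX: "finite X" unfolding X_def by (rule finite_subset[of _ "{-Y..Y}"]) auto
  have Y0: "Y \<ge> 0" using r(2) by (smt (verit) zero_le_power)
  \<comment> \<open>Lower side of the double count: every w in \<open>X\<close> has at least 2^j
    hitting primes, hence at least 2^j choose r sets of size r.\<close>
  have "real (card X) * real (2 ^ j choose r) \<le> (\<Sum>w\<in>X. real (card {A\<in>\<R>. \<forall>p\<in>A. in_difference_set I p w}))"
  proof -
    have "real (2 ^ j choose r) \<le> real (card {A\<in>\<R>. \<forall>p\<in>A. in_difference_set I p w})" if "w \<in> X" for w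
    proof -
      have eq: "{A\<in>\<R>. \<forall>p\<in>A. in_difference_set I p w} = {A. A \<subseteq> {p\<in>R. in_difference_set I p w} \<and> card A = r}"
        unfolding \<R>_def by auto
      have "2 ^ j choose r \<le> card {p\<in>R. in_difference_set I p w} choose r"
        using that unfolding X_def by (intro binomial_right_mono) auto
      also have "\<dots> = card {A\<in>\<R>. \<forall>p\<in>A. in_difference_set I p w}"
        unfolding eq using R(1) by (subst n_subsets) auto
      finally show ?thesis by simp
    qed
    then show ?thesis using sum_bounded_below[of X "real (2 ^ j choose r)"] by simp
  qed
  also have "\<dots> = (\<Sum>w\<in>X. \<Sum>A\<in>\<R>. of_bool (\<forall>p\<in>A. in_difference_set I p w))"
    by (simp only: card_filter_eq_sum[OF fR])
  also have "\<dots> = (\<Sum>A\<in>\<R>. \<Sum>w\<in>X. of_bool (\<forall>p\<in>A. in_difference_set I p w))" by (rule sum.swap)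
  \<comment> \<open>Upper side: for a fixed set of r primes, all above 4^j, the number of w is
    bounded by the Chinese remainder count.\<close>
  also have "\<dots> \<le> (\<Sum>A\<in>\<R>. 4 * of_int Y * (real B ^ 2) ^ r / (4 ^ j) ^ r)"
  proof (intro sum_mono)
    fix A assume A: "A \<in> \<R>"
    then have fA: "finite A" and AR: "A \<subseteq> R" and cA: "card A = r" unfolding \<R>_def using R(1) finite_subset by auto
    have "(\<Sum>w\<in>X. of_bool (\<forall>p\<in>A. in_difference_set I p w)) = real (card {w\<in>X. \<forall>p\<in>A. in_difference_set I p w})"
      by (rule card_filter_eq_sum[OF fX, symmetric])
    also have "\<dots> \<le> real (card {w\<in>{-Y..Y}. \<forall>p\<in>A. in_difference_set I p w})"
      unfolding of_nat_le_iff by (intro card_mono finite_subset[of "{w\<in>{-Y..Y}. _ w}" "{-Y..Y}"]) (auto simp: X_def)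
    also have "\<dots> \<le> 4 * of_int Y * (real B ^ 2) ^ card A / (\<Prod>p\<in>A. real p)"
    proof (rule card_multi_difference[OF fA])
      have "(\<Prod>p\<in>A. int p) \<le> (\<Prod>p\<in>A. 4 ^ Suc j)"
      proof (intro prod_mono conjI)
        fix p assume "p \<in> A"
        then have "p \<le> 4 ^ Suc j" using AR R(2) by blast
        then have "int p \<le> int (4 ^ Suc j)" by (simp only: of_nat_le_iff)
        then show "int p \<le> 4 ^ Suc j" by simp
      qed simp
      also have "\<dots> = 4 ^ (Suc j * r)" by (simp only: prod_constant cA power_mult)
      finally show "(\<Prod>p\<in>A. int p) \<le> Y" using r(2) by linarith
    qed (use AR R in auto)
    also have "\<dots> \<le> 4 * of_int Y * (real B ^ 2) ^ r / (4 ^ j) ^ r"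
    proof -
      have le: "(4 ^ j) ^ r \<le> (\<Prod>p\<in>A. real p)"
      proof -
        have "(4 ^ j :: real) ^ r = (\<Prod>p\<in>A. 4 ^ j)" by (simp add: cA)
        also have "\<dots> \<le> (\<Prod>p\<in>A. real p)"
        proof (intro prod_mono conjI)
          fix p assume "p \<in> A"
          then have "4 ^ j \<le> p" using AR R(2) by (blast intro: less_imp_le)
          then have "real (4 ^ j) \<le> real p" by (simp only: of_nat_le_iff)
          then show "4 ^ j \<le> real p" by simp
        qed simp
        finally show ?thesis .
      qed
      show ?thesis unfolding cA using Y0 by (intro divide_left_mono[OF le]) (auto intro!: mult_pos_pos order.strict_trans2[OF _ le])
    qed
    finally show "(\<Sum>w\<in>X. of_bool (\<forall>p\<in>A. in_difference_set I p w)) \<le> 4 * of_int Y * (real B ^ 2) ^ r / (4 ^ j) ^ r" .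
  qed
  also have "\<dots> = real (card R choose r) * (4 * of_int Y * (real B ^ 2) ^ r / (4 ^ j) ^ r)"
    unfolding \<R>_def using R(1) by (simp add: n_subsets)
  finally have "real (card X) * real (2 ^ j choose r) * fact r \<le> real (card R choose r) * (4 * of_int Y * (real B ^ 2) ^ r / (4 ^ j) ^ r) * fact r"
    by (rule mult_right_mono) simp
  also have "\<dots> = real ((card R choose r) * fact r) * (4 * of_int Y * (real B ^ 2) ^ r / (4 ^ j) ^ r)" by simp
  also have "\<dots> \<le> (4 ^ Suc j) ^ r * (4 * of_int Y * (real B ^ 2) ^ r / (4 ^ j) ^ r)"
  proof (intro mult_right_mono)
    have "R \<subseteq> {1..4 ^ Suc j}" using R(2) by fastforce
    then have "card R \<le> 4 ^ Suc j" using card_mono[of "{1..4 ^ Suc j}" R] by simp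
    then have "(card R choose r) * fact r \<le> (4 ^ Suc j) ^ r"
      using binomial_fact_pow[of "card R" r] by (meson order_trans power_mono zero_le)
    then have "real ((card R choose r) * fact r) \<le> real ((4 ^ Suc j) ^ r)" by (simp only: of_nat_le_iff)
    then show "real ((card R choose r) * fact r) \<le> (4 ^ Suc j) ^ r" by simp
  qed (use Y0 in auto)
  also have "\<dots> = 4 * of_int Y * (4 * real B ^ 2) ^ r"
  proof -
    have "(4 ^ Suc j :: real) ^ r = 4 ^ r * (4 ^ j) ^ r" by (simp add: power_mult_distrib)
    then show ?thesis by (simp add: power_mult_distrib)
  qed
  finally have main: "real (card X) * real (2 ^ j choose r) * fact r \<le> 4 * of_int Y * (4 * real B ^ 2) ^ r" .
  \<comment> \<open>As r \<le> 2^(j-1), each of the r factors of the falling factorial of 2^j is at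
    least 2^j / 2.\<close>
  have low: "(2 ^ j / 2) ^ r \<le> real (2 ^ j choose r) * fact r"
  proof -
    have "(2 ^ j / 2 :: real) ^ r \<le> real (2 ^ j - r) ^ r"
    proof (rule power_mono)
      have "real (2 ^ j - r) = 2 ^ j - real r" using r(1) by (subst of_nat_diff) auto
      moreover have "2 * real r \<le> 2 ^ j" using r(1) by (metis of_nat_le_iff of_nat_mult of_nat_numeral of_nat_power)
      ultimately show "2 ^ j / 2 \<le> real (2 ^ j - r)" by simp
    qed simp
    also have "\<dots> \<le> real ((2 ^ j choose r) * fact r)"
      using falling_power_le[of "2 ^ j" r] by (metis of_nat_le_iff of_nat_power)
    finally show ?thesis by simp
  qed
  have "real (card X) * (2 ^ j / 2) ^ r \<le> real (card X) * (real (2 ^ j choose r) * fact r)"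
    using low by (intro mult_left_mono) auto
  also have "\<dots> \<le> 4 * of_int Y * (4 * real B ^ 2) ^ r" using main by simp
  finally have "real (card X) \<le> 4 * of_int Y * (4 * real B ^ 2) ^ r / (2 ^ j / 2) ^ r"
    by (subst pos_le_divide_eq) auto
  also have "\<dots> = 4 * of_int Y * (4 * real B ^ 2 / (2 ^ j / 2)) ^ r"
    by (simp only: power_divide times_divide_eq_right)
  also have "4 * real B ^ 2 / (2 ^ j / 2) = 8 * real B ^ 2 / 2 ^ j" by simp
  finally have "real (card X) \<le> 4 * of_int Y * (8 * real B ^ 2 / 2 ^ j) ^ r" .
  \<comment> \<open>The assumption 64 B^4 \<le> 2^j says 8 B^2 \<le> 2^(j/2), so every chosen prime
    still saves 2^(-j/2).\<close>
  also have "4 * of_int Y * (8 * real B ^ 2 / 2 ^ j) ^ r \<le> 4 * of_int Y * exp (- (ln 2 / 2 * real j)) ^ r"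
  proof (intro mult_left_mono power_mono)
    have e: "exp (ln 2 / 2 * real j) ^ 2 = 2 ^ j"
    proof -
      have "exp (ln 2 / 2 * real j) ^ 2 = exp (2 * (ln 2 / 2 * real j))" by (rule exp_double[symmetric])
      also have "2 * (ln 2 / 2 * real j) = real j * ln 2" by simp
      also have "exp (real j * ln 2) = (2 :: real) ^ j" by (subst exp_of_nat_mult) simp
      finally show ?thesis .
    qed
    have "(8 * real B ^ 2) ^ 2 = real (64 * B ^ 4)" by (simp add: power_mult_distrib)
    also have "\<dots> \<le> real (2 ^ j)" using B by (simp only: of_nat_le_iff)
    finally have "(8 * real B ^ 2) ^ 2 \<le> exp (ln 2 / 2 * real j) ^ 2" unfolding e by simp
    then have "8 * real B ^ 2 \<le> exp (ln 2 / 2 * real j)" by (rule power2_le_imp_le) simp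
    then have "8 * real B ^ 2 / 2 ^ j \<le> exp (ln 2 / 2 * real j) / exp (ln 2 / 2 * real j) ^ 2"
      unfolding e by (rule divide_right_mono) simp
    then show "8 * real B ^ 2 / 2 ^ j \<le> exp (- (ln 2 / 2 * real j))"
      by (simp add: power2_eq_square exp_minus inverse_eq_divide)
  qed (use Y0 in auto)
  also have "exp (- (ln 2 / 2 * real j)) ^ r = exp (- (ln 2 / 2 * real (j * r)))"
    by (simp add: exp_of_nat_mult[symmetric] mult_ac)
  finally show ?thesis unfolding X_def .
qed

end

lemma sum_UNION_le:
  fixes f :: "'a \<Rightarrow> real"
  assumes "finite K" "\<And>j. j \<in> K \<Longrightarrow> finite (A j)" "\<And>x. f x \<ge> 0"
  shows "sum f (\<Union>j\<in>K. A j) \<le> (\<Sum>j\<in>K. sum f (A j))"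
  using assms
proof (induction K rule: finite_induct)
  case (insert j K)
  have "sum f (\<Union>j\<in>insert j K. A j) \<le> sum f (A j) + sum f (\<Union>j\<in>K. A j)"
    using insert sum_union_le[of "A j" "\<Union>j\<in>K. A j" f] by simp
  with insert show ?case by simp
qed simp

text \<open>A block of primes in (4^j, 4^(j+1)] with at most 2^j hits contributes at most 2^j / 4^j
  = 2^(-j). The blocks start where 4^j is about W, so the geometric series is of order 1 / sqrt
  W.\<close>

lemma collision_mass_blocks:
  assumes P: "finite P" "\<And>p. p \<in> P \<Longrightarrow> real p > W" and W: "W \<ge> 1"
    and few: "\<And>j. \<exists>p\<in>P. 4 ^ j < p \<and> p \<le> 4 ^ Suc j \<Longrightarrow>
      card {p\<in>{p\<in>P. 4 ^ j < p \<and> p \<le> 4 ^ Suc j}. in_difference_set I p w} \<le> 2 ^ j"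
  shows "collision_mass I P w \<le> 4 / sqrt W"
proof -
  \<comment> \<open>The first block that can meet \<open>P\<close>: 4^j0 \<le> W < 4^(j0+1),
    expressed through square roots.\<close>
  obtain j0 :: nat where j0: "2 ^ j0 \<le> sqrt W" "sqrt W < 2 ^ Suc j0"
  proof -
    have "\<exists>n. sqrt W < 2 ^ n" by (rule real_arch_pow) simp
    then have ex: "sqrt W < 2 ^ (LEAST n. sqrt W < 2 ^ n)" by (rule LeastI_ex)
    have "(LEAST n. sqrt W < 2 ^ n) \<noteq> 0" using ex W by (cases "(LEAST n. sqrt W < 2 ^ n)") auto
    then obtain m where m: "(LEAST n. sqrt W < 2 ^ n) = Suc m" by (cases "(LEAST n. sqrt W < 2 ^ n)") auto
    have "\<not> sqrt W < 2 ^ m" using not_less_Least[of m "\<lambda>n. sqrt W < 2 ^ n"] m by simp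
    then show ?thesis using that[of m] ex m by simp
  qed
  have W4: "4 ^ j0 \<le> W"
  proof -
    have "(4::real) ^ j0 = (2 ^ j0) ^ 2" by (simp add: power2_eq_square flip: power_mult_distrib)
    also have "\<dots> \<le> (sqrt W) ^ 2" using j0(1) by (intro power_mono) auto
    finally show ?thesis using W by simp
  qed
  obtain T where T: "P \<subseteq> {..T}" using P(1) finite_nat_set_iff_bounded_le by auto
  let ?b = "\<lambda>j. {p\<in>P. 4 ^ j < p \<and> p \<le> 4 ^ Suc j}"
  have cover: "\<exists>j\<in>{j0..<j0 + Suc T}. p \<in> ?b j" if p: "p \<in> P" for p
  proof -
    have big: "4 ^ j0 < p" using P(2)[OF p] W4 by (metis less_le_trans not_le numeral_less_real_of_nat_iff of_nat_less_iff of_nat_numeral of_nat_power order.strict_trans1)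
    have ex: "p \<le> 4 ^ p" by (meson less_exp less_imp_le order_trans power_mono one_le_numeral numeral_le_iff zero_le semiring_norm(68,69,71))
    define n where "n = (LEAST n. p \<le> 4 ^ n)"
    have n: "p \<le> 4 ^ n" unfolding n_def using ex by (rule LeastI)
    have "n \<le> p" unfolding n_def using ex by (rule Least_le)
    have "n > j0"
    proof (rule ccontr)
      assume "\<not> n > j0"
      then have "(4::nat) ^ n \<le> 4 ^ j0" by (intro power_increasing) auto
      then show False using n big by (meson leD order_trans)
    qed
    then obtain m where m: "n = Suc m" "m \<ge> j0" by (cases n) auto
    have "\<not> p \<le> 4 ^ m" using not_less_Least[of m "\<lambda>n. p \<le> 4 ^ n"] m(1) unfolding n_def by simp
    moreover have "m < j0 + Suc T" using \<open>n \<le> p\<close> m T p by auto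
    ultimately show ?thesis using p m n by (intro bexI[of _ m]) auto
  qed
  have "collision_mass I P w \<le> (\<Sum>j\<in>{j0..<j0 + Suc T}. \<Sum>p\<in>{p\<in>?b j. in_difference_set I p w}. 1 / real p)"
  proof -
    have "collision_mass I P w \<le> (\<Sum>p\<in>(\<Union>j\<in>{j0..<j0 + Suc T}. {p\<in>?b j. in_difference_set I p w}). 1 / real p)"
      unfolding collision_mass_def using cover P(1) by (intro sum_mono2) auto
    also have "\<dots> \<le> (\<Sum>j\<in>{j0..<j0 + Suc T}. \<Sum>p\<in>{p\<in>?b j. in_difference_set I p w}. 1 / real p)"
      using P(1) by (intro sum_UNION_le) auto
    finally show ?thesis .
  qed
  also have "\<dots> \<le> (\<Sum>j\<in>{j0..<j0 + Suc T}. (1 / 2) ^ j)"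
  proof (intro sum_mono)
    fix j
    show "(\<Sum>p\<in>{p\<in>?b j. in_difference_set I p w}. 1 / real p) \<le> (1 / 2) ^ j"
    proof (cases "?b j = {}")
      case False
      then have c: "card {p\<in>?b j. in_difference_set I p w} \<le> 2 ^ j" by (intro few) blast
      have "(\<Sum>p\<in>{p\<in>?b j. in_difference_set I p w}. 1 / real p) \<le> (\<Sum>p\<in>{p\<in>?b j. in_difference_set I p w}. 1 / 4 ^ j)"
      proof (intro sum_mono divide_left_mono)
        fix p assume "p \<in> {p\<in>?b j. in_difference_set I p w}"
        then have "4 ^ j < p" by blast
        then have "real (4 ^ j) \<le> real p" by (simp only: of_nat_le_iff less_imp_le)
        then show le: "4 ^ j \<le> real p" by simp
        have "(0::real) < 4 ^ j" by simp
        then show "0 < real p * 4 ^ j" using le by (intro mult_pos_pos) linarith+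
      qed simp
      also have "\<dots> = real (card {p\<in>?b j. in_difference_set I p w}) * (1 / 4 ^ j)" by (rule sum_constant)
      also have "\<dots> \<le> real (2 ^ j) * (1 / 4 ^ j)"
        using c by (intro mult_right_mono) (simp_all only: of_nat_le_iff, simp)
      also have "\<dots> = (1 / 2) ^ j"
      proof -
        have "(4::real) ^ j = 2 ^ j * 2 ^ j" by (simp flip: power_mult_distrib)
        then show ?thesis by (simp add: power_divide)
      qed
      finally show ?thesis .
    next
      case True
      then have "{p\<in>?b j. in_difference_set I p w} = {}" by blast
      then show ?thesis by (simp only: sum.empty) simp
    qed
  qed
  also have "\<dots> \<le> 2 * (1 / 2) ^ j0"
  proof -
    have "(\<Sum>j\<in>{j0..<j0 + N}. (1 / 2 :: real) ^ j) = 2 * (1 / 2) ^ j0 - 2 * (1 / 2) ^ (j0 + N)" for N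
      by (induction N) simp_all
    then show ?thesis by simp
  qed
  also have "\<dots> \<le> 4 / sqrt W" using j0 W by (simp add: field_simps)
  finally show ?thesis .
qed

context progression_sieve
begin

text \<open>If every block had fewer than 2^j hits, the collision mass would be at most 4 / sqrt W,
  and 64 B k \<le> sqrt W puts this below the threshold in \<open>heavy\<close>.\<close>

lemma heavy_block:
  assumes "heavy w" "64 * real B * real k \<le> sqrt W"
  shows "\<exists>j. (\<exists>p\<in>P2. 4 ^ j < p \<and> p \<le> 4 ^ Suc j) \<and>
    2 ^ j \<le> card {p\<in>{p\<in>P2. 4 ^ j < p \<and> p \<le> 4 ^ Suc j}. in_difference_set I p w}"
proof (rule ccontr)
  assume neg: "\<not> ?thesis"
  have "collision_mass I P2 w \<le> 4 / sqrt W"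
  proof (rule collision_mass_blocks[OF fin(2) W W1])
    fix j assume "\<exists>p\<in>P2. 4 ^ j < p \<and> p \<le> 4 ^ Suc j"
    then have "\<not> 2 ^ j \<le> card {p\<in>{p\<in>P2. 4 ^ j < p \<and> p \<le> 4 ^ Suc j}. in_difference_set I p w}"
      using neg by blast
    then show "card {p\<in>{p\<in>P2. 4 ^ j < p \<and> p \<le> 4 ^ Suc j}. in_difference_set I p w} \<le> 2 ^ j"
      by (simp only: not_le less_imp_le)
  qed
  then have "8 * real B * real k * collision_mass I P2 w \<le> 8 * real B * real k * (4 / sqrt W)"
    by (intro mult_left_mono) auto
  also have "\<dots> \<le> 1 / 2" using assms(2) W1 by (simp add: divide_le_eq)
  finally show False using assms(1) by (simp add: heavy_def)
qed

text \<open>A heavy shift has an overfull block. For each block the moment order r is taken as large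
  as both constraints of \<open>card_block_hits\<close> permit: r \<le> 2^(j-1) gives the term with
  sqrt W, and 4^((j+1) r) \<le> Y gives the term with ln Y. There are at most ln Y blocks.\<close>

lemma card_heavy:
  fixes Y :: int
  assumes kW': "64 * real B * real k \<le> sqrt W" and BW: "128 * real B ^ 4 \<le> sqrt W" and W4: "4 \<le> sqrt W"
    and Y: "Y \<ge> 1" "\<And>p. p \<in> P2 \<Longrightarrow> 4 * int p \<le> Y"
  shows "real (card {w\<in>{-Y..Y}. heavy w}) \<le> ln (of_int Y) * (4 * of_int Y * (exp (- sqrt W / 12) + exp (- ln (of_int Y) / 16)))"
proof -
  let ?b = "\<lambda>j. {p\<in>P2. 4 ^ j < p \<and> p \<le> 4 ^ Suc j}"
  let ?X = "\<lambda>j. {w\<in>{-Y..Y}. 2 ^ j \<le> card {p\<in>?b j. in_difference_set I p w}}"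
  define y where "y = (of_int Y :: real)"
  define Js where "Js = {j. (\<exists>p\<in>P2. 4 ^ j < p \<and> p \<le> 4 ^ Suc j)}"
  define E where "E = exp (- sqrt W / 12) + exp (- ln y / 16)"
  have y1: "y \<ge> 1" using Y(1) unfolding y_def by simp
  have ln2: "ln 2 \<ge> (2/3::real)" using ln2_ge_two_thirds by simp
  have ln4: "ln 4 = 2 * ln (2::real)" using ln_realpow[of 2 2] by simp
  have Js: "2 ^ Suc j > sqrt W" "real (Suc j) * ln 4 \<le> ln y" if "j \<in> Js" for j
  proof -
    from that obtain p where p: "p \<in> P2" "4 ^ j < p" "p \<le> 4 ^ Suc j" unfolding Js_def by blast
    have "real p \<le> real (4 ^ Suc j)" using p(3) by (simp only: of_nat_le_iff)
    then have "W < 4 ^ Suc j" using W[OF p(1)] by simp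
    also have "(4::real) ^ Suc j = (2 ^ Suc j) ^ 2"
    proof -
      have "(4::real) = 2 * 2" by simp
      then show ?thesis by (simp only: power_mult_distrib power2_eq_square)
    qed
    finally show "2 ^ Suc j > sqrt W" by (intro real_less_lsqrt) auto
    have "int (4 ^ j) < int p" using p(2) by (simp only: of_nat_less_iff)
    then have "4 * int (4 ^ j) \<le> Y" using Y(2)[OF p(1)] by linarith
    then have "4 ^ Suc j \<le> Y" by simp
    then have "4 ^ Suc j \<le> y" unfolding y_def by (metis of_int_le_iff of_int_numeral of_int_power)
    then have "ln (4 ^ Suc j) \<le> ln y" using y1 by (subst ln_le_cancel_iff) auto
    then show "real (Suc j) * ln 4 \<le> ln y" by (subst (asm) ln_realpow) auto
  qed
  have bound: "real (card (?X j)) \<le> 4 * y * E" if j: "j \<in> Js" for j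
  proof -
    have j1: "j \<ge> 1" using Js(1)[OF j] W4 by (cases j) auto
    have pow: "(2::nat) ^ j = 2 * 2 ^ (j - 1)" using j1 by (cases j) auto
    have main: "real (card (?X j)) \<le> 4 * y * exp (- (ln 2 / 2 * real (j * r)))"
      if "2 * r \<le> 2 ^ j" "real (Suc j * r) * ln 4 \<le> ln y" for r
      unfolding y_def
    proof (rule card_block_hits)
      have "ln ((4::real) ^ (Suc j * r)) \<le> ln y" using that(2) by (subst ln_realpow) auto
      then have "4 ^ (Suc j * r) \<le> y" using y1 by (subst (asm) ln_le_cancel_iff) auto
      then show "4 ^ (Suc j * r) \<le> Y" unfolding y_def by (metis of_int_le_iff of_int_numeral of_int_power)
      have "real (64 * B ^ 4) \<le> real (2 ^ j)" using Js(1)[OF j] BW by simp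
      then show "64 * B ^ 4 \<le> 2 ^ j" by (simp only: of_nat_le_iff)
    qed (use that fin pr in auto)
    show ?thesis
    \<comment> \<open>The case distinction asks which constraint on r binds; here r = 2^(j-1) still
      keeps products of r primes inside the window.\<close>
    proof (cases "real (Suc j * 2 ^ (j - 1)) * ln 4 \<le> ln y")
      case True
      \<comment> \<open>The 12 is 3 times 4: ln 2 / 2 \<ge> 1/3, and 2^(j-1) is a quarter of 2^(j+1)
        > sqrt W.\<close>
      have "sqrt W / 12 \<le> (1/3) * (1 * 2 ^ (j - 1))"
      proof -
        have "(2::real) ^ Suc j = 4 * 2 ^ (j - 1)" using j1 by (cases j) auto
        then show ?thesis using Js(1)[OF j] by simp
      qed
      also have "\<dots> \<le> (ln 2 / 2) * (real j * 2 ^ (j - 1))"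
        using ln2 j1 by (intro mult_mono) auto
      finally have "exp (- (ln 2 / 2 * real (j * 2 ^ (j - 1)))) \<le> exp (- sqrt W / 12)" by simp
      also have "\<dots> \<le> E" unfolding E_def by simp
      finally have "4 * y * exp (- (ln 2 / 2 * real (j * 2 ^ (j - 1)))) \<le> 4 * y * E"
        using y1 by (intro mult_left_mono) auto
      then show ?thesis using main[of "2 ^ (j - 1)"] True pow by linarith
    next
      case False
      \<comment> \<open>Now the window binds: \<open>u\<close> is the largest real moment order
        allowed by it, and rounding down keeps at least half since u \<ge> 1.\<close>
      define u where "u = ln y / (real (Suc j) * ln 4)"
      define r where "r = nat \<lfloor>u\<rfloor>"
      have den: "real (Suc j) * ln 4 > 0" by (intro mult_pos_pos) auto
      have u1: "u \<ge> 1" using Js(2)[OF j] den unfolding u_def by (simp add: le_divide_eq)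
      have "1 \<le> \<lfloor>u\<rfloor>" using u1 by simp
      then have "real r = of_int \<lfloor>u\<rfloor>" "1 \<le> real r" unfolding r_def by auto
      then have r: "real r \<le> u" "u / 2 \<le> real r" using u1 by linarith+
      have ur: "real r * (real (Suc j) * ln 4) \<le> ln y"
        using r(1) den unfolding u_def by (simp only: pos_le_divide_eq)
      have "2 * r \<le> 2 ^ j"
      proof -
        have "ln y < 2 ^ (j - 1) * (real (Suc j) * ln 4)" using False by (simp only: not_le of_nat_mult of_nat_power of_nat_numeral mult_ac)
        then have "u < 2 ^ (j - 1)" using den unfolding u_def by (simp only: pos_divide_less_eq)
        then have "real r < real (2 ^ (j - 1))" using r(1) unfolding of_nat_power of_nat_numeral by linarith
        then have "r < 2 ^ (j - 1)" by (simp only: of_nat_less_iff)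
        then show ?thesis unfolding pow by linarith
      qed
      moreover have "real (Suc j * r) * ln 4 \<le> ln y" using ur by (simp only: of_nat_mult mult_ac)
      ultimately have X: "real (card (?X j)) \<le> 4 * y * exp (- (ln 2 / 2 * real (j * r)))" by (rule main)
      \<comment> \<open>The 16 collects r \<ge> u / 2, j \<ge> (j + 1) / 2, the factor ln 2 / 2 in
        the exponent, and ln 4 = 2 ln 2.\<close>
      have "ln y / 16 \<le> ln 2 / 2 * real (j * r)"
      proof -
        have "ln y / 16 = u / 2 * (real (Suc j) / 2 * (ln 2 / 2))" 
        proof -
          have "L / 16 = L / (S * (2 * l)) / 2 * (S / 2 * (l / 2))" if "S > 0" "l > 0" for L S l :: real
            using that by (simp add: field_simps)
          then show ?thesis unfolding u_def ln4 by simp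
        qed
        also have "\<dots> \<le> real r * (real j * (ln 2 / 2))"
          using r(2) u1 j1 by (intro mult_mono) auto
        finally show ?thesis by (simp add: mult_ac)
      qed
      then have "exp (- (ln 2 / 2 * real (j * r))) \<le> exp (- ln y / 16)" by simp
      also have "\<dots> \<le> E" unfolding E_def by simp
      finally have "4 * y * exp (- (ln 2 / 2 * real (j * r))) \<le> 4 * y * E"
        using y1 by (intro mult_left_mono) auto
      then show ?thesis using X by linarith
    qed
  qed
  have JsN: "Js \<subseteq> {..<nat \<lfloor>ln y\<rfloor>}"
  proof
    fix j assume j: "j \<in> Js"
    have "real (Suc j) * 1 \<le> real (Suc j) * ln 4" using ln2 unfolding ln4 by (intro mult_left_mono) auto
    from order_trans[OF this Js(2)[OF j]] have "real (Suc j) \<le> ln y" by (simp only: mult_1_right)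
    then have "int (Suc j) \<le> \<lfloor>ln y\<rfloor>" by (simp only: le_floor_iff of_int_of_nat_eq)
    then show "j \<in> {..<nat \<lfloor>ln y\<rfloor>}" by (simp add: zless_nat_eq_int_zless)
  qed
  have finJ: "finite Js" using JsN finite_subset by blast
  have "card {w\<in>{-Y..Y}. heavy w} \<le> card (\<Union>j\<in>Js. ?X j)"
  proof (intro card_mono finite_UN_I finJ)
    show "finite (?X j)" for j by (rule finite_subset[of _ "{-Y..Y}"]) auto
    show "{w\<in>{-Y..Y}. heavy w} \<subseteq> (\<Union>j\<in>Js. ?X j)"
      using heavy_block[OF _ kW'] unfolding Js_def by blast
  qed
  also have "\<dots> \<le> (\<Sum>j\<in>Js. card (?X j))" by (rule card_UN_le[OF finJ])
  finally have "real (card {w\<in>{-Y..Y}. heavy w}) \<le> (\<Sum>j\<in>Js. real (card (?X j)))"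
    by (simp only: of_nat_le_iff flip: of_nat_sum)
  also have "\<dots> \<le> (\<Sum>j\<in>Js. 4 * y * E)" by (intro sum_mono bound)
  also have "\<dots> = real (card Js) * (4 * y * E)" by simp
  also have "\<dots> \<le> ln y * (4 * y * E)"
  proof (intro mult_right_mono)
    have "card Js \<le> nat \<lfloor>ln y\<rfloor>" using card_mono[OF _ JsN] by simp
    moreover have "0 \<le> \<lfloor>ln y\<rfloor>" using y1 by simp
    ultimately have "int (card Js) \<le> \<lfloor>ln y\<rfloor>" by linarith
    then show "real (card Js) \<le> ln y" by (simp only: le_floor_iff of_int_of_nat_eq)
  qed (use y1 in \<open>auto simp: E_def\<close>)
  finally show ?thesis unfolding E_def y_def .
qed

end

section \<open>Families of differences\<close>

text \<open>The tail hypothesis wants one nonzero element of I_q - I_q for every prime q with a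
  nonempty I_q, so each index must define a total choice. Where the labels do not exist the value is
  q itself, a nonzero representative of the class 0.\<close>

definition difference_family :: "(nat \<Rightarrow> int set) \<Rightarrow> (nat \<Rightarrow> nat \<Rightarrow> int) \<Rightarrow> nat \<times> nat \<times> int \<Rightarrow> nat \<Rightarrow> int" where
  "difference_family I a = (\<lambda>(i, j, t) q. if prime q \<and> i \<in> {1..card (I q)} \<and> j \<in> {1..card (I q)}
     then a i q - a j q + t * int q else int q)"

text \<open>The index is independent of q, so all differences of all progressions of one class size
  come from boundedly many families. The excluded case is the zero difference.\<close>

definition family_indices :: "nat \<Rightarrow> nat \<Rightarrow> (nat \<times> nat \<times> int) set" where
  "family_indices \<nu> J = {(i, j, t). i \<in> {1..\<nu>} \<and> j \<in> {1..\<nu>} \<and> t \<in> {- int J..int J} \<and> \<not> (i = j \<and> t = 0)}"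

lemma finite_family_indices: "finite (family_indices \<nu> J)"
  unfolding family_indices_def
  by (rule finite_subset[of _ "{1..\<nu>} \<times> {1..\<nu>} \<times> {- int J..int J}"]) auto

lemma card_family_indices: "card (family_indices \<nu> J) \<le> \<nu> ^ 2 * (2 * J + 1)"
proof -
  have "card (family_indices \<nu> J) \<le> card ({1..\<nu>} \<times> {1..\<nu>} \<times> {- int J..int J})"
    unfolding family_indices_def by (intro card_mono) auto
  also have "\<dots> = \<nu> ^ 2 * (2 * J + 1)"
    by (simp add: card_cartesian_product power2_eq_square nat_add_distrib nat_mult_distrib algebra_simps)
  finally show ?thesis .
qed

text \<open>Two distinct labels lie in an interval of length less than q, so their difference is not
  a multiple of q and no multiple of q can cancel it.\<close>

lemma difference_family_valid:
  assumes lab: "labelling I a" and q: "prime q" "card (I q) \<ge> 1" and \<tau>: "\<tau> \<in> family_indices \<nu> J"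
  shows "difference_family I a \<tau> q \<noteq> 0" "in_difference_set I q (difference_family I a \<tau> q)"
proof -
  obtain i j t where ijt: "\<tau> = (i, j, t)" "\<not> (i = j \<and> t = 0)" using \<tau> unfolding family_indices_def by auto
  have q0: "int q > 0" using prime_gt_0_nat[OF q(1)] by simp
  have lab': "\<And>i. i \<in> {1..card (I q)} \<Longrightarrow> a i q \<in> {1..int q}" "inj_on (\<lambda>i. a i q) {1..card (I q)}"
    "(\<lambda>i. a i q mod int q) ` {1..card (I q)} = I q"
    using lab q(1) unfolding labelling_def by auto
  have "difference_family I a \<tau> q \<noteq> 0 \<and> in_difference_set I q (difference_family I a \<tau> q)"
  proof (cases "i \<in> {1..card (I q)} \<and> j \<in> {1..card (I q)}")
    case True
    then have df: "difference_family I a \<tau> q = a i q - a j q + t * int q"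
      unfolding difference_family_def ijt(1) using q(1) by auto
    have r: "a i q \<in> {1..int q}" "a j q \<in> {1..int q}" using lab'(1) True by auto
    have "a i q - a j q + t * int q \<noteq> 0"
    proof (cases "i = j")
      case True
      then show ?thesis using ijt(2) q0 by simp
    next
      case False
      have "a i q \<noteq> a j q" using False True lab'(2) by (auto dest: inj_onD)
      show ?thesis
      proof
        assume "a i q - a j q + t * int q = 0"
        then have "a i q - a j q = (- t) * int q" by simp
        then have "int q dvd a i q - a j q" by simp
        moreover have "\<bar>a i q - a j q\<bar> < int q" using r by auto
        moreover from calculation(1) have "\<bar>int q\<bar> \<le> \<bar>a i q - a j q\<bar>"
          by (intro dvd_imp_le_int) (use \<open>a i q \<noteq> a j q\<close> in auto)
        ultimately show False by simp
      qed
    qed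
    moreover have "in_difference_set I q (a i q - a j q + t * int q)"
      unfolding in_difference_set_def
    proof (intro bexI)
      show "[a i q - a j q + t * int q = a i q mod int q - a j q mod int q] (mod int q)"
        by (simp add: unique_euclidean_semiring_class.cong_def mod_diff_eq)
    qed (use lab'(3) True in auto)
    ultimately show ?thesis unfolding df by blast
  next
    case False
    then have df: "difference_family I a \<tau> q = int q" unfolding difference_family_def ijt(1) by auto
    \<comment> \<open>The default value is congruent to c - c for any c in I_q; this is where I_q
      must be nonempty.\<close>
    obtain c where "c \<in> I q" using q(2) by fastforce
    moreover have "[int q = c - c] (mod int q)" by (simp add: unique_euclidean_semiring_class.cong_def)
    ultimately have "in_difference_set I q (int q)" unfolding in_difference_set_def by blast
    then show ?thesis using q0 df by simp
  qed
  then show "difference_family I a \<tau> q \<noteq> 0" "in_difference_set I q (difference_family I a \<tau> q)" by auto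
qed

lemma difference_family_le:
  assumes lab: "labelling I a" and q: "prime q" and \<tau>: "\<tau> \<in> family_indices \<nu> J"
  shows "\<bar>difference_family I a \<tau> q\<bar> \<le> int q * (int J + 1)"
proof -
  obtain i j t where ijt: "\<tau> = (i, j, t)" "\<bar>t\<bar> \<le> int J" using \<tau> unfolding family_indices_def by auto
  show ?thesis
  proof (cases "i \<in> {1..card (I q)} \<and> j \<in> {1..card (I q)}")
    case True
    then have df: "difference_family I a \<tau> q = a i q - a j q + t * int q"
      unfolding difference_family_def ijt(1) using q(1) by auto
    have "a i q \<in> {1..int q}" "a j q \<in> {1..int q}" using lab q True unfolding labelling_def by auto
    then have "\<bar>a i q - a j q\<bar> \<le> int q" by auto
    moreover have "\<bar>t * int q\<bar> \<le> int J * int q" using ijt(2) by (simp add: abs_mult mult_right_mono)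
    ultimately have "\<bar>a i q - a j q + t * int q\<bar> \<le> int q + int J * int q" by linarith
    then show ?thesis unfolding df by (simp add: algebra_simps)
  next
    case False
    then have "difference_family I a \<tau> q = int q" unfolding difference_family_def ijt(1) by auto
    then show ?thesis using mult_left_mono[of 1 "int J + 1" "int q"] by simp
  qed
qed

text \<open>Only the difference h - h' of the two step counts matters, which is why the third index
  ranges over integers up to J in absolute value.\<close>

lemma offset_differences_subset:
  assumes "prime q" "card (I q) = \<nu>"
  shows "offset_differences I a J q \<subseteq> (\<lambda>\<tau>. difference_family I a \<tau> q) ` family_indices \<nu> J"
proof
  fix d assume "d \<in> offset_differences I a J q"
  then obtain i h j h' where *: "i \<in> {1..\<nu>}" "j \<in> {1..\<nu>}" "h \<in> {1..J}" "h' \<in> {1..J}" "d \<noteq> 0"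
    "d = (a i q + int h * int q) - (a j q + int h' * int q)"
    unfolding offset_differences_def offsets_def assms(2) by auto
  have d: "d = a i q - a j q + (int h - int h') * int q" using *(6) by (simp add: algebra_simps)
  have "(i, j, int h - int h') \<in> family_indices \<nu> J" using * d unfolding family_indices_def by auto
  moreover have "d = difference_family I a (i, j, int h - int h') q"
    unfolding difference_family_def using * d assms by auto
  ultimately show "d \<in> (\<lambda>\<tau>. difference_family I a \<tau> q) ` family_indices \<nu> J" by blast
qed

lemma sum_offset_differences_le:
  fixes f :: "int \<Rightarrow> real"
  assumes "prime q" "card (I q) = \<nu>" "\<And>d. f d \<ge> 0"
  shows "(\<Sum>d\<in>offset_differences I a J q. f d) \<le> (\<Sum>\<tau>\<in>family_indices \<nu> J. f (difference_family I a \<tau> q))"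
proof -
  have "(\<Sum>d\<in>offset_differences I a J q. f d) \<le> (\<Sum>d\<in>(\<lambda>\<tau>. difference_family I a \<tau> q) ` family_indices \<nu> J. f d)"
    using offset_differences_subset[of q I \<nu> a J, OF assms(1,2)] assms(3) finite_family_indices by (intro sum_mono2) auto
  also have "\<dots> \<le> (\<Sum>\<tau>\<in>family_indices \<nu> J. f (difference_family I a \<tau> q))"
    using assms(3) by (intro sum_image_le[unfolded o_def] finite_family_indices)
  finally show ?thesis .
qed

lemma card_offset_differences_le:
  assumes "prime q" "card (I q) = \<nu>"
  shows "card (offset_differences I a J q) \<le> \<nu> ^ 2 * (2 * J + 1)"
proof -
  have "card (offset_differences I a J q) \<le> card ((\<lambda>\<tau>. difference_family I a \<tau> q) ` family_indices \<nu> J)"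
    using offset_differences_subset[of q I \<nu> a J, OF assms] finite_family_indices by (intro card_mono) auto
  also have "\<dots> \<le> card (family_indices \<nu> J)" by (rule card_image_le[OF finite_family_indices])
  finally show ?thesis using card_family_indices order_trans by blast
qed

lemma geometric_tail_le:
  fixes K :: "nat set"
  assumes "finite K" "0 < r" "r < 1" "\<And>k. k \<in> K \<Longrightarrow> n0 \<le> k"
  shows "(\<Sum>k\<in>K. r ^ k) \<le> r ^ n0 / (1 - r :: real)"
proof -
  obtain T where T: "K \<subseteq> {..T}" using assms(1) finite_nat_set_iff_bounded_le by auto
  have "(\<Sum>k\<in>K. r ^ k) \<le> (\<Sum>k\<in>{n0..<n0 + Suc T}. r ^ k)"
    using T assms by (intro sum_mono2) (auto simp: trans_le_add2 subset_iff)
  also have "\<dots> \<le> r ^ n0 / (1 - r)"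
  proof -
    have "(\<Sum>k\<in>{n0..<n0 + N}. r ^ k) * (1 - r) = r ^ n0 - r ^ (n0 + N)" for N
    proof (induction N)
      case (Suc N)
      have "(\<Sum>k\<in>{n0..<n0 + Suc N}. r ^ k) * (1 - r) = (\<Sum>k\<in>{n0..<n0 + N}. r ^ k) * (1 - r) + r ^ (n0 + N) * (1 - r)"
        by (simp add: distrib_right)
      then show ?case unfolding Suc.IH by (simp add: right_diff_distrib)
    qed simp
    then have "(\<Sum>k\<in>{n0..<n0 + N}. r ^ k) = (r ^ n0 - r ^ (n0 + N)) / (1 - r)" for N
      using assms by (subst eq_divide_eq) auto
    moreover have "(r ^ n0 - r ^ (n0 + N)) / (1 - r) \<le> r ^ n0 / (1 - r)" for N
      using assms by (intro divide_right_mono) auto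
    ultimately show ?thesis by (simp only:)
  qed
  finally show ?thesis .
qed

lemma sum_split_terms:
  fixes A E :: "'a \<Rightarrow> 'b \<Rightarrow> real" and b G :: "'b \<Rightarrow> real" and D :: "'a \<Rightarrow> real"
  shows "(\<Sum>w\<in>X. \<Sum>q\<in>Q. V * (A q w + b w) + 2 * (g * G w + e) + 3 * (D q + E q w)) =
    V * (\<Sum>q\<in>Q. \<Sum>w\<in>X. A q w) + V * (real (card Q) * (\<Sum>w\<in>X. b w))
    + 2 * (real (card Q) * (g * (\<Sum>w\<in>X. G w)) + real (card Q) * (e * real (card X)))
    + 3 * (real (card X) * (\<Sum>q\<in>Q. D q) + (\<Sum>w\<in>X. \<Sum>q\<in>Q. E q w))"
  unfolding sum.swap[of A] by (simp add: sum.distrib sum_distrib_left[symmetric] sum_distrib_right[symmetric] algebra_simps)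

context sieving_system
begin

text \<open>The tail hypothesis with its constants named and C \<ge> 0, so that they can be fixed
  once, before x and the scales vary.\<close>

definition tail_constants :: "real \<Rightarrow> real \<Rightarrow> real \<Rightarrow> bool" where
  "tail_constants c1 c2 C \<longleftrightarrow> c1 > 0 \<and> c2 > 0 \<and> C \<ge> 0 \<and> (\<forall>u\<ge>10. \<forall>m::nat \<Rightarrow> int.
         (\<forall>q. prime q \<and> card (I q) \<ge> 1 \<longrightarrow> m q \<noteq> 0 \<and> in_difference_set I q (m q)) \<longrightarrow>
         (\<forall>(w::int) (k::nat). \<bar>real_of_int w\<bar> \<le> u \<and> k \<ge> 1 \<longrightarrow>
           (let X = {q. prime q \<and> card (I q) \<ge> 1 \<and>
                        0 < \<bar>m q\<bar> \<and> real_of_int \<bar>m q\<bar> \<le> u \<and> m q + w \<noteq> 0 \<and>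
                        card (difference_primes I (m q + w)) \<ge> k}
            in finite X \<and> real (card X) \<le> C * (u * ln u powr c1 * exp (- c2 * real k)))))"

lemma tail_constants_exist: "\<exists>c1 c2 C. tail_constants c1 c2 C"
proof -
  obtain c1 c2 C where *: "c1 > 0" "c2 > 0" "\<forall>u\<ge>10. \<forall>m::nat \<Rightarrow> int.
         (\<forall>q. prime q \<and> card (I q) \<ge> 1 \<longrightarrow> m q \<noteq> 0 \<and> in_difference_set I q (m q)) \<longrightarrow>
         (\<forall>(w::int) (k::nat). \<bar>real_of_int w\<bar> \<le> u \<and> k \<ge> 1 \<longrightarrow>
           (let X = {q. prime q \<and> card (I q) \<ge> 1 \<and>
                        0 < \<bar>m q\<bar> \<and> real_of_int \<bar>m q\<bar> \<le> u \<and> m q + w \<noteq> 0 \<and>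
                        card (difference_primes I (m q + w)) \<ge> k}
            in finite X \<and> real (card X) \<le> C * (u * ln u powr c1 * exp (- c2 * real k))))"
    using difference_tail by blast
  have "C * (u * ln u powr c1 * exp (- c2 * real k)) \<le> max C 0 * (u * ln u powr c1 * exp (- c2 * real k))" if "u \<ge> 10" for u k
    using that by (intro mult_right_mono) auto
  then have "tail_constants c1 c2 (max C 0)"
    unfolding tail_constants_def using * unfolding Let_def by (meson max.cobounded2 order_trans)
  then show ?thesis by blast
qed

text \<open>Sum over the level sets of the number of difference primes. Half of the decay rate
  \<open>c2\<close> is spent on the exponential weight; the other half leaves a geometric series
  starting at \<open>k0\<close>.\<close>

lemma tail_sum:
  assumes tc: "tail_constants c1 c2 C" and u: "u \<ge> 10"
    and m: "\<And>q. prime q \<Longrightarrow> card (I q) \<ge> 1 \<Longrightarrow> m q \<noteq> 0 \<and> in_difference_set I q (m q)"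
    and w: "\<bar>real_of_int w\<bar> \<le> u" and k0: "k0 \<ge> 1"
    and Q: "finite Q" "\<And>q. q \<in> Q \<Longrightarrow> prime q \<and> card (I q) \<ge> 1 \<and> real_of_int \<bar>m q\<bar> \<le> u \<and> m q + w \<noteq> 0"
  shows "(\<Sum>q\<in>Q. pair_weight (c2 / 2) k0 (m q + w)) \<le> C * (u * ln u powr c1) * exp (- c2 / 2 * k0) / (1 - exp (- c2 / 2))"
proof -
  define N where "N = (\<lambda>q. card (difference_primes I (m q + w)))"
  define Q' where "Q' = {q\<in>Q. real (N q) > k0}"
  define D where "D = C * (u * ln u powr c1)"
  have c2: "c2 > 0" and D0: "D \<ge> 0" using tc u unfolding tail_constants_def D_def by auto
  have fQ': "finite Q'" using Q unfolding Q'_def by simp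
  \<comment> \<open>The level set with exactly k difference primes lies in the set bounded by the
    hypothesis; k \<ge> 1 holds on \<open>Q'\<close> because k0 \<ge> 1.\<close>
  have lev: "real (card {q\<in>Q'. N q = k}) \<le> D * exp (- c2 * real k)" if "k \<ge> 1" for k
  proof -
    let ?X = "{q. prime q \<and> card (I q) \<ge> 1 \<and> 0 < \<bar>m q\<bar> \<and> real_of_int \<bar>m q\<bar> \<le> u \<and> m q + w \<noteq> 0 \<and>
                        card (difference_primes I (m q + w)) \<ge> k}"
    have X: "finite ?X" "real (card ?X) \<le> C * (u * ln u powr c1 * exp (- c2 * real k))"
      using tc u m w that unfolding tail_constants_def Let_def by blast+
    have "{q\<in>Q'. N q = k} \<subseteq> ?X" using Q(2) m unfolding Q'_def N_def by auto
    then have "real (card {q\<in>Q'. N q = k}) \<le> real (card ?X)" using X(1) by (simp add: card_mono)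
    then show ?thesis using X(2) unfolding D_def by (simp add: mult_ac)
  qed
  define n0 where "n0 = nat \<lceil>k0\<rceil>"
  have n0: "k0 \<le> real n0" unfolding n0_def by linarith
  have Nn0: "n0 \<le> N q" "N q \<ge> 1" if "q \<in> Q'" for q
  proof -
    have "k0 < real (N q)" using that unfolding Q'_def by simp
    then show "n0 \<le> N q" "N q \<ge> 1" using k0 unfolding n0_def by linarith+
  qed
  have "(\<Sum>q\<in>Q. pair_weight (c2 / 2) k0 (m q + w)) = (\<Sum>q\<in>Q'. exp (c2 / 2 * real (N q)))"
    unfolding pair_weight_def tail_weight_def Q'_def N_def by (simp only: sum.inter_filter[OF Q(1)])
  also have "\<dots> = (\<Sum>k\<in>N ` Q'. \<Sum>q\<in>{q\<in>Q'. N q = k}. exp (c2 / 2 * real (N q)))"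
    by (rule sum.image_gen[OF fQ'])
  also have "\<dots> \<le> (\<Sum>k\<in>N ` Q'. D * exp (- c2 / 2) ^ k)"
  proof (rule sum_mono)
    fix k assume "k \<in> N ` Q'"
    then have k1: "k \<ge> 1" using Nn0 by auto
    have "(\<Sum>q\<in>{q\<in>Q'. N q = k}. exp (c2 / 2 * real (N q))) = real (card {q\<in>Q'. N q = k}) * exp (c2 / 2 * real k)"
      by simp
    also have "\<dots> \<le> D * exp (- c2 * real k) * exp (c2 / 2 * real k)"
      using lev[OF k1] by (intro mult_right_mono) auto
    also have "\<dots> = D * exp (- c2 / 2) ^ k"
    proof -
      have "exp (- c2 * real k) * exp (c2 / 2 * real k) = exp (real k * (- c2 / 2))"
        unfolding exp_add[symmetric] by (simp add: algebra_simps)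
      then show ?thesis by (simp only: mult.assoc exp_of_nat_mult)
    qed
    finally show "(\<Sum>q\<in>{q\<in>Q'. N q = k}. exp (c2 / 2 * real (N q))) \<le> D * exp (- c2 / 2) ^ k" .
  qed
  also have "\<dots> = D * (\<Sum>k\<in>N ` Q'. exp (- c2 / 2) ^ k)" by (simp add: sum_distrib_left)
  also have "\<dots> \<le> D * (exp (- c2 / 2) ^ n0 / (1 - exp (- c2 / 2)))"
    using fQ' Nn0 c2 by (intro mult_left_mono D0 geometric_tail_le) auto
  also have "\<dots> \<le> D * (exp (- c2 / 2 * k0) / (1 - exp (- c2 / 2)))"
  proof (intro mult_left_mono D0 divide_right_mono)
    have "exp (- c2 / 2) ^ n0 = exp (- c2 / 2 * real n0)" by (simp add: exp_of_nat_mult[symmetric] mult.commute)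
    also have "\<dots> \<le> exp (- c2 / 2 * k0)" using n0 c2 by simp
    finally show "exp (- c2 / 2) ^ n0 \<le> exp (- c2 / 2 * k0)" .
  qed (use c2 in auto)
  finally show ?thesis unfolding D_def by simp
qed

end

text \<open>\<open>T\<close> bounds the truncated exponential moment over \<open>Q\<close> for each
  index and every shift of size at most \<open>u\<close>; this is the form in which the tail
  hypothesis is used from here on.\<close>

locale progression_family = progression_sieve +
  fixes Q :: "nat set" and \<nu> :: nat and T u :: real
  assumes Q: "finite Q" "\<And>q. q \<in> Q \<Longrightarrow> prime q \<and> card (I q) = \<nu> \<and> real q * (real J + 1) \<le> u"
    and lab: "labelling I a" and \<nu>: "\<nu> \<ge> 1" and T0: "T \<ge> 0"
    and T: "\<And>\<tau> w. \<tau> \<in> family_indices \<nu> J \<Longrightarrow> \<bar>real_of_int w\<bar> \<le> u \<Longrightarrow>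
      (\<Sum>q\<in>{q\<in>Q. difference_family I a \<tau> q + w \<noteq> 0}. pair_weight c k0 (difference_family I a \<tau> q + w)) \<le> T"
begin

definition F :: nat where "F = \<nu> ^ 2 * (2 * J + 1)"

text \<open>The guard excludes \<open>0\<close>, whose set of difference primes may be infinite, so that its \<^const>\<open>card\<close> is junk.\<close>

lemma sum_tail_le:
  assumes "\<bar>real_of_int w\<bar> \<le> u"
  shows "(\<Sum>q\<in>Q. \<Sum>d\<in>odiffs q. of_bool (d + w \<noteq> 0) * pair_weight c k0 (d + w)) \<le> real F * T"
proof -
  have "(\<Sum>q\<in>Q. \<Sum>d\<in>odiffs q. of_bool (d + w \<noteq> 0) * pair_weight c k0 (d + w)) \<le>
     (\<Sum>q\<in>Q. \<Sum>\<tau>\<in>family_indices \<nu> J. of_bool (difference_family I a \<tau> q + w \<noteq> 0) * pair_weight c k0 (difference_family I a \<tau> q + w))"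
    using Q(2) pair_weight_nonneg
    by (intro sum_mono sum_offset_differences_le[where f = "\<lambda>d. of_bool (d + w \<noteq> 0) * pair_weight c k0 (d + w)"]) auto
  also have "\<dots> = (\<Sum>\<tau>\<in>family_indices \<nu> J. \<Sum>q\<in>Q. of_bool (difference_family I a \<tau> q + w \<noteq> 0) * pair_weight c k0 (difference_family I a \<tau> q + w))"
    by (rule sum.swap)
  also have "\<dots> \<le> (\<Sum>\<tau>\<in>family_indices \<nu> J. T)"
  proof (rule sum_mono)
    fix \<tau> assume \<tau>: "\<tau> \<in> family_indices \<nu> J"
    have "(\<Sum>q\<in>Q. of_bool (difference_family I a \<tau> q + w \<noteq> 0) * pair_weight c k0 (difference_family I a \<tau> q + w)) =
      (\<Sum>q\<in>{q\<in>Q. difference_family I a \<tau> q + w \<noteq> 0}. pair_weight c k0 (difference_family I a \<tau> q + w))"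
      unfolding sum.inter_filter[OF Q(1)] by (intro sum.cong) auto
    then show "(\<Sum>q\<in>Q. of_bool (difference_family I a \<tau> q + w \<noteq> 0) * pair_weight c k0 (difference_family I a \<tau> q + w)) \<le> T"
      using T[OF \<tau> assms] by simp
  qed
  also have "\<dots> = real (card (family_indices \<nu> J)) * T" by simp
  also have "\<dots> \<le> real F * T"
    unfolding F_def using card_family_indices T0 by (intro mult_right_mono) (simp_all only: of_nat_le_iff)
  finally show ?thesis .
qed

lemma u_nonneg: "Q \<noteq> {} \<Longrightarrow> u \<ge> 0"
  using Q(2) by (meson ex_in_conv mult_nonneg_nonneg of_nat_0_le_iff order_trans add_nonneg_nonneg zero_le_one)

lemma sum_tail0_le: "(\<Sum>q\<in>Q. \<Sum>d\<in>odiffs q. pair_weight c k0 d) \<le> real F * T"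
proof (cases "Q = {}")
  case False
  have "(\<Sum>q\<in>Q. \<Sum>d\<in>odiffs q. pair_weight c k0 d) = (\<Sum>q\<in>Q. \<Sum>d\<in>odiffs q. of_bool (d + 0 \<noteq> 0) * pair_weight c k0 (d + 0))"
    by (intro sum.cong refl) (auto simp: offset_differences_def)
  also have "\<dots> \<le> real F * T" using u_nonneg[OF False] by (intro sum_tail_le) auto
  finally show ?thesis .
qed (use T0 in simp)

text \<open>For a single prime the tail weights cannot be bounded, only their sum over
  \<open>Q\<close> for each fixed w. The trivial bound \<open>V\<close> is paid for the at most F +
  1 overlapping shifts of each q and for the heavy ones.\<close>

lemma sum_pair_excess:
  fixes Y :: int
  assumes Y: "\<And>p. p \<in> P2 \<Longrightarrow> int p \<le> Y" "Y \<ge> 0" "of_int Y \<le> u"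
  shows "(\<Sum>w\<in>{-Y..Y}. \<Sum>q\<in>Q. pair_excess q w) \<le>
     real (card Q) * (V * (real F + 1 + real (card {w\<in>{-Y..Y}. heavy w}))
        + 2 * (8 * real B * real k * (8 * of_int Y * real B ^ 2 / W) + s * k0 * (2 * of_int Y + 1)))
     + 6 * (2 * of_int Y + 1) * (real F * T)"
proof -
  \<comment> \<open>The alternatives in \<open>pair_excess\<close> are replaced by a sum of
    nonnegative terms, so that the double sum can be split linearly.\<close>
  have pw: "pair_excess q w \<le> V * (of_bool (- w \<in> insert 0 (odiffs q)) + of_bool (heavy w))
     + 2 * (8 * real B * real k * collision_mass I P2 w + s * k0)
     + 3 * ((\<Sum>d\<in>odiffs q. pair_weight c k0 d) + (\<Sum>d\<in>odiffs q. of_bool (d + w \<noteq> 0) * pair_weight c k0 (d + w)))" for q w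
  proof (cases "(\<exists>d\<in>insert 0 (odiffs q). d + w = 0) \<or> heavy w")
    case True
    then have "- w \<in> insert 0 (odiffs q) \<or> heavy w" by (metis add.inverse_unique add.commute)
    then have "V \<le> V * (of_bool (- w \<in> insert 0 (odiffs q)) + of_bool (heavy w))" using V_nonneg by auto
    moreover have "0 \<le> 2 * (8 * real B * real k * collision_mass I P2 w + s * k0)
     + 3 * ((\<Sum>d\<in>odiffs q. pair_weight c k0 d) + (\<Sum>d\<in>odiffs q. of_bool (d + w \<noteq> 0) * pair_weight c k0 (d + w)))"
      using collision_mass_nonneg s_nonneg k0 pair_weight_nonneg
      by (intro add_nonneg_nonneg mult_nonneg_nonneg sum_nonneg) auto
    ultimately show ?thesis using True by (simp add: pair_excess_def)
  next
    case False
    then have "(\<Sum>d\<in>odiffs q. pair_weight c k0 (d + w)) = (\<Sum>d\<in>odiffs q. of_bool (d + w \<noteq> 0) * pair_weight c k0 (d + w))"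
      by (intro sum.cong) auto
    moreover have "0 \<le> V * (of_bool (- w \<in> insert 0 (odiffs q)) + of_bool (heavy w))" using V_nonneg by auto
    ultimately show ?thesis using False by (simp add: pair_excess_def sum.distrib)
  qed
  have cardY: "real (card {-Y..Y}) = 2 * of_int Y + 1" using Y(2) by simp
  have fW: "finite {-Y..Y}" by simp
  have "(\<Sum>w\<in>{-Y..Y}. \<Sum>q\<in>Q. pair_excess q w) \<le>
    (\<Sum>w\<in>{-Y..Y}. \<Sum>q\<in>Q. V * (of_bool (- w \<in> insert 0 (odiffs q)) + of_bool (heavy w))
     + 2 * (8 * real B * real k * collision_mass I P2 w + s * k0)
     + 3 * ((\<Sum>d\<in>odiffs q. pair_weight c k0 d) + (\<Sum>d\<in>odiffs q. of_bool (d + w \<noteq> 0) * pair_weight c k0 (d + w))))"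
    by (intro sum_mono pw)
  also have "\<dots> = V * (\<Sum>q\<in>Q. \<Sum>w\<in>{-Y..Y}. of_bool (- w \<in> insert 0 (odiffs q))) + V * (real (card Q) * (\<Sum>w\<in>{-Y..Y}. of_bool (heavy w)))
     + 2 * (real (card Q) * (8 * real B * real k * (\<Sum>w\<in>{-Y..Y}. collision_mass I P2 w)) + real (card Q) * (s * k0 * real (card {-Y..Y})))
     + 3 * (real (card {-Y..Y}) * (\<Sum>q\<in>Q. \<Sum>d\<in>odiffs q. pair_weight c k0 d)
       + (\<Sum>w\<in>{-Y..Y}. \<Sum>q\<in>Q. \<Sum>d\<in>odiffs q. of_bool (d + w \<noteq> 0) * pair_weight c k0 (d + w)))"
    by (rule sum_split_terms)
  also have "\<dots> \<le> V * (\<Sum>q\<in>Q. real F + 1) + V * (real (card Q) * real (card {w\<in>{-Y..Y}. heavy w}))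
     + 2 * (real (card Q) * (8 * real B * real k * (8 * of_int Y * real B ^ 2 / W)) + real (card Q) * (s * k0 * (2 * of_int Y + 1)))
     + 3 * ((2 * of_int Y + 1) * (real F * T) + (\<Sum>w\<in>{-Y..Y}. real F * T))"
  proof (intro add_mono mult_left_mono sum_mono)
    fix q assume q: "q \<in> Q"
    have "(\<Sum>w\<in>{-Y..Y}. of_bool (- w \<in> insert 0 (odiffs q)) :: real) = real (card {w\<in>{-Y..Y}. - w \<in> insert 0 (odiffs q)})"
      by (rule card_filter_eq_sum[OF fW, symmetric])
    also have "\<dots> \<le> real (card (uminus ` insert 0 (odiffs q)))"
      unfolding of_nat_le_iff
    proof (intro card_mono subsetI)
      fix w assume "w \<in> {w\<in>{-Y..Y}. - w \<in> insert 0 (odiffs q)}"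
      then show "w \<in> uminus ` insert 0 (odiffs q)" by (intro image_eqI[of w uminus "- w"]) auto
    qed (simp add: finite_offset_differences)
    also have "\<dots> \<le> real (card (insert 0 (odiffs q)))" unfolding of_nat_le_iff using finite_offset_differences by (intro card_image_le) auto
    also have "\<dots> \<le> real F + 1"
    proof -
      have "card (insert 0 (odiffs q)) \<le> Suc (card (odiffs q))"
        using finite_offset_differences by (simp add: card_insert_if)
      also have "\<dots> \<le> Suc F"
        using card_offset_differences_le[of q I \<nu> a J] Q(2)[OF q] unfolding F_def by simp
      finally have "real (card (insert 0 (odiffs q))) \<le> real (Suc F)" by (simp only: of_nat_le_iff)
      then show ?thesis by simp
    qed
    finally show "(\<Sum>w\<in>{-Y..Y}. of_bool (- w \<in> insert 0 (odiffs q)) :: real) \<le> real F + 1" .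
  next
    show "(\<Sum>w\<in>{-Y..Y}. of_bool (heavy w) :: real) \<le> real (card {w\<in>{-Y..Y}. heavy w})"
      using card_filter_eq_sum[OF fW, of heavy] by simp
    show "(\<Sum>w\<in>{-Y..Y}. collision_mass I P2 w) \<le> 8 * of_int Y * real B ^ 2 / W"
      using fin pr W W1 Y by (intro sum_collision_mass_window) auto
    show "(\<Sum>q\<in>Q. \<Sum>d\<in>odiffs q. of_bool (d + w \<noteq> 0) * pair_weight c k0 (d + w)) \<le> real F * T" if "w \<in> {-Y..Y}" for w
    proof (rule sum_tail_le)
      have "\<bar>w\<bar> \<le> Y" using that by auto
      then have "\<bar>real_of_int w\<bar> \<le> of_int Y" by linarith
      then show "\<bar>real_of_int w\<bar> \<le> u" using Y(3) by linarith
    qed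
    show "real (card {-Y..Y}) * (\<Sum>q\<in>Q. \<Sum>d\<in>odiffs q. pair_weight c k0 d) \<le> (2 * of_int Y + 1) * (real F * T)"
      unfolding cardY using Y(2) sum_tail0_le by (intro mult_left_mono) auto
  qed (use V_nonneg s_nonneg k0 W1 cardY in auto)
  also have "\<dots> = real (card Q) * (V * (real F + 1 + real (card {w\<in>{-Y..Y}. heavy w}))
        + 2 * (8 * real B * real k * (8 * of_int Y * real B ^ 2 / W) + s * k0 * (2 * of_int Y + 1)))
     + 6 * (2 * of_int Y + 1) * (real F * T)"
    using cardY by (simp add: algebra_simps)
  finally show ?thesis .
qed

text \<open>A difference shared by q and q' makes q a difference prime of one of the at most F
  differences of q'. For fixed q' this happens for at most F * Nm primes q, including q =
  q'.\<close>

lemma sum_cross_excess: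
  assumes Nmax: "\<And>v. v \<noteq> 0 \<Longrightarrow> \<bar>real_of_int v\<bar> \<le> u \<Longrightarrow> real (card (difference_primes I v)) \<le> Nm" and Nm0: "Nm \<ge> 0"
  shows "(\<Sum>q\<in>Q. \<Sum>q'\<in>Q. cross_excess q q') \<le>
    real (card Q) * (V * (real F * Nm)) + (real (card Q))\<^sup>2 * (2 * (s * k0))
     + 3 * real (card Q) * (real F * T) * (2 + real F)"
proof -
  have du: "\<bar>real_of_int d\<bar> \<le> u" "d \<noteq> 0" "q \<in> difference_primes I d" if dq: "d \<in> odiffs q" "q \<in> Q" for d q
  proof -
    have q: "prime q" "card (I q) = \<nu>" "real q * (real J + 1) \<le> u" using Q(2) dq by auto
    obtain \<tau> where \<tau>: "\<tau> \<in> family_indices \<nu> J" "d = difference_family I a \<tau> q"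
      using offset_differences_subset[of q I \<nu> a J, OF q(1,2)] dq(1) by blast
    have "real_of_int \<bar>d\<bar> \<le> real_of_int (int q * (int J + 1))"
      unfolding \<tau>(2) of_int_le_iff by (rule difference_family_le[OF lab q(1) \<tau>(1)])
    then show "\<bar>real_of_int d\<bar> \<le> u" using q(3) by simp
    show "d \<noteq> 0" "q \<in> difference_primes I d"
      using difference_family_valid[OF lab q(1) _ \<tau>(1)] q \<nu> unfolding \<tau>(2) difference_primes_def by auto
  qed
  have pw: "cross_excess q q' \<le> V * of_bool (odiffs q \<inter> odiffs q' \<noteq> {}) + 2 * (s * k0)
     + 3 * ((\<Sum>d\<in>odiffs q. pair_weight c k0 d) + (\<Sum>d\<in>odiffs q'. pair_weight c k0 d)
       + (\<Sum>d'\<in>odiffs q'. \<Sum>d\<in>odiffs q. of_bool (d + (- d') \<noteq> 0) * pair_weight c k0 (d + (- d'))))" for q q'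
  proof (cases "odiffs q \<inter> odiffs q' \<noteq> {}")
    case True
    have "0 \<le> 2 * (s * k0)
     + 3 * ((\<Sum>d\<in>odiffs q. pair_weight c k0 d) + (\<Sum>d\<in>odiffs q'. pair_weight c k0 d)
       + (\<Sum>d'\<in>odiffs q'. \<Sum>d\<in>odiffs q. of_bool (d + (- d') \<noteq> 0) * pair_weight c k0 (d + (- d'))))"
      using s_nonneg k0 pair_weight_nonneg by (intro add_nonneg_nonneg mult_nonneg_nonneg sum_nonneg) auto
    then show ?thesis using True by (simp add: cross_excess_def)
  next
    case False
    have "(\<Sum>d\<in>odiffs q. \<Sum>d'\<in>odiffs q'. pair_weight c k0 (d - d')) =
       (\<Sum>d\<in>odiffs q. \<Sum>d'\<in>odiffs q'. of_bool (d + (- d') \<noteq> 0) * pair_weight c k0 (d + (- d')))"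
      using False by (intro sum.cong refl) auto
    also have "\<dots> = (\<Sum>d'\<in>odiffs q'. \<Sum>d\<in>odiffs q. of_bool (d + (- d') \<noteq> 0) * pair_weight c k0 (d + (- d')))"
      by (rule sum.swap)
    finally show ?thesis using False by (simp add: cross_excess_def)
  qed
  have cF: "real (card (odiffs q)) \<le> real F" if "q \<in> Q" for q
    unfolding F_def of_nat_le_iff using card_offset_differences_le Q(2)[OF that] by blast
  have "(\<Sum>q\<in>Q. \<Sum>q'\<in>Q. cross_excess q q') = (\<Sum>q'\<in>Q. \<Sum>q\<in>Q. cross_excess q q')" by (rule sum.swap)
  also have "\<dots> \<le> (\<Sum>q'\<in>Q. V * (real F * Nm) + real (card Q) * (2 * (s * k0))
      + 3 * (real F * T + real (card Q) * (\<Sum>d\<in>odiffs q'. pair_weight c k0 d) + real F * (real F * T)))"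
  proof (rule sum_mono)
    fix q' assume q': "q' \<in> Q"
    have "(\<Sum>q\<in>Q. cross_excess q q') \<le> (\<Sum>q\<in>Q. V * of_bool (odiffs q \<inter> odiffs q' \<noteq> {}) + 2 * (s * k0)
     + 3 * ((\<Sum>d\<in>odiffs q. pair_weight c k0 d) + (\<Sum>d\<in>odiffs q'. pair_weight c k0 d)
       + (\<Sum>d'\<in>odiffs q'. \<Sum>d\<in>odiffs q. of_bool (d + (- d') \<noteq> 0) * pair_weight c k0 (d + (- d')))))"
      by (intro sum_mono pw)
    also have "\<dots> = V * (\<Sum>q\<in>Q. of_bool (odiffs q \<inter> odiffs q' \<noteq> {})) + real (card Q) * (2 * (s * k0))
      + 3 * ((\<Sum>q\<in>Q. \<Sum>d\<in>odiffs q. pair_weight c k0 d) + real (card Q) * (\<Sum>d\<in>odiffs q'. pair_weight c k0 d)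
       + (\<Sum>q\<in>Q. \<Sum>d'\<in>odiffs q'. \<Sum>d\<in>odiffs q. of_bool (d + (- d') \<noteq> 0) * pair_weight c k0 (d + (- d'))))"
      by (simp only: sum.distrib sum_distrib_left[symmetric] sum_constant) (simp only: mult_ac)
    also have "(\<Sum>q\<in>Q. \<Sum>d'\<in>odiffs q'. \<Sum>d\<in>odiffs q. of_bool (d + (- d') \<noteq> 0) * pair_weight c k0 (d + (- d'))) =
      (\<Sum>d'\<in>odiffs q'. \<Sum>q\<in>Q. \<Sum>d\<in>odiffs q. of_bool (d + (- d') \<noteq> 0) * pair_weight c k0 (d + (- d')))"
      by (rule sum.swap)
    also have "V * (\<Sum>q\<in>Q. of_bool (odiffs q \<inter> odiffs q' \<noteq> {})) + real (card Q) * (2 * (s * k0))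
      + 3 * ((\<Sum>q\<in>Q. \<Sum>d\<in>odiffs q. pair_weight c k0 d) + real (card Q) * (\<Sum>d\<in>odiffs q'. pair_weight c k0 d)
       + (\<Sum>d'\<in>odiffs q'. \<Sum>q\<in>Q. \<Sum>d\<in>odiffs q. of_bool (d + (- d') \<noteq> 0) * pair_weight c k0 (d + (- d')))) \<le>
       V * (real F * Nm) + real (card Q) * (2 * (s * k0))
      + 3 * (real F * T + real (card Q) * (\<Sum>d\<in>odiffs q'. pair_weight c k0 d) + real F * (real F * T))"
    proof (intro add_mono mult_left_mono sum_tail0_le order_refl)
      \<comment> \<open>Counts the q for which \<open>V\<close> is paid, by covering them with the
        difference primes of the differences of q'.\<close>
      have "(\<Sum>q\<in>Q. of_bool (odiffs q \<inter> odiffs q' \<noteq> {}) :: real) = real (card {q\<in>Q. odiffs q \<inter> odiffs q' \<noteq> {}})"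
        by (rule card_filter_eq_sum[OF Q(1), symmetric])
      also have "\<dots> \<le> real (card (\<Union>d\<in>odiffs q'. difference_primes I d))"
        unfolding of_nat_le_iff using du q' finite_difference_primes finite_offset_differences
        by (intro card_mono finite_UN_I) auto
      also have "\<dots> \<le> real (\<Sum>d\<in>odiffs q'. card (difference_primes I d))"
        unfolding of_nat_le_iff by (rule card_UN_le[OF finite_offset_differences])
      also have "\<dots> = (\<Sum>d\<in>odiffs q'. real (card (difference_primes I d)))" by simp
      also have "\<dots> \<le> (\<Sum>d\<in>odiffs q'. Nm)" using du q' by (intro sum_mono Nmax) auto
      also have "\<dots> \<le> real F * Nm" using cF[OF q'] Nm0 by (simp add: mult_right_mono)
      finally show "(\<Sum>q\<in>Q. of_bool (odiffs q \<inter> odiffs q' \<noteq> {}) :: real) \<le> real F * Nm" .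
      have "(\<Sum>d'\<in>odiffs q'. \<Sum>q\<in>Q. \<Sum>d\<in>odiffs q. of_bool (d + (- d') \<noteq> 0) * pair_weight c k0 (d + (- d'))) \<le> (\<Sum>d'\<in>odiffs q'. real F * T)"
        using du(1) q' by (intro sum_mono sum_tail_le) auto
      also have "\<dots> \<le> real F * (real F * T)" using cF[OF q'] T0 by (simp add: mult_right_mono)
      finally show "(\<Sum>d'\<in>odiffs q'. \<Sum>q\<in>Q. \<Sum>d\<in>odiffs q. of_bool (d + (- d') \<noteq> 0) * pair_weight c k0 (d + (- d'))) \<le> real F * (real F * T)" .
    qed (use V_nonneg s_nonneg k0 in auto)
    finally show "(\<Sum>q\<in>Q. cross_excess q q') \<le> V * (real F * Nm) + real (card Q) * (2 * (s * k0))
      + 3 * (real F * T + real (card Q) * (\<Sum>d\<in>odiffs q'. pair_weight c k0 d) + real F * (real F * T))" .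
  qed
  also have "\<dots> = real (card Q) * (V * (real F * Nm)) + (real (card Q))\<^sup>2 * (2 * (s * k0))
     + 3 * (real (card Q) * (real F * T) + real (card Q) * (\<Sum>q\<in>Q. \<Sum>d\<in>odiffs q. pair_weight c k0 d) + real (card Q) * (real F * (real F * T)))"
    by (simp only: sum.distrib sum_distrib_left[symmetric] sum_constant power2_eq_square mult_ac)
  also have "\<dots> \<le> real (card Q) * (V * (real F * Nm)) + (real (card Q))\<^sup>2 * (2 * (s * k0))
     + 3 * (real (card Q) * (real F * T) + real (card Q) * (real F * T) + real (card Q) * (real F * (real F * T)))"
    by (intro add_mono mult_left_mono sum_tail0_le order_refl) auto
  finally show ?thesis by (simp add: algebra_simps)
qed

end

section \<open>Asymptotics of the scales\<close>

lemma class_frequency_tendsto: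
  assumes "sieving_system I B" "\<nu> \<in> supp_densities I B"
  shows "(class_frequency I \<nu> \<longlongrightarrow> class_density I \<nu>) at_top"
proof -
  interpret sieving_system I B by fact
  obtain l where l: "(class_frequency I \<nu> \<longlongrightarrow> l) at_top"
    using density_exists assms(2) unfolding supp_densities_def by auto
  then have "Lim at_top (class_frequency I \<nu>) = l" by (intro tendsto_Lim) auto
  then show ?thesis using l by (simp add: class_density_def)
qed

lemma finite_primes_upto: "finite (primes_upto w)"
  unfolding primes_upto_def by (rule finite_subset[of _ "{..nat \<lceil>w\<rceil>}"]) (auto simp: real_nat_ceiling_ge le_nat_iff, linarith)

lemma sieve_density_eq: "sieve_density I w = density_of I (primes_upto w)"
  by (simp add: sieve_density_def density_of_def)

lemma sieve_density_tendsto: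
  assumes "sieving_system I B"
  obtains C1 where "C1 > 0" "((\<lambda>w. sieve_density I w * ln w) \<longlongrightarrow> C1) at_top"
proof -
  interpret sieving_system I B by fact
  obtain C1 where C1: "C1 > 0" "sieve_density I \<sim>[at_top] (\<lambda>x. C1 / ln x)" using one_dimensional by blast
  have "((\<lambda>x. sieve_density I x / (C1 / ln x)) \<longlongrightarrow> 1) at_top"
    using C1(2)
  proof (rule asymp_equivD_strong)
    show "\<forall>\<^sub>F x in at_top. sieve_density I x \<noteq> 0 \<or> C1 / ln x \<noteq> 0"
      using eventually_gt_at_top[of 1] by eventually_elim (use C1(1) in auto)
  qed
  then have "((\<lambda>x. C1 * (sieve_density I x / (C1 / ln x))) \<longlongrightarrow> C1 * 1) at_top" by (intro tendsto_intros)
  then have "((\<lambda>w. sieve_density I w * ln w) \<longlongrightarrow> C1) at_top"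
    using C1(1) by simp
  then show ?thesis using that C1 by blast
qed

lemma C_one_le_half: "C_one \<le> 1 / 2"
proof -
  \<comment> \<open>A witness that the set defining \<open>C_one\<close> is nonempty: the logarithm
    is exactly 20, while 6 * 10^(2 d) < 6 * 10 / 3 = 20.\<close>
  define d :: real where "d = exp (- 20) / 2"
  have d: "0 < d" "d < 1 / 2" unfolding d_def by auto
  have "1 / (2 * d) = exp 20" unfolding d_def by (simp add: exp_minus inverse_eq_divide)
  then have l20: "ln (1 / (2 * d)) = 20" by simp
  have p1: "10 powr (2 * d) \<le> (10 :: real) powr (1 / 2)"
  proof (rule powr_mono)
    have "exp (- 20) \<le> 1 / (1 + (20::real))" using exp_ge_add_one_self[of 20] by (simp add: exp_minus field_simps)
    then show "2 * d \<le> 1 / 2" unfolding d_def by simp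
  qed simp
  have p2: "(10 :: real) powr (1 / 2) < 10 / 3"
  proof -
    have "sqrt 10 < sqrt ((10 / 3) ^ 2)" by (rule real_sqrt_less_mono) (simp add: power2_eq_square)
    then show ?thesis by (simp add: powr_half_sqrt)
  qed
  have "6 * 10 powr (2 * d) / ln (1 / (2 * d)) < 1" using order.strict_trans1[OF p1 p2] l20 by simp
  then have "{\<delta>. 0 < \<delta> \<and> \<delta> < 1/2 \<and> 6 * 10 powr (2 * \<delta>) / ln (1 / (2 * \<delta>)) < (1::real)} \<noteq> {}"
    using d by blast
  then show ?thesis unfolding C_one_def by (rule cSup_least) auto
qed

text \<open>Uniformity over the scales is reduced to limits along selections, by selecting a worst scale for each \<open>x\<close>.\<close>

lemma uniform_of_selections:
  fixes g :: "real \<Rightarrow> 'a \<Rightarrow> real"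
  assumes sel: "\<And>h. (\<forall>\<^sub>F x in at_top. h x \<in> S x) \<Longrightarrow> ((\<lambda>x. g x (h x)) \<longlongrightarrow> c) at_top"
    and ne: "\<forall>\<^sub>F x in at_top. S x \<noteq> {}" and e: "e > 0"
  shows "\<forall>\<^sub>F x in at_top. \<forall>H\<in>S x. \<bar>g x H - c\<bar> < e"
proof -
  define h where "h = (\<lambda>x. if \<exists>H\<in>S x. \<not> \<bar>g x H - c\<bar> < e then SOME H. H \<in> S x \<and> \<not> \<bar>g x H - c\<bar> < e else SOME H. H \<in> S x)"
  have h1: "h x \<in> S x" if "S x \<noteq> {}" for x
  proof (cases "\<exists>H\<in>S x. \<not> \<bar>g x H - c\<bar> < e")
    case True
    then have "\<exists>H. H \<in> S x \<and> \<not> \<bar>g x H - c\<bar> < e" by blast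
    from someI_ex[OF this] True show ?thesis unfolding h_def by simp
  next
    case False
    then show ?thesis using that some_in_eq[of "S x"] unfolding h_def by auto
  qed
  have h2: "\<not> \<bar>g x (h x) - c\<bar> < e" if "\<exists>H\<in>S x. \<not> \<bar>g x H - c\<bar> < e" for x
  proof -
    have "\<exists>H. H \<in> S x \<and> \<not> \<bar>g x H - c\<bar> < e" using that by blast
    from someI_ex[OF this] that show ?thesis unfolding h_def by simp
  qed
  have "((\<lambda>x. g x (h x)) \<longlongrightarrow> c) at_top"
    by (intro sel eventually_mono[OF ne] h1)
  then have "\<forall>\<^sub>F x in at_top. \<bar>g x (h x) - c\<bar> < e" using e by (auto simp: tendsto_iff dist_real_def)
  then show ?thesis by eventually_elim (use h2 in blast)
qed

section \<open>The geometric grid of scales and its two ends\<close>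

locale window =
  fixes \<delta> \<xi> M :: real and K :: nat
  assumes \<delta>: "0 < \<delta>" "\<delta> < 1 / 2" and \<xi>: "\<xi> > 1" and M: "M > 6" and K: "K \<ge> 1"
begin

abbreviation "y x \<equiv> real_of_int (y_of \<delta> x)"
abbreviation "z x \<equiv> z_of \<delta> x"
abbreviation "S x \<equiv> scales \<delta> \<xi> x"

lemma y_bounds: "\<forall>\<^sub>F x in at_top. x * ln x powr \<delta> \<le> y x \<and> y x \<le> x * ln x powr \<delta> + 1 \<and> x \<le> y x \<and> y x \<le> 2 * (x * ln x powr \<delta>) \<and> 1 \<le> x"
proof -
  have "\<forall>\<^sub>F x in at_top. 1 \<le> x * ln x powr \<delta> \<and> x \<le> x * ln x powr \<delta> \<and> 1 \<le> (x::real)"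
    using \<delta>(1) by (intro eventually_conj) real_asymp+
  then show ?thesis
  proof eventually_elim
    case (elim x)
    then show ?case unfolding y_of_def using ceiling_correct[of "x * ln x powr \<delta>"] by linarith
  qed
qed

lemma ln_y: "((\<lambda>x. ln (y x) / ln x) \<longlongrightarrow> 1) at_top"
proof (rule real_tendsto_sandwich)
  show "((\<lambda>x::real. ln (x * ln x powr \<delta>) / ln x) \<longlongrightarrow> 1) at_top" using \<delta>(1) by real_asymp
  show "((\<lambda>x::real. ln (2 * (x * ln x powr \<delta>)) / ln x) \<longlongrightarrow> 1) at_top" using \<delta>(1) by real_asymp
  have pos: "\<forall>\<^sub>F x in at_top. 0 < x * ln x powr \<delta> \<and> 1 < (x::real)" using \<delta>(1) by (intro eventually_conj) real_asymp+
  show "\<forall>\<^sub>F x in at_top. ln (x * ln x powr \<delta>) / ln x \<le> ln (y x) / ln x"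
    using pos y_bounds by eventually_elim (auto intro!: divide_right_mono)
  show "\<forall>\<^sub>F x in at_top. ln (y x) / ln x \<le> ln (2 * (x * ln x powr \<delta>)) / ln x"
    using pos y_bounds by eventually_elim (auto intro!: divide_right_mono)
qed

text \<open>\<open>y\<close> cancels, so up to ln (ln x) the upper end is the square root of ln x,
  against a lower end of order (ln x)^\<delta>. This is where \<delta> < 1/2 makes the grid
  long.\<close>

lemma upper_end: "y x > 0 \<Longrightarrow> y x / (\<xi> * z x) = sqrt (ln x) / (\<xi> * ln (ln x))"
  unfolding z_of_def by (simp add: field_simps)

lemma ln_z: "((\<lambda>x. ln (z x) / ln x) \<longlongrightarrow> 1) at_top"
proof -
  have "((\<lambda>x. ln (y x) / ln x + ln (ln (ln x) / sqrt (ln x)) / ln x) \<longlongrightarrow> 1 + 0) at_top"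
    by (intro tendsto_add ln_y) real_asymp
  moreover have "\<forall>\<^sub>F x in at_top. ln (y x) / ln x + ln (ln (ln x) / sqrt (ln x)) / ln x = ln (z x) / ln x"
  proof -
    have "\<forall>\<^sub>F x in at_top. ln (ln x) / sqrt (ln x) > (0::real)" by real_asymp
    then show ?thesis using y_bounds
    proof eventually_elim
      case (elim x)
      then have "ln (z x) = ln (y x) + ln (ln (ln x) / sqrt (ln x))"
        unfolding z_of_def times_divide_eq_right[symmetric] by (intro ln_mult_pos) auto
      then show ?case by (simp add: add_divide_distrib)
    qed
  qed
  ultimately show ?thesis by (simp add: tendsto_cong)
qed

lemma z_at_top: "filterlim z at_top at_top"
proof -
  have "filterlim (\<lambda>x::real. x * (ln (ln x) / sqrt (ln x))) at_top at_top" by real_asymp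
  moreover have "\<forall>\<^sub>F x in at_top. ln (ln x) / sqrt (ln x) > (0::real)" by real_asymp
  then have "\<forall>\<^sub>F x in at_top. x * (ln (ln x) / sqrt (ln x)) \<le> z x"
    using y_bounds
  proof eventually_elim
    case (elim x)
    then have "x * (ln (ln x) / sqrt (ln x)) \<le> y x * (ln (ln x) / sqrt (ln x))"
      by (intro mult_right_mono) auto
    then show ?case unfolding z_of_def by simp
  qed
  ultimately show ?thesis by (rule filterlim_at_top_mono)
qed

lemma scales_bounds: "\<forall>\<^sub>F x in at_top. \<forall>H\<in>S x. 2 * ln x powr \<delta> \<le> H \<and> H * ln (ln x) \<le> sqrt (ln x) \<and> H \<le> sqrt (ln x) \<and> y x / H \<ge> 1 \<and> 1 \<le> H"
proof -
  have "\<forall>\<^sub>F x in at_top. 1 \<le> ln (ln x) \<and> (1::real) < x \<and> 1 < ln x \<and> 1 \<le> ln x powr \<delta> \<and> sqrt (ln x) \<le> x" using \<delta>(1) by (intro eventually_conj) real_asymp+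
  then show ?thesis using y_bounds
  proof eventually_elim
    case (elim x)
    show ?case
    proof
      fix H assume H: "H \<in> S x"
      have "2 * ln x powr \<delta> \<le> 2 * y x / x" using elim by (simp add: field_simps)
      also have "\<dots> \<le> H" using H by (simp add: scales_def)
      finally have lo: "2 * ln x powr \<delta> \<le> H" .
      have "H \<le> y x / (\<xi> * z x)" using H by (simp add: scales_def)
      also have "\<dots> = sqrt (ln x) / (\<xi> * ln (ln x))" using elim by (intro upper_end) auto
      also have "\<dots> \<le> sqrt (ln x) / (1 * ln (ln x))" using elim \<xi> by (intro divide_left_mono mult_right_mono mult_pos_pos) auto
      finally have "H * ln (ln x) \<le> sqrt (ln x)" using elim by (simp add: field_simps)
      moreover have "H * 1 \<le> H * ln (ln x)" using elim lo by (intro mult_left_mono) auto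
      ultimately have "H * ln (ln x) \<le> sqrt (ln x)" "H \<le> sqrt (ln x)" by linarith+
      moreover have "H \<le> y x" using calculation(2) elim by linarith
      ultimately show "2 * ln x powr \<delta> \<le> H \<and> H * ln (ln x) \<le> sqrt (ln x) \<and> H \<le> sqrt (ln x) \<and> y x / H \<ge> 1 \<and> 1 \<le> H"
        using lo elim by (auto simp: le_divide_eq)
    qed
  qed
qed

text \<open>The exponents of the smallest and the largest power of \<xi> in the grid, for large
  x.\<close>

definition jlo :: "real \<Rightarrow> nat" where "jlo x = nat \<lceil>ln (2 * y x / x) / ln \<xi>\<rceil>"
definition jhi :: "real \<Rightarrow> nat" where "jhi x = nat \<lfloor>ln (sqrt (ln x) / (\<xi> * ln (ln x))) / ln \<xi>\<rfloor>"

lemma ln_lower_end: "((\<lambda>x. ln (2 * y x / x) / ln (ln x)) \<longlongrightarrow> \<delta>) at_top"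
proof (rule real_tendsto_sandwich)
  show "((\<lambda>x::real. ln (2 * ln x powr \<delta>) / ln (ln x)) \<longlongrightarrow> \<delta>) at_top" using \<delta>(1) by real_asymp
  show "((\<lambda>x::real. ln (4 * ln x powr \<delta>) / ln (ln x)) \<longlongrightarrow> \<delta>) at_top" using \<delta>(1) by real_asymp
  have pos: "\<forall>\<^sub>F x in at_top. 0 < ln x powr \<delta> \<and> 1 < (x::real) \<and> ln (ln x) > 0" using \<delta>(1) by (intro eventually_conj) real_asymp+
  show "\<forall>\<^sub>F x in at_top. ln (2 * ln x powr \<delta>) / ln (ln x) \<le> ln (2 * y x / x) / ln (ln x)"
    using pos y_bounds
  proof eventually_elim
    case (elim x)
    then have "2 * ln x powr \<delta> \<le> 2 * y x / x" by (simp add: field_simps)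
    then show ?case using elim by (intro divide_right_mono) (auto intro!: ln_mono mult_pos_pos)
  qed
  show "\<forall>\<^sub>F x in at_top. ln (2 * y x / x) / ln (ln x) \<le> ln (4 * ln x powr \<delta>) / ln (ln x)"
    using pos y_bounds
  proof eventually_elim
    case (elim x)
    then have "2 * y x / x \<le> 4 * ln x powr \<delta>" by (simp add: field_simps)
    then show ?case using elim by (intro divide_right_mono) (auto intro!: ln_mono)
  qed
qed

text \<open>Rounding is lost after division by an unbounded function; the lemma serves ceilings,
  floors and shifts by one alike.\<close>

lemma tendsto_ceiling_ratio:
  fixes f g :: "real \<Rightarrow> real"
  assumes "((\<lambda>x. f x / g x) \<longlongrightarrow> l) at_top" "filterlim g at_top at_top"
    and "\<forall>\<^sub>F x in at_top. \<bar>n x - f x\<bar> \<le> 1"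
  shows "((\<lambda>x. n x / g x) \<longlongrightarrow> l) at_top"
proof -
  have inv: "((\<lambda>x. 1 / g x) \<longlongrightarrow> 0) at_top"
    using tendsto_inverse_0_at_top[OF assms(2)] by (simp add: inverse_eq_divide)
  have gp: "\<forall>\<^sub>F x in at_top. g x > 0" using assms(2) by (simp add: filterlim_at_top_dense)
  have "((\<lambda>x. n x / g x - f x / g x) \<longlongrightarrow> 0) at_top"
  proof (rule Lim_null_comparison[OF _ inv])
    show "\<forall>\<^sub>F x in at_top. norm (n x / g x - f x / g x) \<le> 1 / g x"
      using gp assms(3)
    proof eventually_elim
      case (elim x)
      have "n x / g x - f x / g x = (n x - f x) / g x" by (simp add: diff_divide_distrib)
      then show ?case using elim by (simp add: abs_divide divide_right_mono)
    qed
  qed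
  from tendsto_add[OF this assms(1)] show ?thesis by simp
qed

lemma lnln_at_top: "filterlim (\<lambda>x::real. ln (ln x)) at_top at_top"
  by real_asymp

lemma jlo_tendsto: "((\<lambda>x. real (jlo x) / ln (ln x)) \<longlongrightarrow> \<delta> / ln \<xi>) at_top"
proof (rule tendsto_ceiling_ratio[OF _ lnln_at_top])
  have "((\<lambda>x. ln (2 * y x / x) / ln (ln x) / ln \<xi>) \<longlongrightarrow> \<delta> / ln \<xi>) at_top"
    using \<xi> by (intro tendsto_divide ln_lower_end tendsto_const) auto
  then show "((\<lambda>x. ln (2 * y x / x) / ln \<xi> / ln (ln x)) \<longlongrightarrow> \<delta> / ln \<xi>) at_top" by (simp add: mult.commute)
  show "\<forall>\<^sub>F x in at_top. \<bar>real (jlo x) - ln (2 * y x / x) / ln \<xi>\<bar> \<le> 1"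
    using y_bounds eventually_ge_at_top[of "exp 1"]
  proof eventually_elim
    case (elim x)
    have "1 \<le> 2 * y x / x" using elim by (simp add: le_divide_eq)
    then have "ln (2 * y x / x) / ln \<xi> \<ge> 0" using \<xi> by (intro divide_nonneg_nonneg) auto
    then show ?case unfolding jlo_def by linarith
  qed
qed

lemma jhi_tendsto: "((\<lambda>x. real (jhi x) / ln (ln x)) \<longlongrightarrow> (1 / 2) / ln \<xi>) at_top"
proof (rule tendsto_ceiling_ratio[OF _ lnln_at_top])
  have "((\<lambda>x. ln (sqrt (ln x) / (\<xi> * ln (ln x))) / ln \<xi> / ln (ln x)) \<longlongrightarrow> inverse (ln \<xi>) / 2) at_top"
    using \<xi> by real_asymp
  moreover have "inverse (ln \<xi>) / 2 = (1 / 2) / ln \<xi>" by (simp add: field_simps)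
  ultimately show "((\<lambda>x. ln (sqrt (ln x) / (\<xi> * ln (ln x))) / ln \<xi> / ln (ln x)) \<longlongrightarrow> (1 / 2) / ln \<xi>) at_top"
    by simp
  have "\<forall>\<^sub>F x in at_top. 1 \<le> sqrt (ln x) / (\<xi> * ln (ln x))" using \<xi> by real_asymp
  then show "\<forall>\<^sub>F x in at_top. \<bar>real (jhi x) - ln (sqrt (ln x) / (\<xi> * ln (ln x))) / ln \<xi>\<bar> \<le> 1"
  proof eventually_elim
    case (elim x)
    then have "ln (sqrt (ln x) / (\<xi> * ln (ln x))) / ln \<xi> \<ge> 0" using \<xi> by (intro divide_nonneg_nonneg) auto
    then show ?case unfolding jhi_def by linarith
  qed
qed

lemma j_at_top: "filterlim jlo at_top at_top" "filterlim jhi at_top at_top"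
proof -
  have *: "filterlim j at_top at_top" if "((\<lambda>x. real (j x) / ln (ln x)) \<longlongrightarrow> l) at_top" "l > 0" for j :: "real \<Rightarrow> nat" and l
  proof -
    have "filterlim (\<lambda>x. real (j x) / ln (ln x) * ln (ln x)) at_top at_top"
      by (rule filterlim_tendsto_pos_mult_at_top[OF that lnln_at_top])
    moreover have "\<forall>\<^sub>F x in at_top. real (j x) / ln (ln x) * ln (ln x) = real (j x)"
      using lnln_at_top by (simp add: filterlim_at_top_dense) (metis (mono_tags, lifting) eventually_mono less_irrefl)
    ultimately have "filterlim (\<lambda>x. real (j x)) at_top at_top" by (simp add: filterlim_cong)
    then have "\<forall>\<^sub>F x in at_top. real Z \<le> real (j x)" for Z unfolding filterlim_at_top by blast
    then show ?thesis unfolding filterlim_at_top by simp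
  qed
  show "filterlim jlo at_top at_top" "filterlim jhi at_top at_top"
    using *[OF jlo_tendsto] *[OF jhi_tendsto] \<delta> \<xi> by auto
qed

lemma scales_eq: "\<forall>\<^sub>F x in at_top. S x = (\<lambda>j. \<xi> ^ j) ` {jlo x..jhi x}"
proof -
  have "\<forall>\<^sub>F x in at_top. 1 \<le> sqrt (ln x) / (\<xi> * ln (ln x)) \<and> (1::real) < x" using \<xi> by (intro eventually_conj) real_asymp+
  then show ?thesis using y_bounds
  proof eventually_elim
    case (elim x)
    have lx: "ln \<xi> > 0" using \<xi> by simp
    have A: "0 < 2 * y x / x" "1 \<le> 2 * y x / x" using elim by (auto simp: le_divide_eq)
    have ue: "y x / (\<xi> * z x) = sqrt (ln x) / (\<xi> * ln (ln x))" using elim by (intro upper_end) auto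
    have 1: "2 * y x / x \<le> \<xi> ^ j \<longleftrightarrow> jlo x \<le> j" for j
    proof -
      have "2 * y x / x \<le> \<xi> ^ j \<longleftrightarrow> ln (2 * y x / x) \<le> ln (\<xi> ^ j)" using A \<xi> by (subst ln_le_cancel_iff) auto
      also have "\<dots> \<longleftrightarrow> ln (2 * y x / x) / ln \<xi> \<le> real j" using \<xi> lx by (simp add: ln_realpow divide_le_eq)
      also have "\<dots> \<longleftrightarrow> jlo x \<le> j" unfolding jlo_def by (simp add: nat_le_iff ceiling_le_iff)
      finally show ?thesis .
    qed
    have 2: "\<xi> ^ j \<le> y x / (\<xi> * z x) \<longleftrightarrow> j \<le> jhi x" for j
    proof -
      let ?U = "sqrt (ln x) / (\<xi> * ln (ln x))"
      have U: "ln ?U / ln \<xi> \<ge> 0" using elim lx by (intro divide_nonneg_nonneg) auto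
      have "\<xi> ^ j \<le> ?U \<longleftrightarrow> ln (\<xi> ^ j) \<le> ln ?U" using elim \<xi> by (subst ln_le_cancel_iff) auto
      also have "\<dots> \<longleftrightarrow> real j \<le> ln ?U / ln \<xi>" using \<xi> lx by (simp add: ln_realpow le_divide_eq)
      also have "\<dots> \<longleftrightarrow> j \<le> jhi x" unfolding jhi_def using U by (simp add: le_nat_iff le_floor_iff)
      finally show ?thesis unfolding ue .
    qed
    show ?case unfolding scales_def using 1 2 by auto
  qed
qed

lemma jlo_less_jhi: "\<forall>\<^sub>F x in at_top. jlo x < jhi x \<and> 2 \<le> jlo x"
proof -
  have "\<delta> / ln \<xi> < (1 / 2) / ln \<xi>" using \<delta> \<xi> by (intro divide_strict_right_mono) auto
  then obtain m where m: "\<delta> / ln \<xi> < m" "m < (1 / 2) / ln \<xi>" using dense by blast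
  have "\<forall>\<^sub>F x in at_top. ln (ln x) > (0::real)" by real_asymp
  then have "\<forall>\<^sub>F x in at_top. jlo x < jhi x"
    using order_tendstoD(2)[OF jlo_tendsto m(1)] order_tendstoD(1)[OF jhi_tendsto m(2)]
  proof eventually_elim
    case (elim x)
    then have "real (jlo x) / ln (ln x) < real (jhi x) / ln (ln x)" by linarith
    then show ?case using elim by (simp add: divide_less_cancel)
  qed
  moreover have "\<forall>\<^sub>F x in at_top. 2 \<le> jlo x" using j_at_top(1) by (simp add: filterlim_at_top)
  ultimately show ?thesis by eventually_elim auto
qed

lemma scales_nonempty: "\<forall>\<^sub>F x in at_top. S x \<noteq> {}"
  using scales_eq jlo_less_jhi by eventually_elim auto

lemma finite_scales: "\<forall>\<^sub>F x in at_top. finite (S x)"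
  using scales_eq by eventually_elim auto

lemma card_scales: "\<exists>C>0. \<forall>\<^sub>F x in at_top. real (card (S x)) \<le> C * ln (ln x)"
proof -
  define C where "C = (1 / 2) / ln \<xi> + 1"
  have "\<forall>\<^sub>F x in at_top. real (jhi x) / ln (ln x) < C"
    using order_tendstoD(2)[OF jhi_tendsto, of C] unfolding C_def by simp
  moreover have "\<forall>\<^sub>F x in at_top. ln (ln x) > (1::real)" by real_asymp
  ultimately have "\<forall>\<^sub>F x in at_top. real (card (S x)) \<le> C * ln (ln x)"
    using scales_eq jlo_less_jhi
  proof eventually_elim
    case (elim x)
    have "card (S x) \<le> card {jlo x..jhi x}" unfolding elim(3) by (rule card_image_le) simp
    also have "\<dots> \<le> jhi x" using elim by auto
    finally have "real (card (S x)) \<le> real (jhi x)" by simp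
    then show ?case using elim by (simp add: divide_less_eq)
  qed
  moreover have "C > 0" unfolding C_def using \<xi> by (intro add_nonneg_pos divide_nonneg_nonneg) auto
  ultimately show ?thesis by blast
qed

text \<open>With ln (\<xi>^j) = j ln \<xi> this is a stretch of the harmonic series. Both ends tend
  to infinity, so the Euler-Mascheroni constants cancel and the logarithm of the ratio of the ends,
  (1/2) / \<delta>, remains.\<close>

lemma sum_inverse_ln_scales: "((\<lambda>x. \<Sum>H\<in>S x. 1 / ln H) \<longlongrightarrow> ln (1 / (2 * \<delta>)) / ln \<xi>) at_top"
proof -
  have lx: "ln \<xi> > 0" using \<xi> by simp
  \<comment> \<open>The sum includes \<open>jlo\<close>, so the harmonic number to be subtracted is
    the one at \<open>jlo - 1\<close>.\<close>
  define m where "m = (\<lambda>x. jlo x - 1)"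
  have m_eq: "\<forall>\<^sub>F x in at_top. real (m x) = real (jlo x) - 1" using jlo_less_jhi unfolding m_def by eventually_elim auto
  have m_lim: "((\<lambda>x. real (m x) / ln (ln x)) \<longlongrightarrow> \<delta> / ln \<xi>) at_top"
    by (rule tendsto_ceiling_ratio[OF jlo_tendsto lnln_at_top]) (use m_eq in \<open>auto elim: eventually_mono\<close>)
  have m_top: "filterlim m at_top at_top"
    unfolding filterlim_at_top
  proof
    fix Z
    have "\<forall>\<^sub>F x in at_top. Suc Z \<le> jlo x" using j_at_top(1) unfolding filterlim_at_top by blast
    then show "\<forall>\<^sub>F x in at_top. Z \<le> m x" by eventually_elim (auto simp: m_def)
  qed
  have harm: "((\<lambda>x. (harm (jhi x) - ln (real (jhi x))) - (harm (m x) - ln (real (m x)))) \<longlongrightarrow> euler_mascheroni - euler_mascheroni) at_top"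
    by (intro tendsto_diff filterlim_compose[OF euler_mascheroni_LIMSEQ] j_at_top m_top)
  have ratio: "((\<lambda>x. ln (real (jhi x)) - ln (real (m x))) \<longlongrightarrow> ln (1 / (2 * \<delta>))) at_top"
  proof -
    have "((\<lambda>x. (real (jhi x) / ln (ln x)) / (real (m x) / ln (ln x))) \<longlongrightarrow> ((1 / 2) / ln \<xi>) / (\<delta> / ln \<xi>)) at_top"
      using \<delta> lx by (intro tendsto_divide jhi_tendsto m_lim) auto
    also have "((1 / 2) / ln \<xi>) / (\<delta> / ln \<xi>) = 1 / (2 * \<delta>)" using lx by simp
    finally have "((\<lambda>x. ln ((real (jhi x) / ln (ln x)) / (real (m x) / ln (ln x)))) \<longlongrightarrow> ln (1 / (2 * \<delta>))) at_top"
      using \<delta> by (intro tendsto_ln) auto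
    moreover have "\<forall>\<^sub>F x in at_top. ln (ln x) > (0::real)" by real_asymp
    then have "\<forall>\<^sub>F x in at_top. ln ((real (jhi x) / ln (ln x)) / (real (m x) / ln (ln x))) = ln (real (jhi x)) - ln (real (m x))"
      using jlo_less_jhi
    proof eventually_elim
      case (elim x)
      then have "(real (jhi x) / ln (ln x)) / (real (m x) / ln (ln x)) = real (jhi x) / real (m x)" by simp
      moreover have "real (jhi x) > 0" "real (m x) > 0" using elim unfolding m_def by auto
      ultimately show ?case by (simp add: ln_div)
    qed
    ultimately show ?thesis by (simp add: tendsto_cong)
  qed
  have "((\<lambda>x. ((harm (jhi x) - ln (real (jhi x))) - (harm (m x) - ln (real (m x))) + (ln (real (jhi x)) - ln (real (m x)))) / ln \<xi>)
     \<longlongrightarrow> ((euler_mascheroni - euler_mascheroni) + ln (1 / (2 * \<delta>))) / ln \<xi>) at_top"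
    using lx by (intro tendsto_divide tendsto_add harm ratio tendsto_const) auto
  moreover have "\<forall>\<^sub>F x in at_top. ((harm (jhi x) - ln (real (jhi x))) - (harm (m x) - ln (real (m x))) + (ln (real (jhi x)) - ln (real (m x)))) / ln \<xi>
     = (\<Sum>H\<in>S x. 1 / ln H)"
    using scales_eq jlo_less_jhi
  proof eventually_elim
    case (elim x)
    have inj: "inj_on (\<lambda>j. \<xi> ^ j) {jlo x..jhi x}" using \<xi> by (intro inj_onI) simp
    have "(\<Sum>H\<in>S x. 1 / ln H) = (\<Sum>j\<in>{jlo x..jhi x}. 1 / real j / ln \<xi>)"
      unfolding elim(1) sum.reindex[OF inj] using \<xi> by (intro sum.cong) (auto simp: ln_realpow)
    also have "\<dots> = (\<Sum>j\<in>{jlo x..jhi x}. inverse (real j)) / ln \<xi>" by (simp add: sum_divide_distrib inverse_eq_divide)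
    also have "(\<Sum>j\<in>{jlo x..jhi x}. inverse (real j)) = harm (jhi x) - harm (m x)"
    proof -
      have "{1..jhi x} = {1..m x} \<union> {jlo x..jhi x}" "{1..m x} \<inter> {jlo x..jhi x} = {}" using elim unfolding m_def by auto
      then show ?thesis unfolding harm_def by (simp add: sum.union_disjoint)
    qed
    finally show ?case by simp
  qed
  ultimately show ?thesis by (simp add: tendsto_cong)
qed

end

definition prime_count :: "(nat \<Rightarrow> int set) \<Rightarrow> nat \<Rightarrow> real \<Rightarrow> real" where
  "prime_count I \<nu> t = real (card {p \<in> primes_upto t. card (I p) = \<nu>})"

text \<open>The expected contribution of one scale at a surviving point: the number of pairs (q, h)
  times the conditional mean 1 / \<sigma>_2 of a weight.\<close>

definition scale_mass :: "(nat \<Rightarrow> int set) \<Rightarrow> real \<Rightarrow> real \<Rightarrow> real \<Rightarrow> nat \<Rightarrow> nat \<Rightarrow> real \<Rightarrow> real \<Rightarrow> real" where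
  "scale_mass I \<delta> \<xi> M K \<nu> x H = real (card (Q_scale I \<delta> \<xi> x H \<nu>) * card (step_range (real K * H)))
     * (1 / (sieve_density I (z_of \<delta> x) / sieve_density I (H powr M)))"

lemma step_range_eq: "step_range J = {1..nat \<lfloor>J\<rfloor>}"
proof (rule set_eqI)
  fix h
  have "real h \<le> J" if "1 \<le> h" "h \<le> nat \<lfloor>J\<rfloor>" using that by linarith
  moreover have "h \<le> nat \<lfloor>J\<rfloor>" if "real h \<le> J" using that by (simp add: le_nat_floor)
  ultimately show "h \<in> step_range J \<longleftrightarrow> h \<in> {1..nat \<lfloor>J\<rfloor>}" unfolding step_range_def by auto
qed

lemma card_step_range: "card (step_range J) = nat \<lfloor>J\<rfloor>"
  by (simp add: step_range_eq)

context window
begin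

context
  fixes h :: "real \<Rightarrow> real"
  assumes h: "\<forall>\<^sub>F x in at_top. h x \<in> S x"
begin

lemma selection_bounds: "\<forall>\<^sub>F x in at_top. 2 * ln x powr \<delta> \<le> h x \<and> h x \<le> sqrt (ln x) \<and> 1 \<le> h x"
  using h scales_bounds by eventually_elim auto

lemma selection_at_top: "filterlim h at_top at_top"
proof -
  have "filterlim (\<lambda>x::real. 2 * ln x powr \<delta>) at_top at_top" using \<delta> by real_asymp
  then show ?thesis by (rule filterlim_at_top_mono) (use selection_bounds in \<open>auto elim: eventually_mono\<close>)
qed

lemma ln_selection: "((\<lambda>x. ln (h x) / ln x) \<longlongrightarrow> 0) at_top"
proof (rule real_tendsto_sandwich)
  show "((\<lambda>x::real. 0) \<longlongrightarrow> 0) at_top" by simp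
  show "((\<lambda>x::real. ln (sqrt (ln x)) / ln x) \<longlongrightarrow> 0) at_top" by real_asymp
  show "\<forall>\<^sub>F x in at_top. 0 \<le> ln (h x) / ln x"
    using selection_bounds eventually_gt_at_top[of 1] by eventually_elim auto
  show "\<forall>\<^sub>F x in at_top. ln (h x) / ln x \<le> ln (sqrt (ln x)) / ln x"
    using selection_bounds eventually_gt_at_top[of 1] by eventually_elim (auto intro!: divide_right_mono ln_mono)
qed

text \<open>The count is taken at t = y / (l h), where ln t ~ ln x because h is at most a power of
  ln x. The cases l = 1 and l = \<xi> are the two ends of the range of q.\<close>

lemma prime_count_selection:
  assumes I: "sieving_system I B" "\<nu> \<in> supp_densities I B" and l: "l \<ge> 1"
  shows "((\<lambda>x. prime_count I \<nu> (y x / (l * h x)) * h x * ln x / y x) \<longlongrightarrow> class_density I \<nu> / l) at_top"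
proof -
  define t where "t = (\<lambda>x. y x / (l * h x))"
  have t_top: "filterlim t at_top at_top"
  proof -
    have "filterlim (\<lambda>x::real. x / (l * sqrt (ln x))) at_top at_top" using l by real_asymp
    moreover have "\<forall>\<^sub>F x in at_top. x / (l * sqrt (ln x)) \<le> t x"
      using selection_bounds y_bounds eventually_gt_at_top[of 1] by eventually_elim (use l in \<open>auto simp: t_def intro!: frac_le mult_pos_pos\<close>)
    ultimately show ?thesis by (rule filterlim_at_top_mono)
  qed
  have ln_t: "((\<lambda>x. ln (t x) / ln x) \<longlongrightarrow> 1) at_top"
  proof -
    have "((\<lambda>x. ln (y x) / ln x - ln l / ln x - ln (h x) / ln x) \<longlongrightarrow> 1 - 0 - 0) at_top"
      by (intro tendsto_diff ln_y ln_selection) real_asymp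
    moreover have "\<forall>\<^sub>F x in at_top. ln (y x) / ln x - ln l / ln x - ln (h x) / ln x = ln (t x) / ln x"
      using selection_bounds y_bounds
    proof eventually_elim
      case (elim x)
      then have "y x > 0" "l * h x > 0" "h x > 0" using l by auto
      then have "ln (t x) = ln (y x) - (ln l + ln (h x))"
        unfolding t_def using l by (simp add: ln_div ln_mult)
      then show ?case by (simp add: diff_divide_distrib add_divide_distrib)
    qed
    ultimately show ?thesis by (simp add: tendsto_cong)
  qed
  have "((\<lambda>x. class_frequency I \<nu> (t x) / (l * (ln (t x) / ln x))) \<longlongrightarrow> class_density I \<nu> / (l * 1)) at_top"
    using l by (intro tendsto_divide tendsto_mult tendsto_const ln_t filterlim_compose[OF class_frequency_tendsto[OF I] t_top]) auto
  moreover have "\<forall>\<^sub>F x in at_top. class_frequency I \<nu> (t x) / (l * (ln (t x) / ln x)) = prime_count I \<nu> (t x) * h x * ln x / y x"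
  proof -
    have "\<forall>\<^sub>F x in at_top. t x > 1" using t_top by (simp add: filterlim_at_top_dense)
    then show ?thesis using selection_bounds y_bounds eventually_gt_at_top[of 1]
    proof eventually_elim
      case (elim x)
      have pos: "y x > 0" "h x > 0" "ln x > 0" "ln (t x) > 0" "l > 0" "t x > 0" using elim l by auto
      have tx: "t x * (l * h x) = y x" unfolding t_def using pos by simp
      have "class_frequency I \<nu> (t x) / (l * (ln (t x) / ln x)) = prime_count I \<nu> (t x) * ln x / (t x * l)"
        unfolding class_frequency_def prime_count_def using pos by (simp add: field_simps)
      also have "\<dots> = prime_count I \<nu> (t x) * h x * ln x / y x" unfolding tx[symmetric] using pos by simp
      finally show ?case .
    qed
  qed
  ultimately show ?thesis unfolding t_def by (simp add: tendsto_cong)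
qed

lemma card_Q_scale_selection:
  assumes I: "sieving_system I B" "\<nu> \<in> supp_densities I B"
  shows "((\<lambda>x. real (card (Q_scale I \<delta> \<xi> x (h x) \<nu>)) * h x * ln x / y x) \<longlongrightarrow> class_density I \<nu> * (1 - 1 / \<xi>)) at_top"
proof -
  have "((\<lambda>x. prime_count I \<nu> (y x / (1 * h x)) * h x * ln x / y x - prime_count I \<nu> (y x / (\<xi> * h x)) * h x * ln x / y x)
     \<longlongrightarrow> class_density I \<nu> / 1 - class_density I \<nu> / \<xi>) at_top"
    using \<xi> by (intro tendsto_diff prime_count_selection[OF I]) auto
  moreover have "\<forall>\<^sub>F x in at_top. prime_count I \<nu> (y x / (1 * h x)) * h x * ln x / y x - prime_count I \<nu> (y x / (\<xi> * h x)) * h x * ln x / y x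
     = real (card (Q_scale I \<delta> \<xi> x (h x) \<nu>)) * h x * ln x / y x"
    using selection_bounds y_bounds
  proof eventually_elim
    case (elim x)
    have le: "y x / (\<xi> * h x) \<le> y x / h x" using elim \<xi> by (intro divide_left_mono) auto
    let ?P = "\<lambda>t. {p \<in> primes_upto t. card (I p) = \<nu>}"
    have sub: "?P (y x / (\<xi> * h x)) \<subseteq> ?P (y x / h x)" using le by (auto simp: primes_upto_def)
    have "Q_scale I \<delta> \<xi> x (h x) \<nu> = ?P (y x / h x) - ?P (y x / (\<xi> * h x))"
      unfolding Q_scale_def at_scale_def primes_upto_def by auto
    then have "card (Q_scale I \<delta> \<xi> x (h x) \<nu>) = card (?P (y x / h x)) - card (?P (y x / (\<xi> * h x)))"
      using sub finite_primes_upto by (simp add: card_Diff_subset)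
    moreover have "card (?P (y x / (\<xi> * h x))) \<le> card (?P (y x / h x))"
      using sub finite_primes_upto by (intro card_mono) auto
    ultimately have "real (card (Q_scale I \<delta> \<xi> x (h x) \<nu>)) = prime_count I \<nu> (y x / h x) - prime_count I \<nu> (y x / (\<xi> * h x))"
      unfolding prime_count_def by (simp add: of_nat_diff)
    then show ?case by (simp add: diff_divide_distrib left_diff_distrib)
  qed
  ultimately show ?thesis by (simp add: tendsto_cong right_diff_distrib)
qed

text \<open>The one-dimensional sieve gives \<sigma>(H^M) / \<sigma>(z) ~ ln x / (M ln H), with C_1
  cancelling. Multiplied by about K H steps and \<rho>_\<nu> (1 - 1/\<xi>) y / (H ln x) primes, this
  leaves a constant times y / ln H.\<close>

lemma scale_mass_selection:
  assumes I: "sieving_system I B" "\<nu> \<in> supp_densities I B"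
  shows "((\<lambda>x. scale_mass I \<delta> \<xi> M K \<nu> x (h x) / ((real K + 2) * y x) * ln (h x)) \<longlongrightarrow>
    real K * class_density I \<nu> * (1 - 1 / \<xi>) / ((real K + 2) * M)) at_top"
proof -
  obtain C1 where C1: "C1 > 0" "((\<lambda>w. sieve_density I w * ln w) \<longlongrightarrow> C1) at_top"
    using sieve_density_tendsto[OF I(1)] by blast
  have hM: "filterlim (\<lambda>x. h x powr M) at_top at_top"
    by (rule filterlim_compose[OF _ selection_at_top]) (use M in real_asymp)
  have s1: "((\<lambda>x. sieve_density I (h x powr M) * (M * ln (h x))) \<longlongrightarrow> C1) at_top"
  proof -
    have "((\<lambda>x. sieve_density I (h x powr M) * ln (h x powr M)) \<longlongrightarrow> C1) at_top"
      by (rule filterlim_compose[OF C1(2) hM])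
    moreover have "\<forall>\<^sub>F x in at_top. sieve_density I (h x powr M) * ln (h x powr M) = sieve_density I (h x powr M) * (M * ln (h x))"
      using selection_bounds by eventually_elim (simp add: ln_powr)
    ultimately show ?thesis by (simp add: tendsto_cong)
  qed
  have s2: "((\<lambda>x. sieve_density I (z x) * ln x) \<longlongrightarrow> C1) at_top"
  proof -
    have "((\<lambda>x. sieve_density I (z x) * ln (z x) / (ln (z x) / ln x)) \<longlongrightarrow> C1 / 1) at_top"
      by (intro tendsto_divide ln_z filterlim_compose[OF C1(2) z_at_top]) simp
    moreover have "\<forall>\<^sub>F x in at_top. sieve_density I (z x) * ln (z x) / (ln (z x) / ln x) = sieve_density I (z x) * ln x"
    proof -
      have "\<forall>\<^sub>F x in at_top. z x > 1" using z_at_top by (simp add: filterlim_at_top_dense)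
      then show ?thesis by eventually_elim (auto simp: field_simps)
    qed
    ultimately show ?thesis by (simp add: tendsto_cong)
  qed
  have J: "((\<lambda>x. real (card (step_range (real K * h x))) / h x) \<longlongrightarrow> real K) at_top"
  proof (rule tendsto_ceiling_ratio[OF _ selection_at_top])
    have "\<forall>\<^sub>F x in at_top. real K * h x / h x = real K" using selection_bounds by eventually_elim simp
    then show "((\<lambda>x. real K * h x / h x) \<longlongrightarrow> real K) at_top" by (simp add: tendsto_cong)
    show "\<forall>\<^sub>F x in at_top. \<bar>real (card (step_range (real K * h x))) - real K * h x\<bar> \<le> 1"
      using selection_bounds
    proof eventually_elim
      case (elim x)
      have "real K * h x \<ge> 0" using elim by simp
      then show ?case unfolding card_step_range by linarith
    qed
  qed
  have "((\<lambda>x. (real (card (Q_scale I \<delta> \<xi> x (h x) \<nu>)) * h x * ln x / y x) * (real (card (step_range (real K * h x))) / h x)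
      * (sieve_density I (h x powr M) * (M * ln (h x)) / (sieve_density I (z x) * ln x)) / ((real K + 2) * M))
     \<longlongrightarrow> (class_density I \<nu> * (1 - 1 / \<xi>)) * real K * (C1 / C1) / ((real K + 2) * M)) at_top"
    using C1(1) M by (intro tendsto_divide tendsto_mult card_Q_scale_selection[OF I] J s1 s2 tendsto_const) auto
  moreover have "\<forall>\<^sub>F x in at_top. (real (card (Q_scale I \<delta> \<xi> x (h x) \<nu>)) * h x * ln x / y x) * (real (card (step_range (real K * h x))) / h x)
      * (sieve_density I (h x powr M) * (M * ln (h x)) / (sieve_density I (z x) * ln x)) / ((real K + 2) * M)
     = scale_mass I \<delta> \<xi> M K \<nu> x (h x) / ((real K + 2) * y x) * ln (h x)"
    using selection_bounds y_bounds eventually_gt_at_top[of 1]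
  proof eventually_elim
    case (elim x)
    have alg: "(Q * H * l / Y) * (J / H) * (A * (M * L) / (D * l)) / (K' * M) = (Q * J) * (1 / (D / A)) / (K' * Y) * L"
      if "H \<noteq> 0" "l \<noteq> 0" "Y \<noteq> 0" for Q H l Y J A L D K' :: real
      using that M by (simp add: field_simps)
    show ?case unfolding scale_mass_def of_nat_mult by (rule alg) (use elim in auto)
  qed
  ultimately show ?thesis using C1(1) by (simp add: tendsto_cong mult_ac)
qed

end

definition total_mass :: "(nat \<Rightarrow> int set) \<Rightarrow> nat \<Rightarrow> real \<Rightarrow> real" where
  "total_mass I \<nu> x = (\<Sum>H\<in>S x. scale_mass I \<delta> \<xi> M K \<nu> x H) / ((real K + 2) * y x)"

text \<open>The number of scales grows, so the limit at each scale must be uniform before summation;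
  what is then summed is 1 / ln H.\<close>

lemma total_mass_tendsto:
  assumes I: "sieving_system I B" "\<nu> \<in> supp_densities I B"
  shows "(total_mass I \<nu> \<longlongrightarrow> real K * class_density I \<nu> / ((real K + 2) * M) * ((1 - 1 / \<xi>) / ln \<xi>) * ln (1 / (2 * \<delta>))) at_top"
proof -
  define A where "A = real K * class_density I \<nu> * (1 - 1 / \<xi>) / ((real K + 2) * M)"
  define s where "s = ln (1 / (2 * \<delta>)) / ln \<xi>"
  define g where "g = (\<lambda>x H. scale_mass I \<delta> \<xi> M K \<nu> x H / ((real K + 2) * y x) * ln H)"
  have uni: "\<forall>\<^sub>F x in at_top. \<forall>H\<in>S x. \<bar>g x H - A\<bar> < e" if "e > 0" for e
    using uniform_of_selections[OF _ scales_nonempty that, of g A] scale_mass_selection[OF _ I]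
    unfolding g_def A_def by blast
  have s: "((\<lambda>x. \<Sum>H\<in>S x. 1 / ln H) \<longlongrightarrow> s) at_top" unfolding s_def by (rule sum_inverse_ln_scales)
  have lnpos: "\<forall>\<^sub>F x in at_top. \<forall>H\<in>S x. ln H > 0"
  proof -
    have "\<forall>\<^sub>F x in at_top. 1 < 2 * ln x powr \<delta>" using \<delta> by real_asymp
    then show ?thesis using scales_bounds by eventually_elim fastforce
  qed
  have "((\<lambda>x. total_mass I \<nu> x - A * (\<Sum>H\<in>S x. 1 / ln H)) \<longlongrightarrow> 0) at_top"
  proof (rule tendstoI)
    fix e :: real assume e: "e > 0"
    \<comment> \<open>The sum of 1 / ln H is eventually below |s| + 1, so a uniform error
      \<open>e'\<close> contributes at most \<open>e\<close>.\<close>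
    define e' where "e' = e / (\<bar>s\<bar> + 1)"
    have e': "e' > 0" unfolding e'_def using e by simp
    have "\<forall>\<^sub>F x in at_top. (\<Sum>H\<in>S x. 1 / ln H) < \<bar>s\<bar> + 1"
      using order_tendstoD(2)[OF s, of "\<bar>s\<bar> + 1"] by simp
    then show "\<forall>\<^sub>F x in at_top. dist (total_mass I \<nu> x - A * (\<Sum>H\<in>S x. 1 / ln H)) 0 < e"
      using uni[OF e'] lnpos
    proof eventually_elim
      case (elim x)
      have "total_mass I \<nu> x - A * (\<Sum>H\<in>S x. 1 / ln H) = (\<Sum>H\<in>S x. (g x H - A) / ln H)"
        unfolding total_mass_def sum_divide_distrib sum_distrib_left sum_subtractf[symmetric]
        using elim(3) by (intro sum.cong refl) (auto simp: g_def diff_divide_distrib)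
      also have "\<bar>\<dots>\<bar> \<le> (\<Sum>H\<in>S x. e' * (1 / ln H))"
      proof (rule order_trans[OF sum_abs sum_mono])
        fix H assume H: "H \<in> S x"
        then have "\<bar>g x H - A\<bar> \<le> e'" "ln H > 0" using elim(2,3) by (auto intro: less_imp_le)
        then show "\<bar>(g x H - A) / ln H\<bar> \<le> e' * (1 / ln H)" by (simp add: abs_divide divide_right_mono)
      qed
      also have "\<dots> = e' * (\<Sum>H\<in>S x. 1 / ln H)" by (rule sum_distrib_left[symmetric])
      also have "\<dots> < e' * (\<bar>s\<bar> + 1)" using elim(1) e' by (rule mult_strict_left_mono)
      also have "\<dots> = e" unfolding e'_def by simp
      finally show ?case by simp
    qed
  qed
  from tendsto_add[OF this tendsto_mult[OF tendsto_const[of A] s]]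
  have "(total_mass I \<nu> \<longlongrightarrow> A * s) at_top" by simp
  then show ?thesis unfolding A_def s_def by (simp add: mult_ac)
qed

text \<open>The limit \<rho>_\<nu> (1 - 1/\<xi>) is positive, so it may itself serve as the uniform
  error, which bounds the normalised count by twice its limit.\<close>

lemma card_Q_scale_le:
  assumes I: "sieving_system I B" "\<nu> \<in> supp_densities I B"
  shows "\<exists>C>0. \<forall>\<^sub>F x in at_top. \<forall>H\<in>S x. real (card (Q_scale I \<delta> \<xi> x H \<nu>)) \<le> C * (y x / (H * ln x))"
proof -
  define A where "A = class_density I \<nu> * (1 - 1 / \<xi>)"
  have A: "A > 0" unfolding A_def using I(2) \<xi> by (simp add: supp_densities_def)
  have "\<forall>\<^sub>F x in at_top. \<forall>H\<in>S x. \<bar>real (card (Q_scale I \<delta> \<xi> x H \<nu>)) * H * ln x / y x - A\<bar> < A"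
    using card_Q_scale_selection[OF _ I] scales_nonempty A unfolding A_def
    by (intro uniform_of_selections[where g = "\<lambda>x H. real (card (Q_scale I \<delta> \<xi> x H \<nu>)) * H * ln x / y x"]) auto
  then have "\<forall>\<^sub>F x in at_top. \<forall>H\<in>S x. real (card (Q_scale I \<delta> \<xi> x H \<nu>)) \<le> (2 * A) * (y x / (H * ln x))"
    using scales_bounds y_bounds eventually_gt_at_top[of 1]
  proof eventually_elim
    case (elim x)
    show ?case
    proof
      fix H assume H: "H \<in> S x"
      have "real (card (Q_scale I \<delta> \<xi> x H \<nu>)) * H * ln x / y x \<le> 2 * A"
      proof -
        have "\<bar>real (card (Q_scale I \<delta> \<xi> x H \<nu>)) * H * ln x / y x - A\<bar> < A" using elim(1) H by blast
        moreover have "u \<le> 2 * A" if "\<bar>u - A\<bar> < A" for u using that by linarith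
        ultimately show ?thesis by blast
      qed
      moreover have "y x > 0" "H > 0" "ln x > 0" using elim H by force+
      ultimately show "real (card (Q_scale I \<delta> \<xi> x H \<nu>)) \<le> (2 * A) * (y x / (H * ln x))"
        by (simp add: field_simps)
    qed
  qed
  then show ?thesis using A by (intro exI[of _ "2 * A"]) auto
qed

lemma sieve_density_z_bounds:
  assumes I: "sieving_system I B"
  shows "\<exists>C>0. \<forall>\<^sub>F x in at_top. sieve_density I (z x) \<ge> C / ln x"
proof -
  obtain C1 where C1: "C1 > 0" "((\<lambda>w. sieve_density I w * ln w) \<longlongrightarrow> C1) at_top"
    using sieve_density_tendsto[OF I] by blast
  have "((\<lambda>x. sieve_density I (z x) * ln (z x) / (ln (z x) / ln x)) \<longlongrightarrow> C1 / 1) at_top"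
    by (intro tendsto_divide ln_z filterlim_compose[OF C1(2) z_at_top]) simp
  then have "\<forall>\<^sub>F x in at_top. sieve_density I (z x) * ln (z x) / (ln (z x) / ln x) > C1 / 2"
    using C1(1) by (intro order_tendstoD(1)) auto
  moreover have "\<forall>\<^sub>F x in at_top. z x > 1" using z_at_top by (simp add: filterlim_at_top_dense)
  ultimately have "\<forall>\<^sub>F x in at_top. sieve_density I (z x) \<ge> (C1 / 2) / ln x"
    using eventually_gt_at_top[of 1]
  proof eventually_elim
    case (elim x)
    then have "sieve_density I (z x) * ln x > C1 / 2" by (simp add: field_simps)
    then show ?case using elim by (simp add: field_simps)
  qed
  then show ?thesis using C1(1) by (intro exI[of _ "C1 / 2"]) auto
qed

end

section \<open>Moments at a fixed scale\<close>

lemma ln_powr_compare: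
  assumes "a < b" "c > 0"
  shows "\<forall>\<^sub>F x::real in at_top. c * ln x powr a \<le> ln x powr b"
  using assms by real_asymp

locale second_sieve = window \<delta> \<xi> M K + sieving_system I B
  for \<delta> \<xi> M :: real and K :: nat and I :: "nat \<Rightarrow> int set" and B :: nat +
  fixes a :: "nat \<Rightarrow> nat \<Rightarrow> int" and \<nu> :: nat and c1 c2 C Cf :: real
  assumes lab: "labelling I a" and \<nu>: "\<nu> \<in> supp_densities I B" and tc: "tail_constants c1 c2 C"
    and Cf: "Cf \<ge> 0" "\<And>v. v \<ge> 1 \<Longrightarrow> real (card (difference_primes I v)) \<le> Cf * real_of_int v powr 0.49"
begin

definition low :: "real \<Rightarrow> nat set" where "low H = primes_upto (H powr M)"
definition high :: "real \<Rightarrow> real \<Rightarrow> nat set" where "high x H = {p \<in> primes_upto (z x). H powr M < real p}"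
definition J :: "real \<Rightarrow> nat" where "J H = card (step_range (real K * H))"
text \<open>Chosen so that exp (- c2 k0 / 2) = (ln x)^(-(c1 + M + 4)): this cancels the factor (ln
  x)^c1 of the tail hypothesis and leaves (ln x)^(-M - 4) for the later losses.\<close>

definition C0 :: real where "C0 = 2 * (c1 + M + 4) / c2"
definition k0 :: "real \<Rightarrow> real" where "k0 x = C0 * ln (ln x)"
text \<open>The number of starting points n in the range of the statement; it also bounds all
  differences and shifts that occur.\<close>

definition u :: "real \<Rightarrow> real" where "u x = (real K + 2) * y x"
definition T :: "real \<Rightarrow> real" where
  "T x = C * (u x * ln (u x) powr c1) * exp (- c2 / 2 * k0 x) / (1 - exp (- c2 / 2))"
definition Q :: "real \<Rightarrow> real \<Rightarrow> nat set" where "Q x H = Q_scale I \<delta> \<xi> x H \<nu>"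
text \<open>The value of H^(2 - M) at H = (ln x)^\<delta>, hence an upper bound for it at every
  scale.\<close>

definition err :: "real \<Rightarrow> real" where "err x = ln x powr (\<delta> * (2 - M))"

lemma c_pos: "c1 > 0" "c2 > 0" "C \<ge> 0" using tc by (auto simp: tail_constants_def)

lemma C0_pos: "C0 > 0" using c_pos M by (simp add: C0_def)

lemma \<nu>_bounds: "1 \<le> \<nu>" "\<nu> \<le> B" using \<nu> by (auto simp: supp_densities_def)

lemma B_pos: "1 \<le> B" using \<nu>_bounds by linarith

lemma scale_facts: "\<forall>\<^sub>F x in at_top. \<forall>H\<in>S x. ln x powr \<delta> \<le> H \<and> 1 \<le> H \<and> H \<le> sqrt (ln x) \<and> H * ln (ln x) \<le> sqrt (ln x)
   \<and> real (J H) \<le> real K * H \<and> (real (B * J H))\<^sup>2 / H powr M \<le> (real B * real K)\<^sup>2 * err x \<and> H ^ 3 \<le> sqrt (H powr M) \<and> 1 < x"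
proof -
  have "\<forall>\<^sub>F x in at_top. 1 \<le> ln x powr \<delta> \<and> (1::real) < x" using \<delta> by (intro eventually_conj) real_asymp+
  then show ?thesis using scales_bounds
  proof eventually_elim
    case (elim x)
    show ?case
    proof
      fix H assume H: "H \<in> S x"
      have h: "2 * ln x powr \<delta> \<le> H" "H * ln (ln x) \<le> sqrt (ln x)" "H \<le> sqrt (ln x)" "1 \<le> H" using elim(2) H by auto
      have lo: "ln x powr \<delta> \<le> H" using h(1) elim by linarith
      have J: "real (J H) \<le> real K * H"
      proof -
        have "real K * H \<ge> 0" using h by simp
        then show ?thesis unfolding J_def card_step_range by linarith
      qed
      have "(real (B * J H))\<^sup>2 \<le> (real B * (real K * H))\<^sup>2"
        using J by (intro power_mono) (auto intro: mult_left_mono)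
      then have "(real (B * J H))\<^sup>2 / H powr M \<le> (real B * (real K * H))\<^sup>2 / H powr M" by (rule divide_right_mono) simp
      also have "\<dots> = (real B * real K)\<^sup>2 * H powr (2 - M)"
        using h by (simp add: powr_diff power_mult_distrib)
      also have "\<dots> \<le> (real B * real K)\<^sup>2 * (ln x powr \<delta>) powr (2 - M)"
        using lo M elim by (intro mult_left_mono powr_mono2') auto
      also have "\<dots> = (real B * real K)\<^sup>2 * err x" by (simp add: err_def powr_powr)
      finally have e: "(real (B * J H))\<^sup>2 / H powr M \<le> (real B * real K)\<^sup>2 * err x" .
      \<comment> \<open>M > 6 enters here: sqrt (H^M) \<ge> H^3 is what later outweighs the trivial
        bound on a product of weights.\<close>
      have "H ^ 3 = H powr 3" using h by (simp add: powr_numeral)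
      also have "\<dots> \<le> H powr (M / 2)" using h M by (intro powr_mono) auto
      also have "\<dots> = sqrt (H powr M)" using h by (simp add: powr_half_sqrt[symmetric] powr_powr)
      finally have "H ^ 3 \<le> sqrt (H powr M)" .
      then show "ln x powr \<delta> \<le> H \<and> 1 \<le> H \<and> H \<le> sqrt (ln x) \<and> H * ln (ln x) \<le> sqrt (ln x)
        \<and> real (J H) \<le> real K * H \<and> (real (B * J H))\<^sup>2 / H powr M \<le> (real B * real K)\<^sup>2 * err x \<and> H ^ 3 \<le> sqrt (H powr M) \<and> 1 < x"
        using h lo J e elim by blast
    qed
  qed
qed

lemma err_small: "c > 0 \<Longrightarrow> \<forall>\<^sub>F x in at_top. err x * (1 + ln (ln x)) \<le> c"
proof -
  assume c: "c > 0"
  define E where "E = \<delta> * (2 - M)"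
  have E: "E < 0" unfolding E_def using \<delta> M by (intro mult_pos_neg) auto
  have "\<forall>\<^sub>F x::real in at_top. ln x powr E * (1 + ln (ln x)) < c"
    by (rule order_tendstoD(2)[OF _ c]) (use E in real_asymp)
  then show ?thesis unfolding err_def E_def by eventually_elim simp
qed

lemma low_high_union:
  "\<forall>\<^sub>F x in at_top. \<forall>H\<in>S x. low H \<union> high x H = primes_upto (z x) \<and> H powr M \<le> z x"
proof -
  have "\<forall>\<^sub>F x::real in at_top. sqrt (ln x) powr M \<le> x * (ln (ln x) / sqrt (ln x)) \<and> ln (ln x) / sqrt (ln x) \<ge> 0"
    using M by (intro eventually_conj) real_asymp+
  then show ?thesis using scale_facts y_bounds
  proof eventually_elim
    case (elim x)
    show ?case
    proof
      fix H assume H: "H \<in> S x"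
      have "H powr M \<le> sqrt (ln x) powr M" using elim(2) H M by (intro powr_mono2) auto
      also have "\<dots> \<le> x * (ln (ln x) / sqrt (ln x))" using elim by blast
      also have "\<dots> \<le> y x * (ln (ln x) / sqrt (ln x))" using elim by (intro mult_right_mono) auto
      also have "\<dots> = z x" unfolding z_of_def by simp
      finally have le: "H powr M \<le> z x" .
      then have "low H \<union> high x H = primes_upto (z x)" unfolding low_def high_def primes_upto_def by auto
      then show "low H \<union> high x H = primes_upto (z x) \<and> H powr M \<le> z x" using le by blast
    qed
  qed
qed

lemma eventually_progression_family: "\<forall>\<^sub>F x in at_top. \<forall>H\<in>S x.
  progression_family I B (low H) (high x H) (H powr M) a (J H) (B * J H) (c2 / 2) (k0 x) (Q x H) \<nu> (T x) (u x)"
proof -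
  \<comment> \<open>The three minima provide s \<le> c2 / 2, s * k0 \<le> 1/2 and 4 k B \<le> W
    respectively; the denominator turns the bound on \<open>err\<close> into one on s.\<close>
  define c where "c = min (min (c2 / 2) (1 / (2 * C0))) (1 / 4) / (8 * real B * (real B * real K)\<^sup>2)"
  have Bp: "real B > 0" "real K > 0" using B_pos K by auto
  have cp: "c > 0" unfolding c_def using c_pos C0_pos Bp by (intro divide_pos_pos) auto
  have "\<forall>\<^sub>F x in at_top. k0 x \<ge> 1 \<and> ln (ln x) \<ge> 0"
  proof (intro eventually_conj)
    show "\<forall>\<^sub>F x in at_top. k0 x \<ge> 1" unfolding k0_def using C0_pos by real_asymp
    show "\<forall>\<^sub>F x::real in at_top. ln (ln x) \<ge> 0" by real_asymp
  qed
  moreover have "\<forall>\<^sub>F x::real in at_top. x \<ge> 10" by (rule eventually_ge_at_top)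
  ultimately show ?thesis using scale_facts y_bounds err_small[OF cp]
  proof eventually_elim
    case (elim x)
    have u10: "u x \<ge> 10"
    proof -
      have "1 * y x \<le> (real K + 2) * y x" using elim by (intro mult_right_mono) auto
      then show ?thesis unfolding u_def using elim by linarith
    qed
    have T0: "T x \<ge> 0" unfolding T_def using c_pos u10 by simp
    show ?case
    proof
      fix H assume H: "H \<in> S x"
      define W where "W = H powr M"
      define k where "k = B * J H"
      have h: "1 \<le> H" "real (J H) \<le> real K * H" "(real k)\<^sup>2 / W \<le> (real B * real K)\<^sup>2 * err x"
        using elim(3) H unfolding k_def W_def by auto
      have W1: "W \<ge> 1" unfolding W_def using h M by (simp add: ge_one_powr_ge_zero)
      have e: "8 * real B * (real k)\<^sup>2 / W * (1 + ln (ln x)) \<le> min (min (c2 / 2) (1 / (2 * C0))) (1 / 4)"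
      proof -
        have "8 * real B * (real k)\<^sup>2 / W * (1 + ln (ln x)) = 8 * real B * ((real k)\<^sup>2 / W) * (1 + ln (ln x))" by simp
        also have "\<dots> \<le> 8 * real B * ((real B * real K)\<^sup>2 * err x) * (1 + ln (ln x))"
          using h(3) elim by (intro mult_left_mono mult_right_mono) auto
        also have "\<dots> = 8 * real B * (real B * real K)\<^sup>2 * (err x * (1 + ln (ln x)))" by simp
        also have "\<dots> \<le> 8 * real B * (real B * real K)\<^sup>2 * c" using elim by (intro mult_left_mono) auto
        also have "\<dots> = min (min (c2 / 2) (1 / (2 * C0))) (1 / 4)" unfolding c_def using Bp by simp
        finally show ?thesis .
      qed
      have g0: "8 * real B * (real k)\<^sup>2 / W \<ge> 0" using W1 by simp
      have e1: "8 * real B * (real k)\<^sup>2 / W \<le> c2 / 2" "8 * real B * (real k)\<^sup>2 / W \<le> 1 / 4"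
        and e2: "8 * real B * (real k)\<^sup>2 / W * ln (ln x) \<le> 1 / (2 * C0)"
      proof -
        have "8 * real B * (real k)\<^sup>2 / W * 1 \<le> 8 * real B * (real k)\<^sup>2 / W * (1 + ln (ln x))"
          using g0 elim by (intro mult_left_mono) auto
        then show "8 * real B * (real k)\<^sup>2 / W \<le> c2 / 2" "8 * real B * (real k)\<^sup>2 / W \<le> 1 / 4" using e by auto
        have "8 * real B * (real k)\<^sup>2 / W * ln (ln x) \<le> 8 * real B * (real k)\<^sup>2 / W * (1 + ln (ln x))"
          using g0 by (intro mult_left_mono) auto
        then show "8 * real B * (real k)\<^sup>2 / W * ln (ln x) \<le> 1 / (2 * C0)" using e by auto
      qed
      have e3: "8 * real B * (real k)\<^sup>2 / W * k0 x \<le> 1 / 2"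
      proof -
        have "8 * real B * (real k)\<^sup>2 / W * k0 x = C0 * (8 * real B * (real k)\<^sup>2 / W * ln (ln x))" by (simp add: k0_def)
        also have "\<dots> \<le> C0 * (1 / (2 * C0))" using e2 C0_pos by (intro mult_left_mono) auto
        finally show ?thesis using C0_pos by simp
      qed
      have kW: "4 * real (k * B) \<le> W"
      proof -
        have "real k \<le> (real k)\<^sup>2" by (cases k) (auto simp: power2_eq_square)
        then have "4 * real (k * B) \<le> 4 * real B * (real k)\<^sup>2" using mult_left_mono[of "real k" "(real k)\<^sup>2" "4 * real B"] by (simp add: mult_ac)
        also have "8 * real B * (real k)\<^sup>2 \<le> W / 4" using e1(2) W1 by (simp add: divide_le_eq)
        then have "4 * real B * (real k)\<^sup>2 \<le> W" using W1 by simp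
        finally show ?thesis .
      qed
      have Qf: "finite (Q x H)"
      proof -
        have "Q x H \<subseteq> primes_upto (y x / H)" unfolding Q_def Q_scale_def at_scale_def primes_upto_def by auto
        then show ?thesis using finite_primes_upto finite_subset by blast
      qed
      have Qp: "prime q \<and> card (I q) = \<nu> \<and> real q * (real (J H) + 1) \<le> u x" if "q \<in> Q x H" for q
      proof -
        have q: "prime q" "card (I q) = \<nu>" "real q \<le> y x / H" using that unfolding Q_def Q_scale_def at_scale_def by auto
        have "real q * (real (J H) + 1) \<le> y x / H * (real K * H + 1)"
          using q(3) h elim by (intro mult_mono) auto
        also have "\<dots> = real K * y x + y x / H" using h by (simp add: field_simps)
        also have "y x / H \<le> 2 * y x" using h elim by (simp add: divide_le_eq)
        also have "real K * y x + 2 * y x = u x" by (simp add: u_def algebra_simps)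
        finally show ?thesis using q by simp
      qed
      show "progression_family I B (low H) (high x H) (H powr M) a (J H) (B * J H) (c2 / 2) (k0 x) (Q x H) \<nu> (T x) (u x)"
      proof (unfold_locales)
        show "finite (low H)" "finite (high x H)" unfolding low_def high_def using finite_primes_upto by auto
        show "prime p" if "p \<in> low H" for p using that by (simp add: low_def primes_upto_def)
        show "prime p" "H powr M < real p" if "p \<in> high x H" for p using that by (simp_all add: high_def primes_upto_def)
        show "low H \<inter> high x H = {}" by (auto simp: low_def high_def primes_upto_def)
        show "1 \<le> H powr M" using W1 by (simp add: W_def)
        show "4 * real (B * J H * B) \<le> H powr M" using kW by (simp add: k_def W_def)
        show "0 \<le> k0 x" using elim by simp
        show "8 * real B * (real (B * J H))\<^sup>2 / H powr M \<le> c2 / 2" using e1(1) by (simp add: k_def W_def)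
        show "8 * real B * (real (B * J H))\<^sup>2 / H powr M * k0 x \<le> 1 / 2" using e3 by (simp add: k_def W_def)
        show "finite (Q x H)" by (rule Qf)
        show "\<And>q. q \<in> Q x H \<Longrightarrow> prime q \<and> card (I q) = \<nu> \<and> real q * (real (J H) + 1) \<le> u x" by (rule Qp)
        show "labelling I a" by (rule lab)
        show "1 \<le> \<nu>" by (rule \<nu>_bounds)
        show "0 \<le> T x" by (rule T0)
        fix \<tau> w assume \<tau>: "\<tau> \<in> family_indices \<nu> (J H)" and w: "\<bar>real_of_int w\<bar> \<le> u x"
        show "(\<Sum>q\<in>{q\<in>Q x H. difference_family I a \<tau> q + w \<noteq> 0}. pair_weight (c2 / 2) (k0 x) (difference_family I a \<tau> q + w)) \<le> T x"
          unfolding T_def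
        proof (rule tail_sum[OF tc u10 _ w])
          show "1 \<le> k0 x" using elim by simp
          show "finite {q\<in>Q x H. difference_family I a \<tau> q + w \<noteq> 0}" using Qf by simp
          show "difference_family I a \<tau> q \<noteq> 0 \<and> in_difference_set I q (difference_family I a \<tau> q)"
            if "prime q" "1 \<le> card (I q)" for q using difference_family_valid[OF lab that \<tau>] by blast
          fix q assume "q \<in> {q\<in>Q x H. difference_family I a \<tau> q + w \<noteq> 0}"
          then have q: "q \<in> Q x H" "difference_family I a \<tau> q + w \<noteq> 0" by auto
          have "real_of_int \<bar>difference_family I a \<tau> q\<bar> \<le> real_of_int (int q * (int (J H) + 1))"
            unfolding of_int_le_iff using Qp[OF q(1)] \<tau> by (intro difference_family_le[OF lab]) auto
          also have "\<dots> \<le> u x" using Qp[OF q(1)] by simp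
          finally show "prime q \<and> 1 \<le> card (I q) \<and> real_of_int \<bar>difference_family I a \<tau> q\<bar> \<le> u x \<and> difference_family I a \<tau> q + w \<noteq> 0"
            using Qp[OF q(1)] q \<nu>_bounds by auto
        qed
      qed simp
    qed
  qed
qed

lemma density_of_split: "H powr M \<le> z x \<Longrightarrow> density_of I (low H) * density_of I (high x H) = sieve_density I (z x)"
proof -
  assume le: "H powr M \<le> z x"
  have "primes_upto (z x) = low H \<union> high x H" "low H \<inter> high x H = {}"
    using le unfolding low_def high_def primes_upto_def by auto
  moreover have "finite (low H)" "finite (high x H)" unfolding low_def high_def using finite_primes_upto by auto
  ultimately show ?thesis unfolding sieve_density_eq density_of_def by (simp add: prod.union_disjoint)
qed

text \<open>The trivial bound of the progression locale as a function of x and H, so that its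
  estimates can be uniform over the scales.\<close>

definition V :: "real \<Rightarrow> real \<Rightarrow> real" where
  "V x H = 1 / density_of I (high x H) ^ (2 * (B * J H))"

lemma high_density_ge: "H powr M \<le> z x \<Longrightarrow> sieve_density I (z x) \<le> density_of I (high x H)"
  "H powr M \<le> z x \<Longrightarrow> density_of I (low H) / density_of I (high x H) \<le> 1 / sieve_density I (z x)"
  "density_of I (high x H) > 0" "density_of I (low H) > 0"
proof -
  have p: "density_of I (low H) > 0" "density_of I (low H) \<le> 1" "density_of I (high x H) > 0" "density_of I (high x H) \<le> 1"
    using density_of_pos[of "low H"] density_of_pos[of "high x H"] by (auto simp: low_def high_def primes_upto_def)
  assume "H powr M \<le> z x"
  note sp = density_of_split[OF this]
  show "sieve_density I (z x) \<le> density_of I (high x H)"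
    unfolding sp[symmetric] using p by (simp add: mult_left_le_one_le)
  have "density_of I (low H) / density_of I (high x H) = (density_of I (low H))\<^sup>2 * (1 / (density_of I (low H) * density_of I (high x H)))"
    using p by (simp add: power2_eq_square)
  also have "\<dots> \<le> 1 * (1 / (density_of I (low H) * density_of I (high x H)))"
    using p by (intro mult_right_mono) (auto simp: power_le_one)
  finally show "density_of I (low H) / density_of I (high x H) \<le> 1 / sieve_density I (z x)" unfolding sp by simp
next
  show "density_of I (high x H) > 0" "density_of I (low H) > 0"
    using density_of_pos(1)[of "low H"] density_of_pos(1)[of "high x H"] by (auto simp: low_def high_def primes_upto_def)
qed

text \<open>\<sigma>_2 is at least about 1 / ln x, so \<open>V\<close> is at most exp (4 B K H ln
  (ln x)), and H ln (ln x) \<le> sqrt (ln x). Against exp (- H^3 / 12) it loses because H^2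
  dominates ln (ln x).\<close>

lemma V_bounds: "\<forall>\<^sub>F x in at_top. \<forall>H\<in>S x. V x H \<le> exp (4 * real B * real K * sqrt (ln x)) \<and>
   V x H * exp (- sqrt (H powr M) / 12) \<le> exp (- (ln x powr \<delta>)) \<and> V x H \<ge> 0"
proof -
  obtain C' where C': "C' > 0" "\<forall>\<^sub>F x in at_top. sieve_density I (z x) \<ge> C' / ln x"
    using sieve_density_z_bounds[OF sieving_system_axioms] by blast
  have "\<forall>\<^sub>F x::real in at_top. C' * ln x \<ge> 1 \<and> ln x > 1 \<and> ln x powr \<delta> \<ge> 0 \<and> (ln x powr \<delta>)\<^sup>2 / 12 \<ge> 4 * real B * real K * ln (ln x) + 1 \<and> ln (ln x) \<ge> 0"
    using C'(1) \<delta> by (intro eventually_conj) real_asymp+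
  then show ?thesis using C'(2) scale_facts low_high_union
  proof eventually_elim
    case (elim x)
    show ?case
    proof
      fix H assume H: "H \<in> S x"
      have h: "ln x powr \<delta> \<le> H" "1 \<le> H" "H * ln (ln x) \<le> sqrt (ln x)" "real (J H) \<le> real K * H" "H ^ 3 \<le> sqrt (H powr M)"
        using elim(3) H by auto
      \<comment> \<open>One extra power of ln x absorbs the constant, which would otherwise be
        raised to a power of order H.\<close>
      have "1 / (ln x)\<^sup>2 \<le> C' / ln x" using elim by (simp add: field_simps power2_eq_square)
      also have "\<dots> \<le> density_of I (high x H)" using elim(2) high_density_ge(1) elim(4) H order_trans by blast
      finally have lo: "1 / (ln x)\<^sup>2 \<le> density_of I (high x H)" .
      have dp: "density_of I (high x H) > 0" by (rule high_density_ge(3))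
      have "V x H \<le> 1 / (1 / (ln x)\<^sup>2) ^ (2 * (B * J H))"
        unfolding V_def using lo dp elim by (intro divide_left_mono power_mono mult_pos_pos zero_less_power) auto
      also have "\<dots> = (ln x) ^ (4 * (B * J H))" by (simp add: power_divide power_mult[symmetric])
      also have "\<dots> = exp (real (4 * (B * J H)) * ln (ln x))" using elim by (subst exp_of_nat_mult) simp
      also have "\<dots> \<le> exp (4 * real B * real K * (H * ln (ln x)))"
      proof -
        have "real (4 * (B * J H)) \<le> 4 * real B * real K * H" using h(4) by (simp add: mult_left_mono mult.assoc)
        then have "real (4 * (B * J H)) * ln (ln x) \<le> 4 * real B * real K * H * ln (ln x)" using elim by (intro mult_right_mono) auto
        then show ?thesis by (simp add: mult.assoc)
      qed
      finally have V1: "V x H \<le> exp (4 * real B * real K * (H * ln (ln x)))" .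
      also have "\<dots> \<le> exp (4 * real B * real K * sqrt (ln x))" using h(3) by (simp add: mult_left_mono)
      finally have V2: "V x H \<le> exp (4 * real B * real K * sqrt (ln x))" .
      have "V x H * exp (- sqrt (H powr M) / 12) \<le> exp (4 * real B * real K * (H * ln (ln x))) * exp (- (H ^ 3) / 12)"
        using V1 h(5) by (intro mult_mono) auto
      also have "\<dots> = exp (H * (4 * real B * real K * ln (ln x) - H\<^sup>2 / 12))"
        by (simp add: exp_add[symmetric] algebra_simps power2_eq_square power3_eq_cube)
      also have "\<dots> \<le> exp (H * (- 1))"
      proof -
        have "(ln x powr \<delta>)\<^sup>2 \<le> H\<^sup>2" using h(1) elim by (intro power_mono) auto
        then have "4 * real B * real K * ln (ln x) - H\<^sup>2 / 12 \<le> - 1" using elim(1) by linarith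
        then show ?thesis using h(2) by (subst exp_le_cancel_iff, intro mult_left_mono) auto
      qed
      also have "\<dots> \<le> exp (- (ln x powr \<delta>))" using h(1) by simp
      finally have "V x H * exp (- sqrt (H powr M) / 12) \<le> exp (- (ln x powr \<delta>))" .
      then show "V x H \<le> exp (4 * real B * real K * sqrt (ln x)) \<and>
        V x H * exp (- sqrt (H powr M) / 12) \<le> exp (- (ln x powr \<delta>)) \<and> V x H \<ge> 0"
        using V2 dp by (simp add: V_def)
    qed
  qed
qed

end

section \<open>The weights of the statement expressed through the abstract progressions\<close>

lemma mem_translate_sieved: "v \<in> translate (sieved I w) b \<longleftrightarrow> avoids I (primes_upto w) {v} b"
proof -
  have "v \<in> translate (sieved I w) b \<longleftrightarrow> v - b \<in> sieved I w"
    unfolding translate_def by (metis (no_types, lifting) add_diff_cancel_right' diff_add_cancel image_iff)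
  then show ?thesis unfolding sieved_def avoids_def by simp
qed

lemma subset_translate_sieved_between:
  "A \<subseteq> translate (sieved_between I w w') b \<longleftrightarrow> avoids I {p \<in> primes_upto w'. w < real p} A b"
proof -
  have "v \<in> translate (sieved_between I w w') b \<longleftrightarrow> v - b \<in> sieved_between I w w'" for v
    unfolding translate_def by (metis (no_types, lifting) add_diff_cancel_right' diff_add_cancel image_iff)
  then show ?thesis unfolding sieved_between_def avoids_def by auto
qed

lemma AP_eq:
  "AP I a M b H L q n = ((\<lambda>v. n + v) ` offsets I a (card (step_range L)) q) \<inter> {v. avoids I (primes_upto (H powr M)) {v} b}"
proof -
  have "(\<Union>i\<in>{1..card (I q)}. (\<lambda>h. n + a i q + int h * int q) ` step_range L) =
      (\<lambda>v. n + v) ` offsets I a (card (step_range L)) q"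
    unfolding offsets_def image_image card_step_range step_range_eq by (auto simp: image_iff add.assoc) fastforce+
  then show ?thesis unfolding AP_def using mem_translate_sieved by blast
qed

context progression_sieve
begin

lemma pair_excess_nonneg: "pair_excess q w \<ge> 0"
  unfolding pair_excess_def using V_nonneg s_nonneg k0 collision_mass_nonneg pair_weight_nonneg
  by (auto intro!: add_nonneg_nonneg mult_nonneg_nonneg sum_nonneg)

text \<open>The excess depends only on n - n', and for fixed n each difference in the window occurs
  at most once.\<close>

lemma sum_pair_excess_window:
  assumes X: "X \<subseteq> {lo..hi}" "hi - lo \<le> Y" "finite X"
  shows "(\<Sum>n\<in>X. \<Sum>n'\<in>X. pair_excess q (n - n')) \<le> real (card X) * (\<Sum>w\<in>{-Y..Y}. pair_excess q w)"
proof -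
  have "(\<Sum>n'\<in>X. pair_excess q (n - n')) \<le> (\<Sum>w\<in>{-Y..Y}. pair_excess q w)" if n: "n \<in> X" for n
  proof -
    have "(\<Sum>n'\<in>X. pair_excess q (n - n')) = (\<Sum>w\<in>(\<lambda>n'. n - n') ` X. pair_excess q w)"
      by (subst sum.reindex) (auto simp: inj_on_def)
    also have "\<dots> \<le> (\<Sum>w\<in>{-Y..Y}. pair_excess q w)"
    proof (intro sum_mono2 pair_excess_nonneg)
      show "(\<lambda>n'. n - n') ` X \<subseteq> {-Y..Y}"
      proof
        fix w assume "w \<in> (\<lambda>n'. n - n') ` X"
        then obtain n' where "n' \<in> X" "w = n - n'" by blast
        moreover have "lo \<le> n" "n \<le> hi" "lo \<le> n'" "n' \<le> hi" using X(1) n calculation by auto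
        ultimately show "w \<in> {-Y..Y}" using X(2) by auto
      qed
    qed simp
    finally show ?thesis .
  qed
  then have "(\<Sum>n\<in>X. \<Sum>n'\<in>X. pair_excess q (n - n')) \<le> (\<Sum>n\<in>X. \<Sum>w\<in>{-Y..Y}. pair_excess q w)" by (rule sum_mono)
  then show ?thesis by simp
qed

end

context second_sieve
begin

lemma u_bounds: "\<forall>\<^sub>F x in at_top. x \<le> u x \<and> y x \<le> u x \<and> ln (u x) \<le> 2 * ln x \<and> 1 < u x \<and> ln x \<le> ln (u x)"
proof -
  have "((\<lambda>x. ln (real K + 2) / ln x + ln (y x) / ln x) \<longlongrightarrow> 0 + 1) at_top"
    by (intro tendsto_add ln_y) real_asymp
  then have "\<forall>\<^sub>F x in at_top. ln (real K + 2) / ln x + ln (y x) / ln x < 2"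
    by (rule order_tendstoD(2)) simp
  then show ?thesis using y_bounds eventually_gt_at_top[of 1]
  proof eventually_elim
    case (elim x)
    have "1 * y x \<le> u x" unfolding u_def using elim by (intro mult_right_mono) auto
    moreover have "ln (u x) = ln (real K + 2) + ln (y x)" unfolding u_def using elim by (intro ln_mult_pos) auto
    then have "ln (u x) / ln x < 2" using elim(1) by (simp add: add_divide_distrib)
    then have "ln (u x) \<le> 2 * ln x" using elim by (simp add: divide_less_eq)
    moreover have "x \<le> u x" using calculation(1) elim by linarith
    then have "ln x \<le> ln (u x)" using elim by (intro ln_mono) auto
    ultimately show ?case using elim by auto
  qed
qed

text \<open>The choice of \<open>C0\<close> makes the tail smaller than y by a large power of ln x,
  enough for all factors sqrt (ln x) picked up later from H, F and J.\<close>

lemma T_bound: "\<exists>CT>0. \<forall>\<^sub>F x in at_top. T x \<le> CT * y x * ln x powr (- M - 4)"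
proof -
  define CT where "CT = C * (real K + 2) * 2 powr c1 / (1 - exp (- c2 / 2)) + 1"
  have den: "1 - exp (- c2 / 2) > 0" using c_pos by simp
  have "\<forall>\<^sub>F x in at_top. T x \<le> CT * y x * ln x powr (- M - 4)"
    using u_bounds y_bounds eventually_gt_at_top[of 1]
  proof eventually_elim
    case (elim x)
    have l: "ln x > 0" using elim by simp
    have "exp (- c2 / 2 * k0 x) = ln x powr (- (c1 + M + 4))"
      unfolding k0_def C0_def powr_def using c_pos l by (simp add: field_simps)
    then have "T x = C * (u x * ln (u x) powr c1) * ln x powr (- (c1 + M + 4)) / (1 - exp (- c2 / 2))"
      by (simp add: T_def)
    also have "\<dots> \<le> C * (u x * (2 * ln x) powr c1) * ln x powr (- (c1 + M + 4)) / (1 - exp (- c2 / 2))"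
      using elim c_pos den l
      by (intro divide_right_mono mult_right_mono mult_left_mono powr_mono2) auto
    also have "\<dots> = C * (real K + 2) * 2 powr c1 / (1 - exp (- c2 / 2)) * y x * (ln x powr c1 * ln x powr (- (c1 + M + 4)))"
      unfolding u_def using l by (simp add: powr_mult)
    also have "ln x powr c1 * ln x powr (- (c1 + M + 4)) = ln x powr (- M - 4)"
      by (simp add: powr_add[symmetric])
    also have "C * (real K + 2) * 2 powr c1 / (1 - exp (- c2 / 2)) * y x * ln x powr (- M - 4) \<le> CT * y x * ln x powr (- M - 4)"
      unfolding CT_def using elim by (intro mult_right_mono) auto
    finally show ?case .
  qed
  moreover have "CT > 0" unfolding CT_def using c_pos den by (intro add_nonneg_pos divide_nonneg_pos) auto
  ultimately show ?thesis by blast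
qed

definition Fc :: real where "Fc = 3 * (real B)\<^sup>2 * real K"

lemma F_bound:
  assumes "1 \<le> H" "real (J H) \<le> real K * H" "H \<le> sqrt (ln x)"
  shows "real (\<nu>\<^sup>2 * (2 * J H + 1)) \<le> Fc * H" "real (\<nu>\<^sup>2 * (2 * J H + 1)) \<le> Fc * sqrt (ln x)"
proof -
  have "1 * 1 \<le> real K * H" using K assms by (intro mult_mono) auto
  then have "real (2 * J H + 1) \<le> 3 * (real K * H)" using assms(2) by simp
  moreover have "(real \<nu>)\<^sup>2 \<le> (real B)\<^sup>2" using \<nu>_bounds by (intro power_mono) auto
  ultimately have "(real \<nu>)\<^sup>2 * real (2 * J H + 1) \<le> (real B)\<^sup>2 * (3 * (real K * H))" by (intro mult_mono) auto
  then show 1: "real (\<nu>\<^sup>2 * (2 * J H + 1)) \<le> Fc * H" unfolding Fc_def of_nat_mult by (simp add: mult_ac)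
  have "Fc * H \<le> Fc * sqrt (ln x)" using assms unfolding Fc_def by (intro mult_left_mono) auto
  then show "real (\<nu>\<^sup>2 * (2 * J H + 1)) \<le> Fc * sqrt (ln x)" using 1 by linarith
qed

lemma Fc_pos: "Fc > 0" unfolding Fc_def using B_pos K by simp

text \<open>Three terms, each at most u * err: overlapping shifts, few because F is of order H;
  heavy shifts with sqrt W in the exponent, beaten through sqrt W \<ge> H^3; and heavy shifts saving
  a small power of x, which beats exp (O(sqrt (ln x))).\<close>

lemma heavy_bound:
  "\<forall>\<^sub>F x in at_top. \<forall>H\<in>S x. V x H * (real (\<nu>\<^sup>2 * (2 * J H + 1)) + 1 +
     real (card {w \<in> {-((int K + 2) * y_of \<delta> x)..(int K + 2) * y_of \<delta> x}. progression_sieve.heavy I B (high x H) (B * J H) w}))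
     \<le> 3 * u x * err x"
proof -
  define E where "E = \<delta> * (2 - M)"
  have E: "E < 0" unfolding E_def using \<delta> M by (intro mult_pos_neg) auto
  define b where "b = 4 * real B * real K"
  have "b > 0" unfolding b_def using B_pos K by simp
  have ev: "\<forall>\<^sub>F x::real in at_top. exp (b * sqrt (ln x)) * (Fc * sqrt (ln x) + 1) \<le> x * ln x powr E
     \<and> 8 * ln x * exp (- (ln x powr \<delta>)) \<le> ln x powr E
     \<and> 8 * ln x * (exp (b * sqrt (ln x)) * exp (- ln x / 16)) \<le> ln x powr E
     \<and> 4 * (ln (ln x) / sqrt (ln x)) \<le> 1 \<and> 0 \<le> ln (ln x) / sqrt (ln x)
     \<and> 64 * (real B)\<^sup>2 * real K \<le> (ln x powr \<delta>) ^ 2 \<and> 128 * real B ^ 4 \<le> (ln x powr \<delta>) ^ 3 \<and> 4 \<le> (ln x powr \<delta>) ^ 3 \<and> 0 \<le> ln x powr \<delta> \<and> 1 < ln x"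
    using E \<delta> Fc_pos \<open>b > 0\<close> by (intro eventually_conj) real_asymp+
  show ?thesis using ev eventually_progression_family V_bounds scale_facts u_bounds y_bounds
  proof eventually_elim
    case (elim x)
    show ?case
    proof
      fix H assume H: "H \<in> S x"
      interpret pf: progression_family I B "low H" "high x H" "H powr M" a "J H" "B * J H" "c2 / 2" "k0 x" "Q x H" \<nu> "T x" "u x"
        using elim(2) H by blast
      define Y where "Y = (int K + 2) * y_of \<delta> x"
      have Yu: "of_int Y = u x" unfolding Y_def u_def by simp
      have h: "ln x powr \<delta> \<le> H" "1 \<le> H" "H \<le> sqrt (ln x)" "real (J H) \<le> real K * H" "H ^ 3 \<le> sqrt (H powr M)"
        using elim(4) H by auto
      have v: "V x H \<le> exp (b * sqrt (ln x))" "V x H * exp (- sqrt (H powr M) / 12) \<le> exp (- (ln x powr \<delta>))" "V x H \<ge> 0"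
        using elim(3) H unfolding b_def by auto
      have ux: "x \<le> u x" "ln (u x) \<le> 2 * ln x" "1 < u x" "y x \<le> u x" "ln x \<le> ln (u x)" using elim by auto
      have e0: "err x = ln x powr E" "err x \<ge> 0" unfolding err_def E_def by auto
      have H3: "(ln x powr \<delta>) ^ 3 \<le> H ^ 3" using h elim by (intro power_mono) auto
      have "V x H * (real (\<nu>\<^sup>2 * (2 * J H + 1)) + 1) \<le> exp (b * sqrt (ln x)) * (Fc * sqrt (ln x) + 1)"
        using v F_bound(2)[OF h(2,4,3)] by (intro mult_mono add_mono) auto
      also have "\<dots> \<le> x * err x" using elim(1) e0 by simp
      also have "\<dots> \<le> u x * err x" using ux e0 by (intro mult_right_mono) auto
      finally have p1: "V x H * (real (\<nu>\<^sup>2 * (2 * J H + 1)) + 1) \<le> u x * err x" .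
      let ?h = "real (card {w \<in> {-Y..Y}. pf.heavy w})"
      \<comment> \<open>The requirement 4 p \<le> Y holds because p \<le> z and z is y times ln (ln
        x) / sqrt (ln x), a factor tending to 0.\<close>
      have "?h \<le> ln (of_int Y) * (4 * of_int Y * (exp (- sqrt (H powr M) / 12) + exp (- ln (of_int Y) / 16)))"
      proof (rule pf.card_heavy)
        have "64 * real B * real (B * J H) \<le> 64 * real B * (real B * (real K * H))" using h(4) by (simp add: mult_left_mono)
        also have "\<dots> = 64 * (real B)\<^sup>2 * real K * H" by (simp add: power2_eq_square)
        also have "\<dots> \<le> H\<^sup>2 * H"
        proof (intro mult_right_mono)
          have "(ln x powr \<delta>) ^ 2 \<le> H\<^sup>2" using h elim by (intro power_mono) auto
          then show "64 * (real B)\<^sup>2 * real K \<le> H\<^sup>2" using elim(1) by linarith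
        qed (use h in auto)
        also have "\<dots> = H ^ 3" by (simp add: power2_eq_square power3_eq_cube)
        finally show "64 * real B * real (B * J H) \<le> sqrt (H powr M)" using h(5) by linarith
        show "128 * real B ^ 4 \<le> sqrt (H powr M)" "4 \<le> sqrt (H powr M)" using elim(1) H3 h(5) by linarith+
        have "1 \<le> real_of_int Y" using ux Yu by linarith
        then show "1 \<le> Y" by linarith
        fix p assume "p \<in> high x H"
        then have "4 * real p \<le> 4 * z x" by (simp add: high_def primes_upto_def)
        also have "\<dots> = y x * (4 * (ln (ln x) / sqrt (ln x)))" by (simp add: z_of_def)
        also have "\<dots> \<le> y x" using elim by (intro mult_left_le) auto
        also have "\<dots> \<le> of_int Y" using ux Yu by simp
        finally have "real_of_int (4 * int p) \<le> of_int Y" by simp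
        then show "4 * int p \<le> Y" by (simp only: of_int_le_iff)
      qed
      also have "\<dots> \<le> (2 * ln x) * (4 * u x * (exp (- sqrt (H powr M) / 12) + exp (- ln x / 16)))"
        unfolding Yu using ux elim by (intro mult_mono add_mono order_refl) auto
      finally have "V x H * ?h \<le> V x H * ((2 * ln x) * (4 * u x * (exp (- sqrt (H powr M) / 12) + exp (- ln x / 16))))"
        using v(3) by (rule mult_left_mono)
      also have "\<dots> = u x * (8 * ln x * (V x H * exp (- sqrt (H powr M) / 12))) + u x * (8 * ln x * (V x H * exp (- ln x / 16)))"
        by (simp add: algebra_simps)
      also have "\<dots> \<le> u x * (8 * ln x * exp (- (ln x powr \<delta>))) + u x * (8 * ln x * (exp (b * sqrt (ln x)) * exp (- ln x / 16)))"
        using v ux elim by (intro add_mono mult_left_mono mult_right_mono) auto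
      also have "\<dots> \<le> u x * err x + u x * err x"
        using elim(1) ux e0 by (intro add_mono mult_left_mono) auto
      finally have p2: "V x H * ?h \<le> u x * err x + u x * err x" .
      have "V x H * (real (\<nu>\<^sup>2 * (2 * J H + 1)) + 1 + ?h) \<le> 3 * u x * err x"
        using p1 p2 by (simp add: algebra_simps)
      then show "V x H * (real (\<nu>\<^sup>2 * (2 * J H + 1)) + 1 +
         real (card {w \<in> {-((int K + 2) * y_of \<delta> x)..(int K + 2) * y_of \<delta> x}. pf.heavy w})) \<le> 3 * u x * err x"
        unfolding Y_def .
    qed
  qed
qed

text \<open>\<sigma>_2 is a quotient of sieve densities in the statement and a product over the
  large primes here; the two agree once H^M \<le> z.\<close>

lemma weight_eq:
  assumes "progression_family I B (low H) (high x H) (H powr M) a (J H) (B * J H) (c2 / 2) (k0 x) (Q x H) \<nu> (T x) (u x)"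
    and le: "H powr M \<le> z x"
  shows "weight I a M K (z x) b H q n = progression_sieve.lam I (low H) (high x H) a (J H) q n b"
    "scale_mass I \<delta> \<xi> M K \<nu> x H = real (card (Q x H) * J H) * (1 / density_of I (high x H))"
proof -
  interpret pf: progression_family I B "low H" "high x H" "H powr M" a "J H" "B * J H" "c2 / 2" "k0 x" "Q x H" \<nu> "T x" "u x"
    by fact
  have sd: "sieve_density I (z x) / sieve_density I (H powr M) = density_of I (high x H)"
    unfolding density_of_split[OF le, symmetric] using high_density_ge(4)[of H] by (simp add: sieve_density_eq low_def)
  show "weight I a M K (z x) b H q n = pf.lam q n b"
    unfolding weight_def Let_def sd subset_translate_sieved_between AP_eq pf.lam_def lambda_of_def pf.prog_def
    unfolding high_def[symmetric] low_def[symmetric] J_def[symmetric] ..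
  show "scale_mass I \<delta> \<xi> M K \<nu> x H = real (card (Q x H) * J H) * (1 / density_of I (high x H))"
    unfolding scale_mass_def sd Q_def J_def ..
qed

end

context progression_sieve
begin

lemma cross_excess_nonneg: "cross_excess q q' \<ge> 0"
  unfolding cross_excess_def using V_nonneg s_nonneg k0 pair_weight_nonneg
  by (auto intro!: add_nonneg_nonneg mult_nonneg_nonneg sum_nonneg)

end

section \<open>The two second moments, uniformly over the scales\<close>

context second_sieve
begin

abbreviation "Nrange x \<equiv> {- (int K + 1) * y_of \<delta> x <.. y_of \<delta> x}"
abbreviation "mean x \<equiv> avg (primes_upto (z x))"

definition mass :: "real \<Rightarrow> int \<Rightarrow> real \<Rightarrow> nat \<Rightarrow> real" where
  "mass x b H q = (\<Sum>n\<in>Nrange x. weight I a M K (z x) b H q n)"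

definition hits :: "real \<Rightarrow> int \<Rightarrow> nat \<Rightarrow> real \<Rightarrow> nat \<Rightarrow> int \<Rightarrow> real" where
  "hits x b i H q n = (\<Sum>h\<in>step_range (real K * H). weight I a M K (z x) b H q (n - a i q - int q * int h))"

text \<open>The indicator restricts the deviation to surviving points, where the mean of the sum is
  \<open>scale_mass\<close>.\<close>

definition excess_square :: "real \<Rightarrow> int \<Rightarrow> nat \<Rightarrow> real \<Rightarrow> int \<Rightarrow> real" where
  "excess_square x b i H n = of_bool (n \<in> translate (sieved I (z x)) b) *
      ((\<Sum>q\<in>Q x H. hits x b i H q n) - scale_mass I \<delta> \<xi> M K \<nu> x H)\<^sup>2"

lemma card_Nrange: "y x \<ge> 0 \<Longrightarrow> real (card (Nrange x)) = u x"
proof -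
  assume "y x \<ge> 0"
  then have y: "y_of \<delta> x \<ge> 0" by simp
  have "y_of \<delta> x - - (int K + 1) * y_of \<delta> x = (int K + 2) * y_of \<delta> x" by (simp add: algebra_simps)
  then have "card (Nrange x) = nat ((int K + 2) * y_of \<delta> x)" by simp
  moreover have "(int K + 2) * y_of \<delta> x \<ge> 0" using y by simp
  ultimately have "real (card (Nrange x)) = of_int ((int K + 2) * y_of \<delta> x)" by (simp only: of_nat_nat)
  then show ?thesis unfolding u_def by simp
qed

text \<open>Since \<delta> < 1/2, \<open>err\<close> is larger than (ln x)^(-M); the tail terms,
  smaller by further powers of ln x, are therefore negligible.\<close>

lemma err_exponent: "- M < \<delta> * (2 - M)"
proof -
  have "\<delta> * (M - 2) \<le> (1 / 2) * (M - 2)" using \<delta> M by (intro mult_right_mono) auto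
  moreover have "\<delta> * (2 - M) = - (\<delta> * (M - 2))" by (simp add: algebra_simps)
  moreover have "- M < F" if "A \<le> (1 / 2) * (M - 2)" "F = - A" for A F
  proof -
    have "2 * A \<le> M - 2" using that(1) by simp
    then show ?thesis using that(2) M by simp
  qed
  ultimately show ?thesis by blast
qed

text \<open>Pure bookkeeping: r stands for the order of the number of primes and e for
  \<open>err\<close>; L \<ge> 1 allows every term to be bounded with the factor L * e.\<close>

lemma progression_moment_arithmetic:
  fixes q r e Y L VH G g3 et :: real
  assumes "0 \<le> q" "q \<le> CQ * r" "0 \<le> r" "0 \<le> e" "0 \<le> Y" "1 \<le> L" "0 \<le> CQ" "0 \<le> CG" "0 \<le> Ce"
    and "VH \<le> 3 * Y * e" "G \<le> CG * L * e * Y" "g3 \<le> Y * r * e" "et \<le> Ce * e" "0 \<le> et"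
  shows "Y * (q * (VH + G) + g3) + q * (2 * Y\<^sup>2 * et) \<le> (CQ * (3 + CG + 2 * Ce) + 1) * (L * e * (Y\<^sup>2 * r))"
proof -
  have e1: "e * 1 \<le> e * L" using assms by (intro mult_left_mono) auto
  have "VH + G \<le> (3 + CG) * (L * e * Y)"
  proof -
    have "3 * Y * e \<le> 3 * Y * (e * L)" using assms e1 by (intro mult_left_mono) auto
    then show ?thesis using assms(10,11) by (simp add: algebra_simps)
  qed
  then have "q * (VH + G) \<le> q * ((3 + CG) * (L * e * Y))" using assms by (intro mult_left_mono) auto
  also have "\<dots> \<le> (CQ * r) * ((3 + CG) * (L * e * Y))" using assms by (intro mult_right_mono) auto
  finally have a: "q * (VH + G) \<le> (CQ * r) * ((3 + CG) * (L * e * Y))" .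
  have "g3 \<le> Y * r * (e * L)" using assms e1 mult_left_mono[OF e1, of "Y * r"] by simp
  with a have "Y * (q * (VH + G) + g3) \<le> Y * ((CQ * r) * ((3 + CG) * (L * e * Y)) + Y * r * (e * L))"
    using assms by (intro mult_left_mono) auto
  moreover have "q * (2 * Y\<^sup>2 * et) \<le> (CQ * r) * (2 * Y\<^sup>2 * (Ce * (e * L)))"
  proof (rule mult_mono)
    have "et \<le> Ce * (e * L)" using assms mult_left_mono[OF e1, of Ce] by simp
    then show "2 * Y\<^sup>2 * et \<le> 2 * Y\<^sup>2 * (Ce * (e * L))" by (intro mult_left_mono) auto
  qed (use assms in auto)
  ultimately show ?thesis by (simp add: algebra_simps power2_eq_square)
qed

text \<open>The trivial size is u^2 for each of about y / (H ln x) primes; the saving is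
  \<open>err\<close> times ln (ln x), the latter coming from the truncation
  \<open>k0\<close>.\<close>

lemma progression_moment:
  "\<exists>CA>0. \<forall>\<^sub>F x in at_top. \<forall>H\<in>S x.
    (\<Sum>q\<in>Q x H. mean x (\<lambda>b. (mass x b H q - u x)\<^sup>2))
     \<le> CA * (ln (ln x) * err x * ((u x)\<^sup>2 * (y x / (H * ln x))))"
proof -
  obtain CQ where CQ: "CQ > 0" "\<forall>\<^sub>F x in at_top. \<forall>H\<in>S x. real (card (Q_scale I \<delta> \<xi> x H \<nu>)) \<le> CQ * (y x / (H * ln x))"
    using card_Q_scale_le[OF sieving_system_axioms \<nu>] by blast
  obtain CT where CT: "CT > 0" "\<forall>\<^sub>F x in at_top. T x \<le> CT * y x * ln x powr (- M - 4)" using T_bound by blast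
  define E where "E = \<delta> * (2 - M)"
  define Ka where "Ka = (real B * real K)\<^sup>2"
  define CG where "CG = 2 * (64 * real B ^ 3 * Ka + 24 * real B * Ka * C0)"
  define Ce where "Ce = 2 * (real B)\<^sup>2 * Ka"
  have "- M < E" using err_exponent unfolding E_def .
  then have E: "- M - 4 + 1 / 2 < E - 3 / 2" by linarith
  have ev: "\<forall>\<^sub>F x::real in at_top. 18 * Fc * CT * ln x powr (- M - 4 + 1 / 2) \<le> ln x powr (E - 3 / 2)"
    using E Fc_pos CT(1) by (intro ln_powr_compare) auto
  have evL: "\<forall>\<^sub>F x::real in at_top. 1 \<le> ln (ln x) \<and> 1 \<le> ln x \<and> ln (ln x) / sqrt (ln x) \<le> 1 \<and> 0 \<le> ln (ln x) / sqrt (ln x)" by (intro eventually_conj) real_asymp+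
  have "\<forall>\<^sub>F x in at_top. \<forall>H\<in>S x.
    (\<Sum>q\<in>Q x H. mean x (\<lambda>b. (mass x b H q - u x)\<^sup>2))
     \<le> (CQ * (3 + CG + 2 * Ce) + 1) * (ln (ln x) * err x * ((u x)\<^sup>2 * (y x / (H * ln x))))"
    using CQ(2) CT(2) ev evL eventually_progression_family heavy_bound scale_facts u_bounds y_bounds low_high_union
  proof eventually_elim
    case (elim x)
    note evx = elim
    show ?case
    proof
      fix H assume H: "H \<in> S x"
      interpret pf: progression_family I B "low H" "high x H" "H powr M" a "J H" "B * J H" "c2 / 2" "k0 x" "Q x H" \<nu> "T x" "u x"
        using evx(5) H by blast
      have pf: "progression_family I B (low H) (high x H) (H powr M) a (J H) (B * J H) (c2 / 2) (k0 x) (Q x H) \<nu> (T x) (u x)"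
        by (rule pf.progression_family_axioms)
      define Y where "Y = (int K + 2) * y_of \<delta> x"
      define W where "W = H powr M"
      define k where "k = B * J H"
      define r where "r = y x / (H * ln x)"
      have Yu: "of_int Y = u x" unfolding Y_def u_def by simp
      have h: "1 \<le> H" "H \<le> sqrt (ln x)" "real (J H) \<le> real K * H" "(real k)\<^sup>2 / W \<le> Ka * err x"
        using evx(7) H unfolding k_def W_def Ka_def by auto
      have ux: "x \<le> u x" "1 < u x" "y x \<le> u x" and yx: "y x > 0" "x \<ge> 1" using evx by auto
      have L: "1 \<le> ln (ln x)" "1 \<le> ln x" using evx by auto
      have x1: "x > 1" using evx(7) H by auto
      have e0: "err x \<ge> 0" unfolding err_def by simp
      have un: "low H \<union> high x H = primes_upto (z x)" and le: "H powr M \<le> z x" using evx(10) H by auto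
      have cN: "real (card (Nrange x)) = u x" using yx by (intro card_Nrange) auto
      have W1: "W \<ge> 1" unfolding W_def by (rule pf.W1)
      have Ynn: "Y \<ge> 0" using Yu ux by linarith
      have hi: "int p \<le> Y" if "p \<in> high x H" for p
      proof -
        have "real p \<le> z x" using that by (simp add: high_def primes_upto_def)
        also have "\<dots> = y x * (ln (ln x) / sqrt (ln x))" by (simp add: z_of_def)
        also have "\<dots> \<le> y x" using evx(4) yx by (intro mult_left_le) auto
        also have "\<dots> \<le> of_int Y" using Yu ux by simp
        finally have "real_of_int (int p) \<le> of_int Y" by simp
        then show ?thesis by (simp only: of_int_le_iff)
      qed
      have var: "mean x (\<lambda>b. (mass x b H q - u x)\<^sup>2) \<le>
          u x * (\<Sum>w\<in>{-Y..Y}. pf.pair_excess q w) + 2 * (u x)\<^sup>2 * pf.\<eta>" if "q \<in> Q x H" for q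
      proof -
        have q: "prime q" using pf.Q(2) that by blast
        have "mean x (\<lambda>b. (mass x b H q - u x)\<^sup>2) =
          avg (low H \<union> high x H) (\<lambda>b. ((\<Sum>n\<in>Nrange x. pf.lam q n b) - real (card (Nrange x)))\<^sup>2)"
          unfolding mass_def un cN weight_eq(1)[OF pf le] ..
        also have "\<dots> \<le> (\<Sum>n\<in>Nrange x. \<Sum>n'\<in>Nrange x. pf.pair_excess q (n - n')) + 2 * (real (card (Nrange x)))\<^sup>2 * pf.\<eta>"
          by (rule pf.variance_progressions[OF q])
        also have "(\<Sum>n\<in>Nrange x. \<Sum>n'\<in>Nrange x. pf.pair_excess q (n - n')) \<le> real (card (Nrange x)) * (\<Sum>w\<in>{-Y..Y}. pf.pair_excess q w)"
          by (rule pf.sum_pair_excess_window[where lo = "- (int K + 1) * y_of \<delta> x" and hi = "y_of \<delta> x"])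
            (auto simp: Y_def algebra_simps)
        finally show ?thesis unfolding cN by simp
      qed
      have "(\<Sum>q\<in>Q x H. mean x (\<lambda>b. (mass x b H q - u x)\<^sup>2)) \<le>
         (\<Sum>q\<in>Q x H. u x * (\<Sum>w\<in>{-Y..Y}. pf.pair_excess q w) + 2 * (u x)\<^sup>2 * pf.\<eta>)"
        by (rule sum_mono[OF var])
      also have "\<dots> = u x * (\<Sum>w\<in>{-Y..Y}. \<Sum>q\<in>Q x H. pf.pair_excess q w) + real (card (Q x H)) * (2 * (u x)\<^sup>2 * pf.\<eta>)"
        by (subst sum.swap) (simp add: sum.distrib sum_distrib_left)
      also have "(\<Sum>w\<in>{-Y..Y}. \<Sum>q\<in>Q x H. pf.pair_excess q w) \<le>
         real (card (Q x H)) * (pf.V * (real pf.F + 1 + real (card {w\<in>{-Y..Y}. pf.heavy w}))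
          + 2 * (8 * real B * real (B * J H) * (8 * of_int Y * real B ^ 2 / (H powr M)) + pf.s * k0 x * (2 * of_int Y + 1)))
         + 6 * (2 * of_int Y + 1) * (real pf.F * T x)"
        using hi Ynn Yu by (intro pf.sum_pair_excess) auto
      finally have "(\<Sum>q\<in>Q x H. mean x (\<lambda>b. (mass x b H q - u x)\<^sup>2)) \<le>
         u x * (real (card (Q x H)) * (pf.V * (real pf.F + 1 + real (card {w\<in>{-Y..Y}. pf.heavy w}))
          + 2 * (8 * real B * real k * (8 * u x * real B ^ 2 / W) + pf.s * k0 x * (2 * u x + 1)))
         + 6 * (2 * u x + 1) * (real pf.F * T x)) + real (card (Q x H)) * (2 * (u x)\<^sup>2 * pf.\<eta>)"
        using ux unfolding Yu k_def W_def by simp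
      also have "\<dots> \<le> (CQ * (3 + CG + 2 * Ce) + 1) * (ln (ln x) * err x * ((u x)\<^sup>2 * r))"
      proof (rule progression_moment_arithmetic)
        show "real (card (Q x H)) \<le> CQ * r" using evx(1) H unfolding Q_def r_def by blast
        show "0 \<le> r" unfolding r_def using yx h L by simp
        show "0 \<le> CG" "0 \<le> Ce" unfolding CG_def Ce_def Ka_def using C0_pos by auto
        show "pf.V * (real pf.F + 1 + real (card {w\<in>{-Y..Y}. pf.heavy w})) \<le> 3 * u x * err x"
          using evx(6) H unfolding V_def pf.V_def pf.F_def Y_def by blast
        have k1: "real k / W \<le> Ka * err x"
        proof -
          have "real k \<le> (real k)\<^sup>2" by (cases k) (auto simp: power2_eq_square)
          then have "real k / W \<le> (real k)\<^sup>2 / W" using W1 by (intro divide_right_mono) auto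
          then show ?thesis using h(4) by linarith
        qed
        have "8 * real B * real k * (8 * u x * real B ^ 2 / W) = 64 * real B ^ 3 * u x * (real k / W)"
          by (simp add: power2_eq_square power3_eq_cube)
        also have "\<dots> \<le> 64 * real B ^ 3 * u x * (Ka * err x)" using ux k1 by (intro mult_left_mono) auto
        also have "\<dots> \<le> 64 * real B ^ 3 * u x * (Ka * err x) * ln (ln x)"
        proof -
          have "0 \<le> 64 * real B ^ 3 * u x * (Ka * err x)" using ux e0 by (simp add: Ka_def)
          then show ?thesis using mult_left_mono[OF L(1)] by fastforce
        qed
        finally have t1: "8 * real B * real k * (8 * u x * real B ^ 2 / W) \<le> 64 * real B ^ 3 * u x * (Ka * err x) * ln (ln x)" .
        have "pf.s * k0 x * (2 * u x + 1) = 8 * real B * ((real k)\<^sup>2 / W) * k0 x * (2 * u x + 1)"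
          unfolding pf.s_def k_def W_def by simp
        also have "\<dots> \<le> 8 * real B * (Ka * err x) * k0 x * (3 * u x)"
          using h(4) ux L C0_pos e0 by (intro mult_mono mult_left_mono mult_right_mono) (auto simp: k0_def Ka_def)
        finally have t2: "pf.s * k0 x * (2 * u x + 1) \<le> 8 * real B * (Ka * err x) * (C0 * ln (ln x)) * (3 * u x)"
          by (simp only: k0_def)
        show "2 * (8 * real B * real k * (8 * u x * real B ^ 2 / W) + pf.s * k0 x * (2 * u x + 1)) \<le> CG * ln (ln x) * err x * u x"
        proof -
          have "2 * (8 * real B * real k * (8 * u x * real B ^ 2 / W) + pf.s * k0 x * (2 * u x + 1)) \<le>
              2 * (64 * real B ^ 3 * u x * (Ka * err x) * ln (ln x) + 8 * real B * (Ka * err x) * (C0 * ln (ln x)) * (3 * u x))"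
            using t1 t2 by (intro mult_left_mono add_mono) auto
          also have "\<dots> = CG * ln (ln x) * err x * u x" unfolding CG_def by (simp add: algebra_simps)
          finally show ?thesis .
        qed
        \<comment> \<open>The tail term has no factor counting primes, so it must be compared with r
          * err; the spare powers of ln x in \<open>T_bound\<close> supply the missing 1 / (H ln
          x).\<close>
        show "6 * (2 * u x + 1) * (real pf.F * T x) \<le> u x * r * err x"
        proof -
          have F: "real pf.F \<le> Fc * sqrt (ln x)" unfolding pf.F_def by (rule F_bound(2)[OF h(1,3,2)])
          have "6 * (2 * u x + 1) * (real pf.F * T x) \<le> (18 * u x) * ((Fc * sqrt (ln x)) * (CT * y x * ln x powr (- M - 4)))"
            
          proof (rule mult_mono)
            show "6 * (2 * u x + 1) \<le> 18 * u x" using ux by simp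
            show "real pf.F * T x \<le> (Fc * sqrt (ln x)) * (CT * y x * ln x powr (- M - 4))"
              using F evx(2) Fc_pos L pf.T0 by (intro mult_mono) auto
          qed (use ux pf.T0 in auto)
          also have "\<dots> = u x * y x * (18 * Fc * CT * ln x powr (- M - 4 + 1 / 2))"
          proof -
            have "ln x powr (- M - 4 + 1 / 2) = ln x powr (- M - 4) * sqrt (ln x)"
              using L by (simp only: powr_add) (simp add: powr_half_sqrt)
            then show ?thesis by simp
          qed
          also have "\<dots> \<le> u x * y x * ln x powr (E - 3 / 2)" using evx(3) ux yx by (intro mult_left_mono) auto
          also have "ln x powr (E - 3 / 2) = err x / (sqrt (ln x) * ln x)"
          proof -
            have "ln x powr (3 / 2) = ln x powr (1 / 2 + 1)" by simp
            also have "\<dots> = sqrt (ln x) * ln x" using L by (simp only: powr_add) (simp add: powr_half_sqrt)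
            finally show ?thesis by (simp add: powr_diff err_def E_def)
          qed
          also have "u x * y x * (err x / (sqrt (ln x) * ln x)) \<le> u x * y x * (err x / (H * ln x))"
            using h L ux yx e0 x1 by (intro mult_left_mono divide_left_mono mult_right_mono mult_pos_pos) auto
          also have "\<dots> = u x * r * err x" by (simp add: r_def)
          finally show ?thesis .
        qed
        have "pf.\<eta> = 2 * (real B)\<^sup>2 * ((real k)\<^sup>2 / W)" unfolding pf.\<eta>_def k_def W_def by (simp add: power_mult_distrib mult_ac)
        also have "\<dots> \<le> 2 * (real B)\<^sup>2 * (Ka * err x)" using h(4) by (intro mult_left_mono) auto
        finally show "pf.\<eta> \<le> Ce * err x" unfolding Ce_def by simp
        show "0 \<le> pf.\<eta>" unfolding pf.\<eta>_def by simp
      qed (use ux e0 L CQ in auto)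
      finally show "(\<Sum>q\<in>Q x H. mean x (\<lambda>b. (mass x b H q - u x)\<^sup>2))
        \<le> (CQ * (3 + CG + 2 * Ce) + 1) * (ln (ln x) * err x * ((u x)\<^sup>2 * (y x / (H * ln x))))" unfolding r_def .
    qed
  qed
  moreover have "CQ * (3 + CG + 2 * Ce) + 1 > 0"
    unfolding CG_def Ce_def Ka_def using CQ(1) C0_pos by (intro add_nonneg_pos mult_nonneg_nonneg add_nonneg_nonneg) auto
  ultimately show ?thesis by blast
qed

text \<open>The prefactor \<sigma>_1 / \<sigma>_2 is O(ln x) and the number of pairs (q, h) is O(y /
  ln x), which gives y^2 / ln x before the saving.\<close>

lemma point_moment:
  "\<exists>CB>0. \<forall>\<^sub>F x in at_top. \<forall>H\<in>S x. \<forall>i\<in>{1..\<nu>}. \<forall>n.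
    mean x (\<lambda>b. excess_square x b i H n)
     \<le> CB * (ln (ln x) * err x * ((y x)\<^sup>2 / ln x))"
proof -
  obtain CQ where CQ: "CQ > 0" "\<forall>\<^sub>F x in at_top. \<forall>H\<in>S x. real (card (Q_scale I \<delta> \<xi> x H \<nu>)) \<le> CQ * (y x / (H * ln x))"
    using card_Q_scale_le[OF sieving_system_axioms \<nu>] by blast
  obtain CT where CT: "CT > 0" "\<forall>\<^sub>F x in at_top. T x \<le> CT * y x * ln x powr (- M - 4)" using T_bound by blast
  obtain Cz where Cz: "Cz > 0" "\<forall>\<^sub>F x in at_top. sieve_density I (z x) \<ge> Cz / ln x"
    using sieve_density_z_bounds[OF sieving_system_axioms] by blast
  define E where "E = \<delta> * (2 - M)"
  define Ka where "Ka = (real B * real K)\<^sup>2"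
  define b where "b = 4 * real B * real K"
  define D where "D = CQ * real K"
  define c4 where "c4 = 3 * real K * Fc * (2 + Fc) * CT"
  define c5 where "c5 = real K * (real K + 2) * Fc * Cf"
  define CN where "CN = D + D\<^sup>2 * (16 * real B * Ka * C0) + D + D\<^sup>2 * (4 * (real B)\<^sup>2 * Ka)"
  have D: "D > 0" unfolding D_def using CQ(1) K by simp
  have Fp: "Fc > 0" by (rule Fc_pos)
  have Ka: "Ka \<ge> 0" unfolding Ka_def by simp
  have c4p: "c4 > 0" unfolding c4_def using K CT(1) Fp by simp
  have c5p: "c5 \<ge> 0" unfolding c5_def using Cf Fp by simp
  have b: "b > 0" unfolding b_def using B_pos K by simp
  have "- M < E" using err_exponent unfolding E_def .
  then have E: "3 / 2 - M - 4 < E - 1" by linarith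
  have ev: "\<forall>\<^sub>F x::real in at_top. c4 * ln x powr (3 / 2 - M - 4) \<le> ln x powr (E - 1)"
    using E c4p by (intro ln_powr_compare) auto
  have ev2: "\<forall>\<^sub>F x::real in at_top. (c5 + 1) * (ln x)\<^sup>2 * exp (b * sqrt (ln x)) \<le> x powr 0.51 * ln x powr E"
  proof -
    have "c5 + 1 > 0" using c5p by simp
    then show ?thesis using b by real_asymp
  qed
  have evL: "\<forall>\<^sub>F x::real in at_top. 1 \<le> ln (ln x) \<and> 1 \<le> ln x" by (intro eventually_conj) real_asymp+
  have "\<forall>\<^sub>F x in at_top. \<forall>H\<in>S x. \<forall>i\<in>{1..\<nu>}. \<forall>n.
    mean x (\<lambda>b. excess_square x b i H n)
     \<le> (CN / Cz) * (ln (ln x) * err x * ((y x)\<^sup>2 / ln x))"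
    using CQ(2) CT(2) ev evL eventually_progression_family V_bounds scale_facts u_bounds y_bounds low_high_union ev2 Cz(2)
  proof eventually_elim
    case (elim x)
    note evx = elim
    show ?case
    proof (intro ballI allI)
      fix H i n assume H: "H \<in> S x" and i: "i \<in> {1..\<nu>}"
      interpret pf: progression_family I B "low H" "high x H" "H powr M" a "J H" "B * J H" "c2 / 2" "k0 x" "Q x H" \<nu> "T x" "u x"
        using evx(5) H by blast
      have pf: "progression_family I B (low H) (high x H) (H powr M) a (J H) (B * J H) (c2 / 2) (k0 x) (Q x H) \<nu> (T x) (u x)"
        by (rule pf.progression_family_axioms)
      define W where "W = H powr M"
      define k where "k = B * J H"
      define r where "r = y x / ln x"
      define N where "N = real (card (Q x H))"
      define Nm where "Nm = Cf * u x powr 0.49"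
      define j where "j = real (J H)"
      define e where "e = err x"
      define L where "L = ln (ln x)"
      have h: "1 \<le> H" "H \<le> sqrt (ln x)" "real (J H) \<le> real K * H" "(real k)\<^sup>2 / W \<le> Ka * e"
        using evx(7) H unfolding k_def W_def Ka_def e_def by auto
      have ux: "x \<le> u x" "1 < u x" "y x \<le> u x" and yx: "y x > 0" "x \<ge> 1" using evx by auto
      have L: "1 \<le> L" "1 \<le> ln x" using evx unfolding L_def by auto
      have x1: "x > 1" using evx(7) H by auto
      have e0: "e \<ge> 0" unfolding e_def err_def by simp
      have r0: "r > 0" unfolding r_def using yx x1 by (intro divide_pos_pos) auto
      have un: "low H \<union> high x H = primes_upto (z x)" and le: "H powr M \<le> z x" using evx(10) H by auto
      have j0: "j \<ge> 0" "j \<le> real K * sqrt (ln x)"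
        using h(3) mult_left_mono[OF h(2), of "real K"] unfolding j_def by auto
      have N0: "N \<ge> 0" unfolding N_def by simp
      \<comment> \<open>The number of steps grows like H and the number of primes like 1 / H, so the
        number of pairs does not depend on the scale.\<close>
      have Nj: "N * j \<le> D * r"
      proof -
        have "N * j \<le> (CQ * (y x / (H * ln x))) * (real K * H)"
          using evx(1) H h(1,3) yx L CQ(1) unfolding N_def j_def Q_def by (intro mult_mono) auto
        also have "\<dots> = D * r" unfolding D_def r_def using h(1) by simp
        finally show ?thesis .
      qed
      have F: "real pf.F \<le> Fc * sqrt (ln x)" "real pf.F \<ge> 0" unfolding pf.F_def using F_bound(2)[OF h(1,3,2)] by auto
      have V: "pf.V \<le> exp (b * sqrt (ln x))" "pf.V \<ge> 0"
        using evx(6) H pf.V_nonneg unfolding V_def pf.V_def b_def by auto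
      have Nmax: "real (card (difference_primes I v)) \<le> Nm" if v: "v \<noteq> 0" "\<bar>real_of_int v\<bar> \<le> u x" for v
      proof -
        have "real (card (difference_primes I \<bar>v\<bar>)) \<le> Cf * real_of_int \<bar>v\<bar> powr 0.49" using v by (intro Cf(2)) auto
        also have "\<dots> \<le> Nm" unfolding Nm_def using v Cf(1) by (intro mult_left_mono powr_mono2) auto
        also have "difference_primes I \<bar>v\<bar> = difference_primes I v" by (auto simp: abs_if difference_primes_uminus)
        finally show ?thesis .
      qed
      have Nm0: "Nm \<ge> 0" unfolding Nm_def using Cf by simp
      have "mean x (\<lambda>b. excess_square x b i H n)
        = avg (low H \<union> high x H) (\<lambda>b. of_bool (avoids I (low H) {n} b \<and> avoids I (high x H) {n} b) *
           ((\<Sum>(q, h)\<in>Q x H \<times> {1..J H}. pf.lam q (n - a i q - int h * int q) b) - real (card (Q x H) * J H) * (1 / density_of I (high x H)))\<^sup>2)"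
      proof -
        have "n \<in> translate (sieved I (z x)) b \<longleftrightarrow> avoids I (low H) {n} b \<and> avoids I (high x H) {n} b" for b
          unfolding mem_translate_sieved un[symmetric] avoids_def by auto
        moreover have "step_range (real K * H) = {1..J H}" unfolding J_def card_step_range by (rule step_range_eq)
        ultimately show ?thesis
          unfolding excess_square_def hits_def un weight_eq(1)[OF pf le] weight_eq(2)[OF pf le] by (simp only: sum.cartesian_product mult.commute[of "int _" "int _"])
      qed
      also have "\<dots> \<le> density_of I (low H) / density_of I (high x H) *
          ((real (J H))\<^sup>2 * (\<Sum>q\<in>Q x H. \<Sum>q'\<in>Q x H. pf.cross_excess q q') + 2 * (real (card (Q x H) * J H))\<^sup>2 * pf.\<eta>)"
        using pf.Q(2) i by (intro pf.variance_at_point) auto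
      also have "\<dots> \<le> (ln x / Cz) * (CN * (L * e * r\<^sup>2))"
      proof (rule mult_mono)
        have "density_of I (low H) / density_of I (high x H) \<le> 1 / sieve_density I (z x)" by (rule high_density_ge(2)[OF le])
        also have "\<dots> \<le> 1 / (Cz / ln x)" using evx(12) Cz(1) L by (intro divide_left_mono mult_pos_pos) (auto intro: less_le_trans[of 0 "Cz / ln x"])
        finally show "density_of I (low H) / density_of I (high x H) \<le> ln x / Cz" by simp
        have cross: "(\<Sum>q\<in>Q x H. \<Sum>q'\<in>Q x H. pf.cross_excess q q') \<le>
            N * (pf.V * (real pf.F * Nm)) + N\<^sup>2 * (2 * (pf.s * k0 x)) + 3 * N * (real pf.F * T x) * (2 + real pf.F)"
          unfolding N_def by (rule pf.sum_cross_excess[OF Nmax Nm0])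
        have sk: "pf.s * k0 x \<le> 8 * real B * (Ka * e) * (C0 * L)"
        proof -
          have "pf.s * k0 x = 8 * real B * ((real k)\<^sup>2 / W) * (C0 * L)" unfolding pf.s_def k_def W_def k0_def L_def by simp
          also have "\<dots> \<le> 8 * real B * (Ka * e) * (C0 * L)" using h(4) L C0_pos by (intro mult_mono mult_left_mono) (auto simp: Ka e0)
          finally show ?thesis .
        qed
        have eta: "pf.\<eta> \<le> 2 * (real B)\<^sup>2 * (Ka * e)"
        proof -
          have "pf.\<eta> = 2 * (real B)\<^sup>2 * ((real k)\<^sup>2 / W)" unfolding pf.\<eta>_def k_def W_def by (simp add: power_mult_distrib mult_ac)
          also have "\<dots> \<le> 2 * (real B)\<^sup>2 * (Ka * e)" using h(4) by (intro mult_left_mono) auto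
          finally show ?thesis .
        qed
        \<comment> \<open>Primes sharing a difference: their number is O(u^0.49) per difference, and
          the remaining u^0.51 absorbs \<open>V\<close> and all powers of ln x.\<close>
        have t1: "j\<^sup>2 * (N * (pf.V * (real pf.F * Nm))) \<le> D * (e * r\<^sup>2)"
        proof -
          have "j\<^sup>2 * (N * (pf.V * (real pf.F * Nm))) = (N * j) * (j * (pf.V * (real pf.F * Nm)))" by (simp add: power2_eq_square)
          also have "\<dots> \<le> (D * r) * ((real K * sqrt (ln x)) * (exp (b * sqrt (ln x)) * ((Fc * sqrt (ln x)) * Nm)))"
            using j0 V F Nm0 D r0 N0 L Fp x1 by (intro mult_mono[OF Nj] mult_mono) auto
          also have "\<dots> = (D * r) * ((real K * Fc * Cf) * ln x * exp (b * sqrt (ln x)) * u x powr 0.49)"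
            unfolding Nm_def using L by simp
          also have "\<dots> \<le> (D * r) * (e * r)"
          proof (intro mult_left_mono)
            have "c5 * (ln x)\<^sup>2 * exp (b * sqrt (ln x)) \<le> (c5 + 1) * (ln x)\<^sup>2 * exp (b * sqrt (ln x))"
              by (intro mult_right_mono) auto
            also have "\<dots> \<le> x powr 0.51 * e" using evx(11) unfolding e_def err_def E_def .
            also have "\<dots> \<le> u x powr 0.51 * e" using ux yx e0 by (intro mult_right_mono powr_mono2) auto
            finally have "c5 * (ln x)\<^sup>2 * exp (b * sqrt (ln x)) * u x powr 0.49 \<le> u x powr 0.51 * e * u x powr 0.49"
              by (intro mult_right_mono) auto
            also have "\<dots> = e * (u x powr 0.51 * u x powr 0.49)" by simp
            also have "u x powr 0.51 * u x powr 0.49 = u x" using ux by (simp add: powr_add[symmetric])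
            finally have "(real K + 2) * ((real K * Fc * Cf) * (ln x)\<^sup>2 * exp (b * sqrt (ln x)) * u x powr 0.49) \<le> (real K + 2) * (e * y x)"
              unfolding c5_def u_def by (simp add: mult_ac)
            then have "(real K * Fc * Cf) * (ln x)\<^sup>2 * exp (b * sqrt (ln x)) * u x powr 0.49 \<le> e * y x"
              by (subst (asm) mult_le_cancel_left_pos) auto
            then show "(real K * Fc * Cf) * ln x * exp (b * sqrt (ln x)) * u x powr 0.49 \<le> e * r"
              unfolding r_def using L by (simp add: le_divide_eq power2_eq_square mult_ac)
          qed (use D r0 in auto)
          finally show ?thesis by (simp add: power2_eq_square mult_ac)
        qed
        have Nj2: "j\<^sup>2 * N\<^sup>2 \<le> D\<^sup>2 * r\<^sup>2"
          using power_mono[OF Nj, of 2] N0 j0 by (simp add: power_mult_distrib mult.commute)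
        have t2: "j\<^sup>2 * (N\<^sup>2 * (2 * (pf.s * k0 x))) \<le> D\<^sup>2 * (16 * real B * Ka * C0) * (L * e * r\<^sup>2)"
        proof -
          have "j\<^sup>2 * (N\<^sup>2 * (2 * (pf.s * k0 x))) = (j\<^sup>2 * N\<^sup>2) * (2 * (pf.s * k0 x))" by simp
          also have "\<dots> \<le> (D\<^sup>2 * r\<^sup>2) * (2 * (8 * real B * (Ka * e) * (C0 * L)))"
          proof (rule mult_mono[OF Nj2])
            show "2 * (pf.s * k0 x) \<le> 2 * (8 * real B * (Ka * e) * (C0 * L))" using sk by (rule mult_left_mono) simp
          qed (use pf.s_nonneg pf.k0 in auto)
          finally show ?thesis by (simp add: mult_ac)
        qed
        \<comment> \<open>Three factors sqrt (ln x), from J, F and 2 + F, and one factor ln x are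
          paid out of the spare powers in \<open>T_bound\<close>.\<close>
        have t3: "j\<^sup>2 * (3 * N * (real pf.F * T x) * (2 + real pf.F)) \<le> D * (e * r\<^sup>2)"
        proof -
          have s1: "1 \<le> sqrt (ln x)" using L by simp
          have F2: "2 + real pf.F \<le> (2 + Fc) * sqrt (ln x)"
          proof -
            have "2 + f \<le> 2 * t + g" if "1 \<le> t" "f \<le> g" for f g t :: real using that by linarith
            from this[OF s1 F(1)] show ?thesis by (simp only: distrib_right)
          qed
          have "j\<^sup>2 * (3 * N * (real pf.F * T x) * (2 + real pf.F)) = 3 * (N * j) * (j * (real pf.F * T x * (2 + real pf.F)))"
            by (simp add: power2_eq_square)
          also have "\<dots> \<le> 3 * (D * r) * ((real K * sqrt (ln x)) * ((Fc * sqrt (ln x)) * (CT * y x * ln x powr (- M - 4)) * ((2 + Fc) * sqrt (ln x))))"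
          proof (rule mult_mono)
            show "3 * (N * j) \<le> 3 * (D * r)" using Nj by simp
            show "j * (real pf.F * T x * (2 + real pf.F)) \<le> (real K * sqrt (ln x)) * ((Fc * sqrt (ln x)) * (CT * y x * ln x powr (- M - 4)) * ((2 + Fc) * sqrt (ln x)))"
              using j0 F evx(2) pf.T0 L Fp CT(1) yx x1 by (intro mult_mono[OF j0(2)] mult_mono[OF _ F2] mult_mono) auto
            show "0 \<le> j * (real pf.F * T x * (2 + real pf.F))" using j0 F pf.T0 by (intro mult_nonneg_nonneg) auto
          qed (use D r0 in auto)
          also have "\<dots> = D * r * y x * (c4 * ((sqrt (ln x) * sqrt (ln x) * sqrt (ln x)) * ln x powr (- M - 4)))"
            unfolding c4_def by (simp only: mult_ac)
          also have "(sqrt (ln x) * sqrt (ln x) * sqrt (ln x)) * ln x powr (- M - 4) = ln x powr (3 / 2 - M - 4)"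
          proof -
            have "sqrt (ln x) * sqrt (ln x) * sqrt (ln x) = ln x powr (1/2) * ln x powr (1/2) * ln x powr (1/2)"
              using L by (simp add: powr_half_sqrt)
            also have "\<dots> = ln x powr (3 / 2)" unfolding powr_add[symmetric] by simp
            finally show ?thesis by (simp add: powr_add[symmetric] algebra_simps)
          qed
          also have "D * r * y x * (c4 * ln x powr (3 / 2 - M - 4)) \<le> D * r * y x * ln x powr (E - 1)"
            using evx(3) D r0 yx by (intro mult_left_mono) auto
          also have "ln x powr (E - 1) = e / ln x" using L by (simp add: powr_diff e_def err_def E_def)
          also have "D * r * y x * (e / ln x) = D * (e * r\<^sup>2)" unfolding r_def by (simp add: power2_eq_square)
          finally show ?thesis .
        qed
        have t4: "2 * (N * j)\<^sup>2 * pf.\<eta> \<le> D\<^sup>2 * (4 * (real B)\<^sup>2 * Ka) * (e * r\<^sup>2)"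
        proof -
          have "2 * (N * j)\<^sup>2 * pf.\<eta> = (j\<^sup>2 * N\<^sup>2) * (2 * pf.\<eta>)" by (simp add: power_mult_distrib)
          also have "\<dots> \<le> (D\<^sup>2 * r\<^sup>2) * (2 * (2 * (real B)\<^sup>2 * (Ka * e)))"
          proof (rule mult_mono[OF Nj2])
            show "2 * pf.\<eta> \<le> 2 * (2 * (real B)\<^sup>2 * (Ka * e))" using eta by (rule mult_left_mono) simp
          qed (auto simp: pf.\<eta>_def)
          finally show ?thesis by (simp add: mult_ac)
        qed
        have up: "X * (e * r\<^sup>2) \<le> X * (L * e * r\<^sup>2)" if "X \<ge> 0" for X
        proof -
          have "1 * (e * r\<^sup>2) \<le> L * (e * r\<^sup>2)" using L e0 by (intro mult_right_mono) auto
          then show ?thesis using that by (intro mult_left_mono) (auto simp: mult_ac)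
        qed
        have "(real (J H))\<^sup>2 * (\<Sum>q\<in>Q x H. \<Sum>q'\<in>Q x H. pf.cross_excess q q') + 2 * (real (card (Q x H) * J H))\<^sup>2 * pf.\<eta>
          \<le> j\<^sup>2 * (N * (pf.V * (real pf.F * Nm)) + N\<^sup>2 * (2 * (pf.s * k0 x)) + 3 * N * (real pf.F * T x) * (2 + real pf.F)) + 2 * (N * j)\<^sup>2 * pf.\<eta>"
          unfolding j_def[symmetric] of_nat_mult N_def[symmetric] using cross by (intro add_mono mult_left_mono) auto
        also have "\<dots> \<le> D * (L * e * r\<^sup>2) + D\<^sup>2 * (16 * real B * Ka * C0) * (L * e * r\<^sup>2) + D * (L * e * r\<^sup>2) + D\<^sup>2 * (4 * (real B)\<^sup>2 * Ka) * (L * e * r\<^sup>2)"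
        proof -
          have eq: "j\<^sup>2 * (X1 + X2 + X3) = j\<^sup>2 * X1 + j\<^sup>2 * X2 + j\<^sup>2 * X3" for X1 X2 X3 by (simp add: distrib_left)
          have D': "0 \<le> D" "0 \<le> D\<^sup>2 * (4 * (real B)\<^sup>2 * Ka)" using D Ka by auto
          show ?thesis unfolding eq
            by (intro add_mono order_trans[OF t1 up[OF D'(1)]] order_trans[OF t3 up[OF D'(1)]] order_trans[OF t4 up[OF D'(2)]] t2)
        qed
        also have "\<dots> = CN * (L * e * r\<^sup>2)" unfolding CN_def by (simp only: distrib_right)
        finally show "(real (J H))\<^sup>2 * (\<Sum>q\<in>Q x H. \<Sum>q'\<in>Q x H. pf.cross_excess q q') + 2 * (real (card (Q x H) * J H))\<^sup>2 * pf.\<eta> \<le> CN * (L * e * r\<^sup>2)" .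
        show "0 \<le> ln x / Cz" using L Cz by simp
        show "0 \<le> (real (J H))\<^sup>2 * (\<Sum>q\<in>Q x H. \<Sum>q'\<in>Q x H. pf.cross_excess q q') + 2 * (real (card (Q x H) * J H))\<^sup>2 * pf.\<eta>"
          using pf.cross_excess_nonneg by (intro add_nonneg_nonneg mult_nonneg_nonneg sum_nonneg) (auto simp: pf.\<eta>_def)
      qed
      also have "\<dots> = (CN / Cz) * (ln (ln x) * err x * ((y x)\<^sup>2 / ln x))"
        unfolding L_def e_def r_def using L by (simp add: power2_eq_square)
      finally show "mean x (\<lambda>b. excess_square x b i H n)
     \<le> (CN / Cz) * (ln (ln x) * err x * ((y x)\<^sup>2 / ln x))" .
    qed
  qed
  moreover have "CN / Cz > 0"
    unfolding CN_def using D Ka Cz(1) C0_pos by (intro divide_pos_pos add_pos_nonneg) auto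
  ultimately show ?thesis by blast
qed

end

section \<open>Choice of the residue class\<close>

context window
begin

text \<open>The half-open ranges (y / (\<xi> H), y / H] for distinct powers H of \<xi> are disjoint,
  so the description in \<open>scale_of\<close> is unique.\<close>

lemma scale_of_eq:
  assumes H: "H \<in> S x" "at_scale \<delta> \<xi> x H q" and y: "y x > 0"
  shows "scale_of \<delta> \<xi> x q = H"
proof -
  have less: False if "i < j" "at_scale \<delta> \<xi> x (\<xi> ^ i) q" "at_scale \<delta> \<xi> x (\<xi> ^ j) q" for i j
  proof -
    have "\<xi> * \<xi> ^ i \<le> \<xi> ^ j" using that(1) \<xi> by (simp add: power_increasing Suc_le_eq flip: power_Suc)
    then have "y x / \<xi> ^ j \<le> y x / (\<xi> * \<xi> ^ i)" using \<xi> y by (intro divide_left_mono mult_pos_pos) auto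
    then show False using that(2,3) unfolding at_scale_def by linarith
  qed
  have "H' = H" if H': "H' \<in> S x" "at_scale \<delta> \<xi> x H' q" for H'
  proof -
    obtain i j where "H = \<xi> ^ i" "H' = \<xi> ^ j" using H H' unfolding scales_def by auto
    then show ?thesis using less[of i j] less[of j i] H H' by (metis nat_neq_iff)
  qed
  then show ?thesis unfolding scale_of_def using H by (intro the_equality) blast+
qed

end

context second_sieve
begin

text \<open>Discarding the other primes makes the second claim of the theorem hold by construction;
  the cost is transferred to the exceptional points.\<close>

definition regular :: "real \<Rightarrow> real \<Rightarrow> int \<Rightarrow> real \<Rightarrow> nat set" where
  "regular x \<theta> b H = {q \<in> Q x H. \<bar>mass x b H q - u x\<bar> \<le> \<theta> * u x}"

definition regular_primes :: "real \<Rightarrow> real \<Rightarrow> int \<Rightarrow> nat set" where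
  "regular_primes x \<theta> b = (\<Union>H\<in>S x. regular x \<theta> b H)"

definition exceptional :: "real \<Rightarrow> real \<Rightarrow> int \<Rightarrow> nat \<Rightarrow> int set" where
  "exceptional x \<theta> b i = {n \<in> translate (sieved I (z x)) b \<inter> {1..y_of \<delta> x}.
     \<not> (\<exists>\<theta>'. \<bar>\<theta>'\<bar> \<le> 2 * \<theta> \<and>
        (\<Sum>q\<in>regular_primes x \<theta> b. \<Sum>h\<in>step_range (real K * scale_of \<delta> \<xi> x q).
            weight I a M K (z x) b (scale_of \<delta> \<xi> x q) q (n - a i q - int q * int h))
          = (total_mass I \<nu> x + \<theta>') * (real K + 2) * y x)}"

lemma weight_nonneg: "weight I a M K w b H q n \<ge> 0"
proof -
  have "sieve_density I w > 0" for w
    unfolding sieve_density_eq using density_of_pos(1)[of "primes_upto w"] by (simp add: primes_upto_def)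
  then show ?thesis unfolding weight_def Let_def by (simp add: less_imp_le)
qed

lemma finite_Q: "finite (Q x H)"
proof -
  have "Q x H \<subseteq> primes_upto (y x / H)" unfolding Q_def Q_scale_def at_scale_def primes_upto_def by auto
  then show ?thesis using finite_primes_upto finite_subset by blast
qed

text \<open>An irregular prime deviates by d > \<theta> u, and then its whole mass, at most u + d,
  is O(d^2 / (\<theta>^2 u)). The total effect of the discarded primes is thus bounded by the second
  moment.\<close>

lemma irregular_hits_le:
  assumes H: "H \<ge> 1" and y: "y x > 0" and \<theta>: "0 < \<theta>" "\<theta> \<le> 1" and i: "i \<in> {1..\<nu>}"
  shows "(\<Sum>n\<in>{1..y_of \<delta> x}. \<Sum>q\<in>Q x H - regular x \<theta> b H. hits x b i H q n) \<le>
    real (J H) * (2 / (\<theta>\<^sup>2 * u x) * (\<Sum>q\<in>Q x H. (mass x b H q - u x)\<^sup>2))"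
proof -
  have u0: "u x > 0" unfolding u_def using y by (intro mult_pos_pos) auto
  have fin: "finite (Q x H - regular x \<theta> b H)" using finite_Q by simp
  have hit: "(\<Sum>n\<in>{1..y_of \<delta> x}. hits x b i H q n) \<le> real (J H) * mass x b H q" if q: "q \<in> Q x H" for q
  proof -
    have qp: "prime q" "card (I q) = \<nu>" "real q \<le> y x / H"
      using q unfolding Q_def Q_scale_def at_scale_def by auto
    have aq: "1 \<le> a i q" "a i q \<le> int q" using lab qp i unfolding labelling_def by auto
    have "(\<Sum>n\<in>{1..y_of \<delta> x}. hits x b i H q n) =
      (\<Sum>h\<in>step_range (real K * H). \<Sum>n\<in>{1..y_of \<delta> x}. weight I a M K (z x) b H q (n - a i q - int q * int h))"
      unfolding hits_def by (rule sum.swap)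
    also have "\<dots> \<le> (\<Sum>h\<in>step_range (real K * H). mass x b H q)"
    proof (rule sum_mono)
      fix h assume h: "h \<in> step_range (real K * H)"
      let ?f = "\<lambda>n. n - a i q - int q * int h"
      have "(\<Sum>n\<in>{1..y_of \<delta> x}. weight I a M K (z x) b H q (?f n)) = (\<Sum>n\<in>?f ` {1..y_of \<delta> x}. weight I a M K (z x) b H q n)"
        by (subst sum.reindex) (auto simp: inj_on_def)
      also have "\<dots> \<le> mass x b H q"
        unfolding mass_def
      proof (rule sum_mono2)
        \<comment> \<open>This inclusion explains the range of n: a \<le> q \<le> y and q h \<le> K
          y, so the arguments lie between -(K + 1) y and y.\<close>
        show "?f ` {1..y_of \<delta> x} \<subseteq> Nrange x"
        proof
          fix m assume "m \<in> ?f ` {1..y_of \<delta> x}"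
          then obtain n where n: "1 \<le> n" "n \<le> y_of \<delta> x" "m = ?f n" by auto
          have "real q * real h \<le> (y x / H) * (real K * H)"
            using qp(3) h H y unfolding step_range_def by (intro mult_mono) auto
          also have "\<dots> = real K * y x" using H by simp
          finally have "real_of_int (int q * int h) \<le> real_of_int (int K * y_of \<delta> x)" by simp
          then have qh: "int q * int h \<le> int K * y_of \<delta> x" by (simp only: of_int_le_iff)
          have "y x / H \<le> y x / 1" using H y by (intro divide_left_mono) auto
          then have "real_of_int (int q) \<le> y x" using qp(3) by simp
          then have qy: "int q \<le> y_of \<delta> x" by (simp only: of_int_le_iff)
          have "m > - (int K * y_of \<delta> x) - y_of \<delta> x" using n(1,3) aq qh qy by linarith
          moreover have "0 \<le> int q * int h" by simp
          then have "m \<le> y_of \<delta> x" using n(2,3) aq by linarith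
          ultimately show "m \<in> Nrange x" by (simp add: algebra_simps)
        qed
      qed (auto simp: weight_nonneg)
      finally show "(\<Sum>n\<in>{1..y_of \<delta> x}. weight I a M K (z x) b H q (?f n)) \<le> mass x b H q" .
    qed
    also have "\<dots> = real (J H) * mass x b H q" by (simp add: J_def)
    finally show ?thesis .
  qed
  \<comment> \<open>Both u and d are at most d^2 / (\<theta>^2 u): the first by squaring \<theta> u
    < d, the second because \<theta>^2 u \<le> \<theta> u, as \<theta> \<le> 1.\<close>
  have bad: "mass x b H q \<le> 2 / (\<theta>\<^sup>2 * u x) * (mass x b H q - u x)\<^sup>2" if "q \<in> Q x H - regular x \<theta> b H" for q
  proof -
    define d where "d = \<bar>mass x b H q - u x\<bar>"
    have d: "\<theta> * u x < d" using that unfolding regular_def d_def by auto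
    have d0: "d > 0" using d \<theta> u0 by (smt (verit) mult_pos_pos)
    have "(\<theta> * u x) * (\<theta> * u x) \<le> d * d" using d d0 \<theta> u0 by (intro mult_mono) auto
    then have "u x * (\<theta>\<^sup>2 * u x) \<le> d\<^sup>2" by (simp add: power2_eq_square mult_ac)
    moreover have "d * (\<theta>\<^sup>2 * u x) \<le> d * d"
    proof (intro mult_left_mono)
      have "\<theta>\<^sup>2 * u x \<le> \<theta> * u x" using \<theta> u0 by (intro mult_right_mono) (auto simp: power2_eq_square mult_left_le)
      then show "\<theta>\<^sup>2 * u x \<le> d" using d by linarith
    qed (use d0 in auto)
    ultimately have "(u x + d) * (\<theta>\<^sup>2 * u x) \<le> 2 * d\<^sup>2" by (simp add: power2_eq_square algebra_simps)
    then have "u x + d \<le> 2 * d\<^sup>2 / (\<theta>\<^sup>2 * u x)" using \<theta> u0 by (subst pos_le_divide_eq) auto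
    moreover have "mass x b H q \<le> u x + d" unfolding d_def by linarith
    moreover have "d\<^sup>2 = (mass x b H q - u x)\<^sup>2" unfolding d_def by simp
    ultimately show ?thesis by simp
  qed
  have "(\<Sum>n\<in>{1..y_of \<delta> x}. \<Sum>q\<in>Q x H - regular x \<theta> b H. hits x b i H q n) =
    (\<Sum>q\<in>Q x H - regular x \<theta> b H. \<Sum>n\<in>{1..y_of \<delta> x}. hits x b i H q n)" by (rule sum.swap)
  also have "\<dots> \<le> (\<Sum>q\<in>Q x H - regular x \<theta> b H. real (J H) * (2 / (\<theta>\<^sup>2 * u x) * (mass x b H q - u x)\<^sup>2))"
  proof (rule sum_mono)
    fix q assume q: "q \<in> Q x H - regular x \<theta> b H"
    have "real (J H) * mass x b H q \<le> real (J H) * (2 / (\<theta>\<^sup>2 * u x) * (mass x b H q - u x)\<^sup>2)"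
      using bad[OF q] by (intro mult_left_mono) auto
    then show "(\<Sum>n\<in>{1..y_of \<delta> x}. hits x b i H q n) \<le> real (J H) * (2 / (\<theta>\<^sup>2 * u x) * (mass x b H q - u x)\<^sup>2)"
      using hit[of q] q by force
  qed
  also have "\<dots> \<le> (\<Sum>q\<in>Q x H. real (J H) * (2 / (\<theta>\<^sup>2 * u x) * (mass x b H q - u x)\<^sup>2))"
    using finite_Q u0 by (intro sum_mono2) auto
  finally show ?thesis by (simp only: sum_distrib_left)
qed

text \<open>If at every one of the N scales the deviation and the discarded part were each at most
  \<theta> u / N, the total error would be at most 2 \<theta> u. The left bound 1 is thus a
  Chebyshev term (squared) plus a Markov term (linear), prepared for averaging.\<close>

lemma exceptional_deviation:
  assumes y: "y x > 0" and \<theta>: "0 < \<theta>" and fS: "finite (S x)" and n: "n \<in> exceptional x \<theta> b i"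
    and N: "N = real (card (S x))"
  shows "1 \<le> (\<Sum>H\<in>S x. (N / (\<theta> * u x))\<^sup>2 * excess_square x b i H n
     + N / (\<theta> * u x) * (\<Sum>q\<in>Q x H - regular x \<theta> b H. hits x b i H q n))"
proof (rule ccontr)
  assume neg: "\<not> ?thesis"
  have u0: "u x > 0" unfolding u_def using y by (intro mult_pos_pos) auto
  let ?F = "\<lambda>H. \<Sum>q\<in>Q x H. hits x b i H q n"
  let ?B = "\<lambda>H. \<Sum>q\<in>Q x H - regular x \<theta> b H. hits x b i H q n"
  let ?t = "\<lambda>H. (N / (\<theta> * u x))\<^sup>2 * excess_square x b i H n + N / (\<theta> * u x) * ?B H"
  have hits0: "hits x b i H q n \<ge> 0" for H q unfolding hits_def by (intro sum_nonneg weight_nonneg)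
  have B0: "?B H \<ge> 0" for H by (intro sum_nonneg hits0)
  have es0: "excess_square x b i H n \<ge> 0" for H unfolding excess_square_def by simp
  have nS: "n \<in> translate (sieved I (z x)) b" using n unfolding exceptional_def by blast
  \<comment> \<open>A prime belongs to one scale only, so the sum over the retained primes splits
    over the scales without double counting.\<close>
  have disj: "H = H'" if "q \<in> regular x \<theta> b H" "q \<in> regular x \<theta> b H'" "H \<in> S x" "H' \<in> S x" for q H H'
    using scale_of_eq[of H x q] scale_of_eq[of H' x q] that y unfolding regular_def Q_def Q_scale_def by auto
  have each: "\<bar>?F H - scale_mass I \<delta> \<xi> M K \<nu> x H\<bar> * N \<le> \<theta> * u x" "?B H * N \<le> \<theta> * u x" if H: "H \<in> S x" for H
  proof -
    have N0: "N > 0" using H fS unfolding N by (auto simp: card_gt_0_iff)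
    have "?t H \<le> (\<Sum>H\<in>S x. ?t H)"
      using fS H es0 B0 N0 \<theta> u0 by (intro member_le_sum) auto
    then have le1: "?t H < 1" using neg by linarith
    have tu: "\<theta> * u x > 0" using \<theta> u0 by simp
    have p1: "0 \<le> (N / (\<theta> * u x))\<^sup>2 * excess_square x b i H n" using es0 by simp
    have p2: "0 \<le> N / (\<theta> * u x) * ?B H" using N0 tu B0 by simp
    have "N / (\<theta> * u x) * ?B H < 1" using le1 p1 by linarith
    then show "?B H * N \<le> \<theta> * u x" using tu by (simp add: divide_less_eq mult.commute)
    have "(N / (\<theta> * u x))\<^sup>2 * (?F H - scale_mass I \<delta> \<xi> M K \<nu> x H)\<^sup>2 < 1"
      using le1 p2 nS unfolding excess_square_def by simp
    then have "(\<bar>?F H - scale_mass I \<delta> \<xi> M K \<nu> x H\<bar> * N / (\<theta> * u x))\<^sup>2 < 1\<^sup>2"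
      by (simp add: power_mult_distrib power_divide mult.commute)
    then have "\<bar>?F H - scale_mass I \<delta> \<xi> M K \<nu> x H\<bar> * N / (\<theta> * u x) < 1" by (rule power2_less_imp_less) simp
    then show "\<bar>?F H - scale_mass I \<delta> \<xi> M K \<nu> x H\<bar> * N \<le> \<theta> * u x" using tu by (simp add: divide_less_eq)
  qed
  define total where "total = (\<Sum>q\<in>regular_primes x \<theta> b. \<Sum>h\<in>step_range (real K * scale_of \<delta> \<xi> x q).
            weight I a M K (z x) b (scale_of \<delta> \<xi> x q) q (n - a i q - int q * int h))"
  have "total = (\<Sum>H\<in>S x. \<Sum>q\<in>regular x \<theta> b H. hits x b i H q n)"
  proof -
    have "total = (\<Sum>H\<in>S x. \<Sum>q\<in>regular x \<theta> b H. \<Sum>h\<in>step_range (real K * scale_of \<delta> \<xi> x q).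
            weight I a M K (z x) b (scale_of \<delta> \<xi> x q) q (n - a i q - int q * int h))"
      unfolding total_def regular_primes_def
      using fS finite_Q disj by (intro sum.UNION_disjoint) (auto simp: regular_def)
    also have "\<dots> = (\<Sum>H\<in>S x. \<Sum>q\<in>regular x \<theta> b H. hits x b i H q n)"
    proof (intro sum.cong refl)
      fix H q assume "H \<in> S x" "q \<in> regular x \<theta> b H"
      then have "scale_of \<delta> \<xi> x q = H" using y by (intro scale_of_eq) (auto simp: regular_def Q_def Q_scale_def)
      then show "(\<Sum>h\<in>step_range (real K * scale_of \<delta> \<xi> x q).
            weight I a M K (z x) b (scale_of \<delta> \<xi> x q) q (n - a i q - int q * int h)) = hits x b i H q n"
        by (simp add: hits_def)
    qed
    finally show ?thesis .
  qed
  also have "\<dots> = (\<Sum>H\<in>S x. ?F H - ?B H)"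
  proof (intro sum.cong refl)
    fix H
    have "regular x \<theta> b H \<subseteq> Q x H" unfolding regular_def by auto
    from sum.subset_diff[OF this finite_Q, of "\<lambda>q. hits x b i H q n"]
    show "(\<Sum>q\<in>regular x \<theta> b H. hits x b i H q n) = ?F H - ?B H" by simp
  qed
  finally have tot: "total = (\<Sum>H\<in>S x. ?F H - ?B H)" .
  have mass: "total_mass I \<nu> x * u x = (\<Sum>H\<in>S x. scale_mass I \<delta> \<xi> M K \<nu> x H)"
    using u0 y unfolding total_mass_def u_def by simp
  have "\<bar>total - total_mass I \<nu> x * u x\<bar> \<le> 2 * (\<theta> * u x)"
  proof (cases "S x = {}")
    case True
    then show ?thesis unfolding tot mass using \<theta> u0 by simp
  next
    case False
    then have N0: "N > 0" using fS unfolding N by (auto simp: card_gt_0_iff)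
    have "\<bar>total - total_mass I \<nu> x * u x\<bar> = \<bar>\<Sum>H\<in>S x. (?F H - scale_mass I \<delta> \<xi> M K \<nu> x H) - ?B H\<bar>"
      unfolding tot mass by (simp add: sum_subtractf)
    also have "\<dots> \<le> (\<Sum>H\<in>S x. \<bar>?F H - scale_mass I \<delta> \<xi> M K \<nu> x H\<bar> + ?B H)"
      using B0 by (intro order_trans[OF sum_abs sum_mono]) (smt (verit))
    also have "\<dots> \<le> (\<Sum>H\<in>S x. \<theta> * u x / N + \<theta> * u x / N)"
      using each N0 by (intro sum_mono add_mono) (auto simp: pos_le_divide_eq)
    also have "\<dots> = 2 * (\<theta> * u x)" using N0 unfolding N by simp
    finally show ?thesis .
  qed
  moreover have "\<bar>total / u x - total_mass I \<nu> x\<bar> = \<bar>total - total_mass I \<nu> x * u x\<bar> / u x"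
  proof -
    have "total / u x - total_mass I \<nu> x = (total - total_mass I \<nu> x * u x) / u x" using u0 by (simp add: diff_divide_distrib)
    then show ?thesis using u0 by (simp add: abs_divide)
  qed
  ultimately have "\<bar>total / u x - total_mass I \<nu> x\<bar> \<le> 2 * \<theta>" using u0 by (simp add: divide_le_eq mult.assoc)
  moreover have "total = (total_mass I \<nu> x + (total / u x - total_mass I \<nu> x)) * (real K + 2) * y x"
  proof -
    have "(total_mass I \<nu> x + (total / u x - total_mass I \<nu> x)) * (real K + 2) * y x = total / u x * u x"
      by (simp add: u_def)
    also have "\<dots> = total" using u0 by simp
    finally show ?thesis by (rule sym)
  qed
  ultimately show False using n unfolding exceptional_def total_def by blast
qed

lemma card_exceptional_le:
  assumes y: "y x > 0" and \<theta>: "0 < \<theta>" "\<theta> \<le> 1" and fS: "finite (S x)" and S1: "\<And>H. H \<in> S x \<Longrightarrow> 1 \<le> H"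
    and i: "i \<in> {1..\<nu>}" and N: "N = real (card (S x))"
  shows "real (card (exceptional x \<theta> b i)) \<le>
    (\<Sum>H\<in>S x. (N / (\<theta> * u x))\<^sup>2 * (\<Sum>n\<in>{1..y_of \<delta> x}. excess_square x b i H n)
      + N / (\<theta> * u x) * (real (J H) * (2 / (\<theta>\<^sup>2 * u x) * (\<Sum>q\<in>Q x H. (mass x b H q - u x)\<^sup>2))))"
proof -
  have u0: "u x > 0" unfolding u_def using y by (intro mult_pos_pos) auto
  let ?B = "\<lambda>H n. \<Sum>q\<in>Q x H - regular x \<theta> b H. hits x b i H q n"
  let ?t = "\<lambda>n H. (N / (\<theta> * u x))\<^sup>2 * excess_square x b i H n + N / (\<theta> * u x) * ?B H n"
  have N0: "N \<ge> 0" using N by simp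
  have B0: "?B H n \<ge> 0" for H n unfolding hits_def by (intro sum_nonneg weight_nonneg)
  have es0: "excess_square x b i H n \<ge> 0" for H n unfolding excess_square_def by simp
  have sub: "exceptional x \<theta> b i \<subseteq> {1..y_of \<delta> x}" unfolding exceptional_def by auto
  have "real (card (exceptional x \<theta> b i)) = (\<Sum>n\<in>exceptional x \<theta> b i. 1)" by simp
  also have "\<dots> \<le> (\<Sum>n\<in>exceptional x \<theta> b i. \<Sum>H\<in>S x. ?t n H)"
    by (intro sum_mono exceptional_deviation[OF y \<theta>(1) fS _ N])
  also have "\<dots> \<le> (\<Sum>n\<in>{1..y_of \<delta> x}. \<Sum>H\<in>S x. ?t n H)"
    using sub es0 B0 N0 \<theta> u0 by (intro sum_mono2 sum_nonneg) auto
  also have "\<dots> = (\<Sum>H\<in>S x. \<Sum>n\<in>{1..y_of \<delta> x}. ?t n H)" by (rule sum.swap)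
  also have "\<dots> = (\<Sum>H\<in>S x. (N / (\<theta> * u x))\<^sup>2 * (\<Sum>n\<in>{1..y_of \<delta> x}. excess_square x b i H n)
      + N / (\<theta> * u x) * (\<Sum>n\<in>{1..y_of \<delta> x}. ?B H n))"
    by (simp only: sum.distrib sum_distrib_left[symmetric])
  also have "\<dots> \<le> (\<Sum>H\<in>S x. (N / (\<theta> * u x))\<^sup>2 * (\<Sum>n\<in>{1..y_of \<delta> x}. excess_square x b i H n)
      + N / (\<theta> * u x) * (real (J H) * (2 / (\<theta>\<^sup>2 * u x) * (\<Sum>q\<in>Q x H. (mass x b H q - u x)\<^sup>2))))"
    using N0 \<theta> u0 by (intro sum_mono add_left_mono mult_left_mono irregular_hits_le S1 y i) auto
  finally show ?thesis .
qed

text \<open>Any fixed multiple of x / ln x is reached because the accumulated power of ln x is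
  negative: \<epsilon> < (M - 6) / 7 implies 3 \<epsilon> < M - 6.\<close>

lemma avg_exceptional:
  assumes \<epsilon>: "0 < \<epsilon>" "\<epsilon> < 1 / 7 * (M - 6)" and \<tau>: "\<tau> > 0"
  shows "\<forall>\<^sub>F x in at_top. \<forall>i\<in>{1..\<nu>}.
    mean x (\<lambda>b. real (card (exceptional x (ln x powr (- \<delta> * (1 + \<epsilon>))) b i))) \<le> \<tau> * (x / ln x)"
proof -
  obtain CA where CA: "CA > 0" "\<forall>\<^sub>F x in at_top. \<forall>H\<in>S x.
    (\<Sum>q\<in>Q x H. mean x (\<lambda>b. (mass x b H q - u x)\<^sup>2))
     \<le> CA * (ln (ln x) * err x * ((u x)\<^sup>2 * (y x / (H * ln x))))" using progression_moment by blast
  obtain CB where CB: "CB > 0" "\<forall>\<^sub>F x in at_top. \<forall>H\<in>S x. \<forall>i\<in>{1..\<nu>}. \<forall>n.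
    mean x (\<lambda>b. excess_square x b i H n)
     \<le> CB * (ln (ln x) * err x * ((y x)\<^sup>2 / ln x))" using point_moment by blast
  obtain CS where CS: "CS > 0" "\<forall>\<^sub>F x in at_top. real (card (S x)) \<le> CS * ln (ln x)" using card_scales by blast
  \<comment> \<open>The terms are \<delta> (2 - M) from \<open>err\<close>, 3 \<delta> (1 +
    \<epsilon>) from the inverse cube of the accuracy, and \<delta> from y / x.\<close>
  define G where "G = \<delta> * (6 + 3 * \<epsilon> - M)"
  define c where "c = 2 * (CS ^ 3 * CB + 2 * real K * CS\<^sup>2 * CA)"
  have G: "G < 0" unfolding G_def using \<delta> \<epsilon> M by (intro mult_pos_neg) auto
  have cp: "c > 0" unfolding c_def using CS CB CA by (intro mult_pos_pos add_pos_nonneg) auto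
  have "((\<lambda>x::real. c * ln (ln x) ^ 4 * ln x powr G) \<longlongrightarrow> 0) at_top" using G by real_asymp
  then have ev: "\<forall>\<^sub>F x::real in at_top. c * ln (ln x) ^ 4 * ln x powr G < \<tau>" using \<tau> by (rule order_tendstoD(2))
  have evL: "\<forall>\<^sub>F x::real in at_top. 1 \<le> ln (ln x) \<and> 1 \<le> ln x \<and> 1 < x" by (intro eventually_conj) real_asymp+
  show ?thesis using CA(2) CB(2) CS(2) ev evL scale_facts u_bounds y_bounds finite_scales
  proof eventually_elim
    case (elim x)
    define \<theta> where "\<theta> = ln x powr (- \<delta> * (1 + \<epsilon>))"
    define N where "N = real (card (S x))"
    define L where "L = ln (ln x)"
    define l where "l = ln x"
    define e where "e = err x"
    have L: "1 \<le> L" "1 \<le> l" using elim unfolding L_def l_def by auto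
    have e0: "e \<ge> 0" unfolding e_def err_def by simp
    have \<theta>: "0 < \<theta>" "\<theta> \<le> 1"
    proof -
      show "0 < \<theta>" unfolding \<theta>_def using L by (simp add: l_def)
      have "\<theta> \<le> ln x powr 0" unfolding \<theta>_def using L \<delta> \<epsilon> by (intro powr_mono) (auto simp: l_def)
      then show "\<theta> \<le> 1" using L by (simp add: l_def)
    qed
    have yx: "y x > 0" "x > 1" and ux: "y x \<le> u x" "u x > 0" using elim by auto
    have N: "0 \<le> N" "N \<le> CS * L" using elim unfolding N_def L_def by auto
    show ?case
    proof
      fix i assume i: "i \<in> {1..\<nu>}"
      have yint: "real (card {1..y_of \<delta> x}) = y x" using yx by simp
      have es: "mean x (\<lambda>b. \<Sum>n\<in>{1..y_of \<delta> x}. excess_square x b i H n) \<le> y x * (CB * (L * e * ((y x)\<^sup>2 / l)))"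
        if H: "H \<in> S x" for H
      proof -
        have "mean x (\<lambda>b. excess_square x b i H n) \<le> CB * (L * e * ((y x)\<^sup>2 / l))" for n
          using elim(2) H i unfolding L_def l_def e_def by blast
        then have "(\<Sum>n\<in>{1..y_of \<delta> x}. mean x (\<lambda>b. excess_square x b i H n)) \<le> (\<Sum>n\<in>{1..y_of \<delta> x}. CB * (L * e * ((y x)\<^sup>2 / l)))"
          by (intro sum_mono)
        also have "\<dots> = real (card {1..y_of \<delta> x}) * (CB * (L * e * ((y x)\<^sup>2 / l)))" by (rule sum_constant)
        finally show ?thesis unfolding avg_sum yint .
      qed
      have ms: "mean x (\<lambda>b. \<Sum>q\<in>Q x H. (mass x b H q - u x)\<^sup>2) \<le> CA * (L * e * ((u x)\<^sup>2 * (y x / (H * l))))"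
        if H: "H \<in> S x" for H
        using elim(1) H unfolding avg_sum L_def l_def e_def by blast
      have S1: "\<And>H. H \<in> S x \<Longrightarrow> 1 \<le> H" using elim(6) by blast
      have "mean x (\<lambda>b. real (card (exceptional x \<theta> b i))) \<le>
         mean x (\<lambda>b. \<Sum>H\<in>S x. (N / (\<theta> * u x))\<^sup>2 * (\<Sum>n\<in>{1..y_of \<delta> x}. excess_square x b i H n)
      + N / (\<theta> * u x) * (real (J H) * (2 / (\<theta>\<^sup>2 * u x) * (\<Sum>q\<in>Q x H. (mass x b H q - u x)\<^sup>2))))"
        by (rule avg_mono, rule card_exceptional_le[OF yx(1) \<theta> elim(9) S1 i N_def])
      also have "\<dots> = (\<Sum>H\<in>S x. (N / (\<theta> * u x))\<^sup>2 * mean x (\<lambda>b. \<Sum>n\<in>{1..y_of \<delta> x}. excess_square x b i H n)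
      + N / (\<theta> * u x) * (real (J H) * (2 / (\<theta>\<^sup>2 * u x) * mean x (\<lambda>b. \<Sum>q\<in>Q x H. (mass x b H q - u x)\<^sup>2))))"
        by (simp only: avg_sum[of _ _ "S x"] avg_add avg_cmult)
      also have "\<dots> \<le> (\<Sum>H\<in>S x. (CS\<^sup>2 * CB + 2 * real K * CS * CA) * (L ^ 3 * (e / \<theta> ^ 3) * (y x / l)))"
      proof (rule sum_mono)
        fix H assume H: "H \<in> S x"
        have h: "1 \<le> H" "real (J H) \<le> real K * H" using elim(6) H by auto
        have tu: "\<theta> * u x > 0" using \<theta> ux by simp
        define P where "P = L ^ 3 * (e / \<theta> ^ 3) * (y x / l)"
        have e2: "e / \<theta>\<^sup>2 \<le> e / \<theta> ^ 3"
          using e0 \<theta> by (intro divide_left_mono power_decreasing) auto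
        have "(N / (\<theta> * u x))\<^sup>2 * mean x (\<lambda>b. \<Sum>n\<in>{1..y_of \<delta> x}. excess_square x b i H n)
          \<le> (CS * L / (\<theta> * u x))\<^sup>2 * (y x * (CB * (L * e * ((y x)\<^sup>2 / l))))"
        proof (rule order_trans[OF mult_left_mono[OF es[OF H]]])
          show "(N / (\<theta> * u x))\<^sup>2 * (y x * (CB * (L * e * ((y x)\<^sup>2 / l)))) \<le> (CS * L / (\<theta> * u x))\<^sup>2 * (y x * (CB * (L * e * ((y x)\<^sup>2 / l))))"
            using N tu yx CB e0 L by (intro mult_right_mono power_mono divide_right_mono) auto
        qed simp
        also have "\<dots> = CS\<^sup>2 * CB * (L ^ 3 * (e / \<theta>\<^sup>2) * (y x / l)) * ((y x)\<^sup>2 / (u x)\<^sup>2)"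
          by (simp add: power_divide power_mult_distrib power2_eq_square power3_eq_cube mult_ac)
        also have "\<dots> \<le> CS\<^sup>2 * CB * (L ^ 3 * (e / \<theta>\<^sup>2) * (y x / l)) * 1"
        proof (rule mult_left_mono)
          have "(y x)\<^sup>2 \<le> (u x)\<^sup>2" using ux yx by (intro power_mono) auto
          then show "(y x)\<^sup>2 / (u x)\<^sup>2 \<le> 1" using ux by (simp add: divide_le_eq)
        qed (use CB e0 L yx in \<open>auto intro!: mult_nonneg_nonneg divide_nonneg_nonneg\<close>)
        also have "\<dots> \<le> CS\<^sup>2 * CB * P * 1"
          unfolding P_def using e2 CB L yx by (intro mult_right_mono mult_left_mono) auto
        finally have p1: "(N / (\<theta> * u x))\<^sup>2 * mean x (\<lambda>b. \<Sum>n\<in>{1..y_of \<delta> x}. excess_square x b i H n) \<le> CS\<^sup>2 * CB * P" by simp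
        \<comment> \<open>The dominant loss: \<theta>^(-2) from discarding irregular primes and
          \<theta>^(-1) from Markov's inequality for their remaining effect.\<close>
        have "N / (\<theta> * u x) * (real (J H) * (2 / (\<theta>\<^sup>2 * u x) * mean x (\<lambda>b. \<Sum>q\<in>Q x H. (mass x b H q - u x)\<^sup>2)))
          \<le> N / (\<theta> * u x) * (real (J H) * (2 / (\<theta>\<^sup>2 * u x) * (CA * (L * e * ((u x)\<^sup>2 * (y x / (H * l)))))))"
          using ms[OF H] N tu \<theta> ux by (intro mult_left_mono) auto
        also have "\<dots> = (N * real (J H) / H) * (2 * CA * (L * (e / \<theta> ^ 3) * (y x / l)))"
          using ux \<theta> h by (simp add: power2_eq_square power3_eq_cube mult_ac)
        also have "\<dots> \<le> (CS * L * real K) * (2 * CA * (L * (e / \<theta> ^ 3) * (y x / l)))"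
        proof (rule mult_right_mono)
          have "real (J H) / H \<le> real K" using h by (simp add: divide_le_eq)
          then have "N * (real (J H) / H) \<le> (CS * L) * real K" using N L CS h by (intro mult_mono) auto
          then show "N * real (J H) / H \<le> CS * L * real K" by simp
        qed (use CA e0 L yx \<theta> in \<open>auto intro!: mult_nonneg_nonneg divide_nonneg_nonneg\<close>)
        also have "\<dots> = 2 * real K * CS * CA * (L\<^sup>2 * (e / \<theta> ^ 3) * (y x / l))"
          by (simp add: power2_eq_square)
        also have "\<dots> \<le> 2 * real K * CS * CA * P"
        proof -
          have "L\<^sup>2 \<le> L ^ 3" using L by (intro power_increasing) auto
          then show ?thesis unfolding P_def using CA CS e0 \<theta> yx L by (intro mult_left_mono mult_right_mono) auto
        qed
        finally have p2: "N / (\<theta> * u x) * (real (J H) * (2 / (\<theta>\<^sup>2 * u x) * mean x (\<lambda>b. \<Sum>q\<in>Q x H. (mass x b H q - u x)\<^sup>2)))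
          \<le> 2 * real K * CS * CA * P" .
        show "(N / (\<theta> * u x))\<^sup>2 * mean x (\<lambda>b. \<Sum>n\<in>{1..y_of \<delta> x}. excess_square x b i H n)
          + N / (\<theta> * u x) * (real (J H) * (2 / (\<theta>\<^sup>2 * u x) * mean x (\<lambda>b. \<Sum>q\<in>Q x H. (mass x b H q - u x)\<^sup>2)))
          \<le> (CS\<^sup>2 * CB + 2 * real K * CS * CA) * (L ^ 3 * (e / \<theta> ^ 3) * (y x / l))"
          using add_mono[OF p1 p2] unfolding P_def[symmetric] by (simp only: distrib_right)
      qed
      also have "\<dots> = N * ((CS\<^sup>2 * CB + 2 * real K * CS * CA) * (L ^ 3 * (e / \<theta> ^ 3) * (y x / l)))" by (simp add: N_def)
      \<comment> \<open>Here y is replaced by 2 x (ln x)^\<delta>, and the sum over the scales costs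
        one more factor ln (ln x).\<close>
      also have "\<dots> \<le> (CS * L) * ((CS\<^sup>2 * CB + 2 * real K * CS * CA) * (L ^ 3 * (e / \<theta> ^ 3) * (2 * (x * l powr \<delta>) / l)))"
        using N CS CB CA L e0 \<theta> yx elim(8)
        by (intro mult_mono mult_left_mono divide_right_mono mult_nonneg_nonneg add_nonneg_nonneg divide_nonneg_nonneg) (auto simp: l_def)
      also have "\<dots> = c * L ^ 4 * ((e / \<theta> ^ 3) * l powr \<delta>) * (x / l)"
        unfolding c_def by (simp add: power2_eq_square power3_eq_cube power4_eq_xxxx algebra_simps add_divide_distrib)
      also have "(e / \<theta> ^ 3) * l powr \<delta> = l powr G"
      proof -
        have "\<theta> ^ 3 = \<theta> powr 3" by (rule powr_numeral[symmetric]) (use \<theta>(1) in simp)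
        also have "\<dots> = l powr (3 * (- \<delta> * (1 + \<epsilon>)))"
          unfolding \<theta>_def l_def powr_powr by (simp only: mult.commute)
        finally have "\<theta> ^ 3 = l powr (3 * (- \<delta> * (1 + \<epsilon>)))" .
        then have "(e / \<theta> ^ 3) * l powr \<delta> = l powr (\<delta> * (2 - M) - 3 * (- \<delta> * (1 + \<epsilon>)) + \<delta>)"
          unfolding e_def err_def l_def by (simp only: powr_add powr_diff)
        also have "\<delta> * (2 - M) - 3 * (- \<delta> * (1 + \<epsilon>)) + \<delta> = G" unfolding G_def by (simp add: algebra_simps)
        finally show ?thesis .
      qed
      also have "c * L ^ 4 * l powr G * (x / l) \<le> \<tau> * (x / l)"
        using elim(4) yx L unfolding L_def l_def by (intro mult_right_mono divide_nonneg_nonneg) auto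
      finally show "mean x (\<lambda>b. real (card (exceptional x (ln x powr (- \<delta> * (1 + \<epsilon>))) b i))) \<le> \<tau> * (x / ln x)"
        unfolding \<theta>_def l_def .
    qed
  qed
qed

end

lemma (in sieving_system) avg_card_sieved:
  "avg (primes_upto w) (\<lambda>b. real (card (translate (sieved I w) b \<inter> {1..Y}))) = real (card {1..Y}) * sieve_density I w"
proof -
  \<comment> \<open>All primes count as small and the set of large primes is empty, so the one-point
    average applies directly.\<close>
  interpret sieve_split I B "primes_upto w" "{}" 1
    by unfold_locales (rule finite_primes_upto | force simp: primes_upto_def)+
  have "real (card (translate (sieved I w) b \<inter> {1..Y})) = (\<Sum>n\<in>{1..Y}. of_bool (avoids I (primes_upto w) {n} b))" for b
  proof -
    have "translate (sieved I w) b \<inter> {1..Y} = {n\<in>{1..Y}. avoids I (primes_upto w) {n} b}"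
      using mem_translate_sieved by blast
    then show ?thesis by (simp only: card_filter_eq_sum[OF finite_atLeastAtMost_int])
  qed
  then have "avg (primes_upto w) (\<lambda>b. real (card (translate (sieved I w) b \<inter> {1..Y}))) =
      (\<Sum>n\<in>{1..Y}. avg (primes_upto w) (\<lambda>b. of_bool (avoids I (primes_upto w) {n} b)))"
    by (simp only: avg_sum)
  also have "\<dots> = (\<Sum>n\<in>{1..Y}. sieve_density I w)"
    using avg_avoids1 by (simp only: Un_empty_right sieve_density_eq)
  finally show ?thesis by simp
qed

section \<open>Selection of one residue class for all conclusions\<close>

theorem theorem3:
  fixes I :: "nat \<Rightarrow> int set" and B :: nat and a :: "nat \<Rightarrow> nat \<Rightarrow> int"
    and \<delta> M \<xi> :: real and K :: nat
  assumes "sieving_system I B"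
    and "labelling I a"
    and "1 / 10 ^ 3 < \<delta>" and "\<delta> < C_one"
    and "M > 6" and "\<xi> > 1" and "K > 0"
  shows "\<exists>C\<^sub>2 :: nat \<Rightarrow> real \<Rightarrow> real.
    (\<forall>\<nu>\<in>supp_densities I B. C\<^sub>2 \<nu> \<sim>[at_top]
       (\<lambda>_. real K * class_density I \<nu> / ((real K + 2) * M) *
             ((1 - 1 / \<xi>) / ln \<xi>) * ln (1 / (2 * \<delta>)))) \<and>
    (\<forall>\<epsilon>. 0 < \<epsilon> \<and> \<epsilon> < 1 / 7 * (M - 6) \<longrightarrow>
      (\<forall>\<^sub>F x in at_top.
        let y = y_of \<delta> x; z = z_of \<delta> x in
        \<exists>b \<in> {0..<(\<Prod>p\<in>primes_upto z. int p)}. \<exists>R :: nat \<Rightarrow> nat set.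
          let S = translate (sieved I z) b;
              Hq = scale_of \<delta> \<xi> x;
              lam = weight I a M K z b in
          (\<forall>\<nu>\<in>supp_densities I B. R \<nu> \<subseteq> Q_set I \<delta> \<xi> x \<nu>) \<and>
          real (card (S \<inter> {1..y})) \<le> 2 * sieve_density I z * real_of_int y \<and>
          (\<forall>q \<in> (\<Union>\<nu>\<in>supp_densities I B. R \<nu>).
            \<exists>\<theta>. \<bar>\<theta>\<bar> \<le> ln x powr (- \<delta> * (1 + \<epsilon>)) \<and>
              (\<Sum>n \<in> {- (int K + 1) * y <.. y}. lam (Hq q) q n)
                = (1 + \<theta>) * (real K + 2) * real_of_int y) \<and>
          (\<forall>\<nu>\<in>supp_densities I B. \<forall>i\<in>{1..\<nu>}.
            real (card {n \<in> S \<inter> {1..y}.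
              \<not> (\<exists>\<theta>'. \<bar>\<theta>'\<bar> \<le> 2 * ln x powr (- \<delta> * (1 + \<epsilon>)) \<and>
                (\<Sum>q\<in>R \<nu>. \<Sum>h\<in>step_range (real K * Hq q).
                    lam (Hq q) q (n - a i q - int q * int h))
                  = (C\<^sub>2 \<nu> x + \<theta>') * (real K + 2) * real_of_int y)})
              \<le> total_density I B * x / (8 * (real B)\<^sup>2 * ln x))))"
proof -
  interpret sieving_system I B by fact
  have \<delta>: "0 < \<delta>" "\<delta> < 1 / 2"
  proof -
    have "(0::real) < 1 / 10 ^ 3" by simp
    then show "0 < \<delta>" using assms(3) by linarith
    show "\<delta> < 1 / 2" using assms(4) C_one_le_half by linarith
  qed
  interpret w: window \<delta> \<xi> M K using \<delta> assms by unfold_locales auto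
  obtain c1 c2 C where tc: "tail_constants c1 c2 C" using tail_constants_exist by blast
  obtain Cf where Cf: "Cf \<ge> 0" "\<And>v. v \<ge> 1 \<Longrightarrow> real (card (difference_primes I v)) \<le> Cf * real_of_int v powr 0.49"
  proof -
    obtain C' where C': "\<forall>v\<ge>1. finite (difference_primes I v) \<and> real (card (difference_primes I v)) \<le> C' * real_of_int v powr 0.49"
      using difference_bound by blast
    have "real (card (difference_primes I v)) \<le> max C' 0 * real_of_int v powr 0.49" if "v \<ge> 1" for v
    proof -
      have "C' * real_of_int v powr 0.49 \<le> max C' 0 * real_of_int v powr 0.49" by (intro mult_right_mono) auto
      then show ?thesis using C' that by (meson order_trans)
    qed
    then show ?thesis using that[of "max C' 0"] by simp
  qed
  have second: "second_sieve \<delta> \<xi> M K I B a \<nu> c1 c2 C Cf" if "\<nu> \<in> supp_densities I B" for \<nu>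
    using assms(2) that tc Cf by unfold_locales auto
  have fin: "finite (supp_densities I B)" unfolding supp_densities_def by simp
  let ?R = "\<lambda>x \<theta> b \<nu>. second_sieve.regular_primes \<delta> \<xi> M K I a \<nu> x \<theta> b"
  let ?E = "\<lambda>x \<theta> b \<nu> i. second_sieve.exceptional \<delta> \<xi> M K I a \<nu> x \<theta> b i"
  show ?thesis
  \<comment> \<open>The constants are the exact normalised main terms at x, chosen before
    \<epsilon>; their asymptotics form a separate claim.\<close>
  proof (intro exI[of _ "w.total_mass I"] conjI allI impI ballI, goal_cases)
    case (1 \<nu>)
    note \<nu> = 1
    have "class_density I \<nu> > 0" using \<nu> by (simp add: supp_densities_def)
    moreover have "ln (1 / (2 * \<delta>)) > 0" using \<delta> by simp
    ultimately have "real K * class_density I \<nu> / ((real K + 2) * M) * ((1 - 1 / \<xi>) / ln \<xi>) * ln (1 / (2 * \<delta>)) > 0"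
      using assms(5,6,7) by (intro mult_pos_pos divide_pos_pos) auto
    then have "real K * class_density I \<nu> / ((real K + 2) * M) * ((1 - 1 / \<xi>) / ln \<xi>) * ln (1 / (2 * \<delta>)) \<noteq> 0"
      by (rule less_imp_neq[symmetric])
    then show ?case
      using w.total_mass_tendsto[OF assms(1) \<nu>] by (intro tendsto_imp_asymp_equiv_const)
  next
    case (2 \<epsilon>)
    note \<epsilon> = 2
    define \<theta> where "\<theta> = (\<lambda>x. ln x powr (- \<delta> * (1 + \<epsilon>)))"
    define \<rho> where "\<rho> = total_density I B"
    \<comment> \<open>The allowed number of exceptional points, divided by 4 B^2: there are at most
      B^2 pairs (\<nu>, i), so together they will contribute at most 1/4.\<close>
    define \<tau> where "\<tau> = \<rho> / (8 * (real B)\<^sup>2) / (4 * (real B)\<^sup>2)"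
    have \<tau>: "\<tau> > 0" "\<rho> > 0" "B \<ge> 1" if "\<nu> \<in> supp_densities I B" for \<nu>
    proof -
      show B: "B \<ge> 1" using that by (auto simp: supp_densities_def)
      show \<rho>: "\<rho> > 0" unfolding \<rho>_def total_density_def using that fin
        by (intro sum_pos) (auto simp: supp_densities_def)
      show "\<tau> > 0" unfolding \<tau>_def using B \<rho> by (intro divide_pos_pos) auto
    qed
    have "\<forall>\<^sub>F x in at_top. \<forall>\<nu>\<in>supp_densities I B. \<forall>i\<in>{1..\<nu>}.
       avg (primes_upto (w.z x)) (\<lambda>b. real (card (?E x (\<theta> x) b \<nu> i))) \<le> \<tau> * (x / ln x)"
      unfolding \<theta>_def using second_sieve.avg_exceptional[OF second] \<epsilon> \<tau>(1)
      by (intro eventually_ball_finite[OF fin]) blast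
    then show ?case
      using w.y_bounds eventually_gt_at_top[of 1]
    proof eventually_elim
      case (elim x)
      let ?P = "primes_upto (w.z x)"
      define \<sigma> where "\<sigma> = sieve_density I (w.z x)"
      define thr where "thr = \<rho> * x / (8 * (real B)\<^sup>2 * ln x)"
      have yx: "w.y x > 0" "x > 1" using elim by auto
      have \<sigma>: "\<sigma> > 0" unfolding \<sigma>_def sieve_density_eq using density_of_pos(1)[of ?P] by (simp add: primes_upto_def)
      have thr: "thr > 0" "\<tau> * (x / ln x) = thr / (4 * (real B)\<^sup>2)" if "\<nu> \<in> supp_densities I B" for \<nu>
      proof -
        show "thr > 0" unfolding thr_def using \<tau>[OF that] yx by (intro divide_pos_pos mult_pos_pos) auto
        show "\<tau> * (x / ln x) = thr / (4 * (real B)\<^sup>2)" unfolding thr_def \<tau>_def by simp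
      qed
      \<comment> \<open>Each violation is scaled by its allowance, so f b < 1 implies all bounds at
        once. The mean is at most 1/2 for the sifted set plus 1/4 for the exceptional
        points.\<close>
      define f where "f = (\<lambda>b. 1 / (2 * \<sigma> * w.y x) * real (card (translate (sieved I (w.z x)) b \<inter> {1..y_of \<delta> x}))
         + (\<Sum>\<nu>\<in>supp_densities I B. \<Sum>i\<in>{1..\<nu>}. 1 / thr * real (card (?E x (\<theta> x) b \<nu> i))))"
      have "avg ?P f = 1 / (2 * \<sigma> * w.y x) * (real (card {1..y_of \<delta> x}) * \<sigma>)
         + (\<Sum>\<nu>\<in>supp_densities I B. \<Sum>i\<in>{1..\<nu>}. 1 / thr * avg ?P (\<lambda>b. real (card (?E x (\<theta> x) b \<nu> i))))"
        unfolding f_def avg_add avg_sum avg_cmult avg_card_sieved \<sigma>_def ..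
      also have "1 / (2 * \<sigma> * w.y x) * (real (card {1..y_of \<delta> x}) * \<sigma>) = 1 / 2"
        using \<sigma> yx by simp
      also have "(\<Sum>\<nu>\<in>supp_densities I B. \<Sum>i\<in>{1..\<nu>}. 1 / thr * avg ?P (\<lambda>b. real (card (?E x (\<theta> x) b \<nu> i))))
         \<le> (\<Sum>\<nu>\<in>{1..B}. \<Sum>i\<in>{1..B}. 1 / (4 * (real B)\<^sup>2))"
      proof (rule order_trans[OF sum_mono sum_mono2])
        fix \<nu> assume \<nu>: "\<nu> \<in> supp_densities I B"
        have "(\<Sum>i\<in>{1..\<nu>}. 1 / thr * avg ?P (\<lambda>b. real (card (?E x (\<theta> x) b \<nu> i)))) \<le> (\<Sum>i\<in>{1..\<nu>}. 1 / (4 * (real B)\<^sup>2))"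
        proof (rule sum_mono)
          fix i assume "i \<in> {1..\<nu>}"
          then have "avg ?P (\<lambda>b. real (card (?E x (\<theta> x) b \<nu> i))) \<le> thr / (4 * (real B)\<^sup>2)"
            using elim(1) \<nu> thr(2)[OF \<nu>] by metis
          then have "1 / thr * avg ?P (\<lambda>b. real (card (?E x (\<theta> x) b \<nu> i))) \<le> 1 / thr * (thr / (4 * (real B)\<^sup>2))"
            using thr(1)[OF \<nu>] by (intro mult_left_mono) auto
          then show "1 / thr * avg ?P (\<lambda>b. real (card (?E x (\<theta> x) b \<nu> i))) \<le> 1 / (4 * (real B)\<^sup>2)"
            using thr(1)[OF \<nu>] by simp
        qed
        also have "\<dots> \<le> (\<Sum>i\<in>{1..B}. 1 / (4 * (real B)\<^sup>2))"
          using \<nu> by (intro sum_mono2) (auto simp: supp_densities_def)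
        finally show "(\<Sum>i\<in>{1..\<nu>}. 1 / thr * avg ?P (\<lambda>b. real (card (?E x (\<theta> x) b \<nu> i)))) \<le> (\<Sum>i\<in>{1..B}. 1 / (4 * (real B)\<^sup>2))" .
      qed (auto simp: supp_densities_def)
      \<comment> \<open>B = 0 is treated separately: the sum is then empty, since no class size is
        in use.\<close>
      also have "(\<Sum>\<nu>\<in>{1..B}. \<Sum>i\<in>{1..B}. 1 / (4 * (real B)\<^sup>2)) \<le> 1 / 4"
        by (cases "B = 0") (simp_all add: power2_eq_square)
      finally have "avg ?P f < 1" by simp
      then obtain b where b: "b \<in> {0..<(\<Prod>p\<in>?P. int p)}" "f b < 1"
        using avg_pigeonhole[of ?P f 1] by (auto simp: primes_upto_def)
      have p1: "0 \<le> 1 / (2 * \<sigma> * w.y x) * real (card (translate (sieved I (w.z x)) b \<inter> {1..y_of \<delta> x}))"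
        using \<sigma> yx by simp
      have p2: "0 \<le> 1 / thr * real (card (?E x (\<theta> x) b \<nu> i))" if "\<nu> \<in> supp_densities I B" for \<nu> i
        using thr(1)[OF that] by simp
      have p3: "0 \<le> (\<Sum>\<nu>\<in>supp_densities I B. \<Sum>i\<in>{1..\<nu>}. 1 / thr * real (card (?E x (\<theta> x) b \<nu> i)))"
        using p2 by (intro sum_nonneg)
      have card_S: "real (card (translate (sieved I (w.z x)) b \<inter> {1..y_of \<delta> x})) \<le> 2 * \<sigma> * w.y x"
      proof -
        have "1 / (2 * \<sigma> * w.y x) * real (card (translate (sieved I (w.z x)) b \<inter> {1..y_of \<delta> x})) < 1"
          using b(2) p3 unfolding f_def by linarith
        then show ?thesis using \<sigma> yx by (simp add: divide_less_eq)
      qed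
      have card_E: "real (card (?E x (\<theta> x) b \<nu> i)) \<le> thr" if \<nu>: "\<nu> \<in> supp_densities I B" and i: "i \<in> {1..\<nu>}" for \<nu> i
      proof -
        have "1 / thr * real (card (?E x (\<theta> x) b \<nu> i)) \<le> (\<Sum>i\<in>{1..\<nu>}. 1 / thr * real (card (?E x (\<theta> x) b \<nu> i)))"
          using i p2[OF \<nu>] by (intro member_le_sum) auto
        also have "\<dots> \<le> (\<Sum>\<nu>\<in>supp_densities I B. \<Sum>i\<in>{1..\<nu>}. 1 / thr * real (card (?E x (\<theta> x) b \<nu> i)))"
          using \<nu> p2 fin by (intro member_le_sum[where f = "\<lambda>\<nu>. \<Sum>i\<in>{1..\<nu>}. 1 / thr * real (card (?E x (\<theta> x) b \<nu> i))"] sum_nonneg) auto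
        also have "\<dots> < 1" using b(2) p1 unfolding f_def by linarith
        finally show ?thesis using thr(1)[OF \<nu>] by (simp add: divide_less_eq)
      qed
      show ?case
        unfolding Let_def
      proof (intro bexI[OF _ b(1)] exI[of _ "?R x (\<theta> x) b"] conjI ballI)
        fix \<nu> assume \<nu>: "\<nu> \<in> supp_densities I B"
        interpret s: second_sieve \<delta> \<xi> M K I B a \<nu> c1 c2 C Cf by (rule second[OF \<nu>])
        show "?R x (\<theta> x) b \<nu> \<subseteq> Q_set I \<delta> \<xi> x \<nu>"
          unfolding s.regular_primes_def s.regular_def s.Q_def Q_set_def by blast
        fix i assume i: "i \<in> {1..\<nu>}"
        show "real (card {n \<in> translate (sieved I (w.z x)) b \<inter> {1..y_of \<delta> x}.
              \<not> (\<exists>\<theta>'. \<bar>\<theta>'\<bar> \<le> 2 * ln x powr (- \<delta> * (1 + \<epsilon>)) \<and>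
                (\<Sum>q\<in>?R x (\<theta> x) b \<nu>. \<Sum>h\<in>step_range (real K * scale_of \<delta> \<xi> x q).
                    weight I a M K (w.z x) b (scale_of \<delta> \<xi> x q) q (n - a i q - int q * int h))
                  = (w.total_mass I \<nu> x + \<theta>') * (real K + 2) * w.y x)})
              \<le> total_density I B * x / (8 * (real B)\<^sup>2 * ln x)"
          using card_E[OF \<nu> i] unfolding s.exceptional_def thr_def \<rho>_def \<theta>_def .
      next
        show "real (card (translate (sieved I (w.z x)) b \<inter> {1..y_of \<delta> x})) \<le> 2 * sieve_density I (w.z x) * w.y x"
          using card_S unfolding \<sigma>_def .
      next
        fix q assume "q \<in> (\<Union>\<nu>\<in>supp_densities I B. ?R x (\<theta> x) b \<nu>)"
        then obtain \<nu> where \<nu>: "\<nu> \<in> supp_densities I B" "q \<in> ?R x (\<theta> x) b \<nu>" by blast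
        interpret s: second_sieve \<delta> \<xi> M K I B a \<nu> c1 c2 C Cf by (rule second[OF \<nu>(1)])
        obtain H where H: "H \<in> scales \<delta> \<xi> x" "q \<in> s.regular x (\<theta> x) b H"
          using \<nu>(2) unfolding s.regular_primes_def by blast
        have "scale_of \<delta> \<xi> x q = H"
          using H yx by (intro w.scale_of_eq) (auto simp: s.regular_def s.Q_def Q_scale_def)
        moreover have dev: "\<bar>s.mass x b H q - s.u x\<bar> \<le> \<theta> x * s.u x" using H(2) by (simp add: s.regular_def)
        moreover have u0: "s.u x > 0" unfolding s.u_def using yx by (intro mult_pos_pos) auto
        ultimately show "\<exists>\<theta>'. \<bar>\<theta>'\<bar> \<le> ln x powr (- \<delta> * (1 + \<epsilon>)) \<and>
              (\<Sum>n \<in> {- (int K + 1) * y_of \<delta> x <.. y_of \<delta> x}. weight I a M K (w.z x) b (scale_of \<delta> \<xi> x q) q n)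
                = (1 + \<theta>') * (real K + 2) * w.y x"
        proof (intro exI[of _ "(s.mass x b H q - s.u x) / s.u x"] conjI)
          show "\<bar>(s.mass x b H q - s.u x) / s.u x\<bar> \<le> ln x powr (- \<delta> * (1 + \<epsilon>))"
            using dev u0 unfolding \<theta>_def by (simp add: abs_divide divide_le_eq)
          assume "scale_of \<delta> \<xi> x q = H"
          moreover have "(1 + (s.mass x b H q - s.u x) / s.u x) * (real K + 2) * w.y x = s.mass x b H q"
          proof -
            have "(1 + (s.mass x b H q - s.u x) / s.u x) * (real K + 2) * w.y x = (1 + (s.mass x b H q - s.u x) / s.u x) * s.u x"
              unfolding s.u_def by (simp add: mult.assoc)
            also have "\<dots> = s.mass x b H q" using u0 by (simp add: distrib_right)
            finally show ?thesis .
          qed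
          ultimately show "(\<Sum>n \<in> {- (int K + 1) * y_of \<delta> x <.. y_of \<delta> x}. weight I a M K (w.z x) b (scale_of \<delta> \<xi> x q) q n)
                = (1 + (s.mass x b H q - s.u x) / s.u x) * (real K + 2) * w.y x"
            by (simp add: s.mass_def)
        qed
      qed
    qed
  qed
qed

end
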